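(* Suppose that $\gamma>\tfrac12$, that $\ell(N)=o(N)$ as $N\to\infty$, and that $c_i=c_1$ for $i=2,\dots,\ell(N)$. Suppose further that there is a compact set $K\subseteq\mathbb{C}$ such that all the measures $\mu_N$ are supported on $K$, and that $\mu_N$ converges weakly to some probability measure $\mu$ on $\mathbb{C}$ as $N\to\infty$. Then the empirical spectral measure $L_N$ of $M^N+N^{-\gamma}G^N$ converges to $\mu$ weakly in probability as $N\to\infty$.
   Context: Setting. For each $N$, let $B^1(N),\dots,B^{\ell(N)}(N)$ be Jordan blocks, where $B^i=B^i(N)$ has dimension $a_i\log N$ with $a_i=a_i(N)>0$ (so each $a_i\log N$ is a positive integer) and $\sum_{i=1}^{\ell(N)}a_i\log N=N$. The block $B^i$ has eigenvalue $c_i=c_i(N)\in\mathbb{C}$ on its diagonal, ones on the first superdiagonal, and zeros elsewhere. $M^N$ is the $N\times N$ block-diagonal matrix with diagonal blocks $B^1,\dots,B^{\ell(N)}$. $G^N$ is an $N\times N$ random matrix with i.i.d. (real) standard Gaussian entries. Let $r_i=r_i(N)=\exp\big((-\gamma+\tfrac12)/a_i\big)$, let $m_{c,r}$ be the uniform probability measure on the circle in $\mathbb{C}$ with center $c$ and radius $r$, and set $$\mu_N=\sum_{i=1}^{\ell(N)}\frac{a_i\log N}{N}\,m_{c_i,r_i}.$$ The empirical spectral measure of an $N\times N$ matrix with eigenvalues $\lambda_1,\dots,\lambda_N$ (with algebraic multiplicity) is $\frac1N\sum_{i=1}^N\delta_{\lambda_i}$. Random probability measures $L_N$ on $\mathbb{C}$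 converge to $\mu$ weakly in probability if $\int\phi\,dL_N\to\int\phi\,d\mu$ in probability for every bounded continuous $\phi:\mathbb{C}\to\mathbb{R}$. *)

theory Defs
  imports
    "HOL-Probability.Probability"
    "HOL-Library.Landau_Symbols"
    "Jordan_Normal_Form.Jordan_Normal_Form"
begin

text \<open>The finite weighted sum of Borel measures. Being given by \<open>measure_of\<close>, it has the intended
  values only because the weighted sum is countably additive; see \<open>emeasure_mixture\<close>.\<close>

definition mixture :: "'i set \<Rightarrow> ('i \<Rightarrow> real) \<Rightarrow> ('i \<Rightarrow> complex measure) \<Rightarrow> complex measure" where
  "mixture I w M = measure_of UNIV (sets borel) (\<lambda>A. \<Sum>i\<in>I. ennreal (w i) * emeasure (M i) A)"

lemma space_mixture [simp]: "space (mixture I w M) = UNIV"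
  by (simp add: mixture_def space_measure_of_conv)

lemma sets_mixture [simp, measurable_cong]: "sets (mixture I w M) = sets borel"
  unfolding mixture_def
  by (metis sets.sets_measure_of_eq space_borel)

lemma emeasure_mixture:
  assumes M: "\<And>i. i \<in> I \<Longrightarrow> sets (M i) = sets borel" and A: "A \<in> sets borel"
  shows "emeasure (mixture I w M) A = (\<Sum>i\<in>I. ennreal (w i) * emeasure (M i) A)"
proof (rule emeasure_measure_of[OF mixture_def])
  show "countably_additive (sets (mixture I w M)) (\<lambda>A. \<Sum>i\<in>I. ennreal (w i) * emeasure (M i) A)"
  proof (rule countably_additiveI)
    fix F :: "nat \<Rightarrow> complex set"
    assume F: "range F \<subseteq> sets (mixture I w M)" "disjoint_family F"
    have "(\<Sum>n. \<Sum>i\<in>I. ennreal (w i) * emeasure (M i) (F n))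
        = (\<Sum>i\<in>I. \<Sum>n. ennreal (w i) * emeasure (M i) (F n))"
      by (intro suminf_sum) auto
    also have "\<dots> = (\<Sum>i\<in>I. ennreal (w i) * emeasure (M i) (\<Union>n. F n))"
      using F M by (intro sum.cong refl) (subst ennreal_suminf_cmult, subst suminf_emeasure, auto)
    finally show "(\<Sum>n. \<Sum>i\<in>I. ennreal (w i) * emeasure (M i) (F n))
        = (\<Sum>i\<in>I. ennreal (w i) * emeasure (M i) (\<Union>n. F n))" .
  qed
  show "positive (sets (mixture I w M)) (\<lambda>A. \<Sum>i\<in>I. ennreal (w i) * emeasure (M i) A)"
    by (simp add: positive_def)
qed (use A in auto)

definition uniform_circle :: "complex \<Rightarrow> real \<Rightarrow> complex measure" where
  "uniform_circle c r =
     distr (uniform_measure lborel {0..2 * pi}) borel (\<lambda>t. c + of_real r * cis t)"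

definition circle_mixture ::
    "real \<Rightarrow> nat \<Rightarrow> nat \<Rightarrow> (nat \<Rightarrow> real) \<Rightarrow> (nat \<Rightarrow> complex) \<Rightarrow> complex measure" where
  "circle_mixture \<gamma> N l a c =
     mixture {1..l} (\<lambda>i. a i * ln (real N) / real N)
       (\<lambda>i. uniform_circle (c i) (exp ((- \<gamma> + 1 / 2) / a i)))"

text \<open>\<open>Polynomial.order\<close> is qualified because HOL-Algebra also has an \<open>order\<close>.\<close>

definition empirical_spectral_measure :: "complex mat \<Rightarrow> complex measure" where
  "empirical_spectral_measure A =
     mixture {z. eigenvalue A z}
       (\<lambda>z. real (Polynomial.order z (char_poly A)) / real (dim_row A)) (return borel)"

definition std_gaussian_matrix :: "'w measure \<Rightarrow> nat \<Rightarrow> ('w \<Rightarrow> real mat) \<Rightarrow> bool" where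
  "std_gaussian_matrix P n G \<longleftrightarrow>
     prob_space P \<and>
     (\<forall>\<omega>\<in>space P. G \<omega> \<in> carrier_mat n n) \<and>
     prob_space.indep_vars P (\<lambda>_. borel) (\<lambda>p \<omega>. G \<omega> $$ p) ({..<n} \<times> {..<n}) \<and>
     (\<forall>i<n. \<forall>j<n. distributed P lborel (\<lambda>\<omega>. G \<omega> $$ (i, j)) (\<lambda>x. ennreal (std_normal_density x)))"

definition perturbed_matrix ::
    "real \<Rightarrow> nat \<Rightarrow> nat \<Rightarrow> (nat \<Rightarrow> nat) \<Rightarrow> (nat \<Rightarrow> complex) \<Rightarrow> real mat \<Rightarrow> complex mat" where
  "perturbed_matrix \<gamma> N l d c g =
     jordan_matrix (map (\<lambda>i. (d i, c i)) [1..<Suc l])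
       + complex_of_real (real N powr - \<gamma>) \<cdot>\<^sub>m map_mat complex_of_real g"

definition weakly_converges :: "(nat \<Rightarrow> complex measure) \<Rightarrow> complex measure \<Rightarrow> bool" where
  "weakly_converges M \<mu> \<longleftrightarrow>
     (\<forall>\<phi> :: complex \<Rightarrow> real. continuous_on UNIV \<phi> \<and> bounded (range \<phi>) \<longrightarrow>
        (\<lambda>N. \<integral>z. \<phi> z \<partial>M N) \<longlonglongrightarrow> (\<integral>z. \<phi> z \<partial>\<mu>))"

text \<open>The \<open>N\<close>-th random measure lives on its own probability space \<open>P N\<close>; a single common space is
  the special case of constant \<open>P\<close>. The events below are measurable for the empirical spectral
  measure of a random matrix, since the eigenvalues depend continuously on the entries.\<close>

definition weakly_converges_in_probability ::
    "(nat \<Rightarrow> 'w measure) \<Rightarrow> (nat \<Rightarrow> 'w \<Rightarrow> complex measure) \<Rightarrow> complex measure \<Rightarrow> bool" where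
  "weakly_converges_in_probability P L \<mu> \<longleftrightarrow>
     (\<forall>\<phi> :: complex \<Rightarrow> real. continuous_on UNIV \<phi> \<and> bounded (range \<phi>) \<longrightarrow>
        (\<forall>\<epsilon>>0. (\<lambda>N. measure (P N)
            {\<omega> \<in> space (P N). \<bar>(\<integral>z. \<phi> z \<partial>L N \<omega>) - (\<integral>z. \<phi> z \<partial>\<mu>)\<bar> > \<epsilon>}) \<longlonglongrightarrow> 0))"

end

theory Submission
  imports Defs "HOL-Complex_Analysis.Complex_Analysis" "HOL-Real_Asymp.Real_Asymp"
begin

text \<open>Let \<open>z\<close> be the distance vector from the common eigenvalue \<open>c\<close>, \<open>d\<^sub>1, \<dots>, d\<^sub>l\<close> the block sizes and
  \<open>J\<close> the nilpotent part of \<open>M\<close>. The heart of the matter is that, up to an error \<open>o(N)\<close> in mean,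
  \<open>ln \<bar>det (z - J - N\<^sup>-\<^sup>\<gamma> G)\<bar>\<close> equals \<open>\<Sum>i. max (d\<^sub>i ln \<bar>z\<bar>) ((1/2 - \<gamma>) ln N)\<close>, which is \<open>N\<close> times the
  logarithmic potential of the mixture of circles.

  Call a block bad if \<open>\<bar>z\<bar>\<close> to the power of its size is small, and let \<open>L\<close> be \<open>z - J\<close> with the last row
  of each bad block replaced by a multiple of a unit row, the multiple being slightly larger than the
  norm of a noise row. The inverse \<open>Q\<close> of \<open>L\<close> is explicit and has a small Frobenius norm. For the upper bound,
  the perturbed matrix times \<open>Q\<close> is the identity plus a matrix \<open>E\<close> of small Frobenius norm, and by Schur's
  inequality the eigenvalues of \<open>E\<close> contribute little to the determinant. For the lower bound, the noise in
  the last rows of the bad blocks is exposed row by row: by anticoncentration of affine functions of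
  a Gaussian vector each row costs only a bounded amount in mean. What remains is the determinant of
  \<open>1 + E\<close>, whose eigenvalues near \<open>0\<close> are controlled by entries of the inverse, again through
  anticoncentration.

  Integrating over \<open>z\<close> by dominated convergence, the potentials of the empirical measure and of the mixture
  of circles approach each other in mean against any bounded density of bounded support. By
  Jensen's formula, differences of circle means of a test function yield densities whose logarithmic
  potentials approximate the test function uniformly.\<close>

unbundle no vec_syntax

subsection \<open>Schur's inequality\<close>

text \<open>For \<open>cmod z < 1\<close> the inverse of a long block is too large for the noise to
  count as a small perturbation. The blocks concerned have length at least of order
  \<open>ln N\<close>, so there are \<open>O (N / ln N)\<close> of them: a loss of
  \<open>ln (ln N)\<close> per bad row is harmless, a loss of \<open>ln N\<close> is not. This
  dictates two choices. The multiple \<open>e = N powr (1 / 2 - \<gamma>) * ln N\<close> exceeds the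
  norm of a noise row only by the factor \<open>ln N\<close>; that factor makes the mean squared
  Frobenius norm of the noise part of the error so small that it absorbs the cost of order
  \<open>ln N\<close> charged to every eigenvalue that is not small. And a single noise entry is
  smaller than \<open>e\<close> by the factor \<open>sqrt N * ln N\<close>, so reducing a bad row to
  one entry would lose too much: collecting the entries in all columns still free gives back half
  the logarithm of a factorial, which cancels the \<open>ln N / 2\<close> per row up to
  \<open>o (N)\<close>. The anticoncentration estimates use the moment of order
  \<open>- 1 / 2\<close>, because a real Gaussian variable has no finite moment of order
  \<open>- 1\<close>.\<close>

definition fro2 :: "complex mat \<Rightarrow> real" where
  "fro2 A = (\<Sum>i<dim_row A. \<Sum>j<dim_col A. (cmod (A $$ (i, j)))\<^sup>2)"

lemma fro2_nonneg [simp]: "fro2 A \<ge> 0"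
  unfolding fro2_def by (intro sum_nonneg) auto

text \<open>Unitarity of the reflection along \<open>w\<close>, in coordinates: the same statement
  then serves the columns of a matrix and, with \<open>cnj (w j)\<close> in place of
  \<open>w j\<close>, its rows.\<close>

lemma reflection_norm:
  fixes x w :: "nat \<Rightarrow> complex"
  assumes W: "(\<Sum>i<n. (cmod (w i))\<^sup>2) = W" "W > 0"
  shows "(\<Sum>i<n. (cmod (x i - of_real (2 / W) * w i * (\<Sum>k<n. cnj (w k) * x k)))\<^sup>2) =
         (\<Sum>i<n. (cmod (x i))\<^sup>2)"
proof -
  define s where "s = (\<Sum>k<n. cnj (w k) * x k)"
  define c where "c = 2 / W"
  have cW: "c * W = 2" using W by (simp add: c_def)
  have cs: "(\<Sum>i<n. x i * cnj (w i)) = s" by (simp add: s_def mult.commute)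
  have cs': "(\<Sum>i<n. w i * cnj (x i)) = cnj s" by (simp add: s_def mult.commute)
  have ww: "(\<Sum>i<n. w i * cnj (w i)) = of_real W"
    by (simp only: W(1)[symmetric] of_real_sum complex_norm_square)
  have "of_real (\<Sum>i<n. (cmod (x i - of_real c * w i * s))\<^sup>2)
      = (\<Sum>i<n. (x i - of_real c * w i * s) * cnj (x i - of_real c * w i * s))"
    by (simp only: of_real_sum complex_norm_square)
  also have "\<dots> = (\<Sum>i<n. x i * cnj (x i) - of_real c * cnj s * (x i * cnj (w i))
       - of_real c * s * (w i * cnj (x i)) + of_real c * of_real c * s * cnj s * (w i * cnj (w i)))"
    by (intro sum.cong refl) (simp add: algebra_simps)
  also have "\<dots> = (\<Sum>i<n. x i * cnj (x i)) - of_real c * cnj s * s - of_real c * s * cnj s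
       + of_real c * of_real c * s * cnj s * of_real W"
    by (simp add: sum.distrib sum_subtractf sum_distrib_left[symmetric] cs cs' ww)
  also have "\<dots> = (\<Sum>i<n. x i * cnj (x i)) + of_real c * s * cnj s * (of_real (c * W) - 2)"
    by (simp add: algebra_simps)
  also have "\<dots> = of_real (\<Sum>i<n. (cmod (x i))\<^sup>2)"
    by (simp only: cW of_real_sum complex_norm_square) simp
  finally show ?thesis unfolding s_def c_def of_real_eq_iff .
qed

text \<open>The Householder reflection in the hyperplane orthogonal to \<open>w\<close>.\<close>

definition reflection :: "nat \<Rightarrow> (nat \<Rightarrow> complex) \<Rightarrow> complex mat" where
  "reflection n w = mat n n (\<lambda>(i, j). (if i = j then 1 else 0) -
     of_real (2 / (\<Sum>i<n. (cmod (w i))\<^sup>2)) * w i * cnj (w j))"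

lemma reflection_carrier [simp]: "reflection n w \<in> carrier_mat n n"
  by (simp add: reflection_def)

lemma reflection_mult_index:
  assumes X: "X \<in> carrier_mat n m" and i: "i < n" and j: "j < m"
  shows "(reflection n w * X) $$ (i, j) =
     X $$ (i, j) - of_real (2 / (\<Sum>i<n. (cmod (w i))\<^sup>2)) * w i * (\<Sum>k<n. cnj (w k) * X $$ (k, j))"
proof -
  have "(reflection n w * X) $$ (i, j) = (\<Sum>k<n. reflection n w $$ (i, k) * X $$ (k, j))"
    using X i j by (simp add: scalar_prod_def reflection_def atLeast0LessThan)
  also have "\<dots> = (\<Sum>k<n. (if k = i then X $$ (i, j) else 0)
      - of_real (2 / (\<Sum>i<n. (cmod (w i))\<^sup>2)) * w i * (cnj (w k) * X $$ (k, j)))"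
    using i by (intro sum.cong refl) (auto simp: reflection_def algebra_simps)
  finally show ?thesis using i by (simp add: sum_subtractf sum_distrib_left)
qed

lemma mult_reflection_index:
  assumes X: "X \<in> carrier_mat m n" and i: "i < m" and j: "j < n"
  shows "(X * reflection n w) $$ (i, j) =
     X $$ (i, j) - of_real (2 / (\<Sum>i<n. (cmod (w i))\<^sup>2)) * cnj (w j) * (\<Sum>k<n. w k * X $$ (i, k))"
proof -
  have "(X * reflection n w) $$ (i, j) = (\<Sum>k<n. X $$ (i, k) * reflection n w $$ (k, j))"
    using X i j by (simp add: scalar_prod_def reflection_def atLeast0LessThan)
  also have "\<dots> = (\<Sum>k<n. (if k = j then X $$ (i, j) else 0)
      - of_real (2 / (\<Sum>i<n. (cmod (w i))\<^sup>2)) * cnj (w j) * (w k * X $$ (i, k)))"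
    using j by (intro sum.cong refl) (auto simp: reflection_def algebra_simps)
  finally show ?thesis using j by (simp add: sum_subtractf sum_distrib_left)
qed

lemma fro2_reflection_mult:
  assumes X: "X \<in> carrier_mat n m" and w: "(\<Sum>i<n. (cmod (w i))\<^sup>2) > 0"
  shows "fro2 (reflection n w * X) = fro2 X"
proof -
  have "fro2 (reflection n w * X) = (\<Sum>j<m. \<Sum>i<n. (cmod ((reflection n w * X) $$ (i, j)))\<^sup>2)"
    using X unfolding fro2_def by (subst sum.swap) (simp add: reflection_def)
  also have "\<dots> = (\<Sum>j<m. \<Sum>i<n. (cmod (X $$ (i, j)))\<^sup>2)"
  proof (rule sum.cong[OF refl])
    fix j assume "j \<in> {..<m}"
    then have "(\<Sum>i<n. (cmod ((reflection n w * X) $$ (i, j)))\<^sup>2) = (\<Sum>i<n. (cmod (X $$ (i, j) - of_real (2 / (\<Sum>i<n. (cmod (w i))\<^sup>2)) * w i * (\<Sum>k<n. cnj (w k) * X $$ (k, j))))\<^sup>2)"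
      by (intro sum.cong refl) (simp only: reflection_mult_index[OF X] lessThan_iff)
    also have "\<dots> = (\<Sum>i<n. (cmod (X $$ (i, j)))\<^sup>2)"
      by (rule reflection_norm[OF refl w])
    finally show "(\<Sum>i<n. (cmod ((reflection n w * X) $$ (i, j)))\<^sup>2) = (\<Sum>i<n. (cmod (X $$ (i, j)))\<^sup>2)" .
  qed
  also have "\<dots> = fro2 X"
    using X unfolding fro2_def by (subst sum.swap) auto
  finally show ?thesis .
qed

lemma fro2_mult_reflection:
  assumes X: "X \<in> carrier_mat m n" and w: "(\<Sum>i<n. (cmod (w i))\<^sup>2) > 0"
  shows "fro2 (X * reflection n w) = fro2 X"
proof -
  have "fro2 (X * reflection n w) = (\<Sum>i<m. \<Sum>j<n. (cmod ((X * reflection n w) $$ (i, j)))\<^sup>2)"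
    using X unfolding fro2_def by (simp add: reflection_def)
  also have "\<dots> = (\<Sum>i<m. \<Sum>j<n. (cmod (X $$ (i, j)))\<^sup>2)"
  proof (rule sum.cong[OF refl])
    fix i assume "i \<in> {..<m}"
    then have "(\<Sum>j<n. (cmod ((X * reflection n w) $$ (i, j)))\<^sup>2) = (\<Sum>j<n. (cmod (X $$ (i, j) - of_real (2 / (\<Sum>i<n. (cmod (w i))\<^sup>2)) * cnj (w j) * (\<Sum>k<n. w k * X $$ (i, k))))\<^sup>2)"
      by (intro sum.cong refl) (simp only: mult_reflection_index[OF X] lessThan_iff)
    also have "\<dots> = (\<Sum>j<n. (cmod (X $$ (i, j)))\<^sup>2)"
      using reflection_norm[where w = "\<lambda>j. cnj (w j)" and n = n and x = "\<lambda>j. X $$ (i, j)"] w by simp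
    finally show "(\<Sum>j<n. (cmod ((X * reflection n w) $$ (i, j)))\<^sup>2) = (\<Sum>j<n. (cmod (X $$ (i, j)))\<^sup>2)" .
  qed
  also have "\<dots> = fro2 X"
    using X unfolding fro2_def by auto
  finally show ?thesis .
qed

lemma reflection_involution:
  assumes w: "(\<Sum>i<n. (cmod (w i))\<^sup>2) > 0"
  shows "reflection n w * reflection n w = 1\<^sub>m n"
proof (rule eq_matI)
  fix i j assume ij: "i < dim_row (1\<^sub>m n :: complex mat)" "j < dim_col (1\<^sub>m n :: complex mat)"
  define W where "W = (\<Sum>i<n. (cmod (w i))\<^sup>2)"
  have W: "W \<noteq> 0" using w by (simp add: W_def)
  have ww: "(\<Sum>i<n. cnj (w i) * w i) = of_real W"
    by (simp only: W_def of_real_sum complex_norm_square mult.commute)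
  define c where "c = complex_of_real (2 / W)"
  have cW: "c * of_real W = 2" using W by (simp add: c_def)
  have "(\<Sum>k<n. cnj (w k) * reflection n w $$ (k, j)) =
      (\<Sum>k<n. (if k = j then cnj (w j) else 0) - c * cnj (w j) * (cnj (w k) * w k))"
    using ij by (intro sum.cong refl) (auto simp: reflection_def algebra_simps W_def c_def)
  also have "\<dots> = cnj (w j) - c * of_real W * cnj (w j)"
    using ij by (simp add: sum_subtractf sum_distrib_left[symmetric] ww)
  also have "\<dots> = - cnj (w j)" by (simp add: cW)
  finally show "(reflection n w * reflection n w) $$ (i, j) = 1\<^sub>m n $$ (i, j)"
    using ij by (subst reflection_mult_index[where m = n]) (auto simp: reflection_def)
qed (auto simp: reflection_def)

text \<open>Schur's inequality: the reflection exchanging an eigenvector with the first basis vector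
  deflates the matrix without changing its Frobenius norm.\<close>

lemma schur_inequality:
  assumes "A \<in> carrier_mat n n"
  shows "\<exists>es. char_poly A = (\<Prod>e\<leftarrow>es. [:- e, 1:]) \<and> length es = n \<and>
           (\<Sum>e\<leftarrow>es. (cmod e)\<^sup>2) \<le> fro2 A"
  using assms
proof (induction n arbitrary: A)
  case 0
  then show ?case
    by (intro exI[of _ "[]"]) (use char_poly_factorized[OF 0] in auto)
next
  case (Suc m)
  define n where "n = Suc m"
  have A: "A \<in> carrier_mat n n" using Suc.prems by (simp add: n_def)
  have "0 < n" by (simp add: n_def)
  obtain as where as: "char_poly A = (\<Prod>a\<leftarrow>as. [:- a, 1:])" "length as = n"
    using char_poly_factorized[OF A] by auto
  then obtain e as' where as': "as = e # as'" by (cases as) (auto simp: n_def)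
  have "eigenvalue A e"
    unfolding eigenvalue_root_char_poly[OF A] as as' by simp
  then obtain u where u: "u \<in> carrier_vec n" "u \<noteq> 0\<^sub>v n" "A *\<^sub>v u = e \<cdot>\<^sub>v u"
    unfolding eigenvalue_def eigenvector_def using A by auto
  define U where "U = (\<Sum>i<n. (cmod (u $ i))\<^sup>2)"
  have "\<exists>i<n. u $ i \<noteq> 0" using u by (metis eq_vecI carrier_vecD index_zero_vec)
  then have U: "U > 0" unfolding U_def by (auto intro!: sum_pos2)
  \<comment> \<open>The phase makes the first entry of \<open>v\<close> a real number
    \<open>x \<le> 0\<close>. Then \<open>v\<close> stays away from the first basis vector: the
    mirror vector \<open>w\<close>, their difference, has squared norm
    \<open>2 - 2 * x \<ge> 2\<close>.\<close>
  define p where "p = (if u $ 0 = 0 then 1 else - cnj (u $ 0) / of_real (cmod (u $ 0))) / of_real (sqrt U)"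
  have cp: "cmod p = 1 / sqrt U"
    using U by (auto simp: p_def norm_divide)
  define v where "v = p \<cdot>\<^sub>v u"
  have v: "v \<in> carrier_vec n" using u by (simp add: v_def)
  have Av: "A *\<^sub>v v = e \<cdot>\<^sub>v v" using u A
    by (simp add: v_def mult_mat_vec smult_smult_assoc mult.commute)
  have nv: "(\<Sum>i<n. (cmod (v $ i))\<^sup>2) = 1"
  proof -
    have "(\<Sum>i<n. (cmod (v $ i))\<^sup>2) = (\<Sum>i<n. (cmod p)\<^sup>2 * (cmod (u $ i))\<^sup>2)"
      using u by (intro sum.cong refl) (simp add: v_def norm_mult power_mult_distrib)
    also have "\<dots> = 1" using U by (simp add: cp sum_divide_distrib[symmetric] U_def[symmetric] power_divide)
    finally show ?thesis .
  qed
  define x where "x = - cmod (u $ 0) / sqrt U"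
  have v0: "v $ 0 = of_real x" "x \<le> 0"
  proof -
    have "cnj (u $ 0) * (u $ 0) = of_real (cmod (u $ 0)) * of_real (cmod (u $ 0))"
      using complex_norm_square[of "u $ 0"] by (simp add: power2_eq_square mult.commute)
    then show "v $ 0 = of_real x" using u by (simp add: v_def p_def x_def n_def field_simps)
    show "x \<le> 0" using U by (simp add: x_def divide_nonneg_pos)
  qed
  define w where "w = (\<lambda>i. v $ i - (if i = 0 then 1 else 0))"
  have W: "(\<Sum>i<n. (cmod (w i))\<^sup>2) = 2 - 2 * x"
  proof -
    have "(\<Sum>i<n. (cmod (w i))\<^sup>2) = (\<Sum>i<n. (cmod (v $ i))\<^sup>2 + (if i = 0 then 1 - 2 * x else 0))"
    proof (intro sum.cong refl)
      fix i
      have "(cmod (of_real x - 1))\<^sup>2 = x\<^sup>2 + 1 - 2 * x"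
        using norm_of_real[of "x - 1", where ?'a = complex] by (simp add: power2_eq_square algebra_simps)
      moreover have "(cmod (of_real x))\<^sup>2 = x\<^sup>2" by simp
      ultimately show "(cmod (w i))\<^sup>2 = (cmod (v $ i))\<^sup>2 + (if i = 0 then 1 - 2 * x else 0)"
        by (auto simp: w_def v0)
    qed
    also have "\<dots> = 2 - 2 * x" by (simp only: sum.distrib nv) (simp add: n_def)
    finally show ?thesis .
  qed
  have Wpos: "(\<Sum>i<n. (cmod (w i))\<^sup>2) > 0" using W v0(2) by simp
  define H where "H = reflection n w"
  have H: "H \<in> carrier_mat n n" by (simp add: H_def)
  have HH: "H * H = 1\<^sub>m n" unfolding H_def by (rule reflection_involution[OF Wpos])
  \<comment> \<open>The reflection along the difference of two unit vectors exchanges them as soon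
    as their inner product is real, which the phase ensures.\<close>
  have colH: "col H 0 = v"
  proof (rule eq_vecI)
    fix i assume "i < dim_vec v"
    then have i: "i < n" using v by simp
    have "of_real (2 / (2 - 2 * x)) * cnj (w 0) = -1"
    proof -
      have "cnj (w 0) = of_real (x - 1)" by (simp add: w_def v0)
      then show ?thesis using v0(2) by (simp add: complex_eq_iff field_simps)
    qed
    then have "of_real (2 / (2 - 2 * x)) * w i * cnj (w 0) = - w i"
      by (simp only: mult.assoc mult.left_commute[of _ "w i"]) simp
    then show "col H 0 $ i = v $ i"
    proof -
      assume eq: "of_real (2 / (2 - 2 * x)) * w i * cnj (w 0) = - w i"
      have "col H 0 $ i = (if i = 0 then 1 else 0) - of_real (2 / (2 - 2 * x)) * w i * cnj (w 0)"
        using i \<open>0 < n\<close> by (simp add: H_def reflection_def W)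
      also have "\<dots> = v $ i" unfolding eq by (simp add: w_def)
      finally show ?thesis .
    qed
  qed (use v in \<open>simp add: H_def reflection_def\<close>)
  define B where "B = H * A * H"
  have B: "B \<in> carrier_mat n n" using A H by (simp add: B_def)
  have sim: "similar_mat B A"
    unfolding similar_mat_def similar_mat_wit_def
    by (rule exI[of _ H], rule exI[of _ H]) (use A H B HH in \<open>auto simp: Let_def B_def\<close>)
  have colB: "B $$ (i, 0) = (if i = 0 then e else 0)" if i: "i < n" for i
  proof -
    have Hv: "H *\<^sub>v v = col (1\<^sub>m n) 0"
      unfolding colH[symmetric] HH[symmetric] by (rule col_mult2[OF H H \<open>0 < n\<close>, symmetric])
    have "col B 0 = H * A *\<^sub>v v"
      unfolding B_def colH[symmetric] by (rule col_mult2[OF _ H \<open>0 < n\<close>]) (use H A in auto)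
    also have "\<dots> = H *\<^sub>v (e \<cdot>\<^sub>v v)" using H A v Av by (simp add: assoc_mult_mat_vec)
    also have "\<dots> = e \<cdot>\<^sub>v col (1\<^sub>m n) 0" using H v by (simp add: mult_mat_vec Hv)
    finally have "col B 0 $ i = (e \<cdot>\<^sub>v col (1\<^sub>m n) 0) $ i" by simp
    then show ?thesis using i B by (auto simp: n_def)
  qed
  define B2 where "B2 = mat 1 m (\<lambda>(i, j). B $$ (0, Suc j))"
  define C where "C = mat m m (\<lambda>(i, j). B $$ (Suc i, Suc j))"
  have Bblock: "B = four_block_mat (mat 1 1 (\<lambda>_. e)) B2 (0\<^sub>m m 1) C"
    by (rule eq_matI) (use B colB in \<open>auto simp: B2_def C_def n_def\<close>)
  have C: "C \<in> carrier_mat m m" by (simp add: C_def)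
  have cpB: "char_poly B = [:- e, 1:] * char_poly C"
  proof -
    have "char_poly B = char_poly (mat 1 1 (\<lambda>_. e)) * char_poly C"
      unfolding Bblock by (rule char_poly_four_block_zeros_col) (auto simp: B2_def C_def)
    also have "char_poly (mat 1 1 (\<lambda>_. e)) = [:- e, 1:]"
      by (subst char_poly_upper_triangular[where n = 1]) (auto simp: diag_mat_def upper_triangular_def)
    finally show ?thesis .
  qed
  obtain es where es: "char_poly C = (\<Prod>e\<leftarrow>es. [:- e, 1:])" "length es = m"
      "(\<Sum>e\<leftarrow>es. (cmod e)\<^sup>2) \<le> fro2 C"
    using Suc.IH[OF C] by blast
  have "fro2 B = fro2 A"
    unfolding B_def H_def using A
    by (subst fro2_mult_reflection[where m = n])
       (auto simp: Wpos fro2_reflection_mult[where m = n] intro: mult_carrier_mat[where n = n])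
  moreover have "fro2 B = (cmod e)\<^sup>2 + (\<Sum>j<m. (cmod (B $$ (0, Suc j)))\<^sup>2) + fro2 C"
  proof -
    have "fro2 B = (\<Sum>i<Suc m. \<Sum>j<Suc m. (cmod (B $$ (i, j)))\<^sup>2)"
      using B by (simp add: fro2_def n_def)
    also have "\<dots> = (cmod e)\<^sup>2 + (\<Sum>j<m. (cmod (B $$ (0, Suc j)))\<^sup>2) + (\<Sum>i<m. \<Sum>j<m. (cmod (B $$ (Suc i, Suc j)))\<^sup>2)"
      unfolding sum.lessThan_Suc_shift by (simp add: colB n_def)
    finally show ?thesis by (simp add: fro2_def C_def)
  qed
  \<comment> \<open>Dropping the rest of the first row is the only loss in this step.\<close>
  ultimately have "(cmod e)\<^sup>2 + fro2 C \<le> fro2 A"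
    using sum_nonneg[of "{..<m}" "\<lambda>j. (cmod (B $$ (0, Suc j)))\<^sup>2"] by simp
  moreover have "char_poly A = [:- e, 1:] * char_poly C"
    using char_poly_similar[OF sim] cpB by simp
  ultimately show ?case using es by (intro exI[of _ "e # es"]) auto
qed

subsection \<open>Gaussian vectors\<close>

lemma ennreal_divide_left_mono: "x \<le> y \<Longrightarrow> a / y \<le> a / (x::ennreal)"
proof -
  assume "x \<le> y"
  then have "inverse y \<le> inverse x"
  proof (cases "x = 0 \<or> y = \<infinity>")
    case False
    moreover from this have "x \<noteq> \<infinity>" using \<open>x \<le> y\<close> by (auto simp: top_unique)
    ultimately obtain p q where "x = ennreal p" "y = ennreal q" "p > 0" "q > 0"
      using \<open>x \<le> y\<close> by (cases x; cases y) (auto simp: less_le)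
    then show ?thesis using \<open>x \<le> y\<close>
      by (auto simp: inverse_ennreal intro!: ennreal_leI le_imp_inverse_le)
  qed auto
  then show ?thesis unfolding divide_ennreal_def by (rule mult_left_mono) simp
qed

section \<open>Moments of order \<open>- 1 / 2\<close> of real affine functions of a standard normal
  variable\<close>

definition stdn :: "real measure" where
  "stdn = density lborel (\<lambda>x. ennreal (std_normal_density x))"

lemma sets_stdn [simp, measurable_cong]: "sets stdn = sets borel"
  by (simp add: stdn_def)

lemma space_stdn [simp]: "space stdn = UNIV"
  by (simp add: stdn_def)

lemma prob_space_stdn: "prob_space stdn"
  unfolding stdn_def by (rule prob_space_normal_density) simp

interpretation stdn: prob_space stdn by (rule prob_space_stdn)

lemma nn_integral_stdn:
  assumes [measurable]: "f \<in> borel_measurable borel"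
  shows "(\<integral>\<^sup>+x. f x \<partial>stdn) = (\<integral>\<^sup>+x. ennreal (std_normal_density x) * f x \<partial>lborel)"
  unfolding stdn_def by (rule nn_integral_density) auto

lemma std_normal_density_le_1: "std_normal_density x \<le> 1"
proof -
  have "1 \<le> sqrt (2 * pi)" using pi_gt3 by (intro real_le_rsqrt) auto
  then show ?thesis unfolding std_normal_density_def
    by (intro mult_le_one) auto
qed

text \<open>This decay lets a large constant term \<open>b\<close> make up for a small slope
  \<open>s\<close>: the zero of \<open>b + s * g\<close> then lies at the large value
  \<open>- b / s\<close>, where the density is small.\<close>

lemma std_normal_density_le_inverse: "std_normal_density x \<le> 1 / \<bar>x\<bar>" if "x \<noteq> 0"
proof -
  have "1 \<le> sqrt (2 * pi)" using pi_gt3 by (intro real_le_rsqrt) auto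
  moreover have "\<bar>x\<bar> \<le> exp (x\<^sup>2 / 2)"
  proof -
    have "0 \<le> (\<bar>x\<bar> - 1)\<^sup>2" by simp
    then have "\<bar>x\<bar> \<le> 1 + x\<^sup>2 / 2" by (simp add: power2_diff)
    also have "\<dots> \<le> exp (x\<^sup>2 / 2)" by (rule exp_ge_add_one_self)
    finally show ?thesis .
  qed
  ultimately have "1 * \<bar>x\<bar> \<le> sqrt (2 * pi) * exp (x\<^sup>2 / 2)"
    by (intro mult_mono) auto
  then show ?thesis using that pi_gt_zero unfolding std_normal_density_def
    by (simp add: exp_minus field_simps)
qed

lemma nn_integral_inverse_sqrt:
  assumes a: "a \<ge> 0"
  shows "(\<integral>\<^sup>+x. ennreal (indicator {-a..a} x / sqrt \<bar>x\<bar>) \<partial>lborel) \<le> ennreal (4 * sqrt a)"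
proof -
  define f where "f = (\<lambda>x::real. indicator {0..a} x / sqrt \<bar>x\<bar>)"
  have [measurable]: "f \<in> borel_measurable borel" unfolding f_def by measurable
  have "((\<lambda>x. x powr (-1/2)) has_integral (a powr (-1/2 + 1) / (-1/2 + 1))) {0..a}"
    by (rule has_integral_powr_from_0) (use a in auto)
  moreover have "a powr (-1/2 + 1) / (-1/2 + 1) = 2 * sqrt a"
    using a by (simp add: powr_half_sqrt)
  ultimately have "((\<lambda>x. x powr (-1/2)) has_integral 2 * sqrt a) {0..a}" by (simp only:)
  then have "((\<lambda>x. if x \<in> {0..a} then x powr (-1/2) else 0) has_integral 2 * sqrt a) UNIV"
    by (simp only: has_integral_restrict_UNIV)
  moreover have "(\<lambda>x. if x \<in> {0..a} then x powr (-1/2) else 0) = f"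
    by (auto simp: fun_eq_iff f_def indicator_def powr_minus_divide powr_half_sqrt)
  ultimately have "(f has_integral 2 * sqrt a) UNIV" by simp
  then have I: "(\<integral>\<^sup>+x. ennreal (f x) \<partial>lborel) = ennreal (2 * sqrt a)"
    by (intro nn_integral_has_integral_lborel) (auto simp: f_def)
  have I': "(\<integral>\<^sup>+x. ennreal (f (- x)) \<partial>lborel) = ennreal (2 * sqrt a)"
    using nn_integral_real_affine[where f = "\<lambda>x. ennreal (f x)" and c = "-1" and t = 0] I by simp
  have "(\<integral>\<^sup>+x. ennreal (indicator {-a..a} x / sqrt \<bar>x\<bar>) \<partial>lborel)
      \<le> (\<integral>\<^sup>+x. ennreal (f x) + ennreal (f (- x)) \<partial>lborel)"
    by (intro nn_integral_mono) (auto simp: f_def indicator_def)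
  also have "\<dots> = ennreal (4 * sqrt a)"
    using a by (subst nn_integral_add) (auto simp: I I' ennreal_plus[symmetric] simp del: ennreal_plus)
  finally show ?thesis .
qed

text \<open>Where \<open>\<bar>b + s * g\<bar> > a\<close> the integrand is at most
  \<open>1 / sqrt a\<close>. Where it is at most \<open>a\<close>, the density is replaced by
  \<open>D\<close>, and substituting \<open>x = b + s * g\<close> leaves the integrable singularity
  \<open>1 / sqrt \<bar>x\<bar>\<close>.\<close>

lemma nn_integral_stdn_affine_aux:
  fixes b s a D :: real
  assumes s: "s > 0" and a: "a > 0" and D: "D \<ge> 0"
    and le: "\<And>g. \<bar>b + s * g\<bar> \<le> a \<Longrightarrow> std_normal_density g \<le> D"
  shows "(\<integral>\<^sup>+g. 1 / ennreal (sqrt \<bar>b + s * g\<bar>) \<partial>stdn) \<le> ennreal (1 / sqrt a + 4 * D * sqrt a / s)"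
proof -
  define h where "h = (\<lambda>x::real. indicator {-a..a} x / sqrt \<bar>x\<bar>)"
  have [measurable]: "h \<in> borel_measurable borel" unfolding h_def by measurable
  have hint: "(\<integral>\<^sup>+g. ennreal (h (b + s * g)) \<partial>lborel) \<le> ennreal (4 * sqrt a / s)"
  proof -
    have "ennreal s * (\<integral>\<^sup>+g. ennreal (h (b + s * g)) \<partial>lborel) = (\<integral>\<^sup>+x. ennreal (h x) \<partial>lborel)"
      using nn_integral_real_affine[where f = "\<lambda>x. ennreal (h x)" and c = s and t = b] s by simp
    also have "\<dots> \<le> ennreal (4 * sqrt a)"
      unfolding h_def by (rule nn_integral_inverse_sqrt) (use a in auto)
    finally have le: "ennreal s * (\<integral>\<^sup>+g. ennreal (h (b + s * g)) \<partial>lborel) \<le> ennreal (4 * sqrt a)" .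
    have "(\<integral>\<^sup>+g. ennreal (h (b + s * g)) \<partial>lborel) = ennreal (1 / s) * (ennreal s * (\<integral>\<^sup>+g. ennreal (h (b + s * g)) \<partial>lborel))"
      using s by (simp add: mult.assoc[symmetric] ennreal_mult'[symmetric])
    also have "\<dots> \<le> ennreal (1 / s) * ennreal (4 * sqrt a)"
      by (intro mult_left_mono le) auto
    also have "\<dots> = ennreal (4 * sqrt a / s)" using s a by (simp add: ennreal_mult'[symmetric])
    finally show ?thesis .
  qed
  have "(\<integral>\<^sup>+g. ennreal (std_normal_density g) * (1 / ennreal (sqrt \<bar>b + s * g\<bar>)) \<partial>lborel)
     \<le> (\<integral>\<^sup>+g. ennreal (1 / sqrt a) * ennreal (std_normal_density g) + ennreal D * ennreal (h (b + s * g)) \<partial>lborel)"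
  proof (rule nn_integral_mono_AE)
    \<comment> \<open>The zero of the affine function must be left out: there the left side is
      infinite, while the real quotient in \<open>h\<close> is 0 by convention.\<close>
    show "AE g in lborel. ennreal (std_normal_density g) * (1 / ennreal (sqrt \<bar>b + s * g\<bar>))
        \<le> ennreal (1 / sqrt a) * ennreal (std_normal_density g) + ennreal D * ennreal (h (b + s * g))"
      using AE_lborel_singleton[of "- b / s"]
    proof eventually_elim
      case (elim g)
      then have nz: "b + s * g \<noteq> 0" using s by (auto simp: field_simps add_eq_0_iff)
      have "std_normal_density g / sqrt \<bar>b + s * g\<bar> \<le>
          1 / sqrt a * std_normal_density g + D * h (b + s * g)"
      proof (cases "\<bar>b + s * g\<bar> \<le> a")
        case True
        then have "h (b + s * g) = 1 / sqrt \<bar>b + s * g\<bar>" by (auto simp: h_def indicator_def)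
        moreover have "std_normal_density g / sqrt \<bar>b + s * g\<bar> \<le> D / sqrt \<bar>b + s * g\<bar>"
          using le[OF True] by (intro divide_right_mono) auto
        moreover have "0 \<le> 1 / sqrt a * std_normal_density g" using a by auto
        ultimately show ?thesis by simp
      next
        case False
        then have "1 / sqrt \<bar>b + s * g\<bar> \<le> 1 / sqrt a" using a by (intro divide_left_mono) auto
        then have "std_normal_density g * (1 / sqrt \<bar>b + s * g\<bar>) \<le> std_normal_density g * (1 / sqrt a)"
          by (intro mult_left_mono) auto
        moreover have "0 \<le> D * h (b + s * g)" using D by (auto simp: h_def)
        ultimately show ?thesis by (simp add: mult.commute)
      qed
      moreover have "1 / ennreal (sqrt \<bar>b + s * g\<bar>) = ennreal (1 / sqrt \<bar>b + s * g\<bar>)"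
        using nz divide_ennreal[of 1 "sqrt \<bar>b + s * g\<bar>"] by simp
      moreover have "h (b + s * g) \<ge> 0" by (auto simp: h_def)
      ultimately show ?case using a D
        by (simp add: ennreal_mult'[symmetric] ennreal_plus[symmetric] del: ennreal_plus)
    qed
  qed
  also have "\<dots> = ennreal (1 / sqrt a) * (\<integral>\<^sup>+g. ennreal (std_normal_density g) \<partial>lborel)
      + ennreal D * (\<integral>\<^sup>+g. ennreal (h (b + s * g)) \<partial>lborel)"
    by (simp add: nn_integral_add nn_integral_cmult)
  also have "(\<integral>\<^sup>+g. ennreal (std_normal_density g) \<partial>lborel) = 1"
    using nn_integral_stdn[of "\<lambda>_. 1"] stdn.emeasure_space_1 by simp
  also have "ennreal (1 / sqrt a) * 1 + ennreal D * (\<integral>\<^sup>+g. ennreal (h (b + s * g)) \<partial>lborel)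
      \<le> ennreal (1 / sqrt a) * 1 + ennreal D * ennreal (4 * sqrt a / s)"
    by (intro add_left_mono mult_left_mono hint) auto
  also have "ennreal (1 / sqrt a) * 1 + ennreal D * ennreal (4 * sqrt a / s) = ennreal (1 / sqrt a + 4 * D * sqrt a / s)"
    using a D s by (simp add: ennreal_mult'[symmetric] ennreal_plus[symmetric] mult_ac del: ennreal_plus)
  finally have "(\<integral>\<^sup>+g. ennreal (std_normal_density g) * (1 / ennreal (sqrt \<bar>b + s * g\<bar>)) \<partial>lborel)
      \<le> ennreal (1 / sqrt a + 4 * D * sqrt a / s)" .
  then show ?thesis by (subst nn_integral_stdn) auto
qed

text \<open>Cutting at \<open>a = s\<close> with \<open>D = 1\<close> gives
  \<open>1 + 4\<close>.\<close>

lemma nn_integral_stdn_affine_scale: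
  fixes b s :: real
  assumes s: "s > 0"
  shows "(\<integral>\<^sup>+g. 1 / ennreal (sqrt \<bar>b + s * g\<bar>) \<partial>stdn) \<le> ennreal (5 / sqrt s)"
proof -
  have "(\<integral>\<^sup>+g. 1 / ennreal (sqrt \<bar>b + s * g\<bar>) \<partial>stdn) \<le> ennreal (1 / sqrt s + 4 * 1 * sqrt s / s)"
    by (rule nn_integral_stdn_affine_aux) (use s in \<open>auto simp: std_normal_density_le_1\<close>)
  also have "1 / sqrt s + 4 * 1 * sqrt s / s = 5 / sqrt s"
    using s by (simp add: field_simps)
  finally show ?thesis .
qed

text \<open>Rounds the constant \<open>5 * sqrt 2\<close> of both cases below up to 8.\<close>

lemma sqrt_2_le: "sqrt 2 \<le> (8 / 5 :: real)"
  by (rule real_le_lsqrt) (auto simp: power2_eq_square)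

text \<open>The cut is at \<open>a = b / 2\<close>, so that near the zero
  \<open>\<bar>g\<bar> \<ge> b / (2 * s)\<close> and the density is at most
  \<open>2 * s / b\<close>; the slope \<open>s\<close> then cancels.\<close>

lemma nn_integral_stdn_affine_shift:
  fixes b s :: real
  assumes s: "s > 0" and b: "b > 0"
  shows "(\<integral>\<^sup>+g. 1 / ennreal (sqrt \<bar>b + s * g\<bar>) \<partial>stdn) \<le> ennreal (8 / sqrt b)"
proof -
  have "(\<integral>\<^sup>+g. 1 / ennreal (sqrt \<bar>b + s * g\<bar>) \<partial>stdn)
      \<le> ennreal (1 / sqrt (b / 2) + 4 * (2 * s / b) * sqrt (b / 2) / s)"
  proof (rule nn_integral_stdn_affine_aux)
    fix g assume "\<bar>b + s * g\<bar> \<le> b / 2"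
    then have "b / 2 \<le> \<bar>s * g\<bar>" using b by linarith
    then have *: "b / 2 \<le> s * \<bar>g\<bar>" using s by (simp add: abs_mult)
    then have "g \<noteq> 0" using b by auto
    have "std_normal_density g \<le> 1 / \<bar>g\<bar>" using \<open>g \<noteq> 0\<close> by (rule std_normal_density_le_inverse)
    also have "\<dots> \<le> 2 * s / b" using * b \<open>g \<noteq> 0\<close> by (simp add: field_simps)
    finally show "std_normal_density g \<le> 2 * s / b" .
  qed (use s b in auto)
  also have "\<dots> \<le> ennreal (8 / sqrt b)"
  proof (rule ennreal_leI)
    define t where "t = sqrt (b / 2)"
    have t: "t > 0" "b = 2 * (t * t)" using b by (auto simp: t_def)
    have "1 / t + 4 * (2 * s / b) * t / s = 5 / t"
      using t s by (simp add: t(2) field_simps)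
    also have "5 / t = 5 * sqrt 2 / sqrt b" using b by (simp add: t_def real_sqrt_divide)
    finally have "1 / sqrt (b / 2) + 4 * (2 * s / b) * sqrt (b / 2) / s = 5 * sqrt 2 / sqrt b"
      unfolding t_def .
    also have "\<dots> \<le> 8 / sqrt b"
      using b sqrt_2_le by (intro divide_right_mono) auto
    finally show "1 / sqrt (b / 2) + 4 * (2 * s / b) * sqrt (b / 2) / s \<le> 8 / sqrt b" .
  qed
  finally show ?thesis .
qed

section \<open>Linear and affine functions of a Gaussian vector\<close>

definition gauss :: "'i set \<Rightarrow> ('i \<Rightarrow> real) measure" where
  "gauss J = PiM J (\<lambda>_. stdn)"

lemma prob_space_gauss: "prob_space (gauss J)"
  unfolding gauss_def by (intro prob_space_PiM prob_space_stdn)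

lemma sets_gauss [measurable_cong]: "sets (gauss J) = sets (PiM J (\<lambda>_. borel))"
  unfolding gauss_def by (intro sets_PiM_cong) auto

lemma space_gauss: "space (gauss J) = PiE J (\<lambda>_. UNIV)"
  unfolding gauss_def by (simp add: space_PiM)

text \<open>A linear form in independent standard normal variables is centred normal, with the sum
  of the squared weights as variance.\<close>

lemma gauss_linear:
  fixes w :: "'i \<Rightarrow> real"
  assumes J: "finite J" and s: "s = sqrt (\<Sum>j\<in>J. (w j)\<^sup>2)" "s > 0"
    and f[measurable]: "f \<in> borel_measurable borel"
  shows "(\<integral>\<^sup>+y. f (\<Sum>j\<in>J. w j * y j) \<partial>gauss J) = (\<integral>\<^sup>+g. f (s * g) \<partial>stdn)"
proof -
  interpret G: prob_space "gauss J" by (rule prob_space_gauss)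
  \<comment> \<open>Coordinates of weight 0 are removed because the addition theorem for normal
    variables asks for positive standard deviations.\<close>
  define J' where "J' = {j \<in> J. w j \<noteq> 0}"
  have J': "finite J'" "J' \<subseteq> J" using J by (auto simp: J'_def)
  have "J' \<noteq> {}" 
  proof
    assume "J' = {}"
    then have "(\<Sum>j\<in>J. (w j)\<^sup>2) = 0" by (auto simp: J'_def)
    then show False using s by simp
  qed
  have rv: "\<And>j. j \<in> J' \<Longrightarrow> G.random_variable borel (\<lambda>y. y j)"
    using J' by (auto intro!: measurable_component_singleton simp: measurable_cong_sets[OF sets_gauss refl])
  have dj: "distr (gauss J) borel (\<lambda>y. y j) = stdn" if "j \<in> J" for j
  proof -
    have "distr (gauss J) stdn (\<lambda>y. y j) = stdn"
      unfolding gauss_def by (rule distr_PiM_component) (use J that prob_space_stdn in auto)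
    moreover have "distr (gauss J) borel (\<lambda>y. y j) = distr (gauss J) stdn (\<lambda>y. y j)"
      by (intro distr_cong) auto
    ultimately show ?thesis by simp
  qed
  have "J \<noteq> {}" using \<open>J' \<noteq> {}\<close> J' by auto
  have rvJ: "\<And>j. j \<in> J \<Longrightarrow> G.random_variable borel (\<lambda>y. y j)"
    by (auto intro!: measurable_component_singleton simp: measurable_cong_sets[OF sets_gauss refl])
  have "G.indep_vars (\<lambda>_. borel) (\<lambda>j y. y j) J"
  proof (subst G.indep_vars_iff_distr_eq_PiM'[OF \<open>J \<noteq> {}\<close> rvJ])
    have "distr (gauss J) (PiM J (\<lambda>_. borel)) (\<lambda>x. \<lambda>i\<in>J. x i) = distr (gauss J) (PiM J (\<lambda>_. borel)) (\<lambda>x. x)"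
      by (intro distr_cong) (auto simp: space_gauss PiE_def extensional_restrict)
    also have "\<dots> = gauss J" by (rule distr_id2[OF sets_gauss[symmetric]])
    also have "gauss J = PiM J (\<lambda>i. distr (gauss J) borel (\<lambda>y. y i))"
      unfolding gauss_def[of J] using dj by (intro PiM_cong) (auto simp: gauss_def)
    finally show "distr (gauss J) (PiM J (\<lambda>_. borel)) (\<lambda>x. \<lambda>i\<in>J. x i) = PiM J (\<lambda>i. distr (gauss J) borel (\<lambda>y. y i))" .
  qed auto
  then have ind: "G.indep_vars (\<lambda>_. borel) (\<lambda>j y. y j) J'"
    using J' by (rule_tac G.indep_vars_subset)
  have D: "distributed (gauss J) lborel (\<lambda>y. \<Sum>j\<in>J'. w j * y j) (normal_density (\<Sum>j\<in>J'. 0) (sqrt (\<Sum>j\<in>J'. \<bar>w j\<bar>\<^sup>2)))"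
  proof (rule G.sum_indep_normal[OF J'(1) \<open>J' \<noteq> {}\<close>])
    show "G.indep_vars (\<lambda>_. borel) (\<lambda>j y. w j * y j) J'"
      using G.indep_vars_compose2[OF ind, where Y = "\<lambda>j x. w j * x" and N = "\<lambda>_. borel"] by simp
    fix j assume j: "j \<in> J'"
    then show "0 < \<bar>w j\<bar>" by (simp add: J'_def)
    have "distributed (gauss J) lborel (\<lambda>y. y j) std_normal_density"
      unfolding distributed_def using dj[of j] j J' rv[OF j]
      by (auto simp: stdn_def cong: distr_cong)
    then have "distributed (gauss J) lborel (\<lambda>y. 0 + w j * y j) (normal_density (0 + w j * 0) (\<bar>w j\<bar> * 1))"
      by (rule G.normal_density_affine) (use j in \<open>auto simp: J'_def\<close>)
    then show "distributed (gauss J) lborel (\<lambda>y. w j * y j) (normal_density 0 \<bar>w j\<bar>)" by simp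
  qed
  have sJ': "(\<Sum>j\<in>J'. w j * y j) = (\<Sum>j\<in>J. w j * y j)" for y
    unfolding J'_def using J by (intro sum.mono_neutral_left) auto
  have "(\<Sum>j\<in>J'. \<bar>w j\<bar>\<^sup>2) = (\<Sum>j\<in>J. (w j)\<^sup>2)"
    unfolding J'_def power2_abs using J by (intro sum.mono_neutral_left) auto
  then have D': "distributed (gauss J) lborel (\<lambda>y. \<Sum>j\<in>J. w j * y j) (normal_density 0 s)"
    using D by (simp add: sJ' s(1))
  have D'': "distributed (gauss J) lborel (\<lambda>y. (\<Sum>j\<in>J. w j * y j) / s) std_normal_density"
    using D' G.normal_standard_normal_convert[OF s(2), of "\<lambda>y. \<Sum>j\<in>J. w j * y j" 0] by simp
  have m[measurable]: "(\<lambda>y. (\<Sum>j\<in>J. w j * y j) / s) \<in> borel_measurable (gauss J)"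
    using distributed_measurable[OF D''] by simp
  have "(\<integral>\<^sup>+g. f (s * g) \<partial>stdn) = (\<integral>\<^sup>+g. f (s * g) \<partial>distr (gauss J) lborel (\<lambda>y. (\<Sum>j\<in>J. w j * y j) / s))"
    using distributed_distr_eq_density[OF D''] by (simp add: stdn_def)
  also have "\<dots> = (\<integral>\<^sup>+y. f (s * ((\<Sum>j\<in>J. w j * y j) / s)) \<partial>gauss J)"
    by (rule nn_integral_distr) auto
  finally show ?thesis using s by simp
qed

text \<open>Anticoncentration: on the negative half moment scale a complex affine function of a real
  Gaussian vector is not smaller than its constant term and its gradient.\<close>

lemma gauss_affine:
  fixes b :: complex and u :: "'i \<Rightarrow> complex"
  assumes J: "finite J"
  shows "(\<integral>\<^sup>+y. ennreal (sqrt (max (cmod b) (sqrt (\<Sum>j\<in>J. (cmod (u j))\<^sup>2))))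
             / ennreal (sqrt (cmod (b + (\<Sum>j\<in>J. u j * of_real (y j))))) \<partial>gauss J) \<le> 8"
proof -
  interpret G: prob_space "gauss J" by (rule prob_space_gauss)
  have [measurable]: "(\<lambda>y. y j) \<in> borel_measurable (gauss J)" if "j \<in> J" for j
    using that by (auto intro!: measurable_component_singleton simp: measurable_cong_sets[OF sets_gauss refl])
  define U where "U = sqrt (\<Sum>j\<in>J. (cmod (u j))\<^sup>2)"
  have U0: "U \<ge> 0" by (simp add: U_def sum_nonneg)
  \<comment> \<open>Projecting onto a real direction \<open>\<zeta>\<close> can only decrease the
    modulus, and it leaves a real affine function to which the one-dimensional estimates
    apply.\<close>
  have proj: "\<bar>Re (\<zeta> * b) + (\<Sum>j\<in>J. Re (\<zeta> * u j) * y j)\<bar> \<le> cmod (b + (\<Sum>j\<in>J. u j * of_real (y j)))"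
    if "cmod \<zeta> = 1" for \<zeta> y
  proof -
    have "Re (\<zeta> * b) + (\<Sum>j\<in>J. Re (\<zeta> * u j) * y j) = Re (\<zeta> * (b + (\<Sum>j\<in>J. u j * of_real (y j))))"
      by (simp add: algebra_simps sum_distrib_left sum_subtractf sum.distrib)
    then show ?thesis using abs_Re_le_cmod[of "\<zeta> * (b + (\<Sum>j\<in>J. u j * of_real (y j)))"] that
      by (simp add: norm_mult)
  qed
  have main: "(\<integral>\<^sup>+y. ennreal (sqrt m) / ennreal (sqrt (cmod (b + (\<Sum>j\<in>J. u j * of_real (y j))))) \<partial>gauss J)
      \<le> ennreal (sqrt m) * (\<integral>\<^sup>+g. 1 / ennreal (sqrt \<bar>Re (\<zeta> * b) + s * g\<bar>) \<partial>stdn)"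
    if z: "cmod \<zeta> = 1" and s: "s = sqrt (\<Sum>j\<in>J. (Re (\<zeta> * u j))\<^sup>2)" "s > 0" for m s \<zeta>
  proof -
    have "(\<integral>\<^sup>+y. ennreal (sqrt m) / ennreal (sqrt (cmod (b + (\<Sum>j\<in>J. u j * of_real (y j))))) \<partial>gauss J)
      \<le> (\<integral>\<^sup>+y. ennreal (sqrt m) * (1 / ennreal (sqrt \<bar>Re (\<zeta> * b) + (\<Sum>j\<in>J. Re (\<zeta> * u j) * y j)\<bar>)) \<partial>gauss J)"
      unfolding ennreal_times_divide mult_1_right
      by (intro nn_integral_mono ennreal_divide_left_mono ennreal_leI real_sqrt_le_mono proj z)
    also have "\<dots> = ennreal (sqrt m) * (\<integral>\<^sup>+y. 1 / ennreal (sqrt \<bar>Re (\<zeta> * b) + (\<Sum>j\<in>J. Re (\<zeta> * u j) * y j)\<bar>) \<partial>gauss J)"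
      by (rule nn_integral_cmult) measurable
    also have "(\<integral>\<^sup>+y. 1 / ennreal (sqrt \<bar>Re (\<zeta> * b) + (\<Sum>j\<in>J. Re (\<zeta> * u j) * y j)\<bar>) \<partial>gauss J)
        = (\<integral>\<^sup>+g. 1 / ennreal (sqrt \<bar>Re (\<zeta> * b) + s * g\<bar>) \<partial>stdn)"
      by (rule gauss_linear[OF J s, where f = "\<lambda>x. 1 / ennreal (sqrt \<bar>Re (\<zeta> * b) + x\<bar>)"]) measurable
    finally show ?thesis .
  qed
  show ?thesis
  proof (cases "U \<le> cmod b")
    case True
    then have m: "max (cmod b) U = cmod b" by simp
    show ?thesis
    proof (cases "b = 0")
      case True
      then show ?thesis using m by (simp add: U_def[symmetric])
    next
      case b: False
      \<comment> \<open>If the constant term dominates, the projection is along \<open>b\<close>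
        itself, which preserves its full size.\<close>
      define \<zeta> where "\<zeta> = cnj b / of_real (cmod b)"
      have z: "cmod \<zeta> = 1" using b by (simp add: \<zeta>_def norm_divide)
      have zb: "Re (\<zeta> * b) = cmod b"
      proof -
        have "\<zeta> * b = of_real (cmod b)" using b complex_norm_square[of b]
          by (simp add: \<zeta>_def power2_eq_square field_simps)
        then show ?thesis by simp
      qed
      define s where "s = sqrt (\<Sum>j\<in>J. (Re (\<zeta> * u j))\<^sup>2)"
      show ?thesis
      proof (cases "s > 0")
        case True
        have "ennreal (sqrt (cmod b)) * (\<integral>\<^sup>+g. 1 / ennreal (sqrt \<bar>Re (\<zeta> * b) + s * g\<bar>) \<partial>stdn)
            \<le> ennreal (sqrt (cmod b)) * ennreal (8 / sqrt (cmod b))"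
          unfolding zb using b True by (intro mult_left_mono nn_integral_stdn_affine_shift) auto
        also have "\<dots> = 8" using b by (simp add: ennreal_mult'[symmetric])
        finally show ?thesis using main[OF z s_def True, of "cmod b"] m unfolding U_def[symmetric] by auto
      next
        case False
        then have "(\<Sum>j\<in>J. (Re (\<zeta> * u j))\<^sup>2) = 0"
          by (simp add: s_def sum_nonneg antisym)
        then have "\<forall>j\<in>J. Re (\<zeta> * u j) = 0" using J by (simp add: sum_nonneg_eq_0_iff)
        \<comment> \<open>The projection is now the constant \<open>cmod b\<close>, so the quotient
          never exceeds 1.\<close>
        then have "cmod b \<le> cmod (b + (\<Sum>j\<in>J. u j * of_real (y j)))" for y
          using proj[OF z, of y] unfolding zb by simp
        then have "(\<integral>\<^sup>+y. ennreal (sqrt (cmod b)) / ennreal (sqrt (cmod (b + (\<Sum>j\<in>J. u j * of_real (y j))))) \<partial>gauss J)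
            \<le> (\<integral>\<^sup>+y. ennreal (sqrt (cmod b)) / ennreal (sqrt (cmod b)) \<partial>gauss J)"
          by (intro nn_integral_mono ennreal_divide_left_mono ennreal_leI real_sqrt_le_mono)
        also have "\<dots> = 1" using b G.emeasure_space_1 by simp
        finally show ?thesis using m unfolding U_def[symmetric] by (auto intro: order_trans)
      qed
    qed
  next
    case False
    then have m: "max (cmod b) U = U" and Upos: "U > 0" using norm_ge_zero[of b] by (auto simp del: norm_ge_zero)
    \<comment> \<open>If the gradient dominates, its real or its imaginary part carries at least
      half of its norm; multiplying by \<open>- \<i>\<close> turns the imaginary part into a real
      part.\<close>
    define s1 where "s1 = sqrt (\<Sum>j\<in>J. (Re (1 * u j))\<^sup>2)"
    define s2 where "s2 = sqrt (\<Sum>j\<in>J. (Re (- \<i> * u j))\<^sup>2)"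
    have "s1\<^sup>2 + s2\<^sup>2 = U\<^sup>2"
      by (simp add: s1_def s2_def U_def sum_nonneg sum.distrib[symmetric] cmod_power2)
    moreover have "s1 \<ge> 0" "s2 \<ge> 0" by (auto simp: s1_def s2_def sum_nonneg)
    ultimately have "U / 2 \<le> s1 \<or> U / 2 \<le> s2"
    proof -
      have False if "s1 < U / 2" "s2 < U / 2"
      proof -
        have "s1\<^sup>2 < (U / 2)\<^sup>2" "s2\<^sup>2 < (U / 2)\<^sup>2"
          using that \<open>s1 \<ge> 0\<close> \<open>s2 \<ge> 0\<close> by (auto intro!: power_strict_mono)
        then have "s1\<^sup>2 + s2\<^sup>2 < U\<^sup>2 / 2" by (simp add: power_divide)
        then show False using \<open>s1\<^sup>2 + s2\<^sup>2 = U\<^sup>2\<close> by (simp add: field_simps)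
      qed
      then show ?thesis by fastforce
    qed
    then obtain \<zeta> where z: "cmod \<zeta> = 1" and s: "U / 2 \<le> sqrt (\<Sum>j\<in>J. (Re (\<zeta> * u j))\<^sup>2)"
      unfolding s1_def s2_def proof (elim disjE, goal_cases)
      case 1
      show ?case by (rule 1(1)[of 1]) (use 1 in auto)
    next
      case 2
      show ?case by (rule 2(1)[of "- \<i>"]) (use 2 in auto)
    qed
    define s where "s = sqrt (\<Sum>j\<in>J. (Re (\<zeta> * u j))\<^sup>2)"
    have sU: "U / 2 \<le> s" "s > 0" using s Upos unfolding s_def[symmetric] by linarith+
    have "ennreal (sqrt U) * (\<integral>\<^sup>+g. 1 / ennreal (sqrt \<bar>Re (\<zeta> * b) + s * g\<bar>) \<partial>stdn)
        \<le> ennreal (sqrt U) * ennreal (5 / sqrt s)"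
      by (intro mult_left_mono nn_integral_stdn_affine_scale sU) auto
    also have "\<dots> = ennreal (5 * (sqrt U / sqrt s))" using Upos by (simp add: ennreal_mult'[symmetric] mult.commute)
    also have "\<dots> \<le> ennreal 8"
    proof (rule ennreal_leI)
      have "sqrt U / sqrt s \<le> sqrt 2"
        using sU Upos by (simp add: real_sqrt_divide[symmetric] field_simps)
      then show "5 * (sqrt U / sqrt s) \<le> 8" using sqrt_2_le by linarith
    qed
    finally show ?thesis using main[OF z s_def sU(2), of U] m unfolding U_def[symmetric] by auto
  qed
qed

subsection \<open>Determinants with noisy rows\<close>

lemma borel_measurable_det:
  fixes f :: "'a \<Rightarrow> nat \<Rightarrow> nat \<Rightarrow> complex"
  assumes f: "\<And>i j. i < n \<Longrightarrow> j < n \<Longrightarrow> (\<lambda>x. f x i j) \<in> borel_measurable M"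
  shows "(\<lambda>x. det (mat n n (\<lambda>(i, j). f x i j))) \<in> borel_measurable M"
proof -
  have "(\<lambda>x. det (mat n n (\<lambda>(i, j). f x i j))) =
      (\<lambda>x. \<Sum>p | p permutes {0..<n}. signof p * (\<Prod>i = 0..<n. f x i (p i)))"
    by (auto simp: fun_eq_iff det_def' [of _ n] permutes_in_image intro!: sum.cong prod.cong)
  also have "\<dots> \<in> borel_measurable M"
    by (intro borel_measurable_sum borel_measurable_times borel_measurable_const borel_measurable_prod f)
       (auto simp: permutes_in_image)
  finally show ?thesis .
qed

definition unit_row :: "nat \<Rightarrow> nat \<Rightarrow> complex" where
  "unit_row j = (\<lambda>k. if k = j then 1 else 0)"

text \<open>Only the rows in \<open>S\<close> carry noise, so that rows can be exposed one at a time.\<close>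

definition noisy_mat ::
    "nat \<Rightarrow> nat set \<Rightarrow> real \<Rightarrow> (nat \<Rightarrow> nat \<Rightarrow> complex) \<Rightarrow> (nat \<times> nat \<Rightarrow> real) \<Rightarrow> complex mat" where
  "noisy_mat N S \<delta> Y \<omega> = mat N N (\<lambda>(i, j). Y i j + (if i \<in> S then of_real (\<delta> * \<omega> (i, j)) else 0))"

definition noisy_det ::
    "nat \<Rightarrow> nat set \<Rightarrow> real \<Rightarrow> (nat \<Rightarrow> nat \<Rightarrow> complex) \<Rightarrow> (nat \<times> nat \<Rightarrow> real) \<Rightarrow> complex" where
  "noisy_det N S \<delta> Y \<omega> = det (noisy_mat N S \<delta> Y \<omega>)"

abbreviation gauss_sq :: "nat \<Rightarrow> (nat \<times> nat \<Rightarrow> real) measure" where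
  "gauss_sq N \<equiv> gauss ({..<N} \<times> {..<N})"

lemma noisy_mat_carrier [simp]: "noisy_mat N S \<delta> Y \<omega> \<in> carrier_mat N N"
  by (simp add: noisy_mat_def)

lemma noisy_mat_index [simp]:
  "i < N \<Longrightarrow> j < N \<Longrightarrow> noisy_mat N S \<delta> Y \<omega> $$ (i, j) = Y i j + (if i \<in> S then of_real (\<delta> * \<omega> (i, j)) else 0)"
  by (simp add: noisy_mat_def)

lemma measurable_gauss_component:
  "p \<in> J \<Longrightarrow> (\<lambda>\<omega>. \<omega> p) \<in> borel_measurable (gauss J)"
  by (auto intro!: measurable_component_singleton simp: measurable_cong_sets[OF sets_gauss refl])

lemma borel_measurable_noisy_det [measurable]:
  "noisy_det N S \<delta> Y \<in> borel_measurable (gauss_sq N)"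
  unfolding noisy_det_def[abs_def] noisy_mat_def
proof (rule borel_measurable_det)
  fix i j assume "i < N" "j < N"
  then have [measurable]: "(\<lambda>\<omega>. \<omega> (i, j)) \<in> borel_measurable (gauss_sq N)"
    by (intro measurable_gauss_component) auto
  show "(\<lambda>\<omega>. Y i j + (if i \<in> S then of_real (\<delta> * \<omega> (i, j)) else 0)) \<in> borel_measurable (gauss_sq N)"
    by (cases "i \<in> S") (simp_all, measurable)
qed

lemma noisy_det_cong:
  assumes "\<And>i j. i < N \<Longrightarrow> j < N \<Longrightarrow> i \<in> S \<Longrightarrow> \<omega> (i, j) = \<omega>' (i, j)"
    and "\<And>i j. i < N \<Longrightarrow> j < N \<Longrightarrow> Y i j = Y' i j"
  shows "noisy_det N S \<delta> Y \<omega> = noisy_det N S \<delta> Y' \<omega>'"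
  unfolding noisy_det_def by (rule arg_cong[where f = det], rule eq_matI) (use assms in \<open>auto simp: noisy_mat_def\<close>)

lemma cofactor_cong:
  assumes A: "A \<in> carrier_mat n n" and B: "B \<in> carrier_mat n n" and r: "r < n"
    and eq: "\<And>i j. i < n \<Longrightarrow> j < n \<Longrightarrow> i \<noteq> r \<Longrightarrow> A $$ (i, j) = B $$ (i, j)"
  shows "cofactor A r j = cofactor B r j"
proof -
  have "mat_delete A r j = mat_delete B r j"
    by (rule eq_matI) (use A B r eq in \<open>auto simp: mat_delete_def\<close>)
  then show ?thesis by (simp add: cofactor_def)
qed

text \<open>Cofactors are thereby determinants of the same family, so that inductions over rows
  never leave \<open>noisy_det\<close>.\<close>

lemma noisy_det_unit_row:
  assumes r: "r < N" "r \<notin> S" and j: "j < N"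
  shows "noisy_det N S \<delta> (Y(r := unit_row j)) \<omega> = cofactor (noisy_mat N S \<delta> Y \<omega>) r j"
proof -
  have "noisy_det N S \<delta> (Y(r := unit_row j)) \<omega>
      = (\<Sum>k<N. unit_row j k * cofactor (noisy_mat N S \<delta> (Y(r := unit_row j)) \<omega>) r k)"
    unfolding noisy_det_def by (subst laplace_expansion_row[OF noisy_mat_carrier r(1)]) (use r in auto)
  also have "\<dots> = cofactor (noisy_mat N S \<delta> (Y(r := unit_row j)) \<omega>) r j"
    using j by (simp add: unit_row_def if_distrib[of "\<lambda>x. x * _"] cong: if_cong)
  also have "\<dots> = cofactor (noisy_mat N S \<delta> Y \<omega>) r j"
    by (rule cofactor_cong) (use r in auto)
  finally show ?thesis .
qed

lemma noisy_det_row: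
  assumes r: "r < N" "r \<notin> S"
  shows "noisy_det N S \<delta> Y \<omega> = (\<Sum>j<N. Y r j * noisy_det N S \<delta> (Y(r := unit_row j)) \<omega>)"
  unfolding noisy_det_def[of N S \<delta> Y]
  by (subst laplace_expansion_row[OF noisy_mat_carrier r(1)]) (use r in \<open>auto simp: noisy_det_unit_row\<close>)

lemma noisy_det_scale_row:
  assumes r: "r < N" "r \<notin> S"
  shows "noisy_det N S \<delta> (Y(r := (\<lambda>k. \<kappa> * y k))) \<omega> = \<kappa> * noisy_det N S \<delta> (Y(r := y)) \<omega>"
  by (subst (1 2) noisy_det_row[OF r]) (simp add: sum_distrib_left mult.assoc)

text \<open>Multilinearity in row \<open>r\<close>: as a function of the noise in that row the
  determinant is affine, and neither the constant term nor the coefficients see this noise. This is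
  the form to which \<open>gauss_affine\<close> applies.\<close>

lemma noisy_det_expand:
  assumes r: "r < N" "r \<in> S"
  shows "noisy_det N S \<delta> Y \<omega> = noisy_det N (S - {r}) \<delta> Y \<omega> +
     (\<Sum>j<N. of_real \<delta> * noisy_det N (S - {r}) \<delta> (Y(r := unit_row j)) \<omega> * of_real (\<omega> (r, j)))"
proof -
  have c: "cofactor (noisy_mat N S \<delta> Y \<omega>) r j = cofactor (noisy_mat N (S - {r}) \<delta> Y \<omega>) r j" for j
    by (rule cofactor_cong[where n = N]) (use r in auto)
  have "noisy_det N S \<delta> Y \<omega> = (\<Sum>j<N. (Y r j + of_real (\<delta> * \<omega> (r, j))) * cofactor (noisy_mat N (S - {r}) \<delta> Y \<omega>) r j)"
    unfolding noisy_det_def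
    by (subst laplace_expansion_row[OF noisy_mat_carrier r(1)]) (use r in \<open>auto simp: c intro!: sum.cong\<close>)
  also have "\<dots> = (\<Sum>j<N. Y r j * noisy_det N (S - {r}) \<delta> (Y(r := unit_row j)) \<omega>) +
     (\<Sum>j<N. of_real \<delta> * noisy_det N (S - {r}) \<delta> (Y(r := unit_row j)) \<omega> * of_real (\<omega> (r, j)))"
    unfolding sum.distrib[symmetric]
    by (intro sum.cong refl) (use r in \<open>simp add: noisy_det_unit_row algebra_simps\<close>)
  finally show ?thesis using r by (subst noisy_det_row[where S = "S - {r}" and Y = Y]) auto
qed

text \<open>The norm of the gradient of the determinant with respect to the noise entries of row
  \<open>r\<close>.\<close>

definition row_gradient ::
    "nat \<Rightarrow> nat set \<Rightarrow> real \<Rightarrow> (nat \<Rightarrow> nat \<Rightarrow> complex) \<Rightarrow> nat \<Rightarrow> (nat \<times> nat \<Rightarrow> real) \<Rightarrow> real" where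
  "row_gradient N S \<delta> Y r \<omega> =
     \<bar>\<delta>\<bar> * sqrt (\<Sum>j<N. (cmod (noisy_det N (S - {r}) \<delta> (Y(r := unit_row j)) \<omega>))\<^sup>2)"

lemma borel_measurable_row_gradient [measurable]:
  "row_gradient N S \<delta> Y r \<in> borel_measurable (gauss_sq N)"
  unfolding row_gradient_def[abs_def] by measurable

lemma row_gradient_nonneg [simp]: "row_gradient N S \<delta> Y r \<omega> \<ge> 0"
  by (simp add: row_gradient_def sum_nonneg)

lemma sum_singleton_times: "(\<Sum>p\<in>{r} \<times> A. g p) = (\<Sum>j\<in>A. g (r, j))"
  by (rule sum.reindex_bij_witness[of _ "\<lambda>j. (r, j)" snd]) auto

text \<open>By Fubini the noise outside row \<open>r\<close> is frozen. The numerator does not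
  involve row \<open>r\<close> of the noise, so it is constant in the inner integral, and
  \<open>gauss_affine\<close> bounds that integral by 8 for every frozen value.\<close>

lemma noisy_det_row_moment:
  assumes r: "r < N" "r \<in> S"
  shows "(\<integral>\<^sup>+\<omega>. ennreal (sqrt (max (cmod (noisy_det N (S - {r}) \<delta> Y \<omega>)) (row_gradient N S \<delta> Y r \<omega>)))
            / ennreal (sqrt (cmod (noisy_det N S \<delta> Y \<omega>))) \<partial>gauss_sq N) \<le> 8"
    (is "(\<integral>\<^sup>+\<omega>. ?f \<omega> \<partial>_) \<le> 8")
proof -
  interpret product_sigma_finite "\<lambda>_::nat\<times>nat. stdn"
    unfolding product_sigma_finite_def using prob_space_imp_sigma_finite[OF prob_space_stdn] by simp
  define I where "I = ({..<N} - {r}) \<times> {..<N}"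
  define J where "J = {r} \<times> {..<N}"
  have IJ: "I \<inter> J = {}" "finite I" "finite J" "I \<union> J = {..<N} \<times> {..<N}"
    using r by (auto simp: I_def J_def)
  interpret GI: prob_space "gauss I" by (rule prob_space_gauss)
  have m: "?f \<in> borel_measurable (gauss_sq N)" by measurable
  have "(\<integral>\<^sup>+\<omega>. ?f \<omega> \<partial>gauss_sq N) = (\<integral>\<^sup>+x. (\<integral>\<^sup>+y. ?f (merge I J (x, y)) \<partial>gauss J) \<partial>gauss I)"
    using product_nn_integral_fold[OF IJ(1-3), of ?f] m by (simp add: gauss_def IJ)
  also have "\<dots> \<le> (\<integral>\<^sup>+x. 8 \<partial>gauss I)"
  proof (rule nn_integral_mono)
    fix x
    define b where "b = noisy_det N (S - {r}) \<delta> Y x"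
    define v where "v = (\<lambda>j. of_real \<delta> * noisy_det N (S - {r}) \<delta> (Y(r := unit_row j)) x)"
    have c: "noisy_det N (S - {r}) \<delta> Y' (merge I J (x, y)) = noisy_det N (S - {r}) \<delta> Y' x" for Y' y
      by (rule noisy_det_cong) (auto simp: merge_def I_def)
    have g: "row_gradient N S \<delta> Y r (merge I J (x, y)) = sqrt (\<Sum>p\<in>J. (cmod (v (snd p)))\<^sup>2)" for y
    proof -
      have "(\<Sum>p\<in>J. (cmod (v (snd p)))\<^sup>2) = (\<Sum>j<N. (cmod (v j))\<^sup>2)"
        unfolding J_def sum_singleton_times by simp
      also have "\<dots> = \<delta>\<^sup>2 * (\<Sum>j<N. (cmod (noisy_det N (S - {r}) \<delta> (Y(r := unit_row j)) x))\<^sup>2)"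
        by (simp add: v_def norm_mult power_mult_distrib sum_distrib_left)
      finally show ?thesis by (simp add: row_gradient_def c real_sqrt_mult)
    qed
    have d: "noisy_det N S \<delta> Y (merge I J (x, y)) = b + (\<Sum>p\<in>J. v (snd p) * of_real (y p))" for y
    proof -
      have "(\<Sum>p\<in>J. v (snd p) * of_real (y p)) = (\<Sum>j<N. v j * of_real (y (r, j)))"
        unfolding J_def sum_singleton_times by simp
      also have "\<dots> = (\<Sum>j<N. v j * of_real (merge I J (x, y) (r, j)))"
        by (intro sum.cong refl) (auto simp: merge_def I_def J_def)
      finally show ?thesis by (subst noisy_det_expand[OF r]) (simp add: c b_def v_def)
    qed
    show "(\<integral>\<^sup>+y. ?f (merge I J (x, y)) \<partial>gauss J) \<le> 8"
      unfolding d g c b_def[symmetric] by (rule gauss_affine[OF IJ(3)])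
  qed
  also have "\<dots> = 8" using GI.emeasure_space_1 by simp
  finally show ?thesis .
qed

section \<open>Logarithmic loss per exposed row\<close>

lemma ln_le_two_sqrt: "ln y \<le> 2 * sqrt y" if "y > 0"
proof -
  have "ln y = 2 * ln (sqrt y)" using that by (simp add: ln_sqrt)
  also have "\<dots> \<le> 2 * sqrt y" using ln_le_minus_one[of "sqrt y"] that by simp
  finally show ?thesis .
qed

text \<open>Through \<open>ln y \<le> 2 * sqrt y\<close> the moment of order \<open>1 / 2\<close> of
  the ratio bounds the mean of the loss by \<open>2 * 8\<close>. The bound \<open>a\<close> is
  quantified inside the almost sure event because later it depends on
  \<open>\<omega>\<close>.\<close>

lemma row_loss:
  assumes r: "r < N" "r \<in> S"
  obtains W where "W \<in> borel_measurable (gauss_sq N)" "\<And>\<omega>. W \<omega> \<ge> 0"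
    "(\<integral>\<^sup>+\<omega>. ennreal (W \<omega>) \<partial>gauss_sq N) \<le> 16"
    "AE \<omega> in gauss_sq N. \<forall>a>0. a \<le> max (cmod (noisy_det N (S - {r}) \<delta> Y \<omega>)) (row_gradient N S \<delta> Y r \<omega>) \<longrightarrow>
       noisy_det N S \<delta> Y \<omega> \<noteq> 0 \<and> ln a - W \<omega> \<le> ln (cmod (noisy_det N S \<delta> Y \<omega>))"
proof -
  define m where "m = (\<lambda>\<omega>. max (cmod (noisy_det N (S - {r}) \<delta> Y \<omega>)) (row_gradient N S \<delta> Y r \<omega>))"
  define x where "x = (\<lambda>\<omega>. cmod (noisy_det N S \<delta> Y \<omega>))"
  define W where "W = (\<lambda>\<omega>. 2 * sqrt (m \<omega> / x \<omega>))"
  have [measurable]: "m \<in> borel_measurable (gauss_sq N)" "x \<in> borel_measurable (gauss_sq N)"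
    unfolding m_def x_def by measurable
  have m0: "m \<omega> \<ge> 0" and x0: "x \<omega> \<ge> 0" for \<omega> by (auto simp: m_def x_def le_max_iff_disj)
  have I: "(\<integral>\<^sup>+\<omega>. ennreal (sqrt (m \<omega>)) / ennreal (sqrt (x \<omega>)) \<partial>gauss_sq N) \<le> 8"
    unfolding m_def x_def by (rule noisy_det_row_moment[OF r])
  \<comment> \<open>In \<open>ennreal\<close> a positive number over 0 is infinite. Finiteness
    therefore forces a nonzero determinant wherever the comparison value \<open>m\<close> is
    positive.\<close>
  have fin: "AE \<omega> in gauss_sq N. ennreal (sqrt (m \<omega>)) / ennreal (sqrt (x \<omega>)) \<noteq> \<infinity>"
    by (rule nn_integral_PInf_AE) (use I in \<open>auto simp: top_unique\<close>)
  show ?thesis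
  proof (rule that[of W])
    show "W \<in> borel_measurable (gauss_sq N)" unfolding W_def by measurable
    show "W \<omega> \<ge> 0" for \<omega> using m0 x0 by (auto simp: W_def)
    have "(\<integral>\<^sup>+\<omega>. ennreal (W \<omega>) \<partial>gauss_sq N) \<le> (\<integral>\<^sup>+\<omega>. 2 * (ennreal (sqrt (m \<omega>)) / ennreal (sqrt (x \<omega>))) \<partial>gauss_sq N)"
    proof (rule nn_integral_mono)
      fix \<omega>
      show "ennreal (W \<omega>) \<le> 2 * (ennreal (sqrt (m \<omega>)) / ennreal (sqrt (x \<omega>)))"
      proof (cases "x \<omega> = 0")
        case False
        then have "x \<omega> > 0" using x0[of \<omega>] by simp
        then show ?thesis using m0[of \<omega>]
          by (simp add: W_def divide_ennreal real_sqrt_divide ennreal_mult' flip: times_divide_eq_right)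
      qed (simp add: W_def)
    qed
    also have "\<dots> = 2 * (\<integral>\<^sup>+\<omega>. ennreal (sqrt (m \<omega>)) / ennreal (sqrt (x \<omega>)) \<partial>gauss_sq N)"
      by (rule nn_integral_cmult) measurable
    also have "\<dots> \<le> 2 * 8" using I by (intro mult_left_mono) auto
    finally show "(\<integral>\<^sup>+\<omega>. ennreal (W \<omega>) \<partial>gauss_sq N) \<le> 16" by simp
    show "AE \<omega> in gauss_sq N. \<forall>a>0. a \<le> max (cmod (noisy_det N (S - {r}) \<delta> Y \<omega>)) (row_gradient N S \<delta> Y r \<omega>) \<longrightarrow>
       noisy_det N S \<delta> Y \<omega> \<noteq> 0 \<and> ln a - W \<omega> \<le> ln (cmod (noisy_det N S \<delta> Y \<omega>))"
      using fin
    proof eventually_elim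
      case (elim \<omega>)
      have "noisy_det N S \<delta> Y \<omega> \<noteq> 0 \<and> ln a - W \<omega> \<le> ln (cmod (noisy_det N S \<delta> Y \<omega>))"
        if a: "a > 0" "a \<le> m \<omega>" for a
      proof -
        have mp: "m \<omega> > 0" using a by simp
        then have xp: "x \<omega> > 0" using elim x0[of \<omega>]
          by (cases "x \<omega> = 0") (auto simp: ennreal_divide_eq_top_iff)
        have "ln (m \<omega> / x \<omega>) \<le> W \<omega>" unfolding W_def using mp xp by (intro ln_le_two_sqrt) auto
        then have "ln (m \<omega>) - W \<omega> \<le> ln (x \<omega>)" using mp xp by (simp add: ln_div)
        moreover have "ln a \<le> ln (m \<omega>)" using a by simp
        ultimately show ?thesis using xp by (auto simp: x_def)
      qed
      then show ?case unfolding m_def by blast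
    qed
  qed
qed

text \<open>Noise is added row by row, using only the constant term of each affine function. That
  term is the determinant reached before, so every row lowers the logarithm by at most 16 in mean,
  whatever the size of \<open>\<delta>\<close>.\<close>

lemma noisy_det_lower_crude:
  assumes S: "S \<subseteq> {..<N}" and Y: "det (mat N N (\<lambda>(i, j). Y i j)) \<noteq> 0"
  shows "\<exists>W. W \<in> borel_measurable (gauss_sq N) \<and> (\<forall>\<omega>. W \<omega> \<ge> 0) \<and>
    (\<integral>\<^sup>+\<omega>. ennreal (W \<omega>) \<partial>gauss_sq N) \<le> ennreal (16 * card S) \<and>
    (AE \<omega> in gauss_sq N. noisy_det N S \<delta> Y \<omega> \<noteq> 0 \<and>
       ln (cmod (det (mat N N (\<lambda>(i, j). Y i j)))) - W \<omega> \<le> ln (cmod (noisy_det N S \<delta> Y \<omega>)))"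
  using finite_subset[OF S finite_lessThan] S
proof (induction S rule: finite_induct)
  case empty
  have "noisy_det N {} \<delta> Y \<omega> = det (mat N N (\<lambda>(i, j). Y i j))" for \<omega>
    by (simp add: noisy_det_def noisy_mat_def)
  then show ?case using Y by (intro exI[of _ "\<lambda>_. 0"]) auto
next
  case (insert r S)
  obtain W where W: "W \<in> borel_measurable (gauss_sq N)" "\<And>\<omega>. W \<omega> \<ge> 0"
    "(\<integral>\<^sup>+\<omega>. ennreal (W \<omega>) \<partial>gauss_sq N) \<le> ennreal (16 * card S)"
    "AE \<omega> in gauss_sq N. noisy_det N S \<delta> Y \<omega> \<noteq> 0 \<and>
       ln (cmod (det (mat N N (\<lambda>(i, j). Y i j)))) - W \<omega> \<le> ln (cmod (noisy_det N S \<delta> Y \<omega>))"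
    using insert by auto
  obtain V where V: "V \<in> borel_measurable (gauss_sq N)" "\<And>\<omega>. V \<omega> \<ge> 0"
    "(\<integral>\<^sup>+\<omega>. ennreal (V \<omega>) \<partial>gauss_sq N) \<le> 16"
    "AE \<omega> in gauss_sq N. \<forall>a>0. a \<le> max (cmod (noisy_det N (insert r S - {r}) \<delta> Y \<omega>)) (row_gradient N (insert r S) \<delta> Y r \<omega>) \<longrightarrow>
       noisy_det N (insert r S) \<delta> Y \<omega> \<noteq> 0 \<and> ln a - V \<omega> \<le> ln (cmod (noisy_det N (insert r S) \<delta> Y \<omega>))"
    using row_loss[of r N "insert r S"] insert by auto
  have "insert r S - {r} = S" using insert by auto
  note V(4)[unfolded this]
  then have "AE \<omega> in gauss_sq N. noisy_det N (insert r S) \<delta> Y \<omega> \<noteq> 0 \<and>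
       ln (cmod (det (mat N N (\<lambda>(i, j). Y i j)))) - (W \<omega> + V \<omega>) \<le> ln (cmod (noisy_det N (insert r S) \<delta> Y \<omega>))"
    using W(4)
  proof eventually_elim
    case (elim \<omega>)
    then have "noisy_det N (insert r S) \<delta> Y \<omega> \<noteq> 0 \<and> ln (cmod (noisy_det N S \<delta> Y \<omega>)) - V \<omega> \<le> ln (cmod (noisy_det N (insert r S) \<delta> Y \<omega>))"
      using elim(1)[rule_format, of "cmod (noisy_det N S \<delta> Y \<omega>)"] by (auto simp: le_max_iff_disj)
    then show ?case using elim(2) by auto
  qed
  moreover have "(\<integral>\<^sup>+\<omega>. ennreal (W \<omega> + V \<omega>) \<partial>gauss_sq N) \<le> ennreal (16 * card (insert r S))"
  proof -
    have "(\<integral>\<^sup>+\<omega>. ennreal (W \<omega> + V \<omega>) \<partial>gauss_sq N) = (\<integral>\<^sup>+\<omega>. ennreal (W \<omega>) \<partial>gauss_sq N) + (\<integral>\<^sup>+\<omega>. ennreal (V \<omega>) \<partial>gauss_sq N)"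
      using W V by (subst nn_integral_add[symmetric]) auto
    also have "\<dots> \<le> ennreal (16 * card S) + ennreal 16"
      using W V by (intro add_mono) auto
    also have "\<dots> = ennreal (16 * card (insert r S))"
      using insert by (subst ennreal_plus[symmetric]) auto
    finally show ?thesis .
  qed
  ultimately show ?case using W V by (intro exI[of _ "\<lambda>\<omega>. W \<omega> + V \<omega>"]) auto
qed

text \<open>Jensen's inequality for the logarithm. Because the right side has the sum and not the
  mean, \<open>ln (card J)\<close> is gained; these gains multiply up to the factorial
  below.\<close>

lemma mean_ln_le_ln_mean:
  assumes J: "finite J" "J \<noteq> {}" and x: "\<And>j. j \<in> J \<Longrightarrow> x j > (0::real)"
  shows "(\<Sum>j\<in>J. ln (x j)) / card J + ln (card J) \<le> ln (\<Sum>j\<in>J. x j)"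
proof -
  define M where "M = (\<Sum>j\<in>J. x j) / card J"
  have c: "card J > 0" using J by (simp add: card_gt_0_iff)
  have S: "(\<Sum>j\<in>J. x j) > 0" using J x by (intro sum_pos) auto
  then have M: "M > 0" using c by (simp add: M_def)
  have "(\<Sum>j\<in>J. ln (x j)) \<le> (\<Sum>j\<in>J. ln M + x j / M - 1)"
  proof (rule sum_mono)
    fix j assume "j \<in> J"
    then have "ln (x j / M) \<le> x j / M - 1" using x M by (intro ln_le_minus_one) auto
    then show "ln (x j) \<le> ln M + x j / M - 1" using x[OF \<open>j \<in> J\<close>] M by (simp add: ln_div)
  qed
  also have "\<dots> = card J * ln M + (\<Sum>j\<in>J. x j) / M - card J"
    by (simp add: sum.distrib sum_subtractf sum_divide_distrib)
  also have "(\<Sum>j\<in>J. x j) / M = card J" using S c by (simp add: M_def)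
  finally have "(\<Sum>j\<in>J. ln (x j)) / card J \<le> ln M" using c by (simp add: field_simps)
  also have "ln M = ln (\<Sum>j\<in>J. x j) - ln (card J)" using S c by (simp add: M_def ln_div)
  finally show ?thesis by simp
qed

text \<open>Exposing the rows of \<open>R\<close> one at a time: every row costs a bounded amount, and averaging the
  logarithm over the columns of \<open>J\<close> still available produces the factorial.\<close>

lemma noisy_det_lower_expose:
  assumes "finite R" "R \<subseteq> S" "S \<subseteq> {..<N}" "J \<subseteq> {..<N}" "card R = card J" and \<delta>: "\<delta> \<noteq> 0" and \<kappa>: "\<kappa> > 0"
    and F: "\<And>\<sigma> \<omega>. bij_betw \<sigma> R J \<Longrightarrow>
       cmod (noisy_det N (S - R) \<delta> (\<lambda>i. if i \<in> R then (\<lambda>k. of_real \<kappa> * unit_row (\<sigma> i) k) else Y i) \<omega>) = F \<omega>"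
    and nz: "AE \<omega> in gauss_sq N. F \<omega> > 0"
  shows "\<exists>W. W \<in> borel_measurable (gauss_sq N) \<and> (\<forall>\<omega>. W \<omega> \<ge> 0) \<and>
    (\<integral>\<^sup>+\<omega>. ennreal (W \<omega>) \<partial>gauss_sq N) \<le> ennreal (16 * card R) \<and>
    (AE \<omega> in gauss_sq N. noisy_det N S \<delta> Y \<omega> \<noteq> 0 \<and>
       card R * ln (\<bar>\<delta>\<bar> / \<kappa>) + ln (fact (card R)) / 2 + ln (F \<omega>) - W \<omega> \<le> ln (cmod (noisy_det N S \<delta> Y \<omega>)))"
  using assms(1-5) F
proof (induction R arbitrary: S J Y rule: finite_induct)
  case empty
  have "bij_betw (\<lambda>x. x) {} J" using empty finite_subset[OF empty(3)] by (auto simp: bij_betw_def)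
  from empty(5)[OF this] have "cmod (noisy_det N S \<delta> Y \<omega>) = F \<omega>" for \<omega> by simp
  have "AE \<omega> in gauss_sq N. noisy_det N S \<delta> Y \<omega> \<noteq> 0 \<and> ln (F \<omega>) \<le> ln (cmod (noisy_det N S \<delta> Y \<omega>))"
    using nz
  proof eventually_elim
    case (elim \<omega>)
    then show ?case using \<open>\<And>\<omega>. cmod (noisy_det N S \<delta> Y \<omega>) = F \<omega>\<close>[of \<omega>] by auto
  qed
  then show ?case by (intro exI[of _ "\<lambda>_. 0"] conjI) simp_all
next
  case (insert r R)
  have r: "r < N" "r \<in> S" using insert.prems(1,2) by auto
  have fJ: "finite J" using insert.prems(3) finite_subset by blast
  define m where "m = card J"
  have m: "m = Suc (card R)" using insert.prems(4) insert.hyps by (simp add: m_def)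
  then have "J \<noteq> {}" by (auto simp: m_def)
  \<comment> \<open>The noise of row \<open>r\<close> is traded for a multiple of a unit row in one
    free column \<open>j\<close>; the induction hypothesis then works with the columns
    \<open>J - {j}\<close>. The assumption on \<open>F\<close> says that every complete placement of
    the unit rows has the same modulus, so all branches end at the same value.\<close>
  define Y' where "Y' = (\<lambda>j. Y(r := (\<lambda>k. of_real \<kappa> * unit_row j k)))"
  have SR: "S - {r} - R = S - insert r R" by auto
  have IH: "\<exists>W. W \<in> borel_measurable (gauss_sq N) \<and> (\<forall>\<omega>. W \<omega> \<ge> 0) \<and>
    (\<integral>\<^sup>+\<omega>. ennreal (W \<omega>) \<partial>gauss_sq N) \<le> ennreal (16 * card R) \<and>
    (AE \<omega> in gauss_sq N. noisy_det N (S - {r}) \<delta> (Y' j) \<omega> \<noteq> 0 \<and>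
       card R * ln (\<bar>\<delta>\<bar> / \<kappa>) + ln (fact (card R)) / 2 + ln (F \<omega>) - W \<omega> \<le> ln (cmod (noisy_det N (S - {r}) \<delta> (Y' j) \<omega>)))"
    if j: "j \<in> J" for j
  proof (rule insert.IH[where J = "J - {j}"])
    show "card R = card (J - {j})" using j fJ m by (simp add: m_def)
    fix \<sigma> \<omega> assume s: "bij_betw \<sigma> R (J - {j})"
    have "bij_betw (\<sigma>(r := j)) (insert r R) (insert j (J - {j}))"
    proof -
      have "bij_betw (\<sigma>(r := j)) R (J - {j})"
        using s insert.hyps by (subst bij_betw_cong[where g = \<sigma>]) auto
      then show ?thesis using insert.hyps notIn_Un_bij_betw[of r R "\<sigma>(r := j)" "J - {j}"] by auto
    qed
    then have "bij_betw (\<sigma>(r := j)) (insert r R) J" using j by (simp add: insert_absorb)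
    note * = insert.prems(5)[OF this]
    show "cmod (noisy_det N (S - {r} - R) \<delta> (\<lambda>i. if i \<in> R then (\<lambda>k. of_real \<kappa> * unit_row (\<sigma> i) k) else Y' j i) \<omega>) = F \<omega>"
    proof -
      have "(\<lambda>i. if i \<in> R then (\<lambda>k. of_real \<kappa> * unit_row (\<sigma> i) k) else Y' j i)
          = (\<lambda>i. if i \<in> insert r R then (\<lambda>k. of_real \<kappa> * unit_row ((\<sigma>(r := j)) i) k) else Y i)"
        using insert.hyps(2) by (auto simp: fun_eq_iff Y'_def)
      then show ?thesis using *[of \<omega>] unfolding SR by simp
    qed
  qed (use insert.prems(1-3) insert.hyps in \<open>blast+\<close>)
  define P where "P = (\<lambda>j W. W \<in> borel_measurable (gauss_sq N) \<and> (\<forall>\<omega>. W \<omega> \<ge> 0) \<and>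
    (\<integral>\<^sup>+\<omega>. ennreal (W \<omega>) \<partial>gauss_sq N) \<le> ennreal (16 * card R) \<and>
    (AE \<omega> in gauss_sq N. noisy_det N (S - {r}) \<delta> (Y' j) \<omega> \<noteq> 0 \<and>
       card R * ln (\<bar>\<delta>\<bar> / \<kappa>) + ln (fact (card R)) / 2 + ln (F \<omega>) - W \<omega> \<le> ln (cmod (noisy_det N (S - {r}) \<delta> (Y' j) \<omega>))))"
  have "\<forall>j\<in>J. \<exists>W. P j W" unfolding P_def by (rule ballI) (rule IH)
  from bchoice[OF this] obtain W where PW: "\<And>j. j \<in> J \<Longrightarrow> P j (W j)" by blast
  have W: "\<And>j. j \<in> J \<Longrightarrow> W j \<in> borel_measurable (gauss_sq N)" "\<And>j \<omega>. j \<in> J \<Longrightarrow> W j \<omega> \<ge> 0"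
    "\<And>j. j \<in> J \<Longrightarrow> (\<integral>\<^sup>+\<omega>. ennreal (W j \<omega>) \<partial>gauss_sq N) \<le> ennreal (16 * card R)"
    "\<And>j. j \<in> J \<Longrightarrow> AE \<omega> in gauss_sq N. noisy_det N (S - {r}) \<delta> (Y' j) \<omega> \<noteq> 0 \<and>
       card R * ln (\<bar>\<delta>\<bar> / \<kappa>) + ln (fact (card R)) / 2 + ln (F \<omega>) - W j \<omega> \<le> ln (cmod (noisy_det N (S - {r}) \<delta> (Y' j) \<omega>))"
    by (drule PW, unfold P_def, elim conjE, (assumption | erule spec))+
  obtain V where V: "V \<in> borel_measurable (gauss_sq N)" "\<And>\<omega>. V \<omega> \<ge> 0"
    "(\<integral>\<^sup>+\<omega>. ennreal (V \<omega>) \<partial>gauss_sq N) \<le> 16"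
    "AE \<omega> in gauss_sq N. \<forall>a>0. a \<le> max (cmod (noisy_det N (S - {r}) \<delta> Y \<omega>)) (row_gradient N S \<delta> Y r \<omega>) \<longrightarrow>
       noisy_det N S \<delta> Y \<omega> \<noteq> 0 \<and> ln a - V \<omega> \<le> ln (cmod (noisy_det N S \<delta> Y \<omega>))"
    using row_loss[OF r] by blast
  \<comment> \<open>Averaging the losses of the branches over \<open>j\<close> keeps their mean at
    \<open>16 * card R\<close>; the row \<open>r\<close> itself adds 16.\<close>
  define T where "T = (\<lambda>\<omega>. V \<omega> + (\<Sum>j\<in>J. W j \<omega>) / m)"
  have AEW: "AE \<omega> in gauss_sq N. \<forall>j\<in>J. noisy_det N (S - {r}) \<delta> (Y' j) \<omega> \<noteq> 0 \<and>
       card R * ln (\<bar>\<delta>\<bar> / \<kappa>) + ln (fact (card R)) / 2 + ln (F \<omega>) - W j \<omega> \<le> ln (cmod (noisy_det N (S - {r}) \<delta> (Y' j) \<omega>))"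
    using W(4) fJ by (subst AE_finite_all) auto
  have "AE \<omega> in gauss_sq N. noisy_det N S \<delta> Y \<omega> \<noteq> 0 \<and>
       card (insert r R) * ln (\<bar>\<delta>\<bar> / \<kappa>) + ln (fact (card (insert r R))) / 2 + ln (F \<omega>) - T \<omega> \<le> ln (cmod (noisy_det N S \<delta> Y \<omega>))"
    using V(4) AEW
  proof eventually_elim
    case (elim \<omega>)
    define u where "u = (\<lambda>j. cmod (noisy_det N (S - {r}) \<delta> (Y(r := unit_row j)) \<omega>))"
    have Yu: "cmod (noisy_det N (S - {r}) \<delta> (Y' j) \<omega>) = \<kappa> * u j" for j
      unfolding Y'_def using \<kappa> r by (subst noisy_det_scale_row) (auto simp: norm_mult u_def)
    have up: "u j > 0" if "j \<in> J" for j
      using elim(2) that Yu[of j] \<kappa> by (auto simp: u_def less_le)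
    define A where "A = card R * ln (\<bar>\<delta>\<bar> / \<kappa>) + ln (fact (card R)) / 2 + ln (F \<omega>)"
    have lu: "A - W j \<omega> - ln \<kappa> \<le> ln (u j)" if "j \<in> J" for j
    proof -
      have "A - W j \<omega> \<le> ln (\<kappa> * u j)" using elim(2) that by (auto simp: A_def Yu)
      then show ?thesis using up[OF that] \<kappa> by (simp add: ln_mult)
    qed
    \<comment> \<open>Only the columns of \<open>J\<close> are kept from the gradient. Applying
      Jensen to the squares \<open>(u j)\<^sup>2\<close> yields \<open>ln m / 2\<close>, the next
      factor of the square root of the factorial.\<close>
    define a where "a = \<bar>\<delta>\<bar> * sqrt (\<Sum>j\<in>J. (u j)\<^sup>2)"
    have s: "(\<Sum>j\<in>J. (u j)\<^sup>2) > 0" using \<open>J \<noteq> {}\<close> by (intro sum_pos zero_less_power up fJ)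
    then have ap: "a > 0" using \<delta> by (simp add: a_def)
    have "(\<Sum>j\<in>J. (u j)\<^sup>2) \<le> (\<Sum>j<N. (u j)\<^sup>2)" using insert.prems(3) by (intro sum_mono2) auto
    then have "a \<le> row_gradient N S \<delta> Y r \<omega>"
      unfolding a_def row_gradient_def u_def by (intro mult_left_mono real_sqrt_le_mono) auto
    then have main: "noisy_det N S \<delta> Y \<omega> \<noteq> 0" "ln a - V \<omega> \<le> ln (cmod (noisy_det N S \<delta> Y \<omega>))"
      using elim(1) ap by (auto simp: le_max_iff_disj)
    have mp: "real m > 0" using m by simp
    have "A - (\<Sum>j\<in>J. W j \<omega>) / m - ln \<kappa> = (\<Sum>j\<in>J. A - W j \<omega> - ln \<kappa>) / m"
      using mp by (simp add: sum_subtractf sum.distrib m_def[symmetric] field_simps)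
    also have "\<dots> \<le> (\<Sum>j\<in>J. ln (u j)) / m"
      using lu by (intro divide_right_mono sum_mono) auto
    also have "\<dots> = ((\<Sum>j\<in>J. ln ((u j)\<^sup>2)) / m) / 2"
    proof -
      have "(\<Sum>j\<in>J. ln ((u j)\<^sup>2)) = 2 * (\<Sum>j\<in>J. ln (u j))"
        unfolding sum_distrib_left using up by (intro sum.cong refl) (simp add: ln_realpow)
      then show ?thesis by simp
    qed
    also have "\<dots> \<le> (ln (\<Sum>j\<in>J. (u j)\<^sup>2) - ln m) / 2"
      using mean_ln_le_ln_mean[OF fJ \<open>J \<noteq> {}\<close>, of "\<lambda>j. (u j)\<^sup>2", OF zero_less_power[OF up]]
      by (simp add: m_def[symmetric])
    also have "\<dots> = ln a - ln \<bar>\<delta>\<bar> - ln m / 2"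
      using s \<delta> by (simp add: a_def ln_mult ln_sqrt)
    finally have "A + ln (\<bar>\<delta>\<bar> / \<kappa>) + ln m / 2 - (\<Sum>j\<in>J. W j \<omega>) / m \<le> ln a"
      using \<delta> \<kappa> by (simp add: ln_div)
    moreover have "ln (fact (card (insert r R)) :: real) = ln (fact (card R)) + ln m"
      using insert.hyps m by (simp add: ln_mult)
    ultimately show ?case using main insert.hyps unfolding A_def T_def
      by (simp add: algebra_simps add_divide_distrib)
  qed
  moreover have "(\<integral>\<^sup>+\<omega>. ennreal (T \<omega>) \<partial>gauss_sq N) \<le> ennreal (16 * card (insert r R))"
  proof -
    have "(\<integral>\<^sup>+\<omega>. ennreal (T \<omega>) \<partial>gauss_sq N) = (\<integral>\<^sup>+\<omega>. ennreal (V \<omega>) + ennreal (1 / m) * (\<Sum>j\<in>J. ennreal (W j \<omega>)) \<partial>gauss_sq N)"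
      unfolding T_def using V W
      by (intro nn_integral_cong) (simp add: ennreal_mult'[symmetric] ennreal_plus[symmetric] sum_nonneg sum_ennreal del: ennreal_plus)
    also have "\<dots> = (\<integral>\<^sup>+\<omega>. ennreal (V \<omega>) \<partial>gauss_sq N) + ennreal (1 / m) * (\<Sum>j\<in>J. \<integral>\<^sup>+\<omega>. ennreal (W j \<omega>) \<partial>gauss_sq N)"
    proof -
      have mW: "(\<lambda>\<omega>. ennreal (W j \<omega>)) \<in> borel_measurable (gauss_sq N)" if "j \<in> J" for j
        using W(1)[OF that] by measurable
      then have mS: "(\<lambda>\<omega>. \<Sum>j\<in>J. ennreal (W j \<omega>)) \<in> borel_measurable (gauss_sq N)"
        by (rule borel_measurable_sum)
      have "(\<integral>\<^sup>+\<omega>. ennreal (1 / m) * (\<Sum>j\<in>J. ennreal (W j \<omega>)) \<partial>gauss_sq N)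
          = ennreal (1 / m) * (\<Sum>j\<in>J. \<integral>\<^sup>+\<omega>. ennreal (W j \<omega>) \<partial>gauss_sq N)"
        by (simp only: nn_integral_cmult[OF mS] nn_integral_sum[OF mW])
      then show ?thesis using V(1) mS by (subst nn_integral_add) auto
    qed
    also have "\<dots> \<le> ennreal 16 + ennreal (1 / m) * (\<Sum>j\<in>J. ennreal (16 * card R))"
      using V W by (intro add_mono mult_left_mono sum_mono) auto
    also have "ennreal 16 + ennreal (1 / m) * (\<Sum>j\<in>J. ennreal (16 * card R)) = ennreal (16 * card (insert r R))"
    proof -
      have "(\<Sum>j\<in>J. ennreal (16 * card R)) = ennreal (m * (16 * card R))"
        by (simp add: m_def ennreal_of_nat_eq_real_of_nat ennreal_mult')
      then have "ennreal (1 / m) * (\<Sum>j\<in>J. ennreal (16 * card R)) = ennreal (16 * card R)"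
      proof -
        have "ennreal (1 / m) * ennreal (m * (16 * card R)) = ennreal ((1 / m) * (m * (16 * card R)))"
          by (rule ennreal_mult'[symmetric]) simp
        also have "(1 / m) * real (m * (16 * card R)) = 16 * card R" using \<open>J \<noteq> {}\<close> fJ by (auto simp: m_def)
        finally show ?thesis using \<open>(\<Sum>j\<in>J. ennreal (16 * card R)) = ennreal (m * (16 * card R))\<close> by simp
      qed
      then show ?thesis using insert.hyps by (simp only: ennreal_plus[symmetric]) simp
    qed
    finally show ?thesis .
  qed
  moreover have "T \<in> borel_measurable (gauss_sq N)" using V W unfolding T_def by measurable
  moreover have "T \<omega> \<ge> 0" for \<omega> using V W by (auto simp: T_def intro!: add_nonneg_nonneg divide_nonneg_nonneg sum_nonneg)
  ultimately show ?case by (intro exI[of _ T]) auto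
qed

subsection \<open>Jordan blocks\<close>

text \<open>A partition of \<open>{..<N}\<close> into intervals: \<open>f i\<close> is the first index and \<open>len i\<close> the length of the
  interval that contains \<open>i\<close>.\<close>

locale block_partition =
  fixes N :: nat and f len :: "nat \<Rightarrow> nat"
  assumes first_le: "i < N \<Longrightarrow> f i \<le> i"
    and less_end: "i < N \<Longrightarrow> i < f i + len i"
    and end_le: "i < N \<Longrightarrow> f i + len i \<le> N"
    and first_eq: "i < N \<Longrightarrow> f i \<le> j \<Longrightarrow> j < f i + len i \<Longrightarrow> f j = f i"
    and len_eq: "i < N \<Longrightarrow> f i \<le> j \<Longrightarrow> j < f i + len i \<Longrightarrow> len j = len i"
begin

definition lst :: "nat \<Rightarrow> nat" where "lst i = f i + len i - 1"

text \<open>Each block is represented by its last index.\<close>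

definition Lasts :: "nat set" where "Lasts = {i. i < N \<and> i = lst i}"

lemma finite_Lasts [simp]: "finite Lasts" unfolding Lasts_def by auto

lemma len_pos: "i < N \<Longrightarrow> 0 < len i"
  using first_le[of i] less_end[of i] by linarith

lemma block_eq:
  assumes "i < N" "f i \<le> j" "j < f i + len i"
  shows "j < N" "f j = f i" "len j = len i" "lst j = lst i"
  using assms end_le[of i] first_eq[of i j] len_eq[of i j] by (auto simp: lst_def)

lemma same_first:
  assumes "i < N" "j < N" "f i = f j"
  shows "len i = len j" "lst i = lst j" "f i \<le> j" "j < f i + len i"
proof -
  have "f i \<le> f i" "f i < f i + len i" "f j < f j + len j" using assms len_pos by auto
  then have "len (f i) = len i" "len (f j) = len j" using block_eq[of i "f i"] block_eq[of j "f j"] assms by auto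
  then show "len i = len j" using assms by simp
  then show "lst i = lst j" "f i \<le> j" "j < f i + len i"
    using assms first_le[of j] less_end[of j] by (auto simp: lst_def)
qed

lemma le_lst: "i < N \<Longrightarrow> i \<le> lst i" using less_end[of i] by (simp add: lst_def)

lemma lst_props:
  assumes "i < N"
  shows "lst i < N" "f (lst i) = f i" "len (lst i) = len i" "lst (lst i) = lst i"
  using block_eq[of i "lst i"] assms len_pos[of i] first_le[of i] by (auto simp: lst_def)

lemma first_props:
  assumes "i < N"
  shows "f i < N" "f (f i) = f i" "len (f i) = len i" "lst (f i) = lst i"
  using block_eq[of i "f i"] assms len_pos[of i] by auto

lemma lst_in: "i < N \<Longrightarrow> lst i \<in> Lasts" using lst_props[of i] by (simp add: Lasts_def)

lemma block_set:
  assumes b: "b \<in> Lasts"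
  shows "{j. j < N \<and> lst j = b} = {f b..b}"
proof -
  have bN: "b < N" "b = lst b" using b by (auto simp: Lasts_def)
  show ?thesis
  proof (rule Set.set_eqI, rule iffI)
    fix j assume j: "j \<in> {j. j < N \<and> lst j = b}"
    then have jN: "j < N" and jb: "lst j = b" by auto
    have "f b \<le> j" using first_le[OF jN] lst_props(2)[OF jN] unfolding jb by simp
    moreover have "j \<le> b" using le_lst[OF jN] unfolding jb .
    ultimately show "j \<in> {f b..b}" by simp
  next
    fix j assume "j \<in> {f b..b}"
    then have "f b \<le> j" "j < f b + len b" using less_end[OF bN(1)] by auto
    note block_eq[OF bN(1) this]
    then show "j \<in> {j. j < N \<and> lst j = b}" using bN(2) by simp
  qed
qed

lemma card_block: "b \<in> Lasts \<Longrightarrow> card {j. j < N \<and> lst j = b} = len b"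
proof -
  assume b: "b \<in> Lasts"
  then have bN: "b < N" and bl: "lst b = b" by (auto simp: Lasts_def)
  have "Suc b - f b = len b" using bl len_pos[OF bN] unfolding lst_def by linarith
  then show ?thesis by (simp add: block_set[OF b])
qed

lemma sum_by_blocks: "(\<Sum>j<N. g j) = (\<Sum>b\<in>Lasts. \<Sum>j\<in>{j. j < N \<and> lst j = b}. g j)"
proof -
  have "(\<Sum>b\<in>Lasts. \<Sum>j\<in>{j\<in>{..<N}. lst j = b}. g j) = (\<Sum>j<N. g j)"
    by (rule sum.group) (auto simp: lst_in)
  then show ?thesis by (simp add: lessThan_def)
qed

text \<open>Turns quantities attached to blocks into sums over indices, so that no enumeration of
  the blocks is required.\<close>

lemma sum_average: "(\<Sum>j<N. h (lst j) / real (len j)) = (\<Sum>b\<in>Lasts. (h b :: real))"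
proof -
  have "(\<Sum>j\<in>{j. j < N \<and> lst j = b}. h (lst j) / real (len j)) = h b" if b: "b \<in> Lasts" for b
  proof -
    have "(\<Sum>j\<in>{j. j < N \<and> lst j = b}. h (lst j) / real (len j)) = (\<Sum>j\<in>{j. j < N \<and> lst j = b}. h b / real (len b))"
      using lst_props by (intro sum.cong refl) auto
    also have "\<dots> = h b" using card_block[OF b] b len_pos[of b] by (simp add: Lasts_def)
    finally show ?thesis .
  qed
  then show ?thesis by (subst sum_by_blocks) (auto intro: sum.cong)
qed

text \<open>Columns whose weight decays away from the end of their block contribute in proportion to
  the number of blocks, not to \<open>N\<close>.\<close>

lemma sum_geometric_blocks:
  assumes q: "0 \<le> q" "q < (1::real)"
  shows "(\<Sum>j<N. q ^ (lst j - j)) \<le> card Lasts / (1 - q)"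
proof -
  have "(\<Sum>j<N. q ^ (lst j - j)) = (\<Sum>b\<in>Lasts. \<Sum>j\<in>{j. j < N \<and> lst j = b}. q ^ (b - j))"
    by (subst sum_by_blocks) (auto intro!: sum.cong)
  also have "\<dots> \<le> (\<Sum>b\<in>Lasts. 1 / (1 - q))"
  proof (rule sum_mono)
    fix b assume b: "b \<in> Lasts"
    have "(\<Sum>j\<in>{j. j < N \<and> lst j = b}. q ^ (b - j)) \<le> (\<Sum>j\<in>{..b}. q ^ (b - j))"
      unfolding block_set[OF b] by (rule sum_mono2) (use q in auto)
    also have "\<dots> = (\<Sum>m\<le>b. q ^ m)"
      by (rule sum.reindex_bij_witness[of _ "\<lambda>m. b - m" "\<lambda>m. b - m"]) auto
    also have "\<dots> \<le> 1 / (1 - q)"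
      using sum_le_suminf[OF summable_geometric, of q "{..b}"] q suminf_geometric[of q] by auto
    finally show "(\<Sum>j\<in>{j. j < N \<and> lst j = b}. q ^ (b - j)) \<le> 1 / (1 - q)" .
  qed
  finally show ?thesis by simp
qed

end

section \<open>The modified Jordan matrix, its inverse and its determinant\<close>

locale jordan_split = block_partition +
  fixes z :: complex and e :: real
  assumes z0: "z \<noteq> 0" and z1: "cmod z \<noteq> 1" and e: "0 < e" "e \<le> 1"
begin

text \<open>With this threshold the larger of two contributions to the determinant is chosen: a good
  block contributes \<open>cmod z ^ len i \<ge> e\<close>, a bad one contributes \<open>e\<close>
  after its last row is replaced.\<close>

definition bad :: "nat \<Rightarrow> bool" where "bad i \<longleftrightarrow> cmod z ^ len i < e"

definition A :: "nat \<Rightarrow> nat \<Rightarrow> complex" where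
  "A i j = (if i = j then z else if j = Suc i \<and> j < f i + len i then -1 else 0)"

definition R :: "nat set" where "R = {i \<in> Lasts. bad i}"

definition J :: "nat set" where "J = f ` R"

text \<open>In every bad block the last row is replaced by a multiple of the first unit vector: this
  is the choice of one noise entry that contributes most to the determinant.\<close>

definition L :: "nat \<Rightarrow> nat \<Rightarrow> complex" where
  "L i = (if i \<in> R then (\<lambda>k. of_real e * unit_row (f i) k) else A i)"

text \<open>Solving \<open>L y = v\<close> blockwise. In a good block this is back substitution,
  with negative powers of \<open>z\<close>. In a bad block the replaced row gives the first
  coordinate of \<open>y\<close>, which is the last coordinate of \<open>v\<close> divided by
  \<open>e\<close>, and the other rows become the forward recursion
  \<open>y (i + 1) = z * y i - v i\<close>, so that only nonnegative powers of \<open>z\<close>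
  occur.\<close>

definition Q :: "nat \<Rightarrow> nat \<Rightarrow> complex" where
  "Q i j = (if f i \<noteq> f j then 0
     else if bad i then (if j = lst i then z ^ (i - f i) / of_real e else if j < i then - (z ^ (i - j - 1)) else 0)
     else if i \<le> j then inverse (z ^ (j - i + 1)) else 0)"

definition Lmat :: "complex mat" where "Lmat = mat N N (\<lambda>(i, j). L i j)"
definition Qmat :: "complex mat" where "Qmat = mat N N (\<lambda>(i, j). Q i j)"

lemma carriers [simp]: "Lmat \<in> carrier_mat N N" "Qmat \<in> carrier_mat N N"
  by (auto simp: Lmat_def Qmat_def)

lemma R_props: "i \<in> R \<Longrightarrow> i < N \<and> i = lst i \<and> bad i"
  by (auto simp: R_def Lasts_def)

lemma bad_cong: "len i = len j \<Longrightarrow> bad i = bad j" by (simp add: bad_def)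

lemma A_mult:
  assumes i: "i < N"
  shows "(\<Sum>k<N. A i k * g k) = z * g i - (if Suc i < f i + len i then g (Suc i) else 0)"
proof -
  have "(\<Sum>k<N. A i k * g k) = (\<Sum>k<N. (if k = i then z * g i else 0) + (if k = Suc i then (if Suc i < f i + len i then - g (Suc i) else 0) else 0))"
    by (intro sum.cong refl) (auto simp: A_def)
  also have "\<dots> = z * g i - (if Suc i < f i + len i then g (Suc i) else 0)"
    using i end_le[OF i] by (auto simp: sum.distrib)
  finally show ?thesis .
qed

lemma A_Q:
  assumes i: "i < N" "i \<notin> R" and j: "j < N"
  shows "z * Q i j - (if Suc i < f i + len i then Q (Suc i) j else 0) = (if i = j then 1 else 0)"
proof (cases "f i = f j")
  case False
  then show ?thesis using block_eq[OF i(1), of "Suc i"] first_le[OF i(1)] by (auto simp: Q_def)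
next
  case True
  note sf = same_first[OF i(1) j True]
  have S: "f (Suc i) = f i" "bad (Suc i) = bad i" "lst (Suc i) = lst i" if "Suc i < f i + len i"
  proof -
    have "f i \<le> Suc i" using first_le[OF i(1)] by simp
    note b = block_eq[OF i(1) this that]
    show "f (Suc i) = f i" "bad (Suc i) = bad i" "lst (Suc i) = lst i"
      by (rule b(2), rule bad_cong[OF b(3)], rule b(4))
  qed
  have lst_iff: "Suc i < f i + len i \<longleftrightarrow> i \<noteq> lst i"
    using less_end[OF i(1)] by (auto simp: lst_def)
  show ?thesis
  proof (cases "bad i")
    case b: True
    \<comment> \<open>The last row of a bad block lies in \<open>R\<close>, so \<open>i\<close> has
      a successor in its block.\<close>
    then have ni: "i \<noteq> lst i" using i by (auto simp: R_def Lasts_def)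
    then have Si: "Suc i < f i + len i" using lst_iff by simp
    have il: "i < lst i" using ni le_lst[OF i(1)] by simp
    show ?thesis
    proof (cases "j = lst i")
      case True
      then show ?thesis using b True \<open>f i = f j\<close> S[OF Si] Si il first_le[OF i(1)] e
        by (simp add: Q_def Suc_diff_le)
    next
      case jl: False
      consider "j < i" | "j = i" | "j > i" by linarith
      then show ?thesis
      proof cases
        case 1
        then have "Suc i - j - 1 = Suc (i - j - 1)" by simp
        then show ?thesis using b True S[OF Si] Si jl by (simp add: Q_def)
      next
        case 2
        then show ?thesis using b True S[OF Si] Si jl by (simp add: Q_def)
      next
        case 3
        then show ?thesis using b True S[OF Si] Si jl by (simp add: Q_def)
      qed
    qed
  next
    case nb: False
    show ?thesis
    proof (cases "i = lst i")
      case il: True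
      have "j \<le> i" using sf(2) le_lst[OF j] il by linarith
      then show ?thesis using nb True il lst_iff z0 by (auto simp: Q_def)
    next
      case False
      then have Si: "Suc i < f i + len i" using lst_iff by simp
      consider "j < i" | "j = i" | "j > i" by linarith
      then show ?thesis
      proof cases
        case 3
        then have "j - i = Suc (j - Suc i)" by simp
        then show ?thesis using nb True S[OF Si] Si 3 z0 by (simp add: Q_def)
      qed (use nb True S[OF Si] Si z0 in \<open>auto simp: Q_def\<close>)
    qed
  qed
qed

lemma L_Q:
  assumes i: "i < N" and j: "j < N"
  shows "(\<Sum>k<N. L i k * Q k j) = (if i = j then 1 else 0)"
proof (cases "i \<in> R")
  case False
  then show ?thesis using A_mult[OF i, of "\<lambda>k. Q k j"] A_Q[OF i False j] by (simp add: L_def)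
next
  case True
  have il: "i = lst i" "bad i" using R_props[OF True] by auto
  have "(\<Sum>k<N. L i k * Q k j) = (\<Sum>k<N. if k = f i then of_real e * Q (f i) j else 0)"
    using True by (intro sum.cong refl) (auto simp: L_def unit_row_def)
  also have "\<dots> = of_real e * Q (f i) j" using first_props[OF i] by simp
  also have "\<dots> = (if i = j then 1 else 0)"
  proof (cases "f i = f j")
    case T: True
    have "f i \<le> j" using same_first[OF i j T] by simp
    then show ?thesis using T first_props[OF i] il e bad_cong[of "f i" i]
      by (auto simp: Q_def)
  next
    case False
    then show ?thesis using first_props[OF i] by (auto simp: Q_def)
  qed
  finally show ?thesis .
qed

lemma Lmat_Qmat: "Lmat * Qmat = 1\<^sub>m N"
proof (rule eq_matI)
  fix i j assume "i < dim_row (1\<^sub>m N :: complex mat)" "j < dim_col (1\<^sub>m N :: complex mat)"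
  then show "(Lmat * Qmat) $$ (i, j) = 1\<^sub>m N $$ (i, j)"
    using L_Q[of i j] by (simp add: Lmat_def Qmat_def scalar_prod_def atLeast0LessThan)
qed (auto simp: Lmat_def Qmat_def)

lemma det_Lmat_Qmat: "det Lmat * det Qmat = 1"
  using det_mult[OF carriers] Lmat_Qmat by simp

text \<open>The permutations below reverse every bad block, which makes \<open>Lmat\<close> upper triangular.\<close>

definition pr :: "nat \<Rightarrow> nat" where
  "pr p = (if p < N \<and> bad p \<and> p \<noteq> lst p then f p + lst p - p - 1 else p)"

text \<open>All columns of a bad block are reversed, but only the rows before its last one: in this
  way the entries \<open>-1\<close> and finally \<open>e\<close> come to lie on the
  diagonal.\<close>

definition pc :: "nat \<Rightarrow> nat" where
  "pc p = (if p < N \<and> bad p then f p + lst p - p else p)"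

lemma permutes_involution:
  assumes "\<And>p. p < N \<Longrightarrow> g p < N" "\<And>p. p < N \<Longrightarrow> g (g p) = p" "\<And>p. \<not> p < N \<Longrightarrow> g p = p"
  shows "g permutes {0..<N}"
proof (rule bij_imp_permutes)
  show "bij_betw g {0..<N} {0..<N}"
    by (rule bij_betw_byWitness[where f' = g]) (use assms in auto)
qed (use assms in auto)

lemma pc_permutes: "pc permutes {0..<N}"
proof (rule permutes_involution)
  fix p assume p: "p < N"
  have *: "f p \<le> p" "p \<le> lst p" "lst p < N" using first_le[OF p] le_lst[OF p] lst_props[OF p] by auto
  show "pc p < N" using * p by (auto simp: pc_def)
  show "pc (pc p) = p"
  proof (cases "bad p")
    case True
    define p' where "p' = f p + lst p - p"
    have p': "f p \<le> p'" "p' \<le> lst p" using * by (auto simp: p'_def)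
    then have "p' < f p + len p" using len_pos[OF p] by (auto simp: lst_def)
    note b = block_eq[OF p p'(1) this]
    have "pc p = p'" using True p by (simp add: pc_def p'_def)
    moreover have "pc p' = p" using True b bad_cong[of p' p] * by (simp add: pc_def) (simp add: p'_def)
    ultimately show ?thesis by simp
  qed (use p in \<open>simp add: pc_def\<close>)
qed (auto simp: pc_def)

lemma pr_permutes: "pr permutes {0..<N}"
proof (rule permutes_involution)
  fix p assume p: "p < N"
  have *: "f p \<le> p" "p \<le> lst p" "lst p < N" using first_le[OF p] le_lst[OF p] lst_props[OF p] by auto
  show "pr p < N" using * p by (auto simp: pr_def)
  show "pr (pr p) = p"
  proof (cases "bad p \<and> p \<noteq> lst p")
    case True
    define p' where "p' = f p + lst p - p - 1"
    have p': "f p \<le> p'" "p' < lst p" using * True by (auto simp: p'_def)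
    then have "p' < f p + len p" using len_pos[OF p] by (auto simp: lst_def)
    note b = block_eq[OF p p'(1) this]
    have "pr p = p'" using True p by (simp add: pr_def p'_def)
    moreover have "pr p' = p" using True b bad_cong[of p' p] * p' by (simp add: pr_def) (simp add: p'_def)
    ultimately show ?thesis by simp
  qed (use p in \<open>auto simp: pr_def\<close>)
qed (auto simp: pr_def)

lemma det_permute_columns:
  assumes A: "(B :: complex mat) \<in> carrier_mat n n" and p: "p permutes {0..<n}"
  shows "det (mat n n (\<lambda>(i, j). B $$ (i, p j))) = signof p * det B"
proof -
  have "det (mat n n (\<lambda>(i, j). B $$ (i, p j))) = det (mat n n (\<lambda>(i, j). B $$ (i, p j)))\<^sup>T"
    by (rule det_transpose[symmetric, of _ n]) simp
  also have "(mat n n (\<lambda>(i, j). B $$ (i, p j)))\<^sup>T = mat n n (\<lambda>(i, j). B\<^sup>T $$ (p i, j))"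
    by (rule eq_matI) (use A permutes_in_image[OF p] in auto)
  also have "det \<dots> = signof p * det B\<^sup>T" by (rule det_permute_rows[OF _ p]) (use A in auto)
  also have "det B\<^sup>T = det B" by (rule det_transpose[OF A])
  finally show ?thesis .
qed

lemma cmod_signof: "cmod (signof p) = 1"
  by (rule sign_cases[of p]) auto

lemma cmod_det_Lmat:
  "cmod (det Lmat) = (\<Prod>p<N. if bad p then (if p = lst p then e else 1) else cmod z)"
proof -
  define U where "U = mat N N (\<lambda>(i, j). L (pr i) (pc j))"
  have lt: "pr i < N" "pc i < N" if "i < N" for i
    using that permutes_in_image[OF pr_permutes, of i] permutes_in_image[OF pc_permutes, of i] by auto
  define B where "B = mat N N (\<lambda>(i, j). Lmat $$ (pr i, j))"
  have dB: "det B = signof pr * det Lmat"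
    unfolding B_def by (rule det_permute_rows[OF _ pr_permutes]) simp
  have UB: "U = mat N N (\<lambda>(i, j). B $$ (i, pc j))"
    by (rule eq_matI) (auto simp: U_def B_def Lmat_def lt)
  have "det U = signof pc * det B"
    unfolding UB by (rule det_permute_columns[OF _ pc_permutes]) (simp add: B_def)
  then have cU: "cmod (det U) = cmod (det Lmat)" by (simp only: dB norm_mult cmod_signof mult_1)
  have entry: "(p = lst p \<longrightarrow> L (pr p) (pc p') = (if p' = p then of_real e else 0)) \<and>
      (p \<noteq> lst p \<longrightarrow> (p' < p \<longrightarrow> L (pr p) (pc p') = 0) \<and> (p' = p \<longrightarrow> L (pr p) (pc p') = -1))"
    if p: "p < N" "bad p" and p': "p' < N" for p p'
  proof (cases "f p' = f p")
    case True
    note sf = same_first[OF p(1) p' True[symmetric]]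
    have pc: "pc p' = f p + lst p - p'" using sf p p' bad_cong[of p' p] True by (simp add: pc_def)
    have *: "f p \<le> p" "p \<le> lst p" "f p \<le> p'" "p' \<le> lst p" "lst p < N"
      using first_le[OF p(1)] le_lst[OF p(1)] lst_props[OF p(1)] sf le_lst[OF p'] by auto
    show ?thesis
    proof (cases "p = lst p")
      case l: True
      then have "p \<in> R" using p by (simp add: R_def Lasts_def)
      moreover have "pr p = p" using l by (simp add: pr_def)
      moreover have "pc p' = f p \<longleftrightarrow> p' = p" using * l unfolding pc by linarith
      ultimately show ?thesis using l by (simp add: L_def unit_row_def)
    next
      case nl: False
      define m where "m = f p + lst p - p - 1"
      have m: "f p \<le> m" "m < lst p" using * nl by (auto simp: m_def)
      then have mb: "m < f p + len p" by (auto simp: lst_def)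
      note b = block_eq[OF p(1) m(1) mb]
      have prm: "pr p = m" using nl p by (simp add: pr_def m_def)
      have "m \<notin> R" using b m by (auto simp: R_def Lasts_def)
      have bend: "f m + len m = Suc (lst p)" using b len_pos[OF p(1)] by (simp add: lst_def)
      have Lm: "L m k = (if m = k then z else if k = Suc m then -1 else 0)" for k
        using \<open>m \<notin> R\<close> bend m by (auto simp: L_def A_def)
      have k1: "pc p' = m \<longleftrightarrow> p' = Suc p" using * nl unfolding pc m_def by auto
      have k2: "pc p' = Suc m \<longleftrightarrow> p' = p" using * nl unfolding pc m_def by auto
      show ?thesis
      proof (intro conjI impI)
        assume "p' < p"
        then have "m \<noteq> pc p'" "pc p' \<noteq> Suc m" using k1 k2 by auto
        then show "L (pr p) (pc p') = 0" by (simp only: prm Lm if_False)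
      next
        assume "p' = p"
        then have "pc p' = Suc m" using k2 by blast
        then show "L (pr p) (pc p') = -1" by (simp add: prm Lm)
      qed (use nl in blast)
    qed
  next
    case False
    have fp: "f p \<le> pr p \<and> pr p < f p + len p"
      using p first_le[OF p(1)] le_lst[OF p(1)] less_end[OF p(1)] by (auto simp: pr_def lst_def)
    note b = block_eq[OF p(1) conjunct1[OF fp] conjunct2[OF fp]]
    have fp': "f p' \<le> pc p' \<and> pc p' < f p' + len p'"
      using p' first_le[OF p'] le_lst[OF p'] less_end[OF p'] len_pos[OF p'] by (auto simp: pc_def lst_def)
    note b' = block_eq[OF p' conjunct1[OF fp'] conjunct2[OF fp']]
    have "pr p \<noteq> pc p'"
    proof
      assume "pr p = pc p'"
      then show False using b(2) b'(2) False by simp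
    qed
    moreover have "\<not> (pc p' = Suc (pr p) \<and> pc p' < f (pr p) + len (pr p))"
      using block_eq[OF p(1), of "pc p'"] b b' fp False by auto
    moreover have "pc p' \<noteq> f (pr p)"
    proof
      assume "pc p' = f (pr p)"
      then show False using b(2) b'(2) False first_props(2)[OF p(1)] by simp
    qed
    ultimately have "L (pr p) (pc p') = 0" by (auto simp: L_def A_def unit_row_def)
    then show ?thesis using False by auto
  qed
  have good: "(p' < p \<longrightarrow> L (pr p) (pc p') = 0) \<and> (p' = p \<longrightarrow> L (pr p) (pc p') = z)"
    if p: "p < N" "\<not> bad p" and p': "p' < N" for p p'
  proof -
    have prp: "pr p = p" using p by (simp add: pr_def)
    have "p \<notin> R" using p by (auto simp: R_def)
    have Lp: "L p k = (if p = k then z else if k = Suc p \<and> k < f p + len p then -1 else 0)" for k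
      using \<open>p \<notin> R\<close> by (simp add: L_def A_def)
    show ?thesis
    proof (cases "bad p'")
      case False
      then show ?thesis by (auto simp: prp Lp pc_def)
    next
      case True
      then have "f p' \<noteq> f p" using same_first[OF p(1) p'] p bad_cong[of p p'] by auto
      have fp': "f p' \<le> pc p' \<and> pc p' < f p' + len p'"
        using p' first_le[OF p'] le_lst[OF p'] less_end[OF p'] len_pos[OF p'] by (auto simp: pc_def lst_def)
      note b' = block_eq[OF p' conjunct1[OF fp'] conjunct2[OF fp']]
      have "p \<noteq> pc p'" using b' \<open>f p' \<noteq> f p\<close> by auto
      moreover have "\<not> (pc p' = Suc p \<and> pc p' < f p + len p)"
        using block_eq[OF p(1), of "pc p'"] b' \<open>f p' \<noteq> f p\<close> first_le[OF p(1)] by auto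
      ultimately show ?thesis using True p by (auto simp: prp Lp)
    qed
  qed
  have ut: "upper_triangular U"
  proof (rule upper_triangularI)
    fix i j assume "j < i" "i < dim_row U"
    then show "U $$ (i, j) = 0"
      using entry[of i j] good[of i j] by (cases "bad i"; cases "i = lst i") (auto simp: U_def)
  qed
  have "det U = prod_list (diag_mat U)"
    by (rule det_upper_triangular[OF ut, of N]) (simp add: U_def)
  also have "\<dots> = (\<Prod>p<N. U $$ (p, p))"
    by (simp add: diag_mat_def U_def prod.list_conv_set_nth atLeast0LessThan)
  finally have "cmod (det U) = (\<Prod>p<N. cmod (U $$ (p, p)))" by (simp add: prod_norm)
  also have "\<dots> = (\<Prod>p<N. if bad p then (if p = lst p then e else 1) else cmod z)"
  proof (rule prod.cong[OF refl])
    fix p assume "p \<in> {..<N}"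
    then show "cmod (U $$ (p, p)) = (if bad p then (if p = lst p then e else 1) else cmod z)"
      using entry[of p p] good[of p p] e by (cases "bad p"; cases "p = lst p") (auto simp: U_def)
  qed
  finally show ?thesis using cU by simp
qed

text \<open>The contribution \<open>ln e\<close> of a bad block is spread evenly over its indices,
  ready for an index by index comparison with the potential of the circles.\<close>

lemma ln_det_Lmat:
  "ln (cmod (det Lmat)) = (\<Sum>p<N. if bad p then ln e / real (len p) else ln (cmod z))"
proof -
  have "ln (cmod (det Lmat)) = (\<Sum>p<N. ln (if bad p then (if p = lst p then e else 1) else cmod z))"
    unfolding cmod_det_Lmat by (rule ln_prod) (use e z0 in auto)
  also have "\<dots> = (\<Sum>p<N. if p = lst p \<and> bad p then ln e else 0) + (\<Sum>p<N. if bad p then 0 else ln (cmod z))"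
    unfolding sum.distrib[symmetric] by (intro sum.cong refl) auto
  also have "(\<Sum>p<N. if p = lst p \<and> bad p then ln e else 0) = (\<Sum>b\<in>Lasts. if bad b then ln e else 0)"
    unfolding Lasts_def by (rule sum.mono_neutral_cong_right) auto
  also have "\<dots> = (\<Sum>p<N. (if bad (lst p) then ln e else 0) / real (len p))"
    by (rule sum_average[symmetric])
  also have "\<dots> = (\<Sum>p<N. if bad p then ln e / real (len p) else 0)"
    using bad_cong[OF lst_props(3)] by (intro sum.cong refl) simp
  finally show ?thesis unfolding sum.distrib[symmetric] by (auto intro!: sum.cong)
qed

end

subsection \<open>Perturbations of the identity\<close>

text \<open>Up to sign the determinant is the characteristic polynomial of \<open>E\<close> at
  \<open>-1\<close>, and Schur's inequality bounds its roots. That they are eigenvalues is recorded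
  for the lower bound, which argues with eigenvectors.\<close>

lemma det_one_plus:
  fixes E :: "complex mat"
  assumes E: "E \<in> carrier_mat n n"
  obtains es where "length es = n" "\<And>x. x \<in> set es \<Longrightarrow> eigenvalue E x"
    "cmod (det (1\<^sub>m n + E)) = (\<Prod>x\<leftarrow>es. cmod (1 + x))" "(\<Sum>x\<leftarrow>es. (cmod x)\<^sup>2) \<le> fro2 E"
proof -
  obtain es where es: "char_poly E = (\<Prod>e\<leftarrow>es. [:- e, 1:])" "length es = n" "(\<Sum>e\<leftarrow>es. (cmod e)\<^sup>2) \<le> fro2 E"
    using schur_inequality[OF E] by blast
  have ev: "eigenvalue E x" if "x \<in> set es" for x
    unfolding eigenvalue_root_char_poly[OF E] es using that by (auto simp: poly_prod_list prod_list_zero_iff)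
  have "poly (char_poly E) (-1) = det (- (char_matrix E (-1)))" by (rule char_poly_matrix[OF E])
  also have "- (char_matrix E (-1)) = (-1) \<cdot>\<^sub>m (1\<^sub>m n + E)"
    by (rule eq_matI) (use E in \<open>auto simp: char_matrix_def\<close>)
  also have "det \<dots> = (-1) ^ n * det (1\<^sub>m n + E)" using E by (subst det_smult) auto
  finally have "cmod (det (1\<^sub>m n + E)) = cmod (poly (char_poly E) (-1))"
    by (simp add: norm_mult norm_power)
  also have "\<dots> = (\<Prod>x\<leftarrow>es. cmod (1 + x))"
  proof -
    have "cmod (- 1 - x) = cmod (1 + x)" for x :: complex
    proof -
      have "- 1 - x = - (1 + x)" by simp
      then show ?thesis by (simp only: norm_minus_cancel)
    qed
    note c = this
    have "cmod (poly (\<Prod>e\<leftarrow>xs. [:- e, 1:]) (-1)) = (\<Prod>x\<leftarrow>xs. cmod (1 + x))" for xs :: "complex list"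
    proof (induction xs)
      case (Cons a xs)
      have "poly (\<Prod>e\<leftarrow>a # xs. [:- e, 1:]) (-1) = (- 1 - a) * poly (\<Prod>e\<leftarrow>xs. [:- e, 1:]) (-1)"
        by (simp add: algebra_simps)
      then show ?case by (simp only: norm_mult c Cons.IH) simp
    qed simp
    then show ?thesis unfolding es by this
  qed
  finally show ?thesis using that es ev by blast
qed

lemma ln_prod_list: "(\<And>x. x \<in> set xs \<Longrightarrow> f x > (0::real)) \<Longrightarrow> ln (\<Prod>x\<leftarrow>xs. f x) = (\<Sum>x\<leftarrow>xs. ln (f x))"
proof (induction xs)
  case (Cons a xs)
  have "(\<forall>x\<in>set ys. f x > 0) \<Longrightarrow> (\<Prod>x\<leftarrow>ys. f x) > 0" for ys by (induction ys) auto
  then have "(\<Prod>x\<leftarrow>xs. f x) > 0" using Cons.prems by simp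
  moreover have "f a > 0" "\<And>x. x \<in> set xs \<Longrightarrow> f x > 0" using Cons.prems by auto
  ultimately show ?case using Cons.IH by (simp add: ln_mult del: prod_list_zero_iff)
qed simp

text \<open>The logarithm is at most the modulus of the eigenvalue, but only the sum of the squared
  moduli is under control; hence the quadratic majorant with the weight \<open>t\<close>.\<close>

lemma ln_det_one_plus_upper:
  fixes E :: "complex mat"
  assumes E: "E \<in> carrier_mat n n" and t: "t > 0" and nz: "det (1\<^sub>m n + E) \<noteq> 0"
  shows "ln (cmod (det (1\<^sub>m n + E))) \<le> (n * t + fro2 E / t) / 2"
proof -
  obtain es where es: "length es = n" "cmod (det (1\<^sub>m n + E)) = (\<Prod>x\<leftarrow>es. cmod (1 + x))"
    "(\<Sum>x\<leftarrow>es. (cmod x)\<^sup>2) \<le> fro2 E"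
    using det_one_plus[OF E] by metis
  have "cmod (det (1\<^sub>m n + E)) \<noteq> 0" using nz by simp
  then have "(\<Prod>x\<leftarrow>es. cmod (1 + x)) \<noteq> 0" unfolding es(2) .
  then have "0 \<notin> set (map (\<lambda>x. cmod (1 + x)) es)" by (simp only: prod_list_zero_iff) simp
  then have "cmod (1 + x) \<noteq> 0" if "x \<in> set es" for x
    using imageI[OF that, of "\<lambda>x. cmod (1 + x)"] unfolding set_map by (intro notI) (simp only:)
  then have pos: "cmod (1 + x) > 0" if "x \<in> set es" for x using that by (simp add: less_le)
  have "ln (cmod (det (1\<^sub>m n + E))) = (\<Sum>x\<leftarrow>es. ln (cmod (1 + x)))"
    unfolding es(2) by (rule ln_prod_list) (rule pos)
  also have "\<dots> \<le> (\<Sum>x\<leftarrow>es. t / 2 + (cmod x)\<^sup>2 / (2 * t))"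
  proof (rule sum_list_mono)
    fix x assume x: "x \<in> set es"
    have "ln (cmod (1 + x)) \<le> cmod (1 + x) - 1" using pos[OF x] by (rule ln_le_minus_one)
    also have "\<dots> \<le> cmod x" using norm_triangle_ineq[of 1 x] by simp
    also have "\<dots> \<le> t / 2 + (cmod x)\<^sup>2 / (2 * t)"
    proof -
      have "0 \<le> (t - cmod x)\<^sup>2" by simp
      then have "2 * t * cmod x \<le> t\<^sup>2 + (cmod x)\<^sup>2" by (simp add: power2_diff)
      then show ?thesis using t by (simp add: field_simps power2_eq_square)
    qed
    finally show "ln (cmod (1 + x)) \<le> t / 2 + (cmod x)\<^sup>2 / (2 * t)" .
  qed
  also have "\<dots> = n * (t / 2) + (\<Sum>x\<leftarrow>es. (cmod x)\<^sup>2) / (2 * t)"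
    unfolding es(1)[symmetric] by (induction es) (simp_all add: algebra_simps add_divide_distrib)
  also have "\<dots> \<le> n * (t / 2) + fro2 E / (2 * t)"
    using es(3) t by (intro add_left_mono divide_right_mono) auto
  also have "\<dots> = (n * t + fro2 E / t) / 2" using t by (simp add: field_simps)
  finally show ?thesis .
qed

text \<open>Eigenvalues of modulus at most \<open>1 / 2\<close> lose at most
  \<open>2 * cmod x\<close>, treated as in the upper bound. For the others
  \<open>1 \<le> 4 * (cmod x)\<^sup>2\<close>, so a cost of \<open>K\<close> each is paid by
  \<open>4 * K * fro2 E\<close>. What exceeds \<open>K\<close> is bounded through \<open>B\<close>.
  An eigenvalue 0 is harmless, since it contributes the factor 1.\<close>

lemma ln_det_one_plus_lower:
  fixes E :: "complex mat"
  assumes E: "E \<in> carrier_mat n n" and t: "t > 0" and K: "K \<ge> 0" and B: "B \<ge> 0"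
    and ev: "\<And>x. eigenvalue E x \<Longrightarrow> x \<noteq> 0 \<Longrightarrow> 1 + x \<noteq> 0 \<and> 1 / sqrt (cmod (1 + x)) \<le> B"
  shows "- (n * t + fro2 E / t) - 4 * K * fro2 E - 2 * n * exp (- K / 2) * B \<le> ln (cmod (det (1\<^sub>m n + E)))"
proof -
  obtain es where es: "length es = n" "\<And>x. x \<in> set es \<Longrightarrow> eigenvalue E x"
    "cmod (det (1\<^sub>m n + E)) = (\<Prod>x\<leftarrow>es. cmod (1 + x))" "(\<Sum>x\<leftarrow>es. (cmod x)\<^sup>2) \<le> fro2 E"
    using det_one_plus[OF E] by metis
  have pos: "cmod (1 + x) > 0" if "x \<in> set es" for x
    using ev[OF es(2)[OF that]] by (cases "x = 0") auto
  define b where "b = 2 * exp (- K / 2) * B"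
  have b0: "b \<ge> 0" using B by (simp add: b_def)
  have each: "- (t + (cmod x)\<^sup>2 / t) - 4 * K * (cmod x)\<^sup>2 - b \<le> ln (cmod (1 + x))" if x: "x \<in> set es" for x
  proof (cases "cmod x \<le> 1 / 2")
    case True
    have "- (t + (cmod x)\<^sup>2 / t) \<le> - 2 * cmod x"
    proof -
      have "0 \<le> (t - cmod x)\<^sup>2" by simp
      then have "2 * t * cmod x \<le> t\<^sup>2 + (cmod x)\<^sup>2" by (simp add: power2_diff)
      then show ?thesis using t by (simp add: field_simps power2_eq_square)
    qed
    also have "\<dots> \<le> - cmod x - 2 * (cmod x)\<^sup>2"
      using mult_left_mono[OF True, of "cmod x"] by (simp add: power2_eq_square)
    also have "\<dots> \<le> ln (1 - cmod x)" using True by (intro ln_one_minus_pos_lower_bound) auto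
    also have "\<dots> \<le> ln (cmod (1 + x))"
      using True norm_diff_ineq[of 1 x] pos[OF x] by simp
    finally show ?thesis proof -
      have "0 \<le> 4 * K * (cmod x)\<^sup>2" using K by simp
      then show "- (t + (cmod x)\<^sup>2 / t) \<le> ln (cmod (1 + x)) \<Longrightarrow> ?thesis" using b0 by linarith
    qed
  next
    case False
    then have x0: "x \<noteq> 0" by auto
    define y where "y = - ln (cmod (1 + x))"
    have "1 / 4 \<le> (cmod x)\<^sup>2" using power_mono[of "1/2" "cmod x" 2] False by (simp add: power_divide)
    then have "K \<le> 4 * K * (cmod x)\<^sup>2" using mult_left_mono[of "1/4" "(cmod x)\<^sup>2" "4 * K"] K by simp
    moreover have "y - K \<le> b"
    proof -
      \<comment> \<open>The excess is bounded by an exponential so that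
        \<open>exp (y / 2) = 1 / sqrt (cmod (1 + x))\<close> appears, the power for which
        anticoncentration gives a finite mean; \<open>exp (- K / 2)\<close> remains as a small
        factor.\<close>
      have "1 + (y - K) / 2 \<le> exp ((y - K) / 2)" by (rule exp_ge_add_one_self)
      then have "y - K \<le> 2 * exp ((y - K) / 2)" by (simp add: field_simps)
      also have "exp ((y - K) / 2) = exp (- K / 2) * exp (y / 2)" by (simp add: exp_add[symmetric] field_simps)
      also have "exp (y / 2) = 1 / sqrt (cmod (1 + x))"
        using pos[OF x] by (simp add: y_def exp_minus exp_ln powr_half_sqrt[symmetric] powr_def inverse_eq_divide)
      also have "2 * (exp (- K / 2) * (1 / sqrt (cmod (1 + x)))) \<le> b"
        unfolding b_def mult.assoc using ev[OF es(2)[OF x] x0] by (intro mult_left_mono) auto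
      finally show ?thesis by simp
    qed
    moreover have "t + (cmod x)\<^sup>2 / t \<ge> 0" using t by simp
    ultimately show ?thesis by (simp add: y_def)
  qed
  have "- (n * t + (\<Sum>x\<leftarrow>es. (cmod x)\<^sup>2) / t) - 4 * K * (\<Sum>x\<leftarrow>es. (cmod x)\<^sup>2) - n * b
      = (\<Sum>x\<leftarrow>es. - (t + (cmod x)\<^sup>2 / t) - 4 * K * (cmod x)\<^sup>2 - b)"
    unfolding es(1)[symmetric] by (induction es) (simp_all add: algebra_simps add_divide_distrib)
  also have "\<dots> \<le> (\<Sum>x\<leftarrow>es. ln (cmod (1 + x)))" by (rule sum_list_mono) (rule each)
  also have "\<dots> = ln (cmod (det (1\<^sub>m n + E)))" unfolding es(3) by (rule ln_prod_list[symmetric]) (rule pos)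
  finally have "- (n * t + (\<Sum>x\<leftarrow>es. (cmod x)\<^sup>2) / t) - 4 * K * (\<Sum>x\<leftarrow>es. (cmod x)\<^sup>2) - n * b
     \<le> ln (cmod (det (1\<^sub>m n + E)))" .
  moreover have "(\<Sum>x\<leftarrow>es. (cmod x)\<^sup>2) / t \<le> fro2 E / t" using es(4) t by (intro divide_right_mono) auto
  moreover have "4 * K * (\<Sum>x\<leftarrow>es. (cmod x)\<^sup>2) \<le> 4 * K * fro2 E" using es(4) K by (intro mult_left_mono) auto
  ultimately show ?thesis by (simp add: b_def)
qed

section \<open>Mean squares of linear forms in the noise\<close>

lemma gauss_second_moment:
  fixes w :: "'i \<Rightarrow> complex"
  assumes J: "finite J"
  shows "(\<integral>\<^sup>+\<omega>. ennreal ((cmod (\<Sum>p\<in>J. w p * of_real (\<omega> p)))\<^sup>2) \<partial>gauss J) = ennreal (\<Sum>p\<in>J. (cmod (w p))\<^sup>2)"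
proof -
  interpret G: prob_space "gauss J" by (rule prob_space_gauss)
  have m2: "(\<integral>\<^sup>+g. ennreal (g\<^sup>2) \<partial>stdn) = 1"
  proof -
    have "has_bochner_integral lborel (\<lambda>x. std_normal_density x * x ^ (2 * 1)) (fact (2 * 1) / (2 ^ 1 * fact 1))"
      by (rule std_normal_moment_even)
    then have I: "has_bochner_integral lborel (\<lambda>x. std_normal_density x * x\<^sup>2) 1" by (simp add: fact_numeral)
    have "(\<integral>\<^sup>+g. ennreal (g\<^sup>2) \<partial>stdn) = (\<integral>\<^sup>+x. ennreal (std_normal_density x * x\<^sup>2) \<partial>lborel)"
      by (subst nn_integral_stdn) (auto simp: ennreal_mult')
    also have "\<dots> = ennreal 1"
      using I by (subst nn_integral_eq_integral) (auto simp: has_bochner_integral_iff)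
    finally show ?thesis by simp
  qed
  have real: "(\<integral>\<^sup>+\<omega>. ennreal ((\<Sum>p\<in>J. v p * \<omega> p)\<^sup>2) \<partial>gauss J) = ennreal (\<Sum>p\<in>J. (v p)\<^sup>2)" for v :: "'i \<Rightarrow> real"
  proof (cases "(\<Sum>p\<in>J. (v p)\<^sup>2) = 0")
    case True
    then have "\<forall>p\<in>J. v p = 0" using J by (simp add: sum_nonneg_eq_0_iff)
    then show ?thesis using True by simp
  next
    case False
    define s where "s = sqrt (\<Sum>p\<in>J. (v p)\<^sup>2)"
    have "(\<Sum>p\<in>J. (v p)\<^sup>2) > 0" using False sum_nonneg[of J "\<lambda>p. (v p)\<^sup>2"] by (simp add: less_le)
    then have s: "s > 0" by (simp add: s_def)
    have "(\<integral>\<^sup>+\<omega>. ennreal ((\<Sum>p\<in>J. v p * \<omega> p)\<^sup>2) \<partial>gauss J) = (\<integral>\<^sup>+g. ennreal ((s * g)\<^sup>2) \<partial>stdn)"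
      by (rule gauss_linear[OF J s_def s, where f = "\<lambda>x. ennreal (x\<^sup>2)"]) measurable
    also have "\<dots> = (\<integral>\<^sup>+g. ennreal (s\<^sup>2) * ennreal (g\<^sup>2) \<partial>stdn)"
      by (simp add: power_mult_distrib ennreal_mult')
    also have "\<dots> = ennreal (s\<^sup>2)" by (subst nn_integral_cmult) (auto simp: m2)
    also have "s\<^sup>2 = (\<Sum>p\<in>J. (v p)\<^sup>2)" by (simp add: s_def sum_nonneg)
    finally show ?thesis .
  qed
  have m: "(\<lambda>\<omega>. ennreal ((\<Sum>p\<in>J. v p * \<omega> p)\<^sup>2)) \<in> borel_measurable (gauss J)" for v :: "'i \<Rightarrow> real"
  proof -
    have "(\<lambda>\<omega>. \<Sum>p\<in>J. v p * \<omega> p) \<in> borel_measurable (gauss J)"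
      by (intro borel_measurable_sum borel_measurable_times borel_measurable_const measurable_gauss_component)
    then show ?thesis by measurable
  qed
  have "(\<integral>\<^sup>+\<omega>. ennreal ((cmod (\<Sum>p\<in>J. w p * of_real (\<omega> p)))\<^sup>2) \<partial>gauss J)
     = (\<integral>\<^sup>+\<omega>. ennreal ((\<Sum>p\<in>J. Re (w p) * \<omega> p)\<^sup>2) + ennreal ((\<Sum>p\<in>J. Im (w p) * \<omega> p)\<^sup>2) \<partial>gauss J)"
    by (intro nn_integral_cong) (simp add: cmod_power2 ennreal_plus[symmetric] del: ennreal_plus)
  also have "\<dots> = ennreal (\<Sum>p\<in>J. (Re (w p))\<^sup>2) + ennreal (\<Sum>p\<in>J. (Im (w p))\<^sup>2)"
    by (subst nn_integral_add) (auto simp: real m)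
  also have "\<dots> = ennreal (\<Sum>p\<in>J. (cmod (w p))\<^sup>2)"
    by (simp add: ennreal_plus[symmetric] sum_nonneg sum.distrib[symmetric] cmod_power2 del: ennreal_plus)
  finally show ?thesis .
qed

lemma gauss_sq_row_moment:
  assumes i: "i < N"
  shows "(\<integral>\<^sup>+\<omega>. ennreal ((cmod (\<Sum>k<N. of_real (\<omega> (i, k)) * w k))\<^sup>2) \<partial>gauss_sq N) = ennreal (\<Sum>k<N. (cmod (w k))\<^sup>2)"
proof -
  have r: "(\<Sum>p\<in>{..<N} \<times> {..<N}. if fst p = i then g (snd p) (snd p) else 0) = (\<Sum>k<N. g k k)" for g :: "nat \<Rightarrow> nat \<Rightarrow> 'a::comm_monoid_add"
  proof -
    have "(\<Sum>p\<in>{..<N} \<times> {..<N}. if fst p = i then g (snd p) (snd p) else 0) = (\<Sum>p\<in>{i} \<times> {..<N}. g (snd p) (snd p))"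
      by (rule sum.mono_neutral_cong_right) (use i in auto)
    then show ?thesis by (simp add: sum_singleton_times)
  qed
  have "(\<Sum>k<N. of_real (\<omega> (i, k)) * w k) = (\<Sum>p\<in>{..<N} \<times> {..<N}. (if fst p = i then w (snd p) else 0) * of_real (\<omega> p))" for \<omega> :: "nat \<times> nat \<Rightarrow> real"
  proof -
    have "(\<Sum>p\<in>{..<N} \<times> {..<N}. (if fst p = i then w (snd p) else 0) * of_real (\<omega> p))
        = (\<Sum>p\<in>{..<N} \<times> {..<N}. if fst p = i then of_real (\<omega> (i, snd p)) * w (snd p) else 0)"
      by (intro sum.cong refl) (auto simp: mult.commute)
    then show ?thesis using r[of "\<lambda>k _. of_real (\<omega> (i, k)) * w k"] by simp
  qed
  then have "(\<integral>\<^sup>+\<omega>. ennreal ((cmod (\<Sum>k<N. of_real (\<omega> (i, k)) * w k))\<^sup>2) \<partial>gauss_sq N)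
      = ennreal (\<Sum>p\<in>{..<N} \<times> {..<N}. (cmod (if fst p = i then w (snd p) else 0))\<^sup>2)"
    using gauss_second_moment[of "{..<N} \<times> {..<N}" "\<lambda>p. if fst p = i then w (snd p) else 0"] by simp
  also have "(\<Sum>p\<in>{..<N} \<times> {..<N}. (cmod (if fst p = i then w (snd p) else 0))\<^sup>2) = (\<Sum>k<N. (cmod (w k))\<^sup>2)"
    using r[of "\<lambda>k _. (cmod (w k))\<^sup>2"] by (simp add: if_distrib[of cmod] if_distrib[of "\<lambda>x. x\<^sup>2"] cong: if_cong)
  finally show ?thesis .
qed

lemma sum_geometric_inj:
  assumes q: "0 \<le> q" "q < (1::real)" and S: "finite S" "inj_on h S"
  shows "(\<Sum>i\<in>S. q ^ h i) \<le> 1 / (1 - q)"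
proof -
  have "(\<Sum>i\<in>S. q ^ h i) = (\<Sum>m\<in>h ` S. q ^ m)" using S(2) by (simp add: sum.reindex)
  also have "\<dots> \<le> 1 / (1 - q)"
    using sum_le_suminf[OF summable_geometric, of q "h ` S"] q S suminf_geometric[of q] by auto
  finally show ?thesis .
qed

section \<open>Size of the inverse \<open>Qmat\<close>\<close>

context jordan_split
begin

definition q :: real where "q = (cmod z)\<^sup>2"

lemma q_pos: "q > 0" using z0 by (simp add: q_def)

lemma q_less_1: "q < 1 \<longleftrightarrow> cmod z < 1" and q_neq_1: "q \<noteq> 1"
  using z1 norm_ge_zero[of z] unfolding q_def power2_eq_1_iff by (auto simp: power_less_one_iff simp del: norm_ge_zero)

text \<open>From \<open>e \<le> 1\<close>: on and outside the unit circle every block is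
  good.\<close>

lemma bad_imp: "i < N \<Longrightarrow> bad i \<Longrightarrow> q < 1"
proof (rule ccontr)
  assume "i < N" "bad i" "\<not> q < 1"
  then have "1 \<le> cmod z ^ len i" by (simp add: q_less_1 one_le_power)
  then show False using \<open>bad i\<close> e by (simp add: bad_def)
qed

lemma cmod_power_q: "(cmod (z ^ m))\<^sup>2 = q ^ m"
  by (simp add: q_def norm_power power_mult[symmetric] mult.commute)

lemma good_q: "\<not> bad i \<Longrightarrow> 1 / q ^ len i \<le> 1 / e\<^sup>2"
proof -
  assume "\<not> bad i"
  then have "e\<^sup>2 \<le> (cmod z ^ len i)\<^sup>2" using e by (intro power_mono) (auto simp: bad_def)
  also have "\<dots> = q ^ len i" using cmod_power_q[of "len i"] by (simp add: norm_power)
  finally show ?thesis using e q_pos by (intro divide_left_mono) auto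
qed

lemma cmod_inverse_power_q: "(cmod (inverse (z ^ m)))\<^sup>2 = 1 / q ^ m"
  by (simp only: norm_inverse power_inverse cmod_power_q) (simp add: inverse_eq_divide)

text \<open>The geometric series have ratio \<open>q\<close> inside the unit disc and
  \<open>1 / q\<close> outside, and the constant blows up at the unit circle; hence the locale
  assumption \<open>cmod z \<noteq> 1\<close>.\<close>

definition CQ :: real where "CQ = (if q < 1 then 1 / (1 - q)\<^sup>2 else 1 / (q - 1))"

lemma CQ_pos: "CQ > 0" using q_neq_1 by (auto simp: CQ_def)

text \<open>In a bad block the factor \<open>1 / e\<close> occurs only in the last column. In a good
  block every column may be large, but its squared norm is damped by \<open>q ^ (lst j - j)\<close>.
  After summation over the block both cases cost \<open>1 / e\<^sup>2\<close> once per
  block.\<close>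

lemma column_norm:
  assumes j: "j < N" and q1: "q < 1"
  shows "(\<Sum>i<N. (cmod (Q i j))\<^sup>2) \<le> 1 / (1 - q) + q ^ (lst j - j) / (e\<^sup>2 * (1 - q))"
proof -
  define S where "S = {i. i < N \<and> f i = f j}"
  have fS: "finite S" by (auto simp: S_def)
  have S: "f i = f j" "len i = len j" "lst i = lst j" "bad i = bad j" "i < N" "f j \<le> i" "i \<le> lst j" if "i \<in> S" for i
    using that same_first[of i j] j bad_cong[of i j] first_le[of i] le_lst[of i] by (auto simp: S_def)
  have pq: "1 / (1 - q) > 0" using q1 by simp
  have e2: "e\<^sup>2 > 0" using e by simp
  have eq: "(\<Sum>i<N. (cmod (Q i j))\<^sup>2) = (\<Sum>i\<in>S. (cmod (Q i j))\<^sup>2)"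
    by (rule sum.mono_neutral_right) (auto simp: S_def Q_def)
  have inj1: "inj_on (\<lambda>i. i - f j) S"
  proof (rule inj_onI)
    fix x y assume "x \<in> S" "y \<in> S" "x - f j = y - f j"
    then show "x = y" using S(6)[of x] S(6)[of y] by simp
  qed
  consider "bad j" "j = lst j" | "bad j" "j \<noteq> lst j" | "\<not> bad j" by blast
  then show ?thesis
  proof cases
    case 1
    have "(\<Sum>i\<in>S. (cmod (Q i j))\<^sup>2) = (\<Sum>i\<in>S. q ^ (i - f j) / e\<^sup>2)"
    proof (rule sum.cong[OF refl])
      fix i assume i: "i \<in> S"
      have "Q i j = z ^ (i - f j) / of_real e"
        unfolding Q_def using S(1,3,4)[OF i] 1 by simp
      then show "(cmod (Q i j))\<^sup>2 = q ^ (i - f j) / e\<^sup>2"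
        using cmod_power_q[of "i - f j"] e by (simp add: norm_divide power_divide)
    qed
    also have "\<dots> = (\<Sum>i\<in>S. q ^ (i - f j)) / e\<^sup>2" by (simp add: sum_divide_distrib)
    also have "\<dots> \<le> (1 / (1 - q)) / e\<^sup>2"
      by (intro divide_right_mono sum_geometric_inj fS inj1) (use q_pos q1 in auto)
    also have "\<dots> = q ^ (lst j - j) / (e\<^sup>2 * (1 - q))" using 1 by (simp add: mult.commute)
    finally show ?thesis unfolding eq using pq by linarith
  next
    case 2
    have "(\<Sum>i\<in>S. (cmod (Q i j))\<^sup>2) \<le> (\<Sum>i\<in>S \<inter> {j<..}. q ^ (i - j - 1))"
    proof -
      have "(\<Sum>i\<in>S. (cmod (Q i j))\<^sup>2) = (\<Sum>i\<in>S \<inter> {j<..}. q ^ (i - j - 1))"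
      proof (rule sum.mono_neutral_cong_right)
        show "\<forall>i\<in>S - S \<inter> {j<..}. (cmod (Q i j))\<^sup>2 = 0"
        proof
          fix i assume i: "i \<in> S - S \<inter> {j<..}"
          then have "i \<in> S" "\<not> j < i" by auto
          then show "(cmod (Q i j))\<^sup>2 = 0" unfolding Q_def using S(1,3,4)[OF \<open>i \<in> S\<close>] 2 by simp
        qed
        fix i assume i: "i \<in> S \<inter> {j<..}"
        then have "i \<in> S" "j < i" by auto
        then have "Q i j = - (z ^ (i - j - 1))" unfolding Q_def using S(1,3,4)[OF \<open>i \<in> S\<close>] 2 by simp
        then show "(cmod (Q i j))\<^sup>2 = q ^ (i - j - 1)" using cmod_power_q by simp
      qed (use fS in auto)
      then show ?thesis by simp
    qed
    also have "\<dots> \<le> 1 / (1 - q)"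
      by (intro sum_geometric_inj) (use q_pos q1 fS in \<open>auto simp: inj_on_def\<close>)
    finally show ?thesis unfolding eq using q_pos q1 e by (simp add: add_increasing2)
  next
    case 3
    have "(\<Sum>i\<in>S. (cmod (Q i j))\<^sup>2) \<le> (\<Sum>i\<in>S. q ^ (i - f j) * (q ^ (lst j - j) / e\<^sup>2))"
    proof (rule sum_mono)
      fix i assume i: "i \<in> S"
      show "(cmod (Q i j))\<^sup>2 \<le> q ^ (i - f j) * (q ^ (lst j - j) / e\<^sup>2)"
      proof (cases "i \<le> j")
        case True
        have "Q i j = inverse (z ^ (j - i + 1))" unfolding Q_def using S(1,4)[OF i] 3 True by simp
        then have "(cmod (Q i j))\<^sup>2 = 1 / q ^ (j - i + 1)"
          by (simp only: cmod_inverse_power_q)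
        also have "\<dots> = q ^ ((i - f j) + (lst j - j)) / q ^ len j"
        proof -
          \<comment> \<open>The three distances add up to the length of the block, so the negative
            power becomes a positive one over \<open>q ^ len j\<close>, and goodness bounds
            \<open>q ^ len j\<close> from below by \<open>e\<^sup>2\<close>.\<close>
          have "(i - f j) + (lst j - j) + (j - i + 1) = len j"
            using True S(6)[OF i] le_lst[OF j] len_pos[OF j] by (simp add: lst_def)
          then have "q ^ len j = q ^ ((i - f j) + (lst j - j)) * q ^ (j - i + 1)"
            by (metis power_add)
          then show ?thesis using q_pos by simp
        qed
        also have "\<dots> = q ^ ((i - f j) + (lst j - j)) * (1 / q ^ len j)" by simp
        also have "\<dots> \<le> q ^ ((i - f j) + (lst j - j)) * (1 / e\<^sup>2)"
          using good_q[OF 3] q_pos by (intro mult_left_mono) auto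
        finally show ?thesis by (simp add: power_add)
      next
        case False
        then have "Q i j = 0" unfolding Q_def using S(1,4)[OF i] 3 by simp
        then show ?thesis using q_pos by simp
      qed
    qed
    also have "\<dots> = (\<Sum>i\<in>S. q ^ (i - f j)) * (q ^ (lst j - j) / e\<^sup>2)" by (rule sum_distrib_right[symmetric])
    also have "\<dots> \<le> 1 / (1 - q) * (q ^ (lst j - j) / e\<^sup>2)"
      by (intro mult_right_mono sum_geometric_inj fS inj1) (use q_pos q1 in auto)
    also have "\<dots> = q ^ (lst j - j) / (e\<^sup>2 * (1 - q))" by (simp add: field_simps)
    finally show ?thesis unfolding eq using pq by linarith
  qed
qed

text \<open>With no bad blocks \<open>e\<close> does not enter: the column is dominated by a
  geometric series in \<open>1 / q\<close>, extended over all \<open>i \<le> j\<close> regardless of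
  block boundaries.\<close>

lemma column_norm_outside:
  assumes j: "j < N" and q1: "\<not> q < 1"
  shows "(\<Sum>i<N. (cmod (Q i j))\<^sup>2) \<le> 1 / (q - 1)"
proof -
  have q2: "q > 1" using q1 q_neq_1 by simp
  have nb: "\<not> bad i" if "i < N" for i using bad_imp[OF that] q1 by blast
  have "(\<Sum>i<N. (cmod (Q i j))\<^sup>2) \<le> (\<Sum>i\<le>j. (1 / q) ^ (j - i) / q)"
  proof -
    have "(\<Sum>i<N. (cmod (Q i j))\<^sup>2) = (\<Sum>i\<le>j. (cmod (Q i j))\<^sup>2)"
    proof (rule sum.mono_neutral_right)
      show "\<forall>i\<in>{..<N} - {..j}. (cmod (Q i j))\<^sup>2 = 0" using nb by (auto simp: Q_def)
    qed (use j in auto)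
    also have "\<dots> \<le> (\<Sum>i\<le>j. (1 / q) ^ (j - i) / q)"
    proof (rule sum_mono)
      fix i assume i: "i \<in> {..j}"
      have c: "(cmod (inverse (z ^ (j - i + 1))))\<^sup>2 = (1 / q) ^ (j - i) / q"
        unfolding cmod_inverse_power_q using q_pos by (simp add: power_divide)
      have "bad i = False" using nb i j by auto
      then have "cmod (Q i j) \<le> cmod (inverse (z ^ (j - i + 1)))"
        using i by (simp add: Q_def)
      then show "(cmod (Q i j))\<^sup>2 \<le> (1 / q) ^ (j - i) / q"
        unfolding c[symmetric] by (intro power_mono) auto
    qed
    finally show ?thesis .
  qed
  also have "\<dots> = (\<Sum>i\<le>j. (1 / q) ^ (j - i)) / q" by (simp add: sum_divide_distrib)
  also have "\<dots> \<le> (1 / (1 - 1 / q)) / q"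
    by (intro divide_right_mono sum_geometric_inj) (use q2 in \<open>auto simp: inj_on_def\<close>)
  also have "\<dots> = 1 / (q - 1)" using q2 by (simp add: field_simps)
  finally show ?thesis .
qed

text \<open>The term \<open>1 / e\<^sup>2\<close> is multiplied by the number of blocks only. This
  is how the assumption of few blocks makes the noise part of the error small.\<close>

lemma fro2_Qmat: "fro2 Qmat \<le> CQ * (N + card Lasts / e\<^sup>2)"
proof -
  have "fro2 Qmat = (\<Sum>j<N. \<Sum>i<N. (cmod (Q i j))\<^sup>2)"
    unfolding fro2_def by (subst sum.swap) (simp add: Qmat_def)
  also have "\<dots> \<le> CQ * (N + card Lasts / e\<^sup>2)"
  proof (cases "q < 1")
    case True
    have "(\<Sum>j<N. \<Sum>i<N. (cmod (Q i j))\<^sup>2) \<le> (\<Sum>j<N. 1 / (1 - q) + q ^ (lst j - j) / (e\<^sup>2 * (1 - q)))"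
      by (intro sum_mono column_norm) (use True in auto)
    also have "\<dots> = N * (1 / (1 - q)) + (\<Sum>j<N. q ^ (lst j - j)) / (e\<^sup>2 * (1 - q))"
      by (simp add: sum.distrib sum_divide_distrib)
    also have "\<dots> \<le> N * (1 / (1 - q)\<^sup>2) + (card Lasts / (1 - q)) / (e\<^sup>2 * (1 - q))"
    proof (intro add_mono mult_left_mono divide_right_mono sum_geometric_blocks)
      have "(1 - q)\<^sup>2 \<le> 1 - q" using True q_pos mult_left_mono[of "1 - q" 1 "1 - q"] by (simp add: power2_eq_square)
      then show "1 / (1 - q) \<le> 1 / (1 - q)\<^sup>2" using True by (intro divide_left_mono) auto
    qed (use True q_pos in auto)
    also have "\<dots> = CQ * (N + card Lasts / e\<^sup>2)"
    proof -
      define p where "p = 1 - q"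
      have "p \<noteq> 0" "CQ = 1 / p\<^sup>2" using True by (auto simp: p_def CQ_def)
      then show ?thesis using e unfolding p_def[symmetric]
        by (simp only:) (simp add: field_simps power2_eq_square)
    qed
    finally show ?thesis .
  next
    case False
    have "(\<Sum>j<N. \<Sum>i<N. (cmod (Q i j))\<^sup>2) \<le> (\<Sum>j<N. 1 / (q - 1))"
      by (intro sum_mono column_norm_outside) (use False in auto)
    also have "\<dots> = CQ * N" using False by (simp add: CQ_def)
    also have "\<dots> \<le> CQ * (N + card Lasts / e\<^sup>2)" using CQ_pos by (intro mult_left_mono) auto
    finally show ?thesis .
  qed
  finally show ?thesis .
qed

text \<open>The last row of a block of \<open>A\<close> has the single entry \<open>z\<close>, so
  \<open>z * Q i j\<close> is what a bad row of \<open>A\<close> becomes after multiplication by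
  \<open>Qmat\<close>. Badness itself bounds the entry \<open>z ^ len i / e\<close> by 1.\<close>

lemma row_norm_R:
  assumes i: "i \<in> R"
  shows "(\<Sum>j<N. (cmod (z * Q i j))\<^sup>2) \<le> 2 / (1 - q)"
proof -
  have iN: "i < N" and il: "lst i = i" and b: "bad i" using R_props[OF i] by auto
  have q1: "q < 1" by (rule bad_imp[OF iN b])
  have len: "len i = Suc (i - f i)" using il len_pos[OF iN] first_le[OF iN] by (simp add: lst_def)
  have "cmod (z * Q i j) ^ 2 \<le> (if j = i then 1 else 0) + (if j < i then q ^ (i - j - 1) else 0)" for j
  proof -
    have qle: "q * x \<le> x" if "x \<ge> 0" for x using q1 that mult_right_mono[of q 1 x] by simp
    consider "f i \<noteq> f j" | "f i = f j" "j = i" | "f i = f j" "j \<noteq> i" "j < i" | "\<not> j < i" "j \<noteq> i" by linarith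
    then show ?thesis
    proof cases
      case 1
      then show ?thesis using q_pos by (simp add: Q_def)
    next
      case 2
      have "(cmod (z * Q i j))\<^sup>2 = q ^ len i / e\<^sup>2"
        using 2 b il cmod_power_q[of "len i"] e unfolding len
        by (simp add: Q_def norm_mult norm_divide power_mult_distrib power_divide norm_power)
      also have "\<dots> \<le> 1"
      proof -
        have "(cmod z ^ len i)\<^sup>2 \<le> e\<^sup>2" using b e by (intro power_mono) (auto simp: bad_def)
        then have "q ^ len i \<le> e\<^sup>2" using cmod_power_q[of "len i"] by (simp add: norm_power)
        then show ?thesis using e by simp
      qed
      finally show ?thesis using 2 by simp
    next
      case 3
      have "(cmod (z * Q i j))\<^sup>2 = q * q ^ (i - j - 1)"
        using 3 b il cmod_power_q[of "i - j - 1"] by (simp add: Q_def norm_mult power_mult_distrib q_def)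
      then show ?thesis using 3 qle[of "q ^ (i - j - 1)"] q_pos by simp
    next
      case 4
      then show ?thesis using b il by (simp add: Q_def)
    qed
  qed
  then have "(\<Sum>j<N. (cmod (z * Q i j))\<^sup>2) \<le> (\<Sum>j<N. (if j = i then 1 else 0) + (if j < i then q ^ (i - j - 1) else 0))"
    by (intro sum_mono) simp
  also have "\<dots> = 1 + (\<Sum>j<i. q ^ (i - j - 1))"
  proof -
    have "(\<Sum>j<N. if j < i then q ^ (i - j - 1) else 0) = (\<Sum>j<i. q ^ (i - j - 1))"
      by (rule sum.mono_neutral_cong_right) (use iN in auto)
    then show ?thesis using iN by (simp add: sum.distrib)
  qed
  also have "\<dots> \<le> 1 / (1 - q) + 1 / (1 - q)"
  proof (intro add_mono sum_geometric_inj)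
    show "1 \<le> 1 / (1 - q)" using q1 q_pos by simp
    show "inj_on (\<lambda>j. i - j - 1) {..<i}" by (rule inj_onI) auto
  qed (use q1 q_pos in auto)
  finally show ?thesis by simp
qed

end

lemma sqrt_sum_le: "finite S \<Longrightarrow> (\<And>i. i \<in> S \<Longrightarrow> x i \<ge> 0) \<Longrightarrow> sqrt (\<Sum>i\<in>S. x i) \<le> (\<Sum>i\<in>S. sqrt (x i))"
proof (induction S rule: finite_induct)
  case (insert a S)
  have "sqrt (x a + (\<Sum>i\<in>S. x i)) \<le> sqrt (x a) + sqrt (\<Sum>i\<in>S. x i)"
    using insert.prems by (intro sqrt_add_le_add_sqrt sum_nonneg) auto
  also have "sqrt (\<Sum>i\<in>S. x i) \<le> (\<Sum>i\<in>S. sqrt (x i))" using insert by auto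
  finally show ?case using insert.hyps by simp
qed simp

lemma one_plus_minus_mat: "B \<in> carrier_mat n n \<Longrightarrow> 1\<^sub>m n + (B - 1\<^sub>m n) = (B :: complex mat)"
  by (rule eq_matI) auto

lemma smult_one_mult_vec:
  assumes y: "y \<in> carrier_vec n"
  shows "(a \<cdot>\<^sub>m 1\<^sub>m n) *\<^sub>v y = a \<cdot>\<^sub>v (y :: complex vec)"
proof (rule eq_vecI)
  fix i assume "i < dim_vec (a \<cdot>\<^sub>v y)"
  then have i: "i < n" using y by simp
  have "((a \<cdot>\<^sub>m 1\<^sub>m n) *\<^sub>v y) $ i = (\<Sum>j<n. (if j = i then a * y $ i else 0))"
  proof -
    have "((a \<cdot>\<^sub>m 1\<^sub>m n) *\<^sub>v y) $ i = (\<Sum>j<n. a * (if j = i then 1 else 0) * y $ j)"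
      using i y by (simp add: scalar_prod_def atLeast0LessThan eq_commute[of i])
    also have "\<dots> = (\<Sum>j<n. (if j = i then a * y $ i else 0))" by (intro sum.cong refl) auto
    finally show ?thesis .
  qed
  then show "((a \<cdot>\<^sub>m 1\<^sub>m n) *\<^sub>v y) $ i = (a \<cdot>\<^sub>v y) $ i" using i y by simp
qed (use y in auto)

lemma row_gradient_cofactor:
  assumes r: "r < N" "r \<in> S"
  shows "row_gradient N S \<delta> Y r \<omega> = \<bar>\<delta>\<bar> * sqrt (\<Sum>j<N. (cmod (cofactor (noisy_mat N S \<delta> Y \<omega>) r j))\<^sup>2)"
proof -
  have "noisy_det N (S - {r}) \<delta> (Y(r := unit_row j)) \<omega> = cofactor (noisy_mat N S \<delta> Y \<omega>) r j" if "j < N" for j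
  proof -
    have "noisy_det N (S - {r}) \<delta> (Y(r := unit_row j)) \<omega> = cofactor (noisy_mat N (S - {r}) \<delta> Y \<omega>) r j"
      using r that by (intro noisy_det_unit_row) auto
    also have "\<dots> = cofactor (noisy_mat N S \<delta> Y \<omega>) r j"
      by (rule cofactor_cong[where n = N]) (use r in auto)
    finally show ?thesis .
  qed
  then show ?thesis unfolding row_gradient_def by simp
qed

lemma cofactor_le_row_gradient:
  assumes "r < N" "r \<in> S" "j < N" "\<delta> \<noteq> 0"
  shows "cmod (cofactor (noisy_mat N S \<delta> Y \<omega>) r j) \<le> row_gradient N S \<delta> Y r \<omega> / \<bar>\<delta>\<bar>"
proof -
  have "(cmod (cofactor (noisy_mat N S \<delta> Y \<omega>) r j))\<^sup>2 \<le> (\<Sum>j<N. (cmod (cofactor (noisy_mat N S \<delta> Y \<omega>) r j))\<^sup>2)"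
    using assms by (intro member_le_sum) auto
  then have "cmod (cofactor (noisy_mat N S \<delta> Y \<omega>) r j) \<le> sqrt (\<Sum>j<N. (cmod (cofactor (noisy_mat N S \<delta> Y \<omega>) r j))\<^sup>2)"
    by (rule real_le_rsqrt)
  then show ?thesis using assms by (simp add: row_gradient_cofactor)
qed

section \<open>The determinant for a given realisation of the noise\<close>

context jordan_split
begin

text \<open>The squared Frobenius norm of the noise matrix times \<open>Qmat\<close>.\<close>

definition noise_sq :: "(nat \<times> nat \<Rightarrow> real) \<Rightarrow> real" where
  "noise_sq \<omega> = (\<Sum>i<N. \<Sum>j<N. (cmod (\<Sum>k<N. of_real (\<omega> (i, k)) * Q k j))\<^sup>2)"

lemma noise_sq_nonneg [simp]: "noise_sq \<omega> \<ge> 0"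
  unfolding noise_sq_def by (intro sum_nonneg) auto

lemma noise_measurable:
  "i < N \<Longrightarrow> (\<lambda>\<omega>. \<Sum>k<N. of_real (\<omega> (i, k)) * Q k j) \<in> borel_measurable (gauss_sq N)"
  by (intro borel_measurable_sum borel_measurable_times borel_measurable_const borel_measurable_of_real measurable_gauss_component) auto

lemma noise_sq_measurable [measurable]: "noise_sq \<in> borel_measurable (gauss_sq N)"
  unfolding noise_sq_def[abs_def]
  by (intro borel_measurable_sum borel_measurable_power borel_measurable_norm noise_measurable) auto

lemma noise_sq_integral: "(\<integral>\<^sup>+\<omega>. ennreal (noise_sq \<omega>) \<partial>gauss_sq N) = ennreal (N * fro2 Qmat)"
proof -
  have m: "(\<lambda>\<omega>. ennreal ((cmod (\<Sum>k<N. of_real (\<omega> (i, k)) * Q k j))\<^sup>2)) \<in> borel_measurable (gauss_sq N)" if "i < N" for i j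
    using noise_measurable[OF that, of j] by measurable
  have m1: "(\<lambda>\<omega>. \<Sum>j<N. ennreal ((cmod (\<Sum>k<N. of_real (\<omega> (i, k)) * Q k j))\<^sup>2)) \<in> borel_measurable (gauss_sq N)" if "i < N" for i
    by (rule borel_measurable_sum) (rule m[OF that])
  have "(\<integral>\<^sup>+\<omega>. ennreal (noise_sq \<omega>) \<partial>gauss_sq N)
     = (\<integral>\<^sup>+\<omega>. (\<Sum>i<N. \<Sum>j<N. ennreal ((cmod (\<Sum>k<N. of_real (\<omega> (i, k)) * Q k j))\<^sup>2)) \<partial>gauss_sq N)"
    unfolding noise_sq_def by (simp add: sum_nonneg flip: sum_ennreal)
  also have "\<dots> = (\<Sum>i<N. \<Sum>j<N. \<integral>\<^sup>+\<omega>. ennreal ((cmod (\<Sum>k<N. of_real (\<omega> (i, k)) * Q k j))\<^sup>2) \<partial>gauss_sq N)"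
  proof -
    have "(\<integral>\<^sup>+\<omega>. (\<Sum>i<N. \<Sum>j<N. ennreal ((cmod (\<Sum>k<N. of_real (\<omega> (i, k)) * Q k j))\<^sup>2)) \<partial>gauss_sq N)
        = (\<Sum>i<N. \<integral>\<^sup>+\<omega>. (\<Sum>j<N. ennreal ((cmod (\<Sum>k<N. of_real (\<omega> (i, k)) * Q k j))\<^sup>2)) \<partial>gauss_sq N)"
      by (rule nn_integral_sum) (use m1 in auto)
    also have "\<dots> = (\<Sum>i<N. \<Sum>j<N. \<integral>\<^sup>+\<omega>. ennreal ((cmod (\<Sum>k<N. of_real (\<omega> (i, k)) * Q k j))\<^sup>2) \<partial>gauss_sq N)"
      by (rule sum.cong[OF refl], rule nn_integral_sum) (use m in auto)
    finally show ?thesis .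
  qed
  also have "\<dots> = (\<Sum>i<N. \<Sum>j<N. ennreal (\<Sum>k<N. (cmod (Q k j))\<^sup>2))"
    by (intro sum.cong refl gauss_sq_row_moment) auto
  also have "\<dots> = ennreal (\<Sum>i<N. \<Sum>j<N. \<Sum>k<N. (cmod (Q k j))\<^sup>2)"
    by (simp add: sum_nonneg ennreal_mult' ennreal_of_nat_eq_real_of_nat)
  also have "(\<Sum>i<N. \<Sum>j<N. \<Sum>k<N. (cmod (Q k j))\<^sup>2) = N * fro2 Qmat"
    unfolding fro2_def by (subst (2) sum.swap) (simp add: Qmat_def)
  finally show ?thesis .
qed

text \<open>A bound for the operator norm of \<open>Lmat\<close> with respect to the maximum norm,
  used on eigenvectors below.\<close>

lemma L_row_sum: "i < N \<Longrightarrow> (\<Sum>k<N. cmod (L i k)) \<le> cmod z + 1"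
proof -
  assume i: "i < N"
  show ?thesis
  proof (cases "i \<in> R")
    case True
    have "(\<Sum>k<N. cmod (L i k)) = (\<Sum>k<N. if k = f i then e else 0)"
      using True e by (intro sum.cong refl) (auto simp: L_def unit_row_def)
    also have "\<dots> \<le> 1" using first_props(1)[OF i] e by simp
    finally show ?thesis using norm_ge_zero[of z] by linarith
  next
    case False
    have "(\<Sum>k<N. cmod (L i k)) \<le> (\<Sum>k<N. (if k = i then cmod z else 0) + (if k = Suc i then 1 else 0))"
      using False by (intro sum_mono) (auto simp: L_def A_def)
    also have "\<dots> \<le> cmod z + 1" using i by (simp add: sum.distrib)
    finally show ?thesis .
  qed
qed

lemma det_Lmat_nonzero: "det Lmat \<noteq> 0"
  using det_Lmat_Qmat by auto

lemma ln_det_Qmat: "ln (cmod (det Qmat)) = - ln (cmod (det Lmat))"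
proof -
  have "cmod (det Lmat) * cmod (det Qmat) = 1" using det_Lmat_Qmat by (metis norm_mult norm_one)
  then have "cmod (det Qmat) = inverse (cmod (det Lmat))" using det_Lmat_nonzero by (simp add: field_simps)
  then show ?thesis using det_Lmat_nonzero by (simp add: ln_inverse)
qed

lemma noisy_mult_Qmat:
  assumes i: "i < N" and j: "j < N"
  shows "(noisy_mat N S \<delta> Y \<omega> * Qmat) $$ (i, j) = (\<Sum>k<N. Y i k * Q k j) +
     (if i \<in> S then of_real \<delta> * (\<Sum>k<N. of_real (\<omega> (i, k)) * Q k j) else 0)"
proof -
  have "(noisy_mat N S \<delta> Y \<omega> * Qmat) $$ (i, j) = (\<Sum>k<N. noisy_mat N S \<delta> Y \<omega> $$ (i, k) * Q k j)"
    using i j by (simp add: scalar_prod_def noisy_mat_def Qmat_def atLeast0LessThan)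
  also have "\<dots> = (\<Sum>k<N. Y i k * Q k j + (if i \<in> S then of_real \<delta> * (of_real (\<omega> (i, k)) * Q k j) else 0))"
    using i by (intro sum.cong refl) (auto simp: algebra_simps)
  finally show ?thesis by (simp add: sum.distrib sum_distrib_left)
qed

text \<open>Outside \<open>R\<close> the rows of \<open>A\<close> and \<open>L\<close> agree, so
  there \<open>A\<close> times \<open>Qmat\<close> is the identity. The error \<open>E\<close> is
  thus the noise plus a deterministic part confined to the rows of \<open>R\<close>, each of bounded
  norm by \<open>row_norm_R\<close>; since \<open>card R\<close> is small compared with
  \<open>N\<close>, no further care is needed for it.\<close>

lemma upper_bound:
  fixes t :: real
  assumes t: "t > 0" and nz: "noisy_det N {..<N} \<delta> A \<omega> \<noteq> 0"
  shows "ln (cmod (noisy_det N {..<N} \<delta> A \<omega>)) - ln (cmod (det Lmat))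
     \<le> (N * t + (12 * card R / \<bar>1 - q\<bar> + 2 * \<delta>\<^sup>2 * noise_sq \<omega>) / t) / 2"
proof -
  define X where "X = noisy_mat N {..<N} \<delta> A \<omega>"
  define E where "E = X * Qmat - 1\<^sub>m N"
  have XQ: "X * Qmat \<in> carrier_mat N N" by (rule mult_carrier_mat[where n = N]) (auto simp: X_def)
  have E: "E \<in> carrier_mat N N" unfolding E_def by (rule minus_carrier_mat) simp
  have E1: "1\<^sub>m N + E = X * Qmat" unfolding E_def by (rule one_plus_minus_mat[OF XQ])
  have dX: "det (1\<^sub>m N + E) = noisy_det N {..<N} \<delta> A \<omega> * det Qmat"
    unfolding E1 by (subst det_mult[where n = N]) (auto simp: X_def noisy_det_def)
  have Q0: "det Qmat \<noteq> 0" using det_Lmat_Qmat by auto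
  \<comment> \<open>The deterministic part of the error. It bounds each bad row with the constant
    \<open>2 * 2 + 2\<close> over \<open>1 - q\<close>, whence 12 after the outer factor 2.\<close>
  define D where "D = (\<lambda>i j. if i \<in> R then z * Q i j - (if i = j then 1 else 0) else 0)"
  have Eij: "E $$ (i, j) = D i j + of_real \<delta> * (\<Sum>k<N. of_real (\<omega> (i, k)) * Q k j)" if ij: "i < N" "j < N" for i j
  proof -
    have "(\<Sum>k<N. A i k * Q k j) - (if i = j then 1 else 0) = D i j"
    proof (cases "i \<in> R")
      case True
      have "i = lst i" using R_props[OF True] by simp
      then have "\<not> Suc i < f i + len i" unfolding lst_def by linarith
      then show ?thesis using A_mult[OF ij(1), of "\<lambda>k. Q k j"] True by (simp add: D_def)
    next
      case False
      then show ?thesis using L_Q[OF ij] by (simp add: L_def D_def)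
    qed
    moreover have "E $$ (i, j) = (X * Qmat) $$ (i, j) - (if i = j then 1 else 0)"
      using XQ ij by (auto simp: E_def)
    ultimately show ?thesis using noisy_mult_Qmat[OF ij, of "{..<N}" \<delta> A \<omega>] ij by (simp add: X_def)
  qed
  have sq: "(cmod (x + y))\<^sup>2 \<le> 2 * (cmod x)\<^sup>2 + 2 * (cmod y)\<^sup>2" for x y :: complex
  proof -
    have "(cmod (x + y))\<^sup>2 \<le> (cmod x + cmod y)\<^sup>2" by (intro power_mono norm_triangle_ineq) auto
    also have "\<dots> \<le> 2 * (cmod x)\<^sup>2 + 2 * (cmod y)\<^sup>2"
      using zero_le_power2[of "cmod x - cmod y"] by (simp add: power2_sum power2_diff)
    finally show ?thesis .
  qed
  have rowD: "(\<Sum>j<N. (cmod (D i j))\<^sup>2) \<le> (if i \<in> R then 6 / \<bar>1 - q\<bar> else 0)" if i: "i < N" for i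
  proof (cases "i \<in> R")
    case True
    have q1: "q < 1" using bad_imp[OF i] R_props[OF True] by simp
    have "(\<Sum>j<N. (cmod (D i j))\<^sup>2) \<le> (\<Sum>j<N. 2 * (cmod (z * Q i j))\<^sup>2 + (if i = j then 2 else 0))"
    proof (rule sum_mono)
      fix j
      show "(cmod (D i j))\<^sup>2 \<le> 2 * (cmod (z * Q i j))\<^sup>2 + (if i = j then 2 else 0)"
        using True sq[of "z * Q i j" "- (if i = j then 1 else 0)"] by (auto simp: D_def)
    qed
    also have "\<dots> = 2 * (\<Sum>j<N. (cmod (z * Q i j))\<^sup>2) + 2"
      using i by (simp add: sum.distrib sum_distrib_left)
    also have "\<dots> \<le> 2 * (2 / (1 - q)) + 2 * (1 / (1 - q))"
      using row_norm_R[OF True] q1 q_pos by (intro add_mono) (auto simp: field_simps)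
    finally show ?thesis using True q1 by simp
  qed (simp add: D_def)
  have "fro2 E \<le> (\<Sum>i<N. \<Sum>j<N. 2 * (cmod (D i j))\<^sup>2 + 2 * (cmod (of_real \<delta> * (\<Sum>k<N. of_real (\<omega> (i, k)) * Q k j)))\<^sup>2)"
    unfolding fro2_def using E by (auto intro!: sum_mono simp: Eij sq)
  also have "\<dots> = 2 * (\<Sum>i<N. \<Sum>j<N. (cmod (D i j))\<^sup>2) + 2 * \<delta>\<^sup>2 * noise_sq \<omega>"
    by (simp only: norm_mult power_mult_distrib) (simp add: sum.distrib sum_distrib_left noise_sq_def mult.assoc)
  finally have fE1: "fro2 E \<le> 2 * (\<Sum>i<N. \<Sum>j<N. (cmod (D i j))\<^sup>2) + 2 * \<delta>\<^sup>2 * noise_sq \<omega>" .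
  have "(\<Sum>i<N. \<Sum>j<N. (cmod (D i j))\<^sup>2) \<le> (\<Sum>i<N. if i \<in> R then 6 / \<bar>1 - q\<bar> else 0)"
    by (intro sum_mono rowD) auto
  also have "\<dots> = card R * (6 / \<bar>1 - q\<bar>)"
  proof -
    have "{..<N} \<inter> {i. i \<in> R} = R" using R_props by auto
    then show ?thesis by (subst sum.If_cases) auto
  qed
  finally have fE: "fro2 E \<le> 12 * card R / \<bar>1 - q\<bar> + 2 * \<delta>\<^sup>2 * noise_sq \<omega>" using fE1 by simp
  have "ln (cmod (det (1\<^sub>m N + E))) \<le> (N * t + fro2 E / t) / 2"
    by (rule ln_det_one_plus_upper[OF E t]) (use nz Q0 dX in auto)
  also have "\<dots> \<le> (N * t + (12 * card R / \<bar>1 - q\<bar> + 2 * \<delta>\<^sup>2 * noise_sq \<omega>) / t) / 2"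
    using t fE by (intro divide_right_mono add_left_mono) auto
  also have "ln (cmod (det (1\<^sub>m N + E))) = ln (cmod (noisy_det N {..<N} \<delta> A \<omega>)) - ln (cmod (det Lmat))"
    using nz Q0 by (simp add: dX norm_mult ln_mult ln_det_Qmat)
  finally show ?thesis .
qed

text \<open>Row gradient over \<open>\<bar>\<delta>\<bar>\<close> times the determinant is the norm
  of column \<open>r\<close> of the inverse of the noisy matrix, by Cramer's rule. The square root
  is taken term by term since only the half moments of these norms are controlled.\<close>

definition inv_bound :: "real \<Rightarrow> (nat \<times> nat \<Rightarrow> real) \<Rightarrow> real" where
  "inv_bound \<delta> \<omega> = sqrt (cmod z + 1) * (\<Sum>r\<in>{..<N} - R.
     sqrt (row_gradient N ({..<N} - R) \<delta> L r \<omega> / (\<bar>\<delta>\<bar> * cmod (noisy_det N ({..<N} - R) \<delta> L \<omega>))))"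

lemma inv_bound_nonneg: "inv_bound \<delta> \<omega> \<ge> 0"
  unfolding inv_bound_def by (intro mult_nonneg_nonneg sum_nonneg) auto

lemma inv_bound_measurable [measurable]: "inv_bound \<delta> \<in> borel_measurable (gauss_sq N)"
  unfolding inv_bound_def[abs_def] by measurable

lemma inv_bound_integral:
  assumes \<delta>: "\<delta> \<noteq> 0"
  shows "(\<integral>\<^sup>+\<omega>. ennreal (inv_bound \<delta> \<omega>) \<partial>gauss_sq N) \<le> ennreal (sqrt (cmod z + 1) * (N * (8 / sqrt \<bar>\<delta>\<bar>)))"
proof -
  define g where "g = (\<lambda>r \<omega>. sqrt (row_gradient N ({..<N} - R) \<delta> L r \<omega> / (\<bar>\<delta>\<bar> * cmod (noisy_det N ({..<N} - R) \<delta> L \<omega>))))"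
  have gm: "g r \<in> borel_measurable (gauss_sq N)" for r unfolding g_def by measurable
  have g0: "g r \<omega> \<ge> 0" for r \<omega> by (simp add: g_def)
  have each: "(\<integral>\<^sup>+\<omega>. ennreal (g r \<omega>) \<partial>gauss_sq N) \<le> ennreal (8 / sqrt \<bar>\<delta>\<bar>)" if r: "r < N" "r \<notin> R" for r
  proof -
    have "(\<integral>\<^sup>+\<omega>. ennreal (g r \<omega>) \<partial>gauss_sq N) \<le> (\<integral>\<^sup>+\<omega>. ennreal (1 / sqrt \<bar>\<delta>\<bar>) *
       (ennreal (sqrt (max (cmod (noisy_det N ({..<N} - R - {r}) \<delta> L \<omega>)) (row_gradient N ({..<N} - R) \<delta> L r \<omega>)))
            / ennreal (sqrt (cmod (noisy_det N ({..<N} - R) \<delta> L \<omega>)))) \<partial>gauss_sq N)"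
    proof (rule nn_integral_mono)
      fix \<omega>
      define a where "a = row_gradient N ({..<N} - R) \<delta> L r \<omega>"
      define m where "m = max (cmod (noisy_det N ({..<N} - R - {r}) \<delta> L \<omega>)) a"
      define x where "x = cmod (noisy_det N ({..<N} - R) \<delta> L \<omega>)"
      have "a \<ge> 0" "a \<le> m" "x \<ge> 0" by (auto simp: a_def m_def x_def)
      show "ennreal (g r \<omega>) \<le> ennreal (1 / sqrt \<bar>\<delta>\<bar>) * (ennreal (sqrt (max (cmod (noisy_det N ({..<N} - R - {r}) \<delta> L \<omega>)) (row_gradient N ({..<N} - R) \<delta> L r \<omega>)))
            / ennreal (sqrt (cmod (noisy_det N ({..<N} - R) \<delta> L \<omega>))))"
        unfolding g_def a_def[symmetric] m_def[symmetric] x_def[symmetric]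
      proof (cases "x = 0")
        case False
        then have "x > 0" using \<open>x \<ge> 0\<close> by simp
        have "sqrt (a / (\<bar>\<delta>\<bar> * x)) = (1 / sqrt \<bar>\<delta>\<bar>) * (sqrt a / sqrt x)" by (simp add: real_sqrt_divide real_sqrt_mult)
        also have "\<dots> \<le> (1 / sqrt \<bar>\<delta>\<bar>) * (sqrt m / sqrt x)"
          using \<open>a \<le> m\<close> \<open>x > 0\<close> by (intro mult_left_mono divide_right_mono) auto
        finally show "ennreal (sqrt (a / (\<bar>\<delta>\<bar> * x))) \<le> ennreal (1 / sqrt \<bar>\<delta>\<bar>) * (ennreal (sqrt m) / ennreal (sqrt x))"
          using \<open>x > 0\<close> \<open>a \<ge> 0\<close> \<open>a \<le> m\<close> by (simp add: divide_ennreal ennreal_mult'[symmetric] ennreal_leI del: times_divide_eq_left)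
      qed simp
    qed
    also have "\<dots> = ennreal (1 / sqrt \<bar>\<delta>\<bar>) * (\<integral>\<^sup>+\<omega>.
       (ennreal (sqrt (max (cmod (noisy_det N ({..<N} - R - {r}) \<delta> L \<omega>)) (row_gradient N ({..<N} - R) \<delta> L r \<omega>)))
            / ennreal (sqrt (cmod (noisy_det N ({..<N} - R) \<delta> L \<omega>)))) \<partial>gauss_sq N)"
      by (rule nn_integral_cmult) measurable
    also have "\<dots> \<le> ennreal (1 / sqrt \<bar>\<delta>\<bar>) * 8"
      by (intro mult_left_mono noisy_det_row_moment) (use r in auto)
    also have "\<dots> = ennreal (1 / sqrt \<bar>\<delta>\<bar>) * ennreal 8" by simp
    also have "\<dots> = ennreal (8 / sqrt \<bar>\<delta>\<bar>)" by (subst ennreal_mult'[symmetric]) auto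
    finally show ?thesis .
  qed
  have "(\<integral>\<^sup>+\<omega>. ennreal (inv_bound \<delta> \<omega>) \<partial>gauss_sq N) = (\<integral>\<^sup>+\<omega>. ennreal (sqrt (cmod z + 1)) * (\<Sum>r\<in>{..<N} - R. ennreal (g r \<omega>)) \<partial>gauss_sq N)"
    unfolding inv_bound_def g_def[symmetric] by (simp add: ennreal_mult' g_def)
  also have "\<dots> = ennreal (sqrt (cmod z + 1)) * (\<Sum>r\<in>{..<N} - R. \<integral>\<^sup>+\<omega>. ennreal (g r \<omega>) \<partial>gauss_sq N)"
    using gm by (subst nn_integral_cmult; (subst nn_integral_sum)?) (auto intro!: borel_measurable_sum simp del: sum_ennreal)
  also have "\<dots> \<le> ennreal (sqrt (cmod z + 1)) * (\<Sum>r\<in>{..<N} - R. ennreal (8 / sqrt \<bar>\<delta>\<bar>))"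
    by (intro mult_left_mono sum_mono each) auto
  also have "\<dots> \<le> ennreal (sqrt (cmod z + 1)) * (\<Sum>r<N. ennreal (8 / sqrt \<bar>\<delta>\<bar>))"
    by (intro mult_left_mono sum_mono2) auto
  also have "(\<Sum>r<N. ennreal (8 / sqrt \<bar>\<delta>\<bar>)) = ennreal (N * (8 / sqrt \<bar>\<delta>\<bar>))"
    by (simp add: ennreal_of_nat_eq_real_of_nat ennreal_mult'[symmetric])
  also have "ennreal (sqrt (cmod z + 1)) * ennreal (N * (8 / sqrt \<bar>\<delta>\<bar>)) = ennreal (sqrt (cmod z + 1) * (N * (8 / sqrt \<bar>\<delta>\<bar>)))"
    by (rule ennreal_mult'[symmetric]) simp
  finally show ?thesis .
qed

text \<open>With the bad rows equal to those of \<open>L\<close> and free of noise, the error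
  \<open>E\<close> is pure noise. If \<open>E v = x v\<close>, then \<open>y = Q v\<close> satisfies
  \<open>L y = v\<close> and \<open>X y = (1 + x) v\<close>. So a value of \<open>1 + x\<close>
  close to 0 forces a large inverse of \<open>X\<close>, and this is what \<open>inv_bound\<close>
  measures.\<close>

lemma lower_bound_reduced:
  fixes t :: real
  assumes t: "t > 0" and K: "K \<ge> 0" and \<delta>: "\<delta> \<noteq> 0" and nz: "noisy_det N ({..<N} - R) \<delta> L \<omega> \<noteq> 0"
  shows "- (N * t + \<delta>\<^sup>2 * noise_sq \<omega> / t) - 4 * K * (\<delta>\<^sup>2 * noise_sq \<omega>) - 2 * N * exp (- K / 2) * inv_bound \<delta> \<omega>
     \<le> ln (cmod (noisy_det N ({..<N} - R) \<delta> L \<omega>)) - ln (cmod (det Lmat))"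
proof -
  define S where "S = {..<N} - R"
  define X where "X = noisy_mat N S \<delta> L \<omega>"
  define E where "E = X * Qmat - 1\<^sub>m N"
  have X: "X \<in> carrier_mat N N" by (simp add: X_def)
  have XQ: "X * Qmat \<in> carrier_mat N N" using X by (rule mult_carrier_mat) simp
  have E: "E \<in> carrier_mat N N" unfolding E_def by (rule minus_carrier_mat) simp
  have E1: "1\<^sub>m N + E = X * Qmat" unfolding E_def by (rule one_plus_minus_mat[OF XQ])
  have dX: "det (1\<^sub>m N + E) = det X * det Qmat"
    unfolding E1 by (rule det_mult[where n = N]) (auto simp: X_def)
  have dXn: "det X \<noteq> 0" using nz by (simp add: X_def S_def noisy_det_def)
  have Q0: "det Qmat \<noteq> 0" using det_Lmat_Qmat by auto
  have Eij: "E $$ (i, j) = (if i \<in> S then of_real \<delta> * (\<Sum>k<N. of_real (\<omega> (i, k)) * Q k j) else 0)" if ij: "i < N" "j < N" for i j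
  proof -
    have "E $$ (i, j) = (X * Qmat) $$ (i, j) - (if i = j then 1 else 0)"
      using XQ ij by (auto simp: E_def)
    then show ?thesis using noisy_mult_Qmat[OF ij, of S \<delta> L \<omega>] L_Q[OF ij] by (simp add: X_def)
  qed
  have "fro2 E \<le> (\<Sum>i<N. \<Sum>j<N. (cmod (of_real \<delta> * (\<Sum>k<N. of_real (\<omega> (i, k)) * Q k j)))\<^sup>2)"
    unfolding fro2_def using E by (auto intro!: sum_mono simp: Eij)
  also have "\<dots> = \<delta>\<^sup>2 * noise_sq \<omega>"
    by (simp only: norm_mult power_mult_distrib) (simp add: noise_sq_def sum_distrib_left)
  finally have fE: "fro2 E \<le> \<delta>\<^sup>2 * noise_sq \<omega>" .
  define G where "G = (\<Sum>r\<in>S. row_gradient N S \<delta> L r \<omega> / (\<bar>\<delta>\<bar> * cmod (det X)))"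
  have G0: "G \<ge> 0" unfolding G_def by (intro sum_nonneg) auto
  have B: "sqrt ((cmod z + 1) * G) \<le> inv_bound \<delta> \<omega>"
  proof -
    have "sqrt G \<le> (\<Sum>r\<in>S. sqrt (row_gradient N S \<delta> L r \<omega> / (\<bar>\<delta>\<bar> * cmod (det X))))"
      unfolding G_def by (rule sqrt_sum_le) (auto simp: S_def)
    then show ?thesis unfolding inv_bound_def S_def[symmetric] real_sqrt_mult
      by (intro mult_left_mono) (auto simp: X_def noisy_det_def)
  qed
  have ev: "1 + x \<noteq> 0 \<and> 1 / sqrt (cmod (1 + x)) \<le> inv_bound \<delta> \<omega>" if x: "eigenvalue E x" "x \<noteq> 0" for x
  proof -
    obtain v where v: "v \<in> carrier_vec N" "v \<noteq> 0\<^sub>v N" "E *\<^sub>v v = x \<cdot>\<^sub>v v"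
      using x(1) E unfolding eigenvalue_def eigenvector_def by auto
    \<comment> \<open>The rows of \<open>E\<close> in \<open>R\<close> vanish, so an eigenvector for
      a nonzero eigenvalue lives on the noisy rows. Hence only the columns of the inverse that
      anticoncentration controls are involved.\<close>
    have vR: "v $ i = 0" if i: "i < N" "i \<notin> S" for i
    proof -
      have "(E *\<^sub>v v) $ i = (\<Sum>j<N. E $$ (i, j) * v $ j)"
        using i E v(1) by (simp add: scalar_prod_def atLeast0LessThan)
      also have "\<dots> = 0" using i by (simp add: Eij)
      finally show ?thesis using v i x(2) by simp
    qed
    define y where "y = Qmat *\<^sub>v v"
    have y: "y \<in> carrier_vec N" using v by (simp add: y_def mult_mat_vec_carrier[OF carriers(2)])
    have Ly: "Lmat *\<^sub>v y = v"
    proof -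
      have "Lmat *\<^sub>v y = (Lmat * Qmat) *\<^sub>v v" unfolding y_def by (rule assoc_mult_mat_vec[OF carriers v(1), symmetric])
      then show ?thesis using v by (simp add: Lmat_Qmat)
    qed
    have Xy: "X *\<^sub>v y = (1 + x) \<cdot>\<^sub>v v"
    proof -
      have "X *\<^sub>v y = (X * Qmat) *\<^sub>v v" unfolding y_def by (rule assoc_mult_mat_vec[OF X carriers(2) v(1), symmetric])
      also have "\<dots> = (1\<^sub>m N + E) *\<^sub>v v" by (simp add: E1)
      also have "\<dots> = 1\<^sub>m N *\<^sub>v v + E *\<^sub>v v" by (rule add_mult_distrib_mat_vec) (use v E in auto)
      also have "\<dots> = (1 + x) \<cdot>\<^sub>v v" using v by (simp add: add_smult_distrib_vec)
      finally show ?thesis .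
    qed
    \<comment> \<open>Cramer's rule for \<open>X y = (1 + x) v\<close>, written with the adjugate to
      avoid the inverse.\<close>
    have dy: "det X * y $ k = (1 + x) * (\<Sum>r\<in>S. cofactor X r k * v $ r)" if k: "k < N" for k
    proof -
      have "det X \<cdot>\<^sub>v y = (det X \<cdot>\<^sub>m 1\<^sub>m N) *\<^sub>v y" by (rule smult_one_mult_vec[OF y, symmetric])
      also have "\<dots> = (adj_mat X * X) *\<^sub>v y" by (simp add: adj_mat(3)[OF X])
      also have "\<dots> = adj_mat X *\<^sub>v (X *\<^sub>v y)" by (rule assoc_mult_mat_vec) (use adj_mat(1)[OF X] X y in auto)
      also have "\<dots> = (1 + x) \<cdot>\<^sub>v (adj_mat X *\<^sub>v v)" unfolding Xy by (rule mult_mat_vec[OF adj_mat(1)[OF X] v(1)])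
      finally have "(det X \<cdot>\<^sub>v y) $ k = ((1 + x) \<cdot>\<^sub>v (adj_mat X *\<^sub>v v)) $ k" by simp
      moreover have "(adj_mat X *\<^sub>v v) $ k = (\<Sum>r<N. cofactor X r k * v $ r)"
        using k X v by (simp add: scalar_prod_def adj_mat_def atLeast0LessThan)
      moreover have "(\<Sum>r<N. cofactor X r k * v $ r) = (\<Sum>r\<in>S. cofactor X r k * v $ r)"
        by (rule sum.mono_neutral_right) (auto simp: S_def vR)
      ultimately show ?thesis using k y v X by (simp add: adj_mat_def)
    qed
    define m where "m = Max ((\<lambda>i. cmod (v $ i)) ` {..<N})"
    have "\<exists>i<N. v $ i \<noteq> 0" using v by (metis eq_vecI carrier_vecD index_zero_vec)
    then have N0: "{..<N} \<noteq> {}" by auto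
    have mle: "cmod (v $ i) \<le> m" if "i < N" for i unfolding m_def using that by (intro Max_ge) auto
    have "m \<in> (\<lambda>i. cmod (v $ i)) ` {..<N}" unfolding m_def using N0 by (intro Max_in) auto
    then obtain i0 where i0: "i0 < N" "m = cmod (v $ i0)" by auto
    have m0: "m > 0"
    proof -
      obtain i where "i < N" "v $ i \<noteq> 0" using \<open>\<exists>i<N. v $ i \<noteq> 0\<close> by auto
      then show ?thesis using mle[of i] by (simp add: less_le_trans[of 0 "cmod (v $ i)" m])
    qed
    have yk: "cmod (y $ k) \<le> cmod (1 + x) * (G * m)" if k: "k < N" for k
    proof -
      have "cmod (\<Sum>r\<in>S. cofactor X r k * v $ r) \<le> (\<Sum>r\<in>S. (row_gradient N S \<delta> L r \<omega> / \<bar>\<delta>\<bar>) * m)"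
      proof (rule sum_norm_le)
        fix r assume r: "r \<in> S"
        then have rN: "r < N" by (simp add: S_def)
        show "cmod (cofactor X r k * v $ r) \<le> (row_gradient N S \<delta> L r \<omega> / \<bar>\<delta>\<bar>) * m"
          unfolding norm_mult X_def
          by (intro mult_mono cofactor_le_row_gradient mle rN r k \<delta>) auto
      qed
      also have "\<dots> = cmod (det X) * (G * m)"
        using dXn by (simp add: G_def sum_distrib_left sum_distrib_right)
      finally have h: "cmod (\<Sum>r\<in>S. cofactor X r k * v $ r) \<le> cmod (det X) * (G * m)" .
      have "cmod (det X) * cmod (y $ k) = cmod (1 + x) * cmod (\<Sum>r\<in>S. cofactor X r k * v $ r)"
        unfolding norm_mult[symmetric] dy[OF k] ..
      also have "\<dots> \<le> cmod (1 + x) * (cmod (det X) * (G * m))"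
        using h by (rule mult_left_mono) simp
      finally have "cmod (det X) * cmod (y $ k) \<le> cmod (det X) * (cmod (1 + x) * (G * m))"
        by (simp only: mult.left_commute)
      then show ?thesis using dXn by simp
    qed
    have "v $ i0 = (\<Sum>k<N. L i0 k * y $ k)"
    proof -
      have "(Lmat *\<^sub>v y) $ i0 = (\<Sum>k<N. L i0 k * y $ k)"
        using i0(1) y by (simp add: Lmat_def scalar_prod_def atLeast0LessThan)
      then show ?thesis by (simp add: Ly)
    qed
    then have "m \<le> (\<Sum>k<N. cmod (L i0 k * y $ k))"
      unfolding i0(2) by (simp only: norm_sum)
    also have "\<dots> \<le> (\<Sum>k<N. cmod (L i0 k) * (cmod (1 + x) * (G * m)))"
      unfolding norm_mult by (intro sum_mono mult_left_mono yk) auto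
    also have "\<dots> = (\<Sum>k<N. cmod (L i0 k)) * (cmod (1 + x) * (G * m))" by (simp add: sum_distrib_right)
    also have "\<dots> \<le> (cmod z + 1) * (cmod (1 + x) * (G * m))"
      using L_row_sum[OF i0(1)] G0 m0 by (intro mult_right_mono) auto
    \<comment> \<open>The maximum norm \<open>m\<close> of the eigenvector is estimated by itself
      and cancels, leaving a lower bound for \<open>cmod (1 + x)\<close>.\<close>
    finally have "1 * m \<le> (cmod (1 + x) * ((cmod z + 1) * G)) * m" by (simp add: mult_ac)
    then have one: "1 \<le> cmod (1 + x) * ((cmod z + 1) * G)" using m0 by (simp only: mult_le_cancel_right_pos)
    then have nz1: "cmod (1 + x) > 0" by (cases "1 + x = 0") auto
    have "1 / cmod (1 + x) \<le> (cmod z + 1) * G" using one nz1 by (simp add: field_simps)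
    then have "sqrt (1 / cmod (1 + x)) \<le> sqrt ((cmod z + 1) * G)" by (rule real_sqrt_le_mono)
    then show ?thesis using nz1 B by (auto simp: real_sqrt_divide)
  qed
  have "- (N * t + fro2 E / t) - 4 * K * fro2 E - 2 * N * exp (- K / 2) * inv_bound \<delta> \<omega> \<le> ln (cmod (det (1\<^sub>m N + E)))"
    using ln_det_one_plus_lower[OF E t K inv_bound_nonneg ev] by simp
  also have "\<dots> = ln (cmod (noisy_det N ({..<N} - R) \<delta> L \<omega>)) - ln (cmod (det Lmat))"
    using dXn Q0 by (simp add: dX norm_mult ln_mult ln_det_Qmat X_def S_def noisy_det_def)
  finally have "- (N * t + fro2 E / t) - 4 * K * fro2 E - 2 * N * exp (- K / 2) * inv_bound \<delta> \<omega>
     \<le> ln (cmod (noisy_det N ({..<N} - R) \<delta> L \<omega>)) - ln (cmod (det Lmat))" .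
  moreover have "fro2 E / t \<le> \<delta>\<^sup>2 * noise_sq \<omega> / t" using fE t by (intro divide_right_mono) auto
  moreover have "4 * K * fro2 E \<le> 4 * K * (\<delta>\<^sup>2 * noise_sq \<omega>)" using fE K by (intro mult_left_mono) auto
  ultimately show ?thesis by linarith
qed

lemma f_inj_R: "inj_on f R"
proof (rule inj_onI)
  fix i j assume ij: "i \<in> R" "j \<in> R" "f i = f j"
  have "i = lst i" "j = lst j" "i < N" "j < N" using R_props ij by auto
  then show "i = j" using same_first(2)[OF _ _ ij(3)] by metis
qed

text \<open>Distributing the unit rows over the bad rows in another way only permutes rows. This is
  the assumption on \<open>F\<close> in \<open>noisy_det_lower_expose\<close>.\<close>

lemma reduced_det_permuted:
  assumes \<sigma>: "bij_betw \<sigma> R J"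
  shows "cmod (noisy_det N ({..<N} - R) \<delta> (\<lambda>i. if i \<in> R then (\<lambda>k. of_real e * unit_row (\<sigma> i) k) else A i) \<omega>)
     = cmod (noisy_det N ({..<N} - R) \<delta> L \<omega>)"
proof -
  have bf: "bij_betw f R J" using f_inj_R by (simp add: bij_betw_def J_def)
  define p where "p = (\<lambda>i. if i \<in> R then inv_into R f (\<sigma> i) else i)"
  have pb: "bij_betw (\<lambda>i. inv_into R f (\<sigma> i)) R R"
    using bij_betw_trans[OF \<sigma> bij_betw_inv_into[OF bf]] by (simp add: o_def)
  have fp: "f (p i) = \<sigma> i" "p i \<in> R" if "i \<in> R" for i
  proof -
    have "\<sigma> i \<in> J" using \<sigma> that by (auto simp: bij_betw_def)
    then show "f (p i) = \<sigma> i" using that by (simp add: p_def J_def f_inv_into_f)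
    show "p i \<in> R" using that pb by (auto simp: p_def bij_betw_def)
  qed
  have RN: "R \<subseteq> {0..<N}" using R_props by auto
  have "bij_betw p {0..<N} {0..<N}"
  proof -
    have 1: "bij_betw p R R" using pb by (rule bij_betw_cong[THEN iffD1, rotated]) (simp add: p_def)
    have 2: "bij_betw p ({0..<N} - R) ({0..<N} - R)"
      by (rule bij_betw_cong[THEN iffD1, rotated, of id]) (auto simp: p_def bij_betw_def)
    have "bij_betw p (R \<union> ({0..<N} - R)) (R \<union> ({0..<N} - R))"
      by (rule bij_betw_combine[OF 1 2]) auto
    then show ?thesis using RN by (simp add: Un_absorb1)
  qed
  then have pp: "p permutes {0..<N}" using RN by (intro bij_imp_permutes) (auto simp: p_def)
  have "noisy_mat N ({..<N} - R) \<delta> (\<lambda>i. if i \<in> R then (\<lambda>k. of_real e * unit_row (\<sigma> i) k) else A i) \<omega>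
      = mat N N (\<lambda>(i, j). noisy_mat N ({..<N} - R) \<delta> L \<omega> $$ (p i, j))"
  proof (rule eq_matI)
    fix i j assume "i < dim_row (mat N N (\<lambda>(i, j). noisy_mat N ({..<N} - R) \<delta> L \<omega> $$ (p i, j)))"
      "j < dim_col (mat N N (\<lambda>(i, j). noisy_mat N ({..<N} - R) \<delta> L \<omega> $$ (p i, j)))"
    then have ij: "i < N" "j < N" by auto
    have piN: "p i < N" using permutes_in_image[OF pp, of i] ij by simp
    show "noisy_mat N ({..<N} - R) \<delta> (\<lambda>i. if i \<in> R then (\<lambda>k. of_real e * unit_row (\<sigma> i) k) else A i) \<omega> $$ (i, j)
        = mat N N (\<lambda>(i, j). noisy_mat N ({..<N} - R) \<delta> L \<omega> $$ (p i, j)) $$ (i, j)"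
    proof (cases "i \<in> R")
      case True
      then show ?thesis using ij piN fp[OF True] by (simp add: L_def)
    next
      case False
      then have "p i = i" by (simp add: p_def)
      then show ?thesis using ij False by (simp add: L_def)
    qed
  qed (auto simp: noisy_mat_def)
  then have "noisy_det N ({..<N} - R) \<delta> (\<lambda>i. if i \<in> R then (\<lambda>k. of_real e * unit_row (\<sigma> i) k) else A i) \<omega>
      = signof p * noisy_det N ({..<N} - R) \<delta> L \<omega>"
    unfolding noisy_det_def by (simp only:) (rule det_permute_rows[OF noisy_mat_carrier pp])
  then show ?thesis by (simp only: norm_mult cmod_signof mult_1)
qed

end

section \<open>Mean deviation of the logarithm of the determinant\<close>

context jordan_split
begin

text \<open>The free parameter \<open>t\<close> balances the two sides of \<open>2 \<bar>\<lambda>\<bar> \<le> t + \<bar>\<lambda>\<bar>\<^sup>2 / t\<close>, summed over the eigenvalues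
  \<open>\<lambda>\<close> of \<open>E\<close>; \<open>exp (- K)\<close> is the scale below which \<open>\<bar>1 + \<lambda>\<bar>\<close> counts as exceptionally small.\<close>

lemma deviation:
  fixes t K \<delta> :: real
  assumes t: "t > 0" and K: "K \<ge> 0" and \<delta>: "\<delta> \<noteq> 0"
  shows "(\<integral>\<^sup>+\<omega>. ennreal \<bar>ln (cmod (noisy_det N {..<N} \<delta> A \<omega>)) - ln (cmod (det Lmat))\<bar> \<partial>gauss_sq N)
    \<le> ennreal (3 / 2 * N * t + 6 * card R / (\<bar>1 - q\<bar> * t)
        + \<bar>max 0 (card R * ln (e / \<bar>\<delta>\<bar>) - ln (fact (card R)) / 2)\<bar>
        + (2 / t + 4 * K) * (\<delta>\<^sup>2 * (N * fro2 Qmat)) + 16 * card R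
        + 2 * N * exp (- K / 2) * (sqrt (cmod z + 1) * (N * (8 / sqrt \<bar>\<delta>\<bar>))))"
proof -
  \<comment> \<open>The price of exposing the rows of \<open>R\<close>: each unit row with factor
    \<open>e\<close> is exchanged for noise of size \<open>\<bar>\<delta>\<bar>\<close>, and half
    the logarithm of the factorial is refunded. If the balance is a gain, it is ignored.\<close>
  define D where "D = max 0 (card R * ln (e / \<bar>\<delta>\<bar>) - ln (fact (card R)) / 2)"
  define c0 where "c0 = 3 / 2 * N * t + 6 * card R / (\<bar>1 - q\<bar> * t) + D"
  define c1 where "c1 = (2 / t + 4 * K) * \<delta>\<^sup>2"
  define c2 where "c2 = 2 * N * exp (- K / 2)"
  have D: "D \<ge> 0" by (simp add: D_def)
  have c: "c0 \<ge> 0" "c1 \<ge> 0" "c2 \<ge> 0" using t K D by (auto simp: c0_def c1_def c2_def)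
  have RN: "R \<subseteq> {..<N}" using R_props by auto
  have W0: "AE \<omega> in gauss_sq N. noisy_det N ({..<N} - R) \<delta> L \<omega> \<noteq> 0"
  proof -
    have "det (mat N N (\<lambda>(i, j). L i j)) \<noteq> 0" using det_Lmat_nonzero by (simp add: Lmat_def)
    from noisy_det_lower_crude[OF _ this, of "{..<N} - R" \<delta>]
    show ?thesis by (auto elim: eventually_mono)
  qed
  have cRJ: "card R = card J" unfolding J_def by (rule card_image[OF f_inj_R, symmetric])
  have JN: "J \<subseteq> {..<N}" unfolding J_def using R_props first_props(1) by auto
  have fR: "finite R" using RN finite_subset by blast
  have "AE \<omega> in gauss_sq N. 0 < cmod (noisy_det N ({..<N} - R) \<delta> L \<omega>)" using W0 by simp
  from noisy_det_lower_expose[where Y = A and F = "\<lambda>\<omega>. cmod (noisy_det N ({..<N} - R) \<delta> L \<omega>)",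
      OF fR RN order_refl JN cRJ \<delta> e(1) reduced_det_permuted this]
  obtain W where W: "W \<in> borel_measurable (gauss_sq N)" "\<And>\<omega>. W \<omega> \<ge> 0"
    "(\<integral>\<^sup>+\<omega>. ennreal (W \<omega>) \<partial>gauss_sq N) \<le> ennreal (16 * card R)"
    "AE \<omega> in gauss_sq N. noisy_det N {..<N} \<delta> A \<omega> \<noteq> 0 \<and>
       card R * ln (\<bar>\<delta>\<bar> / e) + ln (fact (card R)) / 2 + ln (cmod (noisy_det N ({..<N} - R) \<delta> L \<omega>)) - W \<omega>
         \<le> ln (cmod (noisy_det N {..<N} \<delta> A \<omega>))"
    by blast
  have "AE \<omega> in gauss_sq N. \<bar>ln (cmod (noisy_det N {..<N} \<delta> A \<omega>)) - ln (cmod (det Lmat))\<bar>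
      \<le> c0 + c1 * noise_sq \<omega> + W \<omega> + c2 * inv_bound \<delta> \<omega>"
    using W0 W(4)
  proof eventually_elim
    case (elim \<omega>)
    define x where "x = ln (cmod (noisy_det N {..<N} \<delta> A \<omega>)) - ln (cmod (det Lmat))"
    have W': "W \<omega> \<ge> 0" "noise_sq \<omega> \<ge> 0" "inv_bound \<delta> \<omega> \<ge> 0" using W(2) inv_bound_nonneg by auto
    have u: "x \<le> (N * t + (12 * card R / \<bar>1 - q\<bar> + 2 * \<delta>\<^sup>2 * noise_sq \<omega>) / t) / 2"
      unfolding x_def using elim by (intro upper_bound t) auto
    also have "\<dots> = N * t / 2 + 6 * card R / (\<bar>1 - q\<bar> * t) + \<delta>\<^sup>2 * noise_sq \<omega> / t"
      by (simp add: add_divide_distrib)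
    finally have u: "x \<le> N * t / 2 + 6 * card R / (\<bar>1 - q\<bar> * t) + \<delta>\<^sup>2 * noise_sq \<omega> / t" .
    have "ln (e / \<bar>\<delta>\<bar>) = - ln (\<bar>\<delta>\<bar> / e)" using e \<delta> by (simp add: ln_div)
    then have d: "- D \<le> card R * ln (\<bar>\<delta>\<bar> / e) + ln (fact (card R)) / 2" by (simp add: D_def)
    have "- (N * t + \<delta>\<^sup>2 * noise_sq \<omega> / t) - 4 * K * (\<delta>\<^sup>2 * noise_sq \<omega>) - c2 * inv_bound \<delta> \<omega>
       \<le> ln (cmod (noisy_det N ({..<N} - R) \<delta> L \<omega>)) - ln (cmod (det Lmat))"
      unfolding c2_def using lower_bound_reduced[OF t K \<delta>, of \<omega>] elim by simp
    then have l: "- (N * t + \<delta>\<^sup>2 * noise_sq \<omega> / t) - 4 * K * (\<delta>\<^sup>2 * noise_sq \<omega>) - c2 * inv_bound \<delta> \<omega> - D - W \<omega> \<le> x"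
      using elim(2) d by (simp add: x_def)
    have p: "0 \<le> N * t" "0 \<le> 6 * card R / (\<bar>1 - q\<bar> * t)" "0 \<le> \<delta>\<^sup>2 * noise_sq \<omega> / t" "0 \<le> 4 * K * (\<delta>\<^sup>2 * noise_sq \<omega>)"
      "0 \<le> c2 * inv_bound \<delta> \<omega>" using t K W' c by auto
    have e1: "c0 + c1 * noise_sq \<omega> + W \<omega> + c2 * inv_bound \<delta> \<omega> = 3 / 2 * (N * t) + 6 * card R / (\<bar>1 - q\<bar> * t) + D
       + 2 * (\<delta>\<^sup>2 * noise_sq \<omega> / t) + 4 * K * (\<delta>\<^sup>2 * noise_sq \<omega>) + W \<omega> + c2 * inv_bound \<delta> \<omega>"
      by (simp add: c0_def c1_def distrib_right)
    have "x \<le> c0 + c1 * noise_sq \<omega> + W \<omega> + c2 * inv_bound \<delta> \<omega>"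
      unfolding e1 using u p W' D by linarith
    moreover have "- x \<le> c0 + c1 * noise_sq \<omega> + W \<omega> + c2 * inv_bound \<delta> \<omega>"
      unfolding e1 using l p W' D by linarith
    ultimately show ?case unfolding x_def by linarith
  qed
  then have "(\<integral>\<^sup>+\<omega>. ennreal \<bar>ln (cmod (noisy_det N {..<N} \<delta> A \<omega>)) - ln (cmod (det Lmat))\<bar> \<partial>gauss_sq N)
      \<le> (\<integral>\<^sup>+\<omega>. ennreal (c0 + c1 * noise_sq \<omega> + W \<omega> + c2 * inv_bound \<delta> \<omega>) \<partial>gauss_sq N)"
    by (intro nn_integral_mono_AE) (auto elim: eventually_mono intro: ennreal_leI)
  also have "\<dots> = (\<integral>\<^sup>+\<omega>. ennreal c0 + ennreal c1 * ennreal (noise_sq \<omega>) + ennreal (W \<omega>) + ennreal c2 * ennreal (inv_bound \<delta> \<omega>) \<partial>gauss_sq N)"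
    using c W(2) inv_bound_nonneg
    by (intro nn_integral_cong) (simp add: ennreal_mult'[symmetric] ennreal_plus[symmetric] del: ennreal_plus)
  also have "\<dots> = ennreal c0 + ennreal c1 * (\<integral>\<^sup>+\<omega>. ennreal (noise_sq \<omega>) \<partial>gauss_sq N)
      + (\<integral>\<^sup>+\<omega>. ennreal (W \<omega>) \<partial>gauss_sq N) + ennreal c2 * (\<integral>\<^sup>+\<omega>. ennreal (inv_bound \<delta> \<omega>) \<partial>gauss_sq N)"
  proof -
    interpret G: prob_space "gauss_sq N" by (rule prob_space_gauss)
    note [measurable] = W(1)
    have "emeasure (gauss_sq N) (space (gauss_sq N)) = 1" by (rule G.emeasure_space_1)
    then show ?thesis by (simp add: nn_integral_add nn_integral_cmult)
  qed
  also have "\<dots> \<le> ennreal c0 + ennreal c1 * ennreal (N * fro2 Qmat) + ennreal (16 * card R)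
      + ennreal c2 * ennreal (sqrt (cmod z + 1) * (N * (8 / sqrt \<bar>\<delta>\<bar>)))"
    using W(3) inv_bound_integral[OF \<delta>] noise_sq_integral by (intro add_mono mult_left_mono) auto
  also have "\<dots> = ennreal (c0 + c1 * (N * fro2 Qmat) + 16 * card R + c2 * (sqrt (cmod z + 1) * (N * (8 / sqrt \<bar>\<delta>\<bar>))))"
  proof -
    have "0 \<le> sqrt (cmod z + 1) * (N * (8 / sqrt \<bar>\<delta>\<bar>))" "0 \<le> N * fro2 Qmat" by auto
    then show ?thesis using c by (subst ennreal_mult'[symmetric], simp)+ (simp add: ennreal_plus[symmetric] del: ennreal_plus)
  qed
  also have "c0 + c1 * (N * fro2 Qmat) + 16 * card R + c2 * (sqrt (cmod z + 1) * (N * (8 / sqrt \<bar>\<delta>\<bar>)))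
     = 3 / 2 * N * t + 6 * card R / (\<bar>1 - q\<bar> * t) + \<bar>D\<bar>
        + (2 / t + 4 * K) * (\<delta>\<^sup>2 * (N * fro2 Qmat)) + 16 * card R
        + 2 * N * exp (- K / 2) * (sqrt (cmod z + 1) * (N * (8 / sqrt \<bar>\<delta>\<bar>)))"
    using D by (simp add: c0_def c1_def c2_def)
  finally show ?thesis unfolding D_def .
qed

lemma det_A: "det (mat N N (\<lambda>(i, j). A i j)) = z ^ N"
proof -
  have "det (mat N N (\<lambda>(i, j). A i j)) = prod_list (diag_mat (mat N N (\<lambda>(i, j). A i j)))"
    by (rule det_upper_triangular[where n = N]) (auto simp: upper_triangular_def A_def)
  also have "\<dots> = (\<Prod>p<N. A p p)"
    by (simp add: diag_mat_def prod.list_conv_set_nth atLeast0LessThan)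
  finally show ?thesis by (simp add: A_def)
qed

text \<open>Serves as majorant in the integration over \<open>z\<close>. It is uniform in the block
  structure: below, the determinant is compared with that of the triangular matrix \<open>A\<close>,
  which is \<open>z ^ N\<close>; above, with the identity. Its only singularity in \<open>z\<close>
  is logarithmic.\<close>

lemma crude_deviation:
  fixes x \<delta> :: real
  assumes x: "N * ln (cmod z) \<le> x" "x \<le> N * max 0 (ln (cmod z))"
  shows "(\<integral>\<^sup>+\<omega>. ennreal \<bar>ln (cmod (noisy_det N {..<N} \<delta> A \<omega>)) - x\<bar> \<partial>gauss_sq N)
    \<le> ennreal (N * (18 + (cmod z + 1)\<^sup>2 + \<delta>\<^sup>2 * N + 3 * \<bar>ln (cmod z)\<bar>))"
proof -
  interpret G: prob_space "gauss_sq N" by (rule prob_space_gauss)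
  define S where "S = (\<lambda>\<omega>::nat \<times> nat \<Rightarrow> real. \<Sum>i<N. \<Sum>j<N. (\<omega> (i, j))\<^sup>2)"
  have S0: "S \<omega> \<ge> 0" for \<omega> unfolding S_def by (intro sum_nonneg) auto
  have Sm[measurable]: "S \<in> borel_measurable (gauss_sq N)"
    unfolding S_def by (intro borel_measurable_sum borel_measurable_power measurable_gauss_component) auto
  have SI: "(\<integral>\<^sup>+\<omega>. ennreal (S \<omega>) \<partial>gauss_sq N) = ennreal (N * N)"
  proof -
    have one: "(\<integral>\<^sup>+\<omega>. ennreal ((\<omega> (i, j))\<^sup>2) \<partial>gauss_sq N) = 1" if "i < N" "j < N" for i j
    proof -
      have "(\<Sum>k<N. of_real (\<omega> (i, k)) * (if k = j then 1 else 0 :: complex)) = of_real (\<omega> (i, j))" for \<omega> :: "nat \<times> nat \<Rightarrow> real"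
        using that by (simp add: if_distrib[of "\<lambda>x. _ * x"] cong: if_cong)
      then show ?thesis using gauss_sq_row_moment[OF that(1), of "\<lambda>k. if k = j then 1 else 0"] that
        by (simp add: if_distrib[of cmod] if_distrib[of "\<lambda>x. x\<^sup>2"] cong: if_cong)
    qed
    have m: "(\<lambda>\<omega>. ennreal ((\<omega> (i, j))\<^sup>2)) \<in> borel_measurable (gauss_sq N)" if "i < N" "j < N" for i j
    proof -
      have "(\<lambda>\<omega>. \<omega> (i, j)) \<in> borel_measurable (gauss_sq N)" using that by (intro measurable_gauss_component) auto
      then show ?thesis by measurable
    qed
    have m1: "(\<lambda>\<omega>. \<Sum>j<N. ennreal ((\<omega> (i, j))\<^sup>2)) \<in> borel_measurable (gauss_sq N)" if "i < N" for i
      by (rule borel_measurable_sum) (use m that in auto)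
    have "(\<integral>\<^sup>+\<omega>. ennreal (S \<omega>) \<partial>gauss_sq N) = (\<integral>\<^sup>+\<omega>. (\<Sum>i<N. \<Sum>j<N. ennreal ((\<omega> (i, j))\<^sup>2)) \<partial>gauss_sq N)"
      unfolding S_def by (simp add: sum_nonneg flip: sum_ennreal)
    also have "\<dots> = (\<Sum>i<N. \<integral>\<^sup>+\<omega>. (\<Sum>j<N. ennreal ((\<omega> (i, j))\<^sup>2)) \<partial>gauss_sq N)"
      by (rule nn_integral_sum) (use m1 in auto)
    also have "\<dots> = (\<Sum>i<N. \<Sum>j<N. \<integral>\<^sup>+\<omega>. ennreal ((\<omega> (i, j))\<^sup>2) \<partial>gauss_sq N)"
      by (rule sum.cong[OF refl], rule nn_integral_sum) (use m in auto)
    also have "\<dots> = (\<Sum>i<N. \<Sum>j<N. 1)" by (intro sum.cong refl one) auto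
    finally show ?thesis by (simp add: ennreal_of_nat_eq_real_of_nat ennreal_mult')
  qed
  have dz: "cmod (det (mat N N (\<lambda>(i, j). A i j))) = cmod z ^ N" by (simp add: det_A norm_power)
  then have "det (mat N N (\<lambda>(i, j). A i j)) \<noteq> 0" using z0 by (simp add: det_A)
  from noisy_det_lower_crude[OF order_refl this, of \<delta>]
  obtain W where W: "W \<in> borel_measurable (gauss_sq N)" "\<And>\<omega>. W \<omega> \<ge> 0"
    "(\<integral>\<^sup>+\<omega>. ennreal (W \<omega>) \<partial>gauss_sq N) \<le> ennreal (16 * N)"
    "AE \<omega> in gauss_sq N. noisy_det N {..<N} \<delta> A \<omega> \<noteq> 0 \<and>
       ln (cmod z ^ N) - W \<omega> \<le> ln (cmod (noisy_det N {..<N} \<delta> A \<omega>))"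
    unfolding dz by auto
  \<comment> \<open>A bound for the squared norm of a row of \<open>A\<close> minus the
    identity.\<close>
  define a where "a = (cmod z + 1)\<^sup>2 + 1"
  define c0 where "c0 = N * (1 / 2 + a + 3 * \<bar>ln (cmod z)\<bar>)"
  have c0: "c0 \<ge> 0" by (simp add: c0_def a_def)
  have "AE \<omega> in gauss_sq N. \<bar>ln (cmod (noisy_det N {..<N} \<delta> A \<omega>)) - x\<bar> \<le> c0 + \<delta>\<^sup>2 * S \<omega> + W \<omega>"
    using W(4)
  proof eventually_elim
    case (elim \<omega>)
    define y where "y = ln (cmod (noisy_det N {..<N} \<delta> A \<omega>))"
    define X where "X = noisy_mat N {..<N} \<delta> A \<omega>"
    have X: "X \<in> carrier_mat N N" by (simp add: X_def)
    have XE: "X - 1\<^sub>m N \<in> carrier_mat N N" by (rule minus_carrier_mat) simp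
    have sq: "(cmod (u + of_real v))\<^sup>2 \<le> 2 * (cmod u)\<^sup>2 + 2 * v\<^sup>2" for u v
    proof -
      have "(cmod (u + of_real v))\<^sup>2 \<le> (cmod u + \<bar>v\<bar>)\<^sup>2"
        using norm_triangle_ineq[of u "of_real v"] by (intro power_mono) auto
      also have "\<dots> \<le> 2 * (cmod u)\<^sup>2 + 2 * v\<^sup>2"
        using zero_le_power2[of "cmod u - \<bar>v\<bar>"] by (simp add: power2_sum power2_diff)
      finally show ?thesis .
    qed
    have "fro2 (X - 1\<^sub>m N) \<le> (\<Sum>i<N. \<Sum>j<N. 2 * (cmod (A i j - (if i = j then 1 else 0)))\<^sup>2 + 2 * (\<delta> * \<omega> (i, j))\<^sup>2)"
    proof -
      have "(X - 1\<^sub>m N) $$ (i, j) = (A i j - (if i = j then 1 else 0)) + of_real (\<delta> * \<omega> (i, j))" if "i < N" "j < N" for i j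
        using that by (auto simp: X_def)
      note eq = this
      have "(cmod ((X - 1\<^sub>m N) $$ (i, j)))\<^sup>2 \<le> 2 * (cmod (A i j - (if i = j then 1 else 0)))\<^sup>2 + 2 * (\<delta> * \<omega> (i, j))\<^sup>2"
        if "i < N" "j < N" for i j unfolding eq[OF that] by (rule sq)
      then show ?thesis unfolding fro2_def using XE by (auto intro!: sum_mono)
    qed
    also have "\<dots> = 2 * (\<Sum>i<N. \<Sum>j<N. (cmod (A i j - (if i = j then 1 else 0)))\<^sup>2) + 2 * (\<delta>\<^sup>2 * S \<omega>)"
      by (simp add: sum.distrib sum_distrib_left S_def power_mult_distrib)
    also have "\<dots> \<le> 2 * (N * a) + 2 * (\<delta>\<^sup>2 * S \<omega>)"
    proof -
      have "(\<Sum>j<N. (cmod (A i j - (if i = j then 1 else 0)))\<^sup>2) \<le> a" if i: "i < N" for i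
      proof -
        have "(\<Sum>j<N. (cmod (A i j - (if i = j then 1 else 0)))\<^sup>2)
            \<le> (\<Sum>j<N. (if j = i then (cmod (z - 1))\<^sup>2 else 0) + (if j = Suc i then 1 else 0))"
          by (intro sum_mono) (auto simp: A_def)
        also have "\<dots> \<le> (cmod (z - 1))\<^sup>2 + 1" using i by (simp add: sum.distrib)
        also have "\<dots> \<le> a" unfolding a_def
          using norm_triangle_ineq4[of z 1] by (intro add_mono power_mono) auto
        finally show ?thesis .
      qed
      then have "(\<Sum>i<N. \<Sum>j<N. (cmod (A i j - (if i = j then 1 else 0)))\<^sup>2) \<le> (\<Sum>i<N. a)"
        by (intro sum_mono) auto
      then show ?thesis by simp
    qed
    finally have fX: "fro2 (X - 1\<^sub>m N) \<le> 2 * (N * a) + 2 * (\<delta>\<^sup>2 * S \<omega>)" .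
    have "y = ln (cmod (det (1\<^sub>m N + (X - 1\<^sub>m N))))"
      unfolding one_plus_minus_mat[OF X] by (simp add: y_def X_def noisy_det_def)
    also have "\<dots> \<le> (N + fro2 (X - 1\<^sub>m N)) / 2"
    proof -
      have "det (1\<^sub>m N + (X - 1\<^sub>m N)) \<noteq> 0"
        unfolding one_plus_minus_mat[OF X] using elim by (simp add: X_def noisy_det_def)
      from ln_det_one_plus_upper[OF XE _ this, of 1] show ?thesis by simp
    qed
    also have "\<dots> \<le> N / 2 + N * a + \<delta>\<^sup>2 * S \<omega>" using fX by simp
    finally have u: "y \<le> N / 2 + N * a + \<delta>\<^sup>2 * S \<omega>" .
    have l: "N * ln (cmod z) - W \<omega> \<le> y"
      using elim z0 by (simp add: y_def ln_realpow)
    have b: "\<bar>N * ln (cmod z)\<bar> = N * \<bar>ln (cmod z)\<bar>" by (simp add: abs_mult)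
    have "N * max 0 (ln (cmod z)) \<le> N * \<bar>ln (cmod z)\<bar>" by (intro mult_left_mono) auto
    moreover have "0 \<le> N * a" "0 \<le> N * \<bar>ln (cmod z)\<bar>" by (auto simp: a_def)
    moreover have "0 \<le> \<delta>\<^sup>2 * S \<omega>" using S0 by simp
    moreover have "c0 = N / 2 + N * a + 3 * (N * \<bar>ln (cmod z)\<bar>)" by (simp add: c0_def algebra_simps)
    ultimately show ?case using u l b x W(2)[of \<omega>] unfolding y_def[symmetric] by linarith
  qed
  then have "(\<integral>\<^sup>+\<omega>. ennreal \<bar>ln (cmod (noisy_det N {..<N} \<delta> A \<omega>)) - x\<bar> \<partial>gauss_sq N)
      \<le> (\<integral>\<^sup>+\<omega>. ennreal (c0 + \<delta>\<^sup>2 * S \<omega> + W \<omega>) \<partial>gauss_sq N)"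
    by (intro nn_integral_mono_AE) (auto elim: eventually_mono intro: ennreal_leI)
  also have "\<dots> = (\<integral>\<^sup>+\<omega>. ennreal c0 + ennreal (\<delta>\<^sup>2) * ennreal (S \<omega>) + ennreal (W \<omega>) \<partial>gauss_sq N)"
    using c0 W(2) S0
    by (intro nn_integral_cong) (simp add: ennreal_mult'[symmetric] ennreal_plus[symmetric] del: ennreal_plus)
  also have "\<dots> = ennreal c0 + ennreal (\<delta>\<^sup>2) * ennreal (N * N) + (\<integral>\<^sup>+\<omega>. ennreal (W \<omega>) \<partial>gauss_sq N)"
  proof -
    note [measurable] = W(1)
    have "emeasure (gauss_sq N) (space (gauss_sq N)) = 1" by (rule G.emeasure_space_1)
    then show ?thesis by (simp add: nn_integral_add nn_integral_cmult SI)
  qed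
  also have "\<dots> \<le> ennreal c0 + ennreal (\<delta>\<^sup>2) * ennreal (N * N) + ennreal (16 * N)"
    using W(3) by (intro add_left_mono)
  also have "\<dots> = ennreal (c0 + \<delta>\<^sup>2 * (N * N) + 16 * N)"
    using c0 by (subst ennreal_mult'[symmetric], simp) (simp add: ennreal_plus[symmetric] del: ennreal_plus)
  also have "\<dots> \<le> ennreal (N * (18 + (cmod z + 1)\<^sup>2 + \<delta>\<^sup>2 * N + 3 * \<bar>ln (cmod z)\<bar>))"
    by (intro ennreal_leI) (simp add: c0_def a_def algebra_simps)
  finally show ?thesis .
qed

end

subsection \<open>Asymptotics of the logarithmic potential\<close>

text \<open>The quotient \<open>n ^ n / fact n\<close> is one term of the series of
  \<open>exp n\<close>.\<close>

lemma ln_fact_ge: "n * ln n - n \<le> ln (fact n)"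
proof (cases "n = 0")
  case False
  have "real n ^ n / fact n = (\<lambda>k. real n ^ k /\<^sub>R fact k) n" by (simp add: divide_inverse_commute)
  also have "\<dots> \<le> (\<Sum>k. real n ^ k /\<^sub>R fact k)"
    using sum_le_suminf[OF summable_exp_generic, of "{n}" "real n"] by simp
  also have "\<dots> = exp (real n)" by (simp add: exp_def)
  finally have "ln (real n ^ n / fact n) \<le> n" using False by (subst ln_le_cancel_iff[of _ "exp n", simplified]) auto
  then show ?thesis using False by (simp add: ln_div ln_realpow)
qed simp

context jordan_split
begin

lemma bad_iff: "p < N \<Longrightarrow> bad p \<longleftrightarrow> ln (cmod z) < ln e / len p"
proof -
  assume p: "p < N"
  have "bad p \<longleftrightarrow> ln (cmod z ^ len p) < ln e" using z0 e by (simp add: bad_def)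
  also have "\<dots> \<longleftrightarrow> ln (cmod z) < ln e / len p"
    using len_pos[OF p] z0 by (simp add: ln_realpow field_simps)
  finally show ?thesis .
qed

lemma bad_lst: "p < N \<Longrightarrow> bad (lst p) = bad p"
  by (rule bad_cong) (rule lst_props(3))

lemma sum_bad: "(\<Sum>p<N. if bad p then x / len p else 0) = card R * (x::real)"
proof -
  have "(\<Sum>p<N. if bad p then x / len p else 0) = (\<Sum>p<N. (if bad (lst p) then x else 0) / len p)"
    by (intro sum.cong refl) (simp add: bad_lst)
  also have "\<dots> = (\<Sum>b\<in>Lasts. if bad b then x else 0)" by (rule sum_average)
  also have "\<dots> = card R * x" unfolding R_def by (subst sum.inter_filter[symmetric]) auto
  finally show ?thesis .
qed

text \<open>On good indices both expressions are \<open>ln (cmod z)\<close>. On bad ones the maximum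
  lies between \<open>c / len p\<close> and \<open>ln e / len p\<close>. In the application
  \<open>c = (1 / 2 - \<gamma>) * ln N\<close>, and \<open>ln e - c\<close> is only
  \<open>ln (ln N)\<close>.\<close>

lemma base_deviation:
  assumes c: "c \<le> ln e"
  shows "\<bar>ln (cmod (det Lmat)) - (\<Sum>p<N. max (ln (cmod z)) (c / len p))\<bar> \<le> card R * (ln e - c)"
proof -
  have "\<bar>ln (cmod (det Lmat)) - (\<Sum>p<N. max (ln (cmod z)) (c / len p))\<bar>
      \<le> (\<Sum>p<N. \<bar>(if bad p then ln e / len p else ln (cmod z)) - max (ln (cmod z)) (c / len p)\<bar>)"
    unfolding ln_det_Lmat sum_subtractf[symmetric] by (rule sum_abs)
  also have "\<dots> \<le> (\<Sum>p<N. if bad p then (ln e - c) / len p else 0)"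
  proof (rule sum_mono)
    fix p assume "p \<in> {..<N}"
    then have p: "p < N" by simp
    have ce: "c / len p \<le> ln e / len p" using c by (intro divide_right_mono) auto
    show "\<bar>(if bad p then ln e / len p else ln (cmod z)) - max (ln (cmod z)) (c / len p)\<bar> \<le> (if bad p then (ln e - c) / len p else 0)"
      using bad_iff[OF p] ce by (auto simp: diff_divide_distrib)
  qed
  also have "\<dots> = card R * (ln e - c)" by (rule sum_bad)
  finally show ?thesis .
qed

text \<open>Bad blocks are long: their length times \<open>\<bar>ln (cmod z)\<bar>\<close> exceeds
  \<open>- ln e\<close>, and the lengths add up to at most \<open>N\<close>. With
  \<open>- ln e\<close> of order \<open>ln N\<close> there are \<open>O (N / ln N)\<close> of
  them.\<close>

lemma card_R_bound: "card R * (- ln e) \<le> N * \<bar>ln (cmod z)\<bar>"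
proof -
  have "card R * (- ln e) = (\<Sum>p<N. if bad p then - ln e / len p else 0)" by (rule sum_bad[symmetric])
  also have "\<dots> \<le> (\<Sum>p<N. \<bar>ln (cmod z)\<bar>)"
    by (intro sum_mono) (use bad_iff in auto)
  finally show ?thesis by simp
qed

text \<open>Everything is expressed through \<open>x\<close>, which bounds the ratio
  \<open>card R / N\<close> and is of order \<open>1 / ln N\<close>. The term
  \<open>x * ln (ln N)\<close> occurs twice: once for passing from \<open>ln e\<close> to the
  logarithm of the true radius, once for exposing the bad rows.\<close>

lemma normalized_deviation:
  fixes \<gamma> \<delta> t :: real
  assumes N: "N \<ge> 3" and \<delta>: "\<bar>\<delta>\<bar> = N powr - \<gamma>" and ee: "e = N powr (1 / 2 - \<gamma>) * ln N" and e1: "e < 1"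
    and t: "t > 0" and \<gamma>: "\<gamma> > 1 / 2"
  defines "x \<equiv> \<bar>ln (cmod z)\<bar> / (- ln e)"
  shows "(\<integral>\<^sup>+\<omega>. ennreal (\<bar>ln (cmod (noisy_det N {..<N} \<delta> A \<omega>)) - (\<Sum>p<N. max (ln (cmod z)) ((1 / 2 - \<gamma>) * ln N / len p))\<bar> / N) \<partial>gauss_sq N)
    \<le> ennreal (3 / 2 * t + (6 / (\<bar>1 - q\<bar> * t) + 17) * x + 2 * (x * ln (ln N)) + sqrt x
        + (2 / t + 4 * ((6 + 2 * \<gamma>) * ln N)) * CQ * (N powr (1 - 2 * \<gamma>) + card Lasts / N / (ln N)\<^sup>2)
        + 16 * sqrt (cmod z + 1) * N powr (- 2 - \<gamma> / 2))"
proof -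
  define n where "n = card R"
  define c where "c = (1 / 2 - \<gamma>) * ln N"
  define B where "B = (\<Sum>p<N. max (ln (cmod z)) (c / len p))"
  \<comment> \<open>Chosen so that \<open>exp (- K / 2) = N powr (- 3 - \<gamma>)\<close>, which
    beats the polynomial size of the mean of \<open>inv_bound\<close>, while \<open>K\<close> stays
    of order \<open>ln N\<close>.\<close>
  define K where "K = (6 + 2 * \<gamma>) * ln N"
  have N0: "real N > 0" using N by simp
  \<comment> \<open>From \<open>N \<ge> 3 > exp 1\<close>; it makes \<open>ln (ln N)\<close>
    nonnegative.\<close>
  have lnN: "ln N > 1"
  proof -
    have "exp 1 < (3::real)" using e_less_272 by simp
    also have "3 \<le> real N" using N by simp
    finally have "exp 1 < real N" .
    then show ?thesis using N0 by (metis exp_less_cancel_iff exp_ln)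
  qed
  have llN: "ln (ln N) \<ge> 0" using lnN by simp
  have lne: "ln e = c + ln (ln N)" using lnN N0 unfolding ee c_def by (simp add: ln_mult ln_powr)
  have le0: "ln e < 0" using e e1 by simp
  have x0: "x \<ge> 0" unfolding x_def using le0 by (intro divide_nonneg_pos) auto
  have \<delta>0: "\<delta> \<noteq> 0" using \<delta> N0 by auto
  have nx: "n \<le> N * x"
    unfolding x_def n_def times_divide_eq_right
    by (rule pos_le_divide_eq[THEN iffD2]) (use card_R_bound le0 in auto)
  have K0: "K \<ge> 0" using \<gamma> lnN by (simp add: K_def)
  define bound where "bound = 3 / 2 * N * t + 6 * n / (\<bar>1 - q\<bar> * t)
        + \<bar>max 0 (n * ln (e / \<bar>\<delta>\<bar>) - ln (fact n) / 2)\<bar>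
        + (2 / t + 4 * K) * (\<delta>\<^sup>2 * (N * fro2 Qmat)) + 16 * n
        + 2 * N * exp (- K / 2) * (sqrt (cmod z + 1) * (N * (8 / sqrt \<bar>\<delta>\<bar>)))"
  have d2: "\<delta>\<^sup>2 = N powr (- 2 * \<gamma>)"
  proof -
    have "\<delta>\<^sup>2 = N powr - \<gamma> * N powr - \<gamma>" using \<delta> by (metis power2_abs power2_eq_square)
    then show ?thesis by (simp add: powr_add[symmetric])
  qed
  have I1: "6 * n / (\<bar>1 - q\<bar> * t) \<le> N * (6 / (\<bar>1 - q\<bar> * t) * x)"
  proof -
    have "6 / (\<bar>1 - q\<bar> * t) * n \<le> 6 / (\<bar>1 - q\<bar> * t) * (N * x)" using nx t by (intro mult_left_mono) auto
    then show ?thesis by (simp add: mult_ac)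
  qed
  \<comment> \<open>Per bad row \<open>ln (e / \<bar>\<delta>\<bar>)\<close> is
    \<open>ln N / 2 + ln (ln N)\<close>. The factorial replaces \<open>n * ln N / 2\<close> by
    \<open>n / 2 + n * ln (N / n) / 2\<close>, and the last term is at most
    \<open>sqrt (n * N)\<close>.\<close>
  have I2: "\<bar>max 0 (n * ln (e / \<bar>\<delta>\<bar>) - ln (fact n) / 2)\<bar> \<le> N * (x * ln (ln N) + x / 2 + sqrt x)"
  proof -
    have led: "ln (e / \<bar>\<delta>\<bar>) = ln N / 2 + ln (ln N)"
      using e N0 \<delta> \<delta>0 by (simp add: ln_div lne c_def ln_powr algebra_simps)
    have "n * ln (e / \<bar>\<delta>\<bar>) - ln (fact n) / 2 \<le> N * (x * ln (ln N) + x / 2 + sqrt x)"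
    proof (cases "n = 0")
      case True
      then show ?thesis using x0 llN by simp
    next
      case False
      have "n * ln (e / \<bar>\<delta>\<bar>) - ln (fact n) / 2 \<le> n * (ln N / 2 + ln (ln N)) - (n * ln n - n) / 2"
        unfolding led using ln_fact_ge[of n] by simp
      also have "\<dots> = n * ln (ln N) + n / 2 + n * ln (N / n) / 2"
        using False N0 by (simp add: ln_div algebra_simps add_divide_distrib diff_divide_distrib)
      also have "\<dots> \<le> n * ln (ln N) + n / 2 + n * (2 * sqrt (N / n)) / 2"
        using False N0 by (intro add_left_mono divide_right_mono mult_left_mono ln_le_two_sqrt) auto
      also have "n * (2 * sqrt (N / n)) / 2 = sqrt (n * N)"
      proof -
        have "sqrt (n * N) = sqrt (n * n * (N / n))" using False by simp
        also have "\<dots> = n * sqrt (N / n)" by (simp only: real_sqrt_mult) simp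
        finally show ?thesis by simp
      qed
      also have "n * ln (ln N) + n / 2 + sqrt (n * N) \<le> N * x * ln (ln N) + N * x / 2 + sqrt (N * x * N)"
      proof (intro add_mono real_sqrt_le_mono)
        show "n * ln (ln N) \<le> N * x * ln (ln N)" by (rule mult_right_mono[OF nx llN])
        show "n / 2 \<le> N * x / 2" using nx by simp
        show "real (n * N) \<le> N * x * N" unfolding of_nat_mult by (rule mult_right_mono[OF nx]) simp
      qed
      also have "sqrt (N * x * N) = N * sqrt x" using N0 by (simp add: real_sqrt_mult)
      finally show ?thesis by (simp add: algebra_simps)
    qed
    moreover have "0 \<le> N * (x * ln (ln N) + x / 2 + sqrt x)" using x0 llN by simp
    ultimately show ?thesis by simp
  qed
  \<comment> \<open>Here the factor \<open>ln N\<close> in \<open>e\<close> pays off: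
    \<open>\<delta>\<^sup>2 / e\<^sup>2 = 1 / (N * (ln N)\<^sup>2)\<close>, whose square of the
    logarithm outweighs the single one in \<open>K\<close>.\<close>
  have I3: "(2 / t + 4 * K) * (\<delta>\<^sup>2 * (N * fro2 Qmat))
     \<le> N * ((2 / t + 4 * K) * CQ * (N powr (1 - 2 * \<gamma>) + card Lasts / N / (ln N)\<^sup>2))"
  proof -
    have "\<delta>\<^sup>2 * fro2 Qmat \<le> \<delta>\<^sup>2 * (CQ * (N + card Lasts / e\<^sup>2))"
      by (intro mult_left_mono fro2_Qmat) auto
    also have "\<dots> = CQ * (\<delta>\<^sup>2 * N + card Lasts * (\<delta>\<^sup>2 / e\<^sup>2))" by (simp add: algebra_simps)
    also have "\<delta>\<^sup>2 * N = N powr (1 - 2 * \<gamma>)"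
      unfolding d2 using N0 by (simp add: powr_diff powr_minus field_simps)
    also have "\<delta>\<^sup>2 / e\<^sup>2 = 1 / (N * (ln N)\<^sup>2)"
    proof -
      have "e\<^sup>2 = N powr (1 - 2 * \<gamma>) * (ln N)\<^sup>2"
        unfolding ee using N0 by (simp add: power_mult_distrib powr_power algebra_simps)
      then show ?thesis unfolding d2 using N0 lnN by (simp add: powr_diff powr_minus field_simps)
    qed
    finally have *: "\<delta>\<^sup>2 * fro2 Qmat \<le> CQ * (N powr (1 - 2 * \<gamma>) + card Lasts / N / (ln N)\<^sup>2)"
      by (simp add: mult.commute)
    have "(2 / t + 4 * K) * (\<delta>\<^sup>2 * (N * fro2 Qmat)) = N * (2 / t + 4 * K) * (\<delta>\<^sup>2 * fro2 Qmat)" by (simp add: mult_ac)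
    also have "\<dots> \<le> N * (2 / t + 4 * K) * (CQ * (N powr (1 - 2 * \<gamma>) + card Lasts / N / (ln N)\<^sup>2))"
      using * t K0 N0 by (intro mult_left_mono) auto
    finally show ?thesis by (simp only: mult.assoc)
  qed
  have I4: "2 * N * exp (- K / 2) * (sqrt (cmod z + 1) * (N * (8 / sqrt \<bar>\<delta>\<bar>))) = N * (16 * sqrt (cmod z + 1) * N powr (- 2 - \<gamma> / 2))"
  proof -
    have "exp (- K / 2) = N powr (- 3 - \<gamma>)" using N0 by (simp add: K_def powr_def field_simps)
    moreover have "1 / sqrt \<bar>\<delta>\<bar> = N powr (\<gamma> / 2)"
    proof -
      have "sqrt \<bar>\<delta>\<bar> = (N powr - \<gamma>) powr (1 / 2)" unfolding \<delta> by (rule powr_half_sqrt[symmetric]) simp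
      also have "\<dots> = N powr - (\<gamma> / 2)" unfolding powr_powr by simp
      also have "\<dots> = 1 / N powr (\<gamma> / 2)" by (rule powr_minus_divide)
      finally show ?thesis by simp
    qed
    moreover have "N powr (- 3 - \<gamma>) * N * N powr (\<gamma> / 2) = N powr (- 2 - \<gamma> / 2)"
    proof -
      have "N powr (- 3 - \<gamma>) * N powr 1 * N powr (\<gamma> / 2) = N powr (- 2 - \<gamma> / 2)"
        unfolding powr_add[symmetric] by (rule arg_cong[where f = "\<lambda>y. N powr y"]) linarith
      then show ?thesis using N0 by simp
    qed
    moreover have "2 * N * exp (- K / 2) * (sqrt (cmod z + 1) * (N * (8 / sqrt \<bar>\<delta>\<bar>)))
       = N * (16 * sqrt (cmod z + 1) * (exp (- K / 2) * N * (1 / sqrt \<bar>\<delta>\<bar>)))"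
      by simp
    ultimately show ?thesis by (simp only:)
  qed
  have b0: "bound \<ge> 0" unfolding bound_def using t K0 by simp
  have "(\<integral>\<^sup>+\<omega>. ennreal (\<bar>ln (cmod (noisy_det N {..<N} \<delta> A \<omega>)) - B\<bar> / N) \<partial>gauss_sq N)
     \<le> (\<integral>\<^sup>+\<omega>. ennreal (1 / N) * (ennreal \<bar>ln (cmod (noisy_det N {..<N} \<delta> A \<omega>)) - ln (cmod (det Lmat))\<bar> + ennreal (n * ln (ln N))) \<partial>gauss_sq N)"
  proof (rule nn_integral_mono)
    fix \<omega>
    have "\<bar>ln (cmod (det Lmat)) - B\<bar> \<le> n * ln (ln N)"
      using base_deviation[of c] llN lne by (simp add: B_def n_def)
    then have "\<bar>ln (cmod (noisy_det N {..<N} \<delta> A \<omega>)) - B\<bar> / N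
        \<le> 1 / N * (\<bar>ln (cmod (noisy_det N {..<N} \<delta> A \<omega>)) - ln (cmod (det Lmat))\<bar> + n * ln (ln N))"
      using N0 by (simp add: divide_right_mono)
    then show "ennreal (\<bar>ln (cmod (noisy_det N {..<N} \<delta> A \<omega>)) - B\<bar> / N)
       \<le> ennreal (1 / N) * (ennreal \<bar>ln (cmod (noisy_det N {..<N} \<delta> A \<omega>)) - ln (cmod (det Lmat))\<bar> + ennreal (n * ln (ln N)))"
      using llN by (simp add: ennreal_mult'[symmetric] ennreal_plus[symmetric] ennreal_leI del: ennreal_plus)
  qed
  also have "\<dots> = ennreal (1 / N) * ((\<integral>\<^sup>+\<omega>. ennreal \<bar>ln (cmod (noisy_det N {..<N} \<delta> A \<omega>)) - ln (cmod (det Lmat))\<bar> \<partial>gauss_sq N) + ennreal (n * ln (ln N)))"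
  proof -
    interpret G: prob_space "gauss_sq N" by (rule prob_space_gauss)
    have "emeasure (gauss_sq N) (space (gauss_sq N)) = 1" by (rule G.emeasure_space_1)
    then show ?thesis by (simp add: nn_integral_add nn_integral_cmult)
  qed
  also have "\<dots> \<le> ennreal (1 / N) * (ennreal bound + ennreal (n * ln (ln N)))"
    unfolding bound_def n_def using deviation[OF t K0 \<delta>0] by (intro mult_left_mono add_right_mono) auto
  also have "\<dots> = ennreal ((bound + n * ln (ln N)) / N)"
    using b0 llN by (simp add: ennreal_mult'[symmetric] ennreal_plus[symmetric] del: ennreal_plus)
  also have "\<dots> \<le> ennreal (3 / 2 * t + (6 / (\<bar>1 - q\<bar> * t) + 17) * x + 2 * (x * ln (ln N)) + sqrt x
        + (2 / t + 4 * K) * CQ * (N powr (1 - 2 * \<gamma>) + card Lasts / N / (ln N)\<^sup>2)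
        + 16 * sqrt (cmod z + 1) * N powr (- 2 - \<gamma> / 2))"
  proof (rule ennreal_leI)
    have "n * ln (ln N) \<le> N * x * ln (ln N)" using nx llN by (intro mult_right_mono) auto
    moreover have "16 * n \<le> 16 * (N * x)" using nx by simp
    moreover have "0 \<le> N * x" using x0 by simp
    ultimately have "bound + n * ln (ln N) \<le> 3 / 2 * N * t + N * (6 / (\<bar>1 - q\<bar> * t) * x)
        + N * (x * ln (ln N) + x / 2 + sqrt x)
        + N * ((2 / t + 4 * K) * CQ * (N powr (1 - 2 * \<gamma>) + card Lasts / N / (ln N)\<^sup>2)) + (16 * (N * x) + N * x / 2)
        + N * (16 * sqrt (cmod z + 1) * N powr (- 2 - \<gamma> / 2)) + N * x * ln (ln N)"
      unfolding bound_def I4 using I1 I2 I3 by linarith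
    also have "\<dots> = (3 / 2 * t + (6 / (\<bar>1 - q\<bar> * t) + 17) * x + 2 * (x * ln (ln N)) + sqrt x
        + (2 / t + 4 * K) * CQ * (N powr (1 - 2 * \<gamma>) + card Lasts / N / (ln N)\<^sup>2)
        + 16 * sqrt (cmod z + 1) * N powr (- 2 - \<gamma> / 2)) * N"
      by (simp only: distrib_left distrib_right mult_1_left mult_1_right) (simp add: mult_ac)
    finally show "(bound + n * ln (ln N)) / N \<le> 3 / 2 * t + (6 / (\<bar>1 - q\<bar> * t) + 17) * x + 2 * (x * ln (ln N)) + sqrt x
        + (2 / t + 4 * K) * CQ * (N powr (1 - 2 * \<gamma>) + card Lasts / N / (ln N)\<^sup>2)
        + 16 * sqrt (cmod z + 1) * N powr (- 2 - \<gamma> / 2)"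
      using N0 by (simp only: pos_divide_le_eq)
  qed
  finally show ?thesis unfolding B_def c_def K_def .
qed

end

text \<open>Since \<open>ln r\<^sub>i = (1/2 - \<gamma>) ln N / d\<^sub>i\<close>, the sum is \<open>N\<close> times the logarithmic potential of the mixture
  of circles, with the blocks unfolded into their indices.\<close>

definition log_potential_gap :: "real \<Rightarrow> nat \<Rightarrow> (nat \<Rightarrow> nat) \<Rightarrow> (nat \<Rightarrow> nat) \<Rightarrow> real \<Rightarrow> complex \<Rightarrow> (nat \<times> nat \<Rightarrow> real) \<Rightarrow> real" where
  "log_potential_gap \<gamma> N f len \<delta> z \<omega> =
     \<bar>ln (cmod (noisy_det N {..<N} \<delta> (jordan_split.A f len z) \<omega>))
       - (\<Sum>p<N. max (ln (cmod z)) ((1 / 2 - \<gamma>) * ln N / len p))\<bar> / N"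

text \<open>For fixed \<open>t\<close> every term of the bound except \<open>3 / 2 * t\<close> tends
  to 0; only afterwards is \<open>t\<close> made small.\<close>

lemma log_potential_gap_tendsto:
  fixes \<gamma> :: real and \<delta> :: "nat \<Rightarrow> real"
  assumes part: "\<And>N. N \<ge> 2 \<Longrightarrow> block_partition N (f N) (len N)"
    and few: "(\<lambda>N. real (card (block_partition.Lasts N (f N) (len N))) / N) \<longlonglongrightarrow> 0"
    and \<delta>: "\<And>N. N \<ge> 2 \<Longrightarrow> \<bar>\<delta> N\<bar> = N powr - \<gamma>" and \<gamma>: "\<gamma> > 1 / 2"
    and z: "z \<noteq> 0" "cmod z \<noteq> 1"
  shows "(\<lambda>N. \<integral>\<^sup>+\<omega>. ennreal (log_potential_gap \<gamma> N (f N) (len N) (\<delta> N) z \<omega>) \<partial>gauss_sq N) \<longlonglongrightarrow> 0"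
proof -
  define e where "e = (\<lambda>N::nat. N powr (1 / 2 - \<gamma>) * ln N)"
  define b where "b = \<gamma> - 1 / 2"
  have b: "b > 0" using \<gamma> by (simp add: b_def)
  have ge: "e = (\<lambda>N::nat. N powr (- b) * ln N)" by (simp add: e_def b_def)
  have e0: "e \<longlonglongrightarrow> 0" unfolding ge using b by real_asymp
  have ev1: "eventually (\<lambda>N. e N < 1) sequentially" using order_tendstoD(2)[OF e0, of 1] by simp
  define q where "q = (cmod z)\<^sup>2"
  define CQ where "CQ = (if q < 1 then 1 / (1 - q)\<^sup>2 else 1 / (q - 1))"
  define x where "x = (\<lambda>N::nat. \<bar>ln (cmod z)\<bar> / (- ln (e N)))"
  define L where "L = \<bar>ln (cmod z)\<bar>"
  have x0: "x \<longlonglongrightarrow> 0"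
    unfolding x_def ge L_def[symmetric] using b by real_asymp
  have xl: "(\<lambda>N. x N * ln (ln N)) \<longlonglongrightarrow> 0"
    unfolding x_def ge L_def[symmetric] using b by real_asymp
  define l where "l = (\<lambda>N. real (card (block_partition.Lasts N (f N) (len N))) / N)"
  have l0: "l \<longlonglongrightarrow> 0" using few by (simp add: l_def)
  define F where "F = (\<lambda>t (N::nat). 3 / 2 * t + (6 / (\<bar>1 - q\<bar> * t) + 17) * x N + 2 * (x N * ln (ln N)) + sqrt (x N)
        + (2 / t + 4 * ((6 + 2 * \<gamma>) * ln N)) * CQ * (N powr (1 - 2 * \<gamma>) + l N / (ln N)\<^sup>2)
        + 16 * sqrt (cmod z + 1) * N powr (- 2 - \<gamma> / 2))"
  have Flim: "F t \<longlonglongrightarrow> 3 / 2 * t" if t: "t > 0" for t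
  proof -
    have g: "1 - 2 * \<gamma> = - 2 * b" by (simp add: b_def)
    have a1: "(\<lambda>N::nat. (2 / t + 4 * ((6 + 2 * \<gamma>) * ln N)) * N powr (1 - 2 * \<gamma>)) \<longlonglongrightarrow> 0"
      unfolding g using b \<gamma> by real_asymp
    have a2: "(\<lambda>N::nat. (2 / t + 4 * ((6 + 2 * \<gamma>) * ln N)) / (ln N)\<^sup>2) \<longlonglongrightarrow> 0"
      using \<gamma> by real_asymp
    have a3: "(\<lambda>N::nat. real N powr (- 2 - \<gamma> / 2)) \<longlonglongrightarrow> 0"
      using \<gamma> by real_asymp
    have "(\<lambda>N. 3 / 2 * t + (6 / (\<bar>1 - q\<bar> * t) + 17) * x N + 2 * (x N * ln (ln N)) + sqrt (x N)
        + CQ * ((2 / t + 4 * ((6 + 2 * \<gamma>) * ln N)) * N powr (1 - 2 * \<gamma>) + ((2 / t + 4 * ((6 + 2 * \<gamma>) * ln N)) / (ln N)\<^sup>2) * l N)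
        + 16 * sqrt (cmod z + 1) * N powr (- 2 - \<gamma> / 2)) \<longlonglongrightarrow>
        3 / 2 * t + (6 / (\<bar>1 - q\<bar> * t) + 17) * 0 + 2 * 0 + sqrt 0 + CQ * (0 + 0 * 0) + 16 * sqrt (cmod z + 1) * 0"
      by (intro tendsto_intros x0 xl l0 a1 a2 a3)
    note lim = this
    have eq: "c * CQ * (u + v / w) = CQ * (c * u + c / w * v)" for c u v w :: real
      by (simp add: algebra_simps)
    show ?thesis using lim unfolding F_def eq by simp
  qed
  have bound: "eventually (\<lambda>N. (\<integral>\<^sup>+\<omega>. ennreal (log_potential_gap \<gamma> N (f N) (len N) (\<delta> N) z \<omega>) \<partial>gauss_sq N) \<le> ennreal (F t N)) sequentially"
    if t: "t > 0" for t
    using ev1 eventually_ge_at_top[of 3]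
  proof eventually_elim
    case (elim N)
    have "ln N > 0" using elim by simp
    then have "e N > 0" using elim by (simp add: e_def)
    interpret B: block_partition N "f N" "len N" by (rule part) (use elim in simp)
    interpret J: jordan_split N "f N" "len N" z "e N"
      by standard (use z \<open>e N > 0\<close> elim in auto)
    have "\<bar>\<delta> N\<bar> = N powr - \<gamma>" using \<delta>[of N] elim by simp
    from J.normalized_deviation[OF elim(2) this e_def[THEN fun_cong] elim(1) t \<gamma>]
    show ?case unfolding log_potential_gap_def F_def x_def l_def CQ_def q_def J.CQ_def J.q_def .
  qed
  show ?thesis
  proof (rule order_tendstoI)
    fix a :: ennreal assume a: "0 < a"
    obtain r where r: "r > 0" "ennreal r < a"
    proof (cases a)
      case (real s)
      then have "s > 0" using a by simp
      then show ?thesis using real by (intro that[of "s / 2"]) (auto simp: ennreal_less_iff)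
    next
      case top
      then show ?thesis by (intro that[of 1]) auto
    qed
    \<comment> \<open>Any positive \<open>t\<close> with \<open>3 / 2 * t < r\<close> would
      do.\<close>
    define t where "t = r / 2"
    have t: "t > 0" using r by (simp add: t_def)
    have "3 / 2 * t < r" using r by (simp add: t_def)
    then have "eventually (\<lambda>N. F t N < r) sequentially" using order_tendstoD(2)[OF Flim[OF t]] by simp
    then show "eventually (\<lambda>N. (\<integral>\<^sup>+\<omega>. ennreal (log_potential_gap \<gamma> N (f N) (len N) (\<delta> N) z \<omega>) \<partial>gauss_sq N) < a) sequentially"
      using bound[OF t]
    proof eventually_elim
      case (elim N)
      note elim(2)
      also have "ennreal (F t N) \<le> ennreal r" using elim(1) by (intro ennreal_leI) simp
      also note r(2)
      finally show ?case .
    qed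
  qed simp
qed

text \<open>The majorant for dominated convergence. It does not depend on \<open>N\<close>, because
  \<open>\<gamma> > 1 / 2\<close> makes \<open>\<delta>\<^sup>2 * N \<le> 1\<close>.\<close>

lemma log_potential_gap_bound:
  fixes \<gamma> :: real
  assumes part: "block_partition N f len" and N: "N \<ge> 2"
    and \<delta>: "\<bar>\<delta>\<bar> = N powr - \<gamma>" and \<gamma>: "\<gamma> > 1 / 2"
    and z: "z \<noteq> 0" "cmod z \<noteq> 1"
  shows "(\<integral>\<^sup>+\<omega>. ennreal (log_potential_gap \<gamma> N f len \<delta> z \<omega>) \<partial>gauss_sq N)
     \<le> ennreal (19 + (cmod z + 1)\<^sup>2 + 3 * \<bar>ln (cmod z)\<bar>)"
proof -
  interpret B: block_partition N f len by (rule part)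
  \<comment> \<open>The crude estimate concerns \<open>A\<close> alone, so the admissible value 1
    may be taken for \<open>e\<close>.\<close>
  interpret J: jordan_split N f len z 1 by standard (use z in auto)
  define x where "x = (\<Sum>p<N. max (ln (cmod z)) ((1 / 2 - \<gamma>) * ln N / len p))"
  have N0: "real N > 0" using N by simp
  have lnN: "ln N \<ge> 0" using N by simp
  have x1: "N * ln (cmod z) \<le> x"
  proof -
    have "(\<Sum>p<N. ln (cmod z)) \<le> x" unfolding x_def by (intro sum_mono) auto
    then show ?thesis by simp
  qed
  have x2: "x \<le> N * max 0 (ln (cmod z))"
  proof -
    have np: "(1 / 2 - \<gamma>) * ln N / len p \<le> 0" for p
      using \<gamma> lnN by (intro divide_nonpos_nonneg mult_nonpos_nonneg) auto
    then have "x \<le> (\<Sum>p<N. max 0 (ln (cmod z)))" unfolding x_def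
      by (intro sum_mono max.boundedI order_trans[OF np]) auto
    then show ?thesis by simp
  qed
  have d: "\<delta>\<^sup>2 * N \<le> 1"
  proof -
    have "\<delta>\<^sup>2 * N = N powr (- \<gamma>) * N powr (- \<gamma>) * N powr 1" 
    proof -
      have "\<delta>\<^sup>2 = N powr - \<gamma> * N powr - \<gamma>" using \<delta> by (metis power2_abs power2_eq_square)
      then show ?thesis using N0 by simp
    qed
    also have "\<dots> = N powr (1 - 2 * \<gamma>)" unfolding powr_add[symmetric] by (simp add: algebra_simps)
    also have "\<dots> \<le> N powr 0" using N \<gamma> by (intro powr_mono) auto
    finally show ?thesis using N0 by simp
  qed
  have "(\<integral>\<^sup>+\<omega>. ennreal (log_potential_gap \<gamma> N f len \<delta> z \<omega>) \<partial>gauss_sq N)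
      = (\<integral>\<^sup>+\<omega>. ennreal (1 / N) * ennreal \<bar>ln (cmod (noisy_det N {..<N} \<delta> J.A \<omega>)) - x\<bar> \<partial>gauss_sq N)"
    unfolding log_potential_gap_def x_def[symmetric] by (simp add: ennreal_mult'[symmetric])
  also have "\<dots> = ennreal (1 / N) * (\<integral>\<^sup>+\<omega>. ennreal \<bar>ln (cmod (noisy_det N {..<N} \<delta> J.A \<omega>)) - x\<bar> \<partial>gauss_sq N)"
    by (rule nn_integral_cmult) measurable
  also have "\<dots> \<le> ennreal (1 / N) * ennreal (N * (18 + (cmod z + 1)\<^sup>2 + \<delta>\<^sup>2 * N + 3 * \<bar>ln (cmod z)\<bar>))"
    by (intro mult_left_mono J.crude_deviation x1 x2) auto
  also have "\<dots> = ennreal (18 + (cmod z + 1)\<^sup>2 + \<delta>\<^sup>2 * N + 3 * \<bar>ln (cmod z)\<bar>)"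
    using N0 by (subst ennreal_mult'[symmetric]) auto
  also have "\<dots> \<le> ennreal (19 + (cmod z + 1)\<^sup>2 + 3 * \<bar>ln (cmod z)\<bar>)"
    using d by (intro ennreal_leI) auto
  finally show ?thesis .
qed

subsection \<open>Logarithmic potentials of circles\<close>

lemma measurable_cball [measurable]: "cball c r \<in> sets borel"
  by simp

definition angle :: "real measure" where "angle = uniform_measure lborel {0..2 * pi}"

lemma uniform_circle_angle: "uniform_circle c r = distr angle borel (\<lambda>t. c + of_real r * cis t)"
  by (simp add: uniform_circle_def angle_def)

lemma sets_angle [simp, measurable_cong]: "sets angle = sets borel"
  by (simp add: angle_def)

lemma space_angle [simp]: "space angle = UNIV"
  by (simp add: angle_def)

lemma prob_space_angle: "prob_space angle"
  unfolding angle_def by (rule prob_space_uniform_measure) (auto simp: pi_gt_zero)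

interpretation angle: prob_space angle by (rule prob_space_angle)

lemma measurable_circle [measurable]: "(\<lambda>t. c + of_real r * cis t) \<in> borel_measurable angle"
proof -
  have "continuous_on UNIV (\<lambda>t. c + of_real r * cis t)" by (intro continuous_intros)
  then show ?thesis by (simp add: borel_measurable_continuous_onI measurable_cong_sets[OF sets_angle refl])
qed

lemma integral_angle:
  fixes f :: "real \<Rightarrow> real"
  assumes f: "continuous_on UNIV f" and I: "(f has_integral 2 * pi * I) {0..2 * pi}"
  shows "integral\<^sup>L angle f = I"
proof -
  have [measurable]: "f \<in> borel_measurable borel" using f by (rule borel_measurable_continuous_onI)
  have si: "set_integrable lborel {0..2 * pi} f"
    unfolding set_integrable_def by (intro borel_integrable_compact compact_Icc continuous_on_subset[OF f]) auto
  have "angle = density lborel (\<lambda>x. ennreal (indicator {0..2 * pi} x / (2 * pi)))"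
    unfolding angle_def uniform_measure_def
    by (intro density_cong) (auto simp: indicator_def divide_ennreal[symmetric])
  then have "integral\<^sup>L angle f = (\<integral>x. (indicator {0..2 * pi} x / (2 * pi)) *\<^sub>R f x \<partial>lborel)"
    by (rule ssubst) (rule integral_density, auto)
  also have "\<dots> = (\<integral>x. (indicator {0..2 * pi} x *\<^sub>R f x) * (1 / (2 * pi)) \<partial>lborel)"
    by (intro Bochner_Integration.integral_cong) auto
  also have "\<dots> = (LINT x:{0..2 * pi}|lborel. f x) * (1 / (2 * pi))"
    unfolding set_lebesgue_integral_def by (rule integral_mult_left_zero)
  also have "(LINT x:{0..2 * pi}|lborel. f x) = integral {0..2 * pi} f"
    by (rule set_borel_integral_eq_integral(2)[OF si])
  also have "\<dots> = 2 * pi * I" using I by (rule integral_unique)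
  finally show ?thesis by simp
qed

text \<open>The mean value property of a harmonic function: on the closed unit disc
  \<open>1 - b * z\<close> stays in the right half-plane, so its principal logarithm is holomorphic
  there, and it is 0 at the origin.\<close>

lemma mean_ln_one_minus:
  assumes b: "cmod b < 1"
  shows "integral\<^sup>L angle (\<lambda>t. ln (cmod (1 - b * cis t))) = 0"
proof -
  define f where "f = (\<lambda>z. Ln (1 - b * z))"
  define \<rho> where "\<rho> = 1"
  have re: "Re (1 - b * z) > 0" if "cmod z \<le> 1" for z
  proof -
    have "cmod (b * z) < 1" using b that by (simp add: norm_mult mult_le_one[THEN le_less_trans] mult_left_le[THEN le_less_trans])
    then have "Re (b * z) < 1" using complex_Re_le_cmod[of "b * z"] by linarith
    then show ?thesis by simp
  qed
  have dom: "1 - b * z \<notin> \<real>\<^sub>\<le>\<^sub>0" if "cmod z \<le> 1" for z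
    using re[OF that] by (auto simp: complex_nonpos_Reals_iff)
  have "f holomorphic_on cball 0 1"
    unfolding f_def by (intro holomorphic_intros) (use dom in auto)
  then have "((\<lambda>u. f u / (u - 0)) has_contour_integral (2 * of_real pi * \<i> * f 0)) (circlepath 0 1)"
    by (intro Cauchy_integral_circlepath_simple) auto
  then have "((\<lambda>t. f (cis t) / cis t * \<i> * cis t) has_integral 0) {0..2 * pi}"
    unfolding circlepath_def by (subst (asm) has_contour_integral_part_circlepath_iff) (auto simp: f_def)
  then have "((\<lambda>t. f (cis t) * \<i>) has_integral 0) {0..2 * pi}" by (simp add: field_simps)
  from has_integral_mult_right[OF this, of "- \<i>"] have "((\<lambda>t. f (cis t)) has_integral 0) {0..2 * pi}"
    by (simp add: algebra_simps)
  from has_integral_Re[OF this] have reint: "((\<lambda>t. Re (f (cis t))) has_integral 0) {0..2 * pi}" by simp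
  have nz: "1 - b * cis t \<noteq> 0" for t
  proof
    assume "1 - b * cis t = 0"
    moreover have "Re (1 - b * cis t) > 0" by (rule re) simp
    ultimately show False by (simp only: zero_complex.sel less_irrefl)
  qed
  moreover have "Re (f (cis t)) = ln (cmod (1 - b * cis t))" for t
    unfolding f_def by (rule Re_Ln[OF nz])
  ultimately have I: "((\<lambda>t. ln (cmod (1 - b * cis t))) has_integral 2 * pi * 0) {0..2 * pi}"
    using reint by simp
  have "continuous_on UNIV (\<lambda>t. ln (cmod (1 - b * cis t)))" using nz by (intro continuous_intros) auto
  from integral_angle[OF this I] show ?thesis .
qed

text \<open>Jensen's formula for one zero: the larger of \<open>cmod v\<close> and \<open>r\<close>
  is factored out, and the remaining factor has mean logarithm 0.\<close>

lemma mean_ln_circle: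
  assumes r: "r > 0" and ne: "cmod v \<noteq> r"
  shows "integral\<^sup>L angle (\<lambda>t. ln (cmod (v - of_real r * cis t))) = ln (max (cmod v) r)"
proof -
  have const: "integral\<^sup>L angle (\<lambda>t. c + g t) = c + integral\<^sup>L angle g" if "integrable angle g" for c :: real and g
    using that angle.prob_space by simp
  have int: "integrable angle (\<lambda>t. ln (cmod (1 - b * cis t)))" if b: "cmod b < 1" for b
  proof -
    have nz: "1 - b * cis t \<noteq> 0" for t
    proof
      assume "1 - b * cis t = 0"
      then have "cmod (b * cis t) = 1" by (metis eq_iff_diff_eq_0 norm_one)
      then show False using b by (simp add: norm_mult)
    qed
    show ?thesis
    proof (rule angle.integrable_const_bound[where B = "max \<bar>ln 2\<bar> \<bar>ln (1 - cmod b)\<bar>"])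
      show "AE t in angle. norm (ln (cmod (1 - b * cis t))) \<le> max \<bar>ln 2\<bar> \<bar>ln (1 - cmod b)\<bar>"
      proof (rule AE_I2)
        fix t
        have "1 - cmod b \<le> cmod (1 - b * cis t)" using norm_triangle_ineq2[of 1 "b * cis t"] by (simp add: norm_mult)
        then have l: "ln (1 - cmod b) \<le> ln (cmod (1 - b * cis t))"
          using b nz by (subst ln_le_cancel_iff) auto
        have "cmod (1 - b * cis t) \<le> 2" using norm_triangle_ineq4[of 1 "b * cis t"] b by (simp add: norm_mult)
        then have u: "ln (cmod (1 - b * cis t)) \<le> ln 2" using nz by simp
        show "norm (ln (cmod (1 - b * cis t))) \<le> max \<bar>ln 2\<bar> \<bar>ln (1 - cmod b)\<bar>"
          using l u by (auto simp: abs_if max_def)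
      qed
      have "continuous_on UNIV (\<lambda>t. ln (cmod (1 - b * cis t)))" using nz by (intro continuous_intros) auto
      then show "(\<lambda>t. ln (cmod (1 - b * cis t))) \<in> borel_measurable angle"
        by (simp add: borel_measurable_continuous_onI measurable_cong_sets[OF sets_angle refl])
    qed
  qed
  have nz: "1 - b * cis t \<noteq> 0" if b: "cmod b < 1" for b t
  proof
    assume "1 - b * cis t = 0"
    then have "cmod (b * cis t) = 1" by (metis eq_iff_diff_eq_0 norm_one)
    then show False using b by (simp add: norm_mult)
  qed
  show ?thesis
  proof (cases "cmod v < r")
    case True
    \<comment> \<open>Conjugation does not change the modulus and turns \<open>cis t\<close> into
      \<open>cis (- t)\<close>; after this factor is pulled out, the remainder has the required form
      \<open>1 - b * cis t\<close>.\<close>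
    define b where "b = cnj v / of_real r"
    have b: "cmod b < 1" using True r by (simp add: b_def norm_divide)
    have "ln (cmod (v - of_real r * cis t)) = ln r + ln (cmod (1 - b * cis t))" for t
    proof -
      have "cmod (v - of_real r * cis t) = cmod (cnj (v - of_real r * cis t))" by (simp only: complex_mod_cnj)
      also have "\<dots> = cmod (cnj v - of_real r * cis (- t))" by (simp add: cis_cnj)
      also have "\<dots> = cmod ((- of_real r * cis (- t)) * (1 - b * cis t))"
      proof -
        have "(- of_real r * cis (- t)) * (1 - b * cis t) = - of_real r * cis (- t) + of_real r * b * (cis (- t) * cis t)"
          by (simp add: algebra_simps)
        also have "cis (- t) * cis t = 1" by (simp add: cis_mult)
        also have "of_real r * b = cnj v" using r by (simp add: b_def)
        finally show ?thesis by simp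
      qed
      also have "\<dots> = r * cmod (1 - b * cis t)" using r by (simp add: norm_mult)
      finally show ?thesis using r nz[OF b] by (simp add: ln_mult)
    qed
    then show ?thesis using const[OF int[OF b], of "ln r"] mean_ln_one_minus[OF b] True by simp
  next
    case False
    then have vr: "cmod v > r" using ne by simp
    then have v0: "v \<noteq> 0" using r by auto
    define b where "b = of_real r / v"
    have b: "cmod b < 1" using vr r v0 by (simp add: b_def norm_divide divide_less_eq)
    have "ln (cmod (v - of_real r * cis t)) = ln (cmod v) + ln (cmod (1 - b * cis t))" for t
    proof -
      have "v - of_real r * cis t = v * (1 - b * cis t)" using v0 by (simp add: b_def algebra_simps)
      then show ?thesis using v0 nz[OF b] by (simp add: norm_mult ln_mult)
    qed
    then show ?thesis using const[OF int[OF b], of "ln (cmod v)"] mean_ln_one_minus[OF b] vr by simp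
  qed
qed

section \<open>Integrability of the logarithm in the plane and potentials of densities\<close>

lemma nn_integral_lborel_shift:
  fixes f :: "complex \<Rightarrow> ennreal"
  assumes [measurable]: "f \<in> borel_measurable borel"
  shows "(\<integral>\<^sup>+w. f (c + w) \<partial>lborel) = (\<integral>\<^sup>+w. f w \<partial>lborel)"
  by (subst (2) lborel_distr_plus[symmetric, of c]) (simp add: nn_integral_distr)

lemma integral_lborel_shift:
  fixes f :: "complex \<Rightarrow> real"
  assumes [measurable]: "f \<in> borel_measurable borel"
  shows "(\<integral>w. f (c + w) \<partial>lborel) = (\<integral>w. f w \<partial>lborel)"
  by (subst (2) lborel_distr_plus[symmetric, of c]) (simp add: integral_distr)

text \<open>\<open>\<bar>ln (cmod w)\<bar>\<close> is at most \<open>ln 2\<close> times the number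
  of dyadic discs around 0 that contain \<open>w\<close>, and the areas of these discs form a
  geometric series.\<close>

lemma nn_integral_ln_unit_ball:
  "(\<integral>\<^sup>+w. indicator (cball 0 1) w * ennreal \<bar>ln (cmod w)\<bar> \<partial>lborel) < \<infinity>"
proof -
  have "(\<integral>\<^sup>+w. indicator (cball 0 1) w * ennreal \<bar>ln (cmod w)\<bar> \<partial>lborel)
     \<le> (\<integral>\<^sup>+w. (\<Sum>k. ennreal (ln 2) * indicator (cball 0 ((1 / 2) ^ k)) w) \<partial>(lborel :: complex measure))"
  proof (rule nn_integral_mono)
    fix w :: complex
    show "indicator (cball 0 1) w * ennreal \<bar>ln (cmod w)\<bar> \<le> (\<Sum>k. ennreal (ln 2) * indicator (cball 0 ((1 / 2) ^ k)) w)"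
    proof (cases "w \<in> cball 0 1 \<and> w \<noteq> 0")
      case True
      define x where "x = - ln (cmod w) / ln 2"
      have x0: "x \<ge> 0" using True unfolding x_def by (intro divide_nonneg_pos) auto
      define m where "m = nat \<lfloor>x\<rfloor>"
      have m: "real m \<le> x" "x \<le> real (Suc m)" using x0 by (auto simp: m_def) linarith+
      have "w \<in> cball 0 ((1 / 2) ^ k)" if "k \<le> m" for k
      proof -
        have "real k * ln 2 \<le> - ln (cmod w)"
        proof -
          have "real k \<le> x" using that m by simp
          then show ?thesis unfolding x_def by (simp add: field_simps)
        qed
        then have "ln (cmod w) \<le> ln ((1 / 2) ^ k)" by (simp add: ln_realpow ln_div)
        then show ?thesis using True by simp
      qed
      then have "(\<Sum>k\<le>m. ennreal (ln 2) * indicator (cball 0 ((1 / 2) ^ k)) w) = (\<Sum>k\<le>m. ennreal (ln 2))"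
        by (intro sum.cong refl) (simp add: indicator_def)
      moreover have "(\<Sum>k\<le>m. ennreal (ln 2) * indicator (cball 0 ((1 / 2) ^ k)) w) \<le> (\<Sum>k. ennreal (ln 2) * indicator (cball 0 ((1 / 2) ^ k)) w)"
        by (rule sum_le_suminf) auto
      moreover have "(\<Sum>k\<le>m. ennreal (ln 2)) = ennreal (Suc m * ln 2)"
        by (simp add: ennreal_of_nat_eq_real_of_nat ennreal_mult'[symmetric] del: of_nat_Suc)
      moreover have "\<bar>ln (cmod w)\<bar> \<le> Suc m * ln 2"
      proof -
        have "\<bar>ln (cmod w)\<bar> = x * ln 2" using True by (simp add: x_def)
        also have "\<dots> \<le> Suc m * ln 2" using m by (intro mult_right_mono) auto
        finally show ?thesis .
      qed
      then have "indicator (cball 0 1) w * ennreal \<bar>ln (cmod w)\<bar> \<le> ennreal (Suc m * ln 2)"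
        using True by (auto simp: indicator_def intro: ennreal_leI)
      ultimately show ?thesis by simp
    qed (auto simp: indicator_def)
  qed
  also have "\<dots> = (\<Sum>k. \<integral>\<^sup>+w. ennreal (ln 2) * indicator (cball 0 ((1 / 2) ^ k)) w \<partial>(lborel :: complex measure))"
    by (rule nn_integral_suminf) measurable
  also have "\<dots> = (\<Sum>k. ennreal (ln 2 * pi * (1 / 4) ^ k))"
  proof (rule suminf_cong)
    fix k
    have "(\<integral>\<^sup>+w. ennreal (ln 2) * indicator (cball 0 ((1 / 2) ^ k)) w \<partial>(lborel :: complex measure))
       = ennreal (ln 2) * emeasure lborel (cball (0::complex) ((1 / 2) ^ k))"
      by (subst nn_integral_cmult_indicator) auto
    also have "emeasure lborel (cball (0::complex) ((1 / 2) ^ k)) = ennreal (pi * (1 / 4) ^ k)"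
      by (subst emeasure_cball) (auto simp: unit_ball_vol_2 power2_eq_square power_mult_distrib[symmetric])
    finally show "(\<integral>\<^sup>+w. ennreal (ln 2) * indicator (cball 0 ((1 / 2) ^ k)) w \<partial>(lborel :: complex measure)) = ennreal (ln 2 * pi * (1 / 4) ^ k)"
      by (simp add: ennreal_mult'[symmetric] mult.assoc)
  qed
  also have "\<dots> = ennreal (\<Sum>k. ln 2 * pi * (1 / 4) ^ k)"
    by (rule suminf_ennreal2) (auto intro!: summable_mult summable_geometric)
  finally show ?thesis by (auto intro: le_less_trans)
qed

lemma nn_integral_ln_ball: "(\<integral>\<^sup>+w. indicator (cball 0 \<rho>) w * ennreal \<bar>ln (cmod w)\<bar> \<partial>lborel) < \<infinity>"
proof -
  have "(\<integral>\<^sup>+w. indicator (cball 0 \<rho>) w * ennreal \<bar>ln (cmod w)\<bar> \<partial>lborel)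
     \<le> (\<integral>\<^sup>+w. indicator (cball 0 1) w * ennreal \<bar>ln (cmod w)\<bar> + ennreal \<bar>ln (max 1 \<rho>)\<bar> * indicator (cball 0 \<rho>) w \<partial>lborel)"
  proof (rule nn_integral_mono)
    fix w :: complex
    show "indicator (cball 0 \<rho>) w * ennreal \<bar>ln (cmod w)\<bar> \<le> indicator (cball 0 1) w * ennreal \<bar>ln (cmod w)\<bar> + ennreal \<bar>ln (max 1 \<rho>)\<bar> * indicator (cball 0 \<rho>) w"
    proof (cases "cmod w \<le> 1")
      case False
      have "ennreal \<bar>ln (cmod w)\<bar> \<le> ennreal \<bar>ln (max 1 \<rho>)\<bar>" if "cmod w \<le> \<rho>"
      proof (rule ennreal_leI)
        have "ln (cmod w) \<le> ln \<rho>" using that False by (subst ln_le_cancel_iff) auto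
        then show "\<bar>ln (cmod w)\<bar> \<le> \<bar>ln (max 1 \<rho>)\<bar>" using that False by (simp add: max_def)
      qed
      then show ?thesis using False by (auto simp: indicator_def)
    qed (auto simp: indicator_def)
  qed
  also have "\<dots> = (\<integral>\<^sup>+w. indicator (cball 0 1) w * ennreal \<bar>ln (cmod w)\<bar> \<partial>lborel) + ennreal \<bar>ln (max 1 \<rho>)\<bar> * emeasure lborel (cball (0::complex) \<rho>)"
    by (subst nn_integral_add) (auto simp: nn_integral_cmult_indicator)
  also have "\<dots> < \<infinity>"
    using nn_integral_ln_unit_ball by (auto simp: ennreal_mult_less_top emeasure_bounded_finite[OF bounded_cball, unfolded infinity_ennreal_def])
  finally show ?thesis .
qed

text \<open>After the translation only the radius depends on \<open>v\<close>, which makes the bound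
  uniform over all points of a circle.\<close>

lemma nn_integral_ln_shifted:
  "(\<integral>\<^sup>+w. indicator (cball 0 \<rho>) w * ennreal \<bar>ln (cmod (w - v))\<bar> \<partial>lborel)
    \<le> (\<integral>\<^sup>+w. indicator (cball 0 (\<rho> + cmod v)) w * ennreal \<bar>ln (cmod w)\<bar> \<partial>lborel)"
proof -
  have "(\<integral>\<^sup>+w. indicator (cball 0 \<rho>) w * ennreal \<bar>ln (cmod (w - v))\<bar> \<partial>lborel)
     = (\<integral>\<^sup>+w. indicator (cball 0 \<rho>) (v + w) * ennreal \<bar>ln (cmod ((v + w) - v))\<bar> \<partial>lborel)"
    by (rule nn_integral_lborel_shift[symmetric]) measurable
  also have "\<dots> \<le> (\<integral>\<^sup>+w. indicator (cball 0 (\<rho> + cmod v)) w * ennreal \<bar>ln (cmod w)\<bar> \<partial>lborel)"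
  proof (rule nn_integral_mono)
    fix w
    have "cmod (v + w) \<le> \<rho> \<Longrightarrow> cmod w \<le> \<rho> + cmod v" using norm_triangle_ineq4[of "v + w" v] by simp
    then show "indicator (cball 0 \<rho>) (v + w) * ennreal \<bar>ln (cmod ((v + w) - v))\<bar> \<le> indicator (cball 0 (\<rho> + cmod v)) w * ennreal \<bar>ln (cmod w)\<bar>"
      by (auto simp: indicator_def)
  qed
  finally show ?thesis .
qed

text \<open>The kernel is symmetric: integrating this function against a measure is integrating the
  density \<open>\<phi>\<close> against the logarithmic potential of the measure.\<close>

definition log_potential :: "(complex \<Rightarrow> real) \<Rightarrow> complex \<Rightarrow> real" where
  "log_potential \<phi> v = (\<integral>w. \<phi> w * ln (cmod (w - v)) \<partial>lborel)"

locale bounded_support =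
  fixes \<phi> :: "complex \<Rightarrow> real" and B \<rho> :: real
  assumes meas [measurable]: "\<phi> \<in> borel_measurable borel"
    and bound: "\<And>w. \<bar>\<phi> w\<bar> \<le> B" and supp: "\<And>w. cmod w > \<rho> \<Longrightarrow> \<phi> w = 0"
begin

lemma B_nonneg: "B \<ge> 0" using bound[of 0] abs_ge_zero[of "\<phi> 0"] by linarith

lemma abs_le: "\<bar>\<phi> w\<bar> \<le> B * indicator (cball 0 \<rho>) w"
  using bound[of w] supp[of w] by (auto simp: indicator_def)

lemma nn_bound:
  assumes v: "cmod v \<le> m"
  shows "(\<integral>\<^sup>+w. ennreal \<bar>\<phi> w * ln (cmod (w - v))\<bar> \<partial>lborel)
    \<le> ennreal B * (\<integral>\<^sup>+w. indicator (cball 0 (\<rho> + m)) w * ennreal \<bar>ln (cmod w)\<bar> \<partial>lborel)"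
proof -
  have "(\<integral>\<^sup>+w. ennreal \<bar>\<phi> w * ln (cmod (w - v))\<bar> \<partial>lborel)
     \<le> (\<integral>\<^sup>+w. ennreal B * (indicator (cball 0 \<rho>) w * ennreal \<bar>ln (cmod (w - v))\<bar>) \<partial>lborel)"
  proof (rule nn_integral_mono)
    fix w
    have "\<bar>\<phi> w * ln (cmod (w - v))\<bar> \<le> B * indicator (cball 0 \<rho>) w * \<bar>ln (cmod (w - v))\<bar>"
      unfolding abs_mult by (intro mult_right_mono abs_le) auto
    then have "ennreal \<bar>\<phi> w * ln (cmod (w - v))\<bar> \<le> ennreal (B * indicator (cball 0 \<rho>) w * \<bar>ln (cmod (w - v))\<bar>)"
      by (rule ennreal_leI)
    also have "\<dots> = ennreal B * (indicator (cball 0 \<rho>) w * ennreal \<bar>ln (cmod (w - v))\<bar>)"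
      using B_nonneg by (auto simp: indicator_def ennreal_mult)
    finally show "ennreal \<bar>\<phi> w * ln (cmod (w - v))\<bar> \<le> ennreal B * (indicator (cball 0 \<rho>) w * ennreal \<bar>ln (cmod (w - v))\<bar>)" .
  qed
  also have "\<dots> = ennreal B * (\<integral>\<^sup>+w. indicator (cball 0 \<rho>) w * ennreal \<bar>ln (cmod (w - v))\<bar> \<partial>lborel)"
    by (rule nn_integral_cmult) measurable
  also have "\<dots> \<le> ennreal B * (\<integral>\<^sup>+w. indicator (cball 0 (\<rho> + cmod v)) w * ennreal \<bar>ln (cmod w)\<bar> \<partial>lborel)"
    by (intro mult_left_mono nn_integral_ln_shifted) auto
  also have "\<dots> \<le> ennreal B * (\<integral>\<^sup>+w. indicator (cball 0 (\<rho> + m)) w * ennreal \<bar>ln (cmod w)\<bar> \<partial>lborel)"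
    using v by (intro mult_left_mono nn_integral_mono mult_right_mono) (auto simp: indicator_def)
  finally show ?thesis .
qed

lemma bound_finite: "ennreal B * (\<integral>\<^sup>+w. indicator (cball 0 m) w * ennreal \<bar>ln (cmod w)\<bar> \<partial>lborel) < \<infinity>"
  using nn_integral_ln_ball[of m] by (simp add: ennreal_mult_less_top)

lemma integrable_ln: "integrable lborel (\<lambda>w. \<phi> w * ln (cmod (w - v)))"
proof (rule integrableI_bounded)
  have "(\<integral>\<^sup>+w. ennreal \<bar>\<phi> w * ln (cmod (w - v))\<bar> \<partial>lborel) < \<infinity>"
    using nn_bound[OF order_refl, of v] bound_finite by (rule le_less_trans)
  then show "(\<integral>\<^sup>+w. ennreal (norm (\<phi> w * ln (cmod (w - v)))) \<partial>lborel) < \<infinity>" by simp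
qed measurable

lemma integrable_pair:
  "integrable (lborel \<Otimes>\<^sub>M angle) (\<lambda>(w, t). \<phi> w * ln (cmod (w - (c + of_real r * cis t))))"
proof -
  interpret P: pair_sigma_finite lborel angle
    by (intro pair_sigma_finite.intro sigma_finite_lborel angle.sigma_finite_measure_axioms)
  have cm: "continuous_on UNIV (\<lambda>t. c + of_real r * cis t)" by (intro continuous_intros)
  have [measurable]: "(\<lambda>p. c + of_real r * cis (snd p)) \<in> borel_measurable (lborel \<Otimes>\<^sub>M angle)"
    by (rule measurable_compose[OF measurable_snd measurable_circle])
  have m: "(\<lambda>(w, t). \<phi> w * ln (cmod (w - (c + of_real r * cis t)))) \<in> borel_measurable (lborel \<Otimes>\<^sub>M angle)"
    unfolding case_prod_beta by measurable
  show ?thesis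
  proof (rule integrableI_bounded[OF m])
    define M where "M = ennreal B * (\<integral>\<^sup>+w. indicator (cball 0 (\<rho> + (cmod c + \<bar>r\<bar>))) w * ennreal \<bar>ln (cmod w)\<bar> \<partial>lborel)"
    have "(\<integral>\<^sup>+p. ennreal (norm (case p of (w, t) \<Rightarrow> \<phi> w * ln (cmod (w - (c + of_real r * cis t))))) \<partial>(lborel \<Otimes>\<^sub>M angle))
      = (\<integral>\<^sup>+t. \<integral>\<^sup>+w. ennreal \<bar>\<phi> w * ln (cmod (w - (c + of_real r * cis t)))\<bar> \<partial>lborel \<partial>angle)"
      using m by (subst P.nn_integral_snd[symmetric]) auto
    also have "\<dots> \<le> (\<integral>\<^sup>+t. M \<partial>angle)"
    proof (rule nn_integral_mono)
      fix t
      have "cmod (c + of_real r * cis t) \<le> cmod c + \<bar>r\<bar>"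
        using norm_triangle_ineq[of c "of_real r * cis t"] by (simp add: norm_mult)
      then show "(\<integral>\<^sup>+w. ennreal \<bar>\<phi> w * ln (cmod (w - (c + of_real r * cis t)))\<bar> \<partial>lborel) \<le> M"
        unfolding M_def by (rule nn_bound)
    qed
    also have "\<dots> = M" using angle.emeasure_space_1 by simp
    also have "\<dots> < \<infinity>" unfolding M_def by (rule bound_finite)
    finally show "(\<integral>\<^sup>+p. ennreal (norm (case p of (w, t) \<Rightarrow> \<phi> w * ln (cmod (w - (c + of_real r * cis t))))) \<partial>(lborel \<Otimes>\<^sub>M angle)) < \<infinity>" .
  qed
qed

lemma log_potential_measurable [measurable]: "log_potential \<phi> \<in> borel_measurable borel"
proof -
  have "(\<lambda>(v, w). \<phi> w * ln (cmod (w - v))) \<in> borel_measurable (borel \<Otimes>\<^sub>M lborel)"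
    unfolding case_prod_beta by measurable
  then show ?thesis unfolding log_potential_def[abs_def]
    using sigma_finite_measure.borel_measurable_lebesgue_integral[OF sigma_finite_lborel] by fastforce
qed

text \<open>Fubini and Jensen's formula. The circle itself, where the formula was not shown, is a
  null set.\<close>

lemma circle_potential:
  assumes r: "r > 0"
  shows "integrable lborel (\<lambda>w. \<phi> w * ln (max (cmod (w - c)) r))"
    and "integrable angle (\<lambda>t. log_potential \<phi> (c + of_real r * cis t))"
    and "(\<integral>w. \<phi> w * ln (max (cmod (w - c)) r) \<partial>lborel) = (\<integral>t. log_potential \<phi> (c + of_real r * cis t) \<partial>angle)"
proof -
  interpret P: pair_sigma_finite lborel angle
    by (intro pair_sigma_finite.intro sigma_finite_lborel angle.sigma_finite_measure_axioms)
  have "negligible (sphere c r)" by (rule negligible_sphere)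
  then have "sphere c r \<in> null_sets lebesgue" by (simp add: negligible_iff_null_sets)
  then have "sphere c r \<in> null_sets lborel" by (simp add: null_sets_completion_iff)
  then have ae: "AE w in lborel. w \<notin> sphere c r" by (rule AE_not_in)
  have inner: "AE w in lborel. (\<integral>t. \<phi> w * ln (cmod (w - (c + of_real r * cis t))) \<partial>angle) = \<phi> w * ln (max (cmod (w - c)) r)"
    using ae
  proof eventually_elim
    case (elim w)
    then have ne: "cmod (w - c) \<noteq> r" by (auto simp: dist_norm norm_minus_commute)
    have "(\<integral>t. \<phi> w * ln (cmod (w - (c + of_real r * cis t))) \<partial>angle) = \<phi> w * (\<integral>t. ln (cmod ((w - c) - of_real r * cis t)) \<partial>angle)"
      by (simp add: diff_diff_eq)
    then show ?case using mean_ln_circle[OF r ne] by simp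
  qed
  have i1: "integrable lborel (\<lambda>w. \<integral>t. \<phi> w * ln (cmod (w - (c + of_real r * cis t))) \<partial>angle)"
    using P.integrable_fst'[OF integrable_pair[of c r]] by simp
  show "integrable lborel (\<lambda>w. \<phi> w * ln (max (cmod (w - c)) r))"
    by (rule integrable_cong_AE_imp[OF i1]) (measurable, use inner in \<open>auto elim: eventually_mono\<close>)
  have i2: "integrable angle (\<lambda>t. \<integral>w. \<phi> w * ln (cmod (w - (c + of_real r * cis t))) \<partial>lborel)"
    using P.integrable_snd[OF integrable_pair[of c r]] by simp
  then show "integrable angle (\<lambda>t. log_potential \<phi> (c + of_real r * cis t))" by (simp add: log_potential_def)
  have "(\<integral>w. \<phi> w * ln (max (cmod (w - c)) r) \<partial>lborel) = (\<integral>w. (\<integral>t. \<phi> w * ln (cmod (w - (c + of_real r * cis t))) \<partial>angle) \<partial>lborel)"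
    by (rule integral_cong_AE) (use i1 inner in \<open>auto elim: eventually_mono intro: borel_measurable_integrable\<close>)
  also have "\<dots> = (\<integral>t. (\<integral>w. \<phi> w * ln (cmod (w - (c + of_real r * cis t))) \<partial>lborel) \<partial>angle)"
    using P.Fubini_integral[OF integrable_pair[of c r]] by simp
  finally show "(\<integral>w. \<phi> w * ln (max (cmod (w - c)) r) \<partial>lborel) = (\<integral>t. log_potential \<phi> (c + of_real r * cis t) \<partial>angle)"
    by (simp add: log_potential_def)
qed

end

section \<open>Circle means and approximation by logarithmic potentials\<close>

definition circle_mean :: "real \<Rightarrow> (complex \<Rightarrow> real) \<Rightarrow> complex \<Rightarrow> real" where
  "circle_mean r \<phi> w = (\<integral>t. \<phi> (w + of_real r * cis t) \<partial>angle)"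

lemma pair_sigma_finite_lborel_angle: "pair_sigma_finite (lborel :: complex measure) angle"
  by (intro pair_sigma_finite.intro sigma_finite_lborel angle.sigma_finite_measure_axioms)

lemma (in bounded_support) circle_mean_measurable [measurable]: "circle_mean r \<phi> \<in> borel_measurable borel"
proof -
  have [measurable]: "(\<lambda>p. of_real r * cis (snd p) :: complex) \<in> borel_measurable (borel \<Otimes>\<^sub>M angle)"
    using measurable_compose[OF measurable_snd measurable_circle[of 0 r]] by simp
  have "(\<lambda>(w, t). \<phi> (w + of_real r * cis t)) \<in> borel_measurable (borel \<Otimes>\<^sub>M angle)"
    unfolding case_prod_beta by measurable
  then show ?thesis unfolding circle_mean_def[abs_def]
    by (rule angle.borel_measurable_lebesgue_integral)
qed

lemma (in bounded_support) integrable_circle: "integrable angle (\<lambda>t. \<phi> (w + of_real r * cis t))"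
proof (rule angle.integrable_const_bound[where B = B])
  show "AE t in angle. norm (\<phi> (w + of_real r * cis t)) \<le> B" using bound by simp
  show "(\<lambda>t. \<phi> (w + of_real r * cis t)) \<in> borel_measurable angle"
    by (rule measurable_compose[OF measurable_circle meas])
qed

lemma (in bounded_support) circle_mean_bounded_support:
  assumes r: "r \<ge> 0"
  shows "bounded_support (circle_mean r \<phi>) B (\<rho> + r)"
proof
  show "circle_mean r \<phi> \<in> borel_measurable borel" by measurable
  fix w
  have "\<bar>circle_mean r \<phi> w\<bar> \<le> (\<integral>t. \<bar>\<phi> (w + of_real r * cis t)\<bar> \<partial>angle)"
    unfolding circle_mean_def by (rule integral_abs_bound)
  also have "\<dots> \<le> (\<integral>t. B \<partial>angle)"
    using integrable_circle by (intro integral_mono) (auto simp: bound)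
  also have "\<dots> = B" using angle.prob_space by simp
  finally show "\<bar>circle_mean r \<phi> w\<bar> \<le> B" .
  assume "\<rho> + r < cmod w"
  then have "\<phi> (w + of_real r * cis t) = 0" for t
    using norm_diff_ineq[of w "of_real r * cis t"] r by (intro supp) (simp add: norm_mult)
  then show "circle_mean r \<phi> w = 0" by (simp add: circle_mean_def)
qed

text \<open>By translation invariance the averaging over the circle moves from the density to the
  kernel, where it truncates the logarithm at \<open>r\<close>.\<close>

lemma (in bounded_support) log_potential_circle_mean:
  assumes r: "r > 0"
  shows "log_potential (circle_mean r \<phi>) v = (\<integral>w. \<phi> w * ln (max (cmod (w - v)) r) \<partial>lborel)"
proof -
  interpret P: pair_sigma_finite "lborel :: complex measure" angle by (rule pair_sigma_finite_lborel_angle)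
  have [measurable]: "(\<lambda>p. of_real r * cis (snd p) :: complex) \<in> borel_measurable (lborel \<Otimes>\<^sub>M angle)"
    using measurable_compose[OF measurable_snd measurable_circle[of 0 r]] by simp
  have m: "(\<lambda>(w, t). \<phi> (w + of_real r * cis t) * ln (cmod (w - v))) \<in> borel_measurable (lborel \<Otimes>\<^sub>M angle)"
    unfolding case_prod_beta by measurable
  have sh: "\<phi> (w + of_real r * cis t) * ln (cmod (w - v)) = (\<lambda>w. \<phi> w * ln (cmod (w - (v + of_real r * cis t)))) (of_real r * cis t + w)" for w t
    by (simp add: algebra_simps)
  have ip: "integrable (lborel \<Otimes>\<^sub>M angle) (\<lambda>(w, t). \<phi> (w + of_real r * cis t) * ln (cmod (w - v)))"
  proof (rule integrableI_bounded[OF m])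
    define M where "M = ennreal B * (\<integral>\<^sup>+w. indicator (cball 0 (\<rho> + (cmod v + \<bar>r\<bar>))) w * ennreal \<bar>ln (cmod w)\<bar> \<partial>lborel)"
    have "(\<integral>\<^sup>+p. ennreal (norm (case p of (w, t) \<Rightarrow> \<phi> (w + of_real r * cis t) * ln (cmod (w - v)))) \<partial>(lborel \<Otimes>\<^sub>M angle))
      = (\<integral>\<^sup>+t. \<integral>\<^sup>+w. ennreal \<bar>\<phi> (w + of_real r * cis t) * ln (cmod (w - v))\<bar> \<partial>lborel \<partial>angle)"
      using m by (subst P.nn_integral_snd[symmetric]) auto
    also have "\<dots> \<le> (\<integral>\<^sup>+t. M \<partial>angle)"
    proof (rule nn_integral_mono)
      fix t
      have "cmod (v + of_real r * cis t) \<le> cmod v + \<bar>r\<bar>"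
        using norm_triangle_ineq[of v "of_real r * cis t"] by (simp add: norm_mult)
      then have "(\<integral>\<^sup>+w. ennreal \<bar>\<phi> w * ln (cmod (w - (v + of_real r * cis t)))\<bar> \<partial>lborel) \<le> M"
        unfolding M_def by (rule nn_bound)
      then show "(\<integral>\<^sup>+w. ennreal \<bar>\<phi> (w + of_real r * cis t) * ln (cmod (w - v))\<bar> \<partial>lborel) \<le> M"
        unfolding sh using nn_integral_lborel_shift[of "\<lambda>w. ennreal \<bar>\<phi> w * ln (cmod (w - (v + of_real r * cis t)))\<bar>" "of_real r * cis t"]
        by simp
    qed
    also have "\<dots> = M" using angle.emeasure_space_1 by simp
    also have "\<dots> < \<infinity>" unfolding M_def by (rule bound_finite)
    finally show "(\<integral>\<^sup>+p. ennreal (norm (case p of (w, t) \<Rightarrow> \<phi> (w + of_real r * cis t) * ln (cmod (w - v)))) \<partial>(lborel \<Otimes>\<^sub>M angle)) < \<infinity>" .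
  qed
  have "log_potential (circle_mean r \<phi>) v = (\<integral>w. (\<integral>t. \<phi> (w + of_real r * cis t) * ln (cmod (w - v)) \<partial>angle) \<partial>lborel)"
    unfolding log_potential_def circle_mean_def by simp
  also have "\<dots> = (\<integral>t. (\<integral>w. \<phi> (w + of_real r * cis t) * ln (cmod (w - v)) \<partial>lborel) \<partial>angle)"
    using P.Fubini_integral[OF ip] by simp
  also have "\<dots> = (\<integral>t. log_potential \<phi> (v + of_real r * cis t) \<partial>angle)"
    unfolding log_potential_def sh by (subst integral_lborel_shift) auto
  also have "\<dots> = (\<integral>w. \<phi> w * ln (max (cmod (w - v)) r) \<partial>lborel)"
    using circle_potential(3)[OF r, of v] by simp
  finally show ?thesis .
qed

definition bump :: "real \<Rightarrow> complex \<Rightarrow> real" where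
  "bump s v = ln (max (cmod v) (2 * s)) - ln (max (cmod v) s)"

lemma bump_props:
  assumes s: "s > 0"
  shows "0 \<le> bump s v" "bump s v \<le> ln 2 * indicator (cball 0 (2 * s)) v"
    "ln 2 * indicator (cball 0 s) v \<le> bump s v" "cmod v > 2 * s \<Longrightarrow> bump s v = 0"
proof -
  have l2: "ln (2 * s) = ln 2 + ln s" using s by (simp add: ln_mult)
  have "ln (max (cmod v) s) \<le> ln (max (cmod v) (2 * s))" using s by (subst ln_le_cancel_iff) (auto simp: less_max_iff_disj)
  then have pos: "0 \<le> bump s v" by (simp add: bump_def)
  show "0 \<le> bump s v" by (rule pos)
  show z: "cmod v > 2 * s \<Longrightarrow> bump s v = 0" using s by (simp add: bump_def)
  have "bump s v \<le> ln 2"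
  proof (cases "cmod v \<le> 2 * s")
    case True
    have "ln s \<le> ln (max (cmod v) s)" using s by (subst ln_le_cancel_iff) auto
    then have "ln (max (cmod v) (2 * s)) = ln 2 + ln s" "ln s \<le> ln (max (cmod v) s)"
      using True l2 by (simp_all add: max_def)
    then show ?thesis by (simp add: bump_def)
  next
    case False
    then show ?thesis using z by simp
  qed
  then show "bump s v \<le> ln 2 * indicator (cball 0 (2 * s)) v"
    using z by (cases "cmod v \<le> 2 * s") (auto simp: indicator_def)
  show "ln 2 * indicator (cball 0 s) v \<le> bump s v"
  proof (cases "cmod v \<le> s")
    case True
    then show ?thesis using s l2 by (simp add: bump_def max_def indicator_def)
  next
    case False
    then show ?thesis using pos by (simp add: indicator_def)
  qed
qed

lemma bump_measurable [measurable]: "bump s \<in> borel_measurable borel"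
  unfolding bump_def[abs_def] by measurable

lemma bump_integrable:
  assumes s: "s > 0"
  shows "integrable lborel (bump s)" "integral\<^sup>L lborel (bump s) > 0"
proof -
  have ci: "integrable lborel (indicator (cball (0::complex) m) :: complex \<Rightarrow> real)" for m
    by (rule integrable_real_indicator) (use emeasure_bounded_finite[OF bounded_cball, of 0 m] in \<open>simp_all add: less_top\<close>)
  show i: "integrable lborel (bump s)"
    by (rule Bochner_Integration.integrable_bound[OF integrable_mult_right[OF ci[of "2 * s"], of "ln 2"]])
       (use bump_props[OF s] in \<open>auto simp: abs_of_nonneg\<close>)
  have "0 < ln 2 * measure lborel (cball (0::complex) s)"
    using s by (simp add: content_cball unit_ball_vol_2)
  also have "\<dots> = (\<integral>v. ln 2 * indicator (cball (0::complex) s) v \<partial>lborel)"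
    by simp
  also have "\<dots> \<le> integral\<^sup>L lborel (bump s)"
    using bump_props[OF s] ci i by (intro integral_mono) auto
  finally show "integral\<^sup>L lborel (bump s) > 0" .
qed

text \<open>Logarithmic potentials are uniformly dense: \<open>bump s\<close> is the potential of the difference of the
  uniform measures on two concentric circles, and convolving with it is an approximate identity.\<close>

lemma log_potential_approximation:
  fixes \<phi> :: "complex \<Rightarrow> real"
  assumes cont: "continuous_on UNIV \<phi>" and supp: "\<And>w. cmod w > \<rho> \<Longrightarrow> \<phi> w = 0" and \<eta>: "\<eta> > 0"
  shows "\<exists>\<Phi> B' \<rho>'. bounded_support \<Phi> B' \<rho>' \<and> (\<forall>v. \<bar>log_potential \<Phi> v - \<phi> v\<bar> \<le> \<eta>)"
proof -
  have [measurable]: "\<phi> \<in> borel_measurable borel" using cont by (rule borel_measurable_continuous_onI)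
  have "bounded (\<phi> ` cball 0 \<rho>)"
    by (intro compact_imp_bounded compact_continuous_image continuous_on_subset[OF cont]) auto
  then obtain B where B0: "B > 0" "\<forall>y\<in>\<phi> ` cball 0 \<rho>. norm y \<le> B"
    unfolding bounded_pos by blast
  have B: "\<bar>\<phi> w\<bar> \<le> B" if "w \<in> cball 0 \<rho>" for w
    using B0(2) that by (metis imageI real_norm_def)
  have bB: "\<bar>\<phi> w\<bar> \<le> B" for w
    using B[of w] B0(1) supp[of w] by (cases "cmod w \<le> \<rho>") auto
  interpret bounded_support \<phi> B \<rho>
    by standard (use bB supp in auto)
  have "uniformly_continuous_on (cball 0 (\<rho> + 1)) \<phi>"
    by (intro compact_uniformly_continuous continuous_on_subset[OF cont]) auto
  then obtain d where d: "d > 0" "\<And>x y. x \<in> cball 0 (\<rho> + 1) \<Longrightarrow> y \<in> cball 0 (\<rho> + 1) \<Longrightarrow> dist y x < d \<Longrightarrow> dist (\<phi> y) (\<phi> x) < \<eta>"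
    unfolding uniformly_continuous_on_def using \<eta> by metis
  \<comment> \<open>Small enough for uniform continuity, and such that a shift by at most
    \<open>2 * s < 1\<close> cannot join the disc of radius \<open>\<rho>\<close> to the outside of
    the disc of radius \<open>\<rho> + 1\<close>.\<close>
  define s where "s = min d 1 / 4"
  have s: "s > 0" "2 * s < d" "2 * s < 1" using d by (auto simp: s_def min_def)
  have uc: "\<bar>\<phi> (v + x) - \<phi> v\<bar> \<le> \<eta>" if x: "cmod x \<le> 2 * s" for v x
  proof (cases "cmod v \<le> \<rho> + 1 \<and> cmod (v + x) \<le> \<rho> + 1")
    case True
    then have "v \<in> cball 0 (\<rho> + 1)" "v + x \<in> cball 0 (\<rho> + 1)" "dist (v + x) v < d" using x s by (simp_all, simp add: dist_norm)
    then have "dist (\<phi> (v + x)) (\<phi> v) < \<eta>" by (rule d)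
    then show ?thesis by (simp add: dist_real_def)
  next
    case False
    have "cmod v \<le> cmod (v + x) + cmod x" using norm_triangle_ineq4[of "v + x" x] by simp
    moreover have "cmod (v + x) \<le> cmod v + cmod x" by (rule norm_triangle_ineq)
    ultimately have "cmod v > \<rho>" "cmod (v + x) > \<rho>" using False x s by auto
    then show ?thesis using supp \<eta> by simp
  qed
  define I where "I = integral\<^sup>L lborel (bump s)"
  have I: "I > 0" unfolding I_def by (rule bump_integrable(2)[OF s(1)])
  \<comment> \<open>Its potential at \<open>v\<close> is the mean of \<open>\<phi> (v + w)\<close>
    over \<open>w\<close> with the probability density \<open>bump s w / I\<close>.\<close>
  define \<Phi> where "\<Phi> = (\<lambda>w. (circle_mean (2 * s) \<phi> w - circle_mean s \<phi> w) / I)"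
  interpret M1: bounded_support "circle_mean s \<phi>" B "\<rho> + s" by (rule circle_mean_bounded_support) (use s in simp)
  interpret M2: bounded_support "circle_mean (2 * s) \<phi>" B "\<rho> + 2 * s" by (rule circle_mean_bounded_support) (use s in simp)
  have "bounded_support \<Phi> (2 * B / I) (\<rho> + 2 * s)"
  proof
    show "\<Phi> \<in> borel_measurable borel" unfolding \<Phi>_def by measurable
    fix w
    have "\<bar>circle_mean (2 * s) \<phi> w - circle_mean s \<phi> w\<bar> \<le> 2 * B" using M1.bound[of w] M2.bound[of w] by linarith
    then show "\<bar>\<Phi> w\<bar> \<le> 2 * B / I" unfolding \<Phi>_def using I by (simp add: divide_right_mono)
    assume "\<rho> + 2 * s < cmod w"
    then show "\<Phi> w = 0" using M1.supp[of w] M2.supp[of w] s by (simp add: \<Phi>_def)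
  qed
  moreover have "\<bar>log_potential \<Phi> v - \<phi> v\<bar> \<le> \<eta>" for v
  proof -
    have "log_potential \<Phi> v = (\<integral>w. (circle_mean (2 * s) \<phi> w * ln (cmod (w - v)) - circle_mean s \<phi> w * ln (cmod (w - v))) / I \<partial>lborel)"
      unfolding log_potential_def \<Phi>_def by (simp add: algebra_simps diff_divide_distrib)
    also have "\<dots> = (log_potential (circle_mean (2 * s) \<phi>) v - log_potential (circle_mean s \<phi>) v) / I"
      unfolding log_potential_def using M1.integrable_ln M2.integrable_ln by simp
    also have "log_potential (circle_mean (2 * s) \<phi>) v - log_potential (circle_mean s \<phi>) v
        = (\<integral>w. \<phi> w * ln (max (cmod (w - v)) (2 * s)) - \<phi> w * ln (max (cmod (w - v)) s) \<partial>lborel)"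
      using s circle_potential(1)[of "2 * s" v] circle_potential(1)[of s v]
      by (simp add: log_potential_circle_mean)
    also have "\<dots> = (\<integral>w. \<phi> (v + w) * bump s w \<partial>lborel)"
      by (subst integral_lborel_shift[symmetric, of _ v]) (auto simp: bump_def right_diff_distrib)
    finally have eq: "log_potential \<Phi> v = (\<integral>w. \<phi> (v + w) * bump s w \<partial>lborel) / I" .
    have i1: "integrable lborel (\<lambda>w. \<phi> (v + w) * bump s w)"
    proof (rule Bochner_Integration.integrable_bound[OF integrable_mult_right[OF bump_integrable(1)[OF s(1)], of B]])
      show "AE w in lborel. norm (\<phi> (v + w) * bump s w) \<le> norm (B * bump s w)"
        using bB B0(1) bump_props(1)[OF s(1)] by (auto simp: abs_mult intro!: mult_mono)
    qed measurable
    have "\<bar>(\<integral>w. \<phi> (v + w) * bump s w \<partial>lborel) - \<phi> v * I\<bar> = \<bar>\<integral>w. (\<phi> (v + w) - \<phi> v) * bump s w \<partial>lborel\<bar>"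
      unfolding I_def using i1 bump_integrable(1)[OF s(1)] by (simp add: left_diff_distrib)
    also have "\<dots> \<le> (\<integral>w. \<bar>(\<phi> (v + w) - \<phi> v) * bump s w\<bar> \<partial>lborel)" by (rule integral_abs_bound)
    also have "\<dots> \<le> (\<integral>w. \<eta> * bump s w \<partial>lborel)"
    proof (rule integral_mono)
      show "integrable lborel (\<lambda>w. \<bar>(\<phi> (v + w) - \<phi> v) * bump s w\<bar>)"
        using i1 bump_integrable(1)[OF s(1)] by (intro integrable_abs) (simp add: left_diff_distrib)
      show "integrable lborel (\<lambda>w. \<eta> * bump s w)" using bump_integrable(1)[OF s(1)] by simp
      fix w
      show "\<bar>(\<phi> (v + w) - \<phi> v) * bump s w\<bar> \<le> \<eta> * bump s w"
      proof (cases "cmod w \<le> 2 * s")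
        case True
        then show ?thesis using uc[OF True, of v] bump_props(1)[OF s(1), of w] by (simp add: abs_mult mult_right_mono)
      next
        case False
        then show ?thesis using bump_props(4)[OF s(1), of w] by simp
      qed
    qed
    also have "\<dots> = \<eta> * I" by (simp add: I_def)
    finally have "\<bar>(\<integral>w. \<phi> (v + w) * bump s w \<partial>lborel) - \<phi> v * I\<bar> / I \<le> \<eta>" using I by (simp add: divide_le_eq)
    moreover have "\<bar>log_potential \<Phi> v - \<phi> v\<bar> = \<bar>(\<integral>w. \<phi> (v + w) * bump s w \<partial>lborel) - \<phi> v * I\<bar> / I"
    proof -
      have "log_potential \<Phi> v - \<phi> v = ((\<integral>w. \<phi> (v + w) * bump s w \<partial>lborel) - \<phi> v * I) / I"
        unfolding eq using I by (simp add: diff_divide_distrib)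
      then show ?thesis using I by (simp only: abs_divide)
    qed
    ultimately show ?thesis by simp
  qed
  ultimately show ?thesis by blast
qed

subsection \<open>Spectral measures and mixtures of circles\<close>

text \<open>The mixture is known through its values on sets, hence the induction along the
  construction of a nonnegative measurable function.\<close>

lemma nn_integral_mixture:
  assumes I: "finite I" and M: "\<And>i. i \<in> I \<Longrightarrow> sets (M i) = sets borel"
    and f: "f \<in> borel_measurable borel"
  shows "(\<integral>\<^sup>+z. f z \<partial>mixture I w M) = (\<Sum>i\<in>I. ennreal (w i) * (\<integral>\<^sup>+z. f z \<partial>M i))"
  using f
proof (induction rule: borel_measurable_induct)
  case (cong f g)
  then show ?case by (simp add: fun_eq_iff[symmetric])
next
  case (set A)
  then have "(\<integral>\<^sup>+z. indicator A z \<partial>M i) = emeasure (M i) A" if "i \<in> I" for i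
    using M[OF that] by simp
  then show ?case using set by (simp add: emeasure_mixture[OF M])
next
  case (mult u c)
  have "(\<integral>\<^sup>+z. c * u z \<partial>M i) = c * (\<integral>\<^sup>+z. u z \<partial>M i)" if "i \<in> I" for i
    using mult(2) M[OF that] by (intro nn_integral_cmult) simp
  moreover have "(\<integral>\<^sup>+z. c * u z \<partial>mixture I w M) = c * (\<integral>\<^sup>+z. u z \<partial>mixture I w M)"
    using mult(2) by (intro nn_integral_cmult) simp
  ultimately show ?case using mult by (simp add: sum_distrib_left mult.left_commute)
next
  case (add u v)
  have "(\<integral>\<^sup>+z. v z + u z \<partial>M i) = (\<integral>\<^sup>+z. v z \<partial>M i) + (\<integral>\<^sup>+z. u z \<partial>M i)" if "i \<in> I" for i
    using add M[OF that] by (intro nn_integral_add) simp_all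
  moreover have "(\<integral>\<^sup>+z. v z + u z \<partial>mixture I w M) = (\<integral>\<^sup>+z. v z \<partial>mixture I w M) + (\<integral>\<^sup>+z. u z \<partial>mixture I w M)"
    using add by (intro nn_integral_add) simp_all
  ultimately show ?case using add by (simp add: sum.distrib distrib_left)
next
  case (seq U)
  have mono: "mono (\<lambda>n. \<integral>\<^sup>+z. U n z \<partial>M i)" for i
    using seq(3) by (auto simp: mono_def incseq_def le_fun_def intro!: nn_integral_mono)
  have "(\<integral>\<^sup>+z. (SUP n. U n z) \<partial>M i) = (SUP n. \<integral>\<^sup>+z. U n z \<partial>M i)" if "i \<in> I" for i
    using seq M[OF that] by (intro nn_integral_monotone_convergence_SUP) simp_all
  moreover have "(\<integral>\<^sup>+z. (SUP n. U n z) \<partial>mixture I w M) = (SUP n. \<integral>\<^sup>+z. U n z \<partial>mixture I w M)"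
    using seq by (intro nn_integral_monotone_convergence_SUP) simp_all
  moreover have "(SUP n. \<Sum>i\<in>I. ennreal (w i) * (\<integral>\<^sup>+z. U n z \<partial>M i)) = (\<Sum>i\<in>I. SUP n. ennreal (w i) * (\<integral>\<^sup>+z. U n z \<partial>M i))"
    by (rule ennreal_SUP_sum)
       (use mono in \<open>auto simp: mono_def incseq_def intro!: mult_left_mono\<close>)
  ultimately show ?case using seq by (simp add: SUP_mult_left_ennreal SUP_apply image_image)
qed

lemma integral_mixture:
  fixes f :: "complex \<Rightarrow> real"
  assumes I: "finite I" and M: "\<And>i. i \<in> I \<Longrightarrow> sets (M i) = sets borel"
    and w: "\<And>i. i \<in> I \<Longrightarrow> w i \<ge> 0" and f: "\<And>i. i \<in> I \<Longrightarrow> integrable (M i) f" "f \<in> borel_measurable borel"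
  shows "(\<integral>z. f z \<partial>mixture I w M) = (\<Sum>i\<in>I. w i * (\<integral>z. f z \<partial>M i))"
proof -
  have fin: "(\<integral>\<^sup>+z. ennreal (g z) \<partial>M i) < \<infinity>" if "i \<in> I" "\<And>z. g z \<le> \<bar>f z\<bar>" for i g
  proof -
    have "(\<integral>\<^sup>+z. ennreal (g z) \<partial>M i) \<le> (\<integral>\<^sup>+z. ennreal (norm (f z)) \<partial>M i)"
      using that by (intro nn_integral_mono ennreal_leI) simp
    then show ?thesis using f(1)[OF that(1)] by (auto simp: integrable_iff_bounded elim: le_less_trans)
  qed
  have nn: "(\<integral>\<^sup>+z. ennreal (g z) \<partial>mixture I w M) = (\<Sum>i\<in>I. ennreal (w i * enn2real (\<integral>\<^sup>+z. ennreal (g z) \<partial>M i)))"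
    if "\<And>z. g z \<le> \<bar>f z\<bar>" "g \<in> borel_measurable borel" for g
  proof -
    have "(\<integral>\<^sup>+z. ennreal (g z) \<partial>mixture I w M) = (\<Sum>i\<in>I. ennreal (w i) * (\<integral>\<^sup>+z. ennreal (g z) \<partial>M i))"
      using that(2) by (intro nn_integral_mixture[OF I M]) auto
    also have "\<dots> = (\<Sum>i\<in>I. ennreal (w i * enn2real (\<integral>\<^sup>+z. ennreal (g z) \<partial>M i)))"
      using fin[OF _ that(1)] w by (intro sum.cong refl) (simp add: ennreal_mult less_top)
    finally show ?thesis .
  qed
  have nn': "(\<integral>\<^sup>+z. ennreal (g z) \<partial>mixture I w M) = ennreal (\<Sum>i\<in>I. w i * enn2real (\<integral>\<^sup>+z. ennreal (g z) \<partial>M i))"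
    if "\<And>z. g z \<le> \<bar>f z\<bar>" "g \<in> borel_measurable borel" for g
    unfolding nn[OF that] using w by (intro sum_ennreal) (simp add: mult_nonneg_nonneg)
  have int: "integrable (mixture I w M) f"
    using f(2) nn'[of "\<lambda>z. \<bar>f z\<bar>"] by (intro integrableI_bounded) auto
  have "(\<integral>z. f z \<partial>mixture I w M) = (\<Sum>i\<in>I. w i * enn2real (\<integral>\<^sup>+z. ennreal (f z) \<partial>M i)) - (\<Sum>i\<in>I. w i * enn2real (\<integral>\<^sup>+z. ennreal (- f z) \<partial>M i))"
    unfolding real_lebesgue_integral_def[OF int]
    using nn'[of f] nn'[of "\<lambda>z. - f z"] f(2) w by (simp add: sum_nonneg)
  also have "\<dots> = (\<Sum>i\<in>I. w i * (\<integral>z. f z \<partial>M i))"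
    using f(1) by (simp add: real_lebesgue_integral_def right_diff_distrib sum_subtractf)
  finally show "(\<integral>z. f z \<partial>mixture I w M) = (\<Sum>i\<in>I. w i * (\<integral>z. f z \<partial>M i))" .
qed

context
  fixes X :: "complex mat" and N :: nat
  assumes X: "X \<in> carrier_mat N N" and N: "N \<ge> 1"
begin

lemma eigenvalues_roots: "{z. eigenvalue X z} = {z. poly (char_poly X) z = 0}"
  using eigenvalue_root_char_poly[OF X] by auto

lemma char_poly_nz: "char_poly X \<noteq> 0" "lead_coeff (char_poly X) = 1" "degree (char_poly X) = N"
  using degree_monic_char_poly[OF X] by auto

lemma finite_eigenvalues: "finite {z. eigenvalue X z}"
  unfolding eigenvalues_roots by (rule poly_roots_finite) (rule char_poly_nz)

lemma integral_empirical:
  fixes f :: "complex \<Rightarrow> real"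
  assumes f: "f \<in> borel_measurable borel"
  shows "integral\<^sup>L (empirical_spectral_measure X) f
      = (\<Sum>z | poly (char_poly X) z = 0. real (Polynomial.order z (char_poly X)) / N * f z)"
proof -
  have "integrable (return borel z) f" for z
    using f by (intro integrableI_bounded) (auto simp: nn_integral_return)
  note m = integral_mixture[OF finite_eigenvalues, of "return borel" "\<lambda>z. real (Polynomial.order z (char_poly X)) / real (dim_row X)" f]
  show "integral\<^sup>L (empirical_spectral_measure X) f
      = (\<Sum>z | poly (char_poly X) z = 0. real (Polynomial.order z (char_poly X)) / N * f z)"
    unfolding empirical_spectral_measure_def eigenvalues_roots
    using m X f \<open>\<And>z. integrable (return borel z) f\<close> unfolding eigenvalues_roots
    by (simp add: integral_return)
qed

lemma sum_order: "(\<Sum>z | poly (char_poly X) z = 0. Polynomial.order z (char_poly X)) = N"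
proof -
  have "degree (char_poly X) = degree (Polynomial.smult (lead_coeff (char_poly X)) (\<Prod>z|poly (char_poly X) z = 0. [:- z, 1:] ^ Polynomial.order z (char_poly X)))"
    by (simp only: complex_poly_decompose)
  also have "\<dots> = (\<Sum>z | poly (char_poly X) z = 0. degree ([:- z, 1:] ^ Polynomial.order z (char_poly X)))"
    by (simp add: char_poly_nz(2) degree_prod_eq_sum_degree)
  also have "\<dots> = (\<Sum>z | poly (char_poly X) z = 0. Polynomial.order z (char_poly X))"
    by (simp add: degree_power_eq)
  finally show ?thesis using char_poly_nz(3) by simp
qed

lemma ln_char_poly:
  assumes "poly (char_poly X) w \<noteq> 0"
  shows "ln (cmod (poly (char_poly X) w)) = (\<Sum>z | poly (char_poly X) z = 0. Polynomial.order z (char_poly X) * ln (cmod (w - z)))"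
proof -
  have "poly (char_poly X) w = poly (Polynomial.smult (lead_coeff (char_poly X)) (\<Prod>z|poly (char_poly X) z = 0. [:- z, 1:] ^ Polynomial.order z (char_poly X))) w"
    by (simp only: complex_poly_decompose)
  also have "\<dots> = (\<Prod>z | poly (char_poly X) z = 0. (w - z) ^ Polynomial.order z (char_poly X))"
    by (simp add: char_poly_nz(2) poly_prod)
  finally have "cmod (poly (char_poly X) w) = (\<Prod>z | poly (char_poly X) z = 0. cmod (w - z) ^ Polynomial.order z (char_poly X))"
    by (simp add: prod_norm[symmetric] norm_power)
  moreover have "finite {z. poly (char_poly X) z = 0}" by (rule poly_roots_finite) (rule char_poly_nz)
  ultimately show ?thesis
    using assms by (simp add: ln_prod ln_realpow) (subst ln_prod, auto simp: ln_realpow)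
qed

end


text \<open>The logarithmic potential of the spectral measure is the logarithm of the characteristic
  polynomial over \<open>N\<close>, except at the finitely many roots.\<close>

lemma (in bounded_support) integral_log_potential_empirical:
  assumes X: "X \<in> carrier_mat N N" and N: "N \<ge> 1"
  shows "integrable lborel (\<lambda>w. \<phi> w * (ln (cmod (poly (char_poly X) w)) / N))"
    and "integral\<^sup>L (empirical_spectral_measure X) (log_potential \<phi>)
      = (\<integral>w. \<phi> w * (ln (cmod (poly (char_poly X) w)) / N) \<partial>lborel)"
proof -
  define ord where "ord = (\<lambda>z. real (Polynomial.order z (char_poly X)))"
  have fin: "finite {z. poly (char_poly X) z = 0}" by (rule poly_roots_finite) (rule char_poly_nz[OF X N])
  have "AE w in lborel. w \<notin> {z. poly (char_poly X) z = 0}"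
    by (rule AE_not_in) (rule finite_imp_null_set_lborel[OF fin])
  then have ae: "AE w in lborel. (\<Sum>z | poly (char_poly X) z = 0. ord z / N * (\<phi> w * ln (cmod (w - z))))
      = \<phi> w * (ln (cmod (poly (char_poly X) w)) / N)"
    by eventually_elim (simp add: ln_char_poly[OF X N] ord_def sum_distrib_left sum_divide_distrib mult_ac)
  have m [measurable]: "(\<lambda>w. poly (char_poly X) w) \<in> borel_measurable borel"
    by (intro borel_measurable_continuous_onI continuous_intros)
  have mm: "(\<lambda>w. \<phi> w * (ln (cmod (poly (char_poly X) w)) / N)) \<in> borel_measurable lborel"
    by measurable
  have ms: "(\<lambda>w. \<Sum>z | poly (char_poly X) z = 0. ord z / N * (\<phi> w * ln (cmod (w - z)))) \<in> borel_measurable lborel"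
    by measurable
  have i: "integrable lborel (\<lambda>w. \<Sum>z | poly (char_poly X) z = 0. ord z / N * (\<phi> w * ln (cmod (w - z))))"
    by (intro Bochner_Integration.integrable_sum integrable_mult_right integrable_ln)
  show "integrable lborel (\<lambda>w. \<phi> w * (ln (cmod (poly (char_poly X) w)) / N))"
    using i integrable_cong_AE[OF ms mm ae] by blast
  have "integral\<^sup>L (empirical_spectral_measure X) (log_potential \<phi>)
      = (\<Sum>z | poly (char_poly X) z = 0. ord z / N * log_potential \<phi> z)"
    unfolding ord_def by (rule integral_empirical[OF X N]) measurable
  also have "\<dots> = (\<integral>w. (\<Sum>z | poly (char_poly X) z = 0. ord z / N * (\<phi> w * ln (cmod (w - z)))) \<partial>lborel)"
    unfolding log_potential_def
    by (subst Bochner_Integration.integral_sum) (intro integrable_mult_right integrable_ln, simp)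
  also have "\<dots> = (\<integral>w. \<phi> w * (ln (cmod (poly (char_poly X) w)) / N) \<partial>lborel)"
    by (rule integral_cong_AE[OF ms mm ae])
  finally show "integral\<^sup>L (empirical_spectral_measure X) (log_potential \<phi>)
      = (\<integral>w. \<phi> w * (ln (cmod (poly (char_poly X) w)) / N) \<partial>lborel)" .
qed

lemma sets_uniform_circle [simp, measurable_cong]: "sets (uniform_circle c r) = sets borel"
  by (simp add: uniform_circle_def)

lemma prob_space_uniform_circle: "prob_space (uniform_circle c r)"
  unfolding uniform_circle_angle by (rule angle.prob_space_distr) measurable

lemma (in bounded_support) uniform_circle_potential:
  assumes r: "r > 0"
  shows "integrable (uniform_circle c r) (log_potential \<phi>)"
    and "integral\<^sup>L (uniform_circle c r) (log_potential \<phi>) = (\<integral>w. \<phi> w * ln (max (cmod (w - c)) r) \<partial>lborel)"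
  unfolding uniform_circle_angle using circle_potential[OF r, of c]
  by (simp_all add: integrable_distr_eq integral_distr)

text \<open>Because all centres coincide, every block has the same \<open>ln (cmod (w - c0))\<close>
  in its maximum; only the radius varies.\<close>

lemma (in bounded_support) circle_mixture_potential:
  fixes \<gamma> :: real
  assumes d: "\<And>i. i \<in> {1..l} \<Longrightarrow> a i > 0 \<and> d i > 0 \<and> real (d i) = a i * ln (real N)"
    and c: "\<And>i. i \<in> {1..l} \<Longrightarrow> c i = c0" and N: "N \<ge> 2"
  shows "integrable lborel (\<lambda>w. \<phi> w * ((\<Sum>i=1..l. d i * max (ln (cmod (w - c0))) ((1 / 2 - \<gamma>) * ln N / d i)) / N))"
    and "integral\<^sup>L (circle_mixture \<gamma> N l a c) (log_potential \<phi>)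
      = (\<integral>w. \<phi> w * ((\<Sum>i=1..l. d i * max (ln (cmod (w - c0))) ((1 / 2 - \<gamma>) * ln N / d i)) / N) \<partial>lborel)"
proof -
  define r where "r = (\<lambda>i. exp ((- \<gamma> + 1 / 2) / a i))"
  have r: "r i > 0" for i by (simp add: r_def)
  have cm: "circle_mixture \<gamma> N l a c = mixture {1..l} (\<lambda>i. a i * ln N / N) (\<lambda>i. uniform_circle (c i) (r i))"
    by (simp add: circle_mixture_def r_def)
  have lnr: "ln (r i) = (1 / 2 - \<gamma>) * ln N / d i" if "i \<in> {1..l}" for i
    using d[OF that] N by (simp add: r_def)
  have w: "a i * ln N / N = d i / N" if "i \<in> {1..l}" for i using d[OF that] by simp
  have w0: "a i * ln N / N \<ge> 0" if "i \<in> {1..l}" for i unfolding w[OF that] by simp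
  \<comment> \<open>At the centre the convention \<open>ln 0 = 0\<close> would break the exchange of
    \<open>ln\<close> and \<open>max\<close>.\<close>
  have "AE w in lborel. w \<notin> {c0}"
    by (rule AE_not_in) (rule finite_imp_null_set_lborel, simp)
  then have ae: "AE w in lborel. (\<Sum>i=1..l. d i / N * (\<phi> w * ln (max (cmod (w - c0)) (r i))))
      = \<phi> w * ((\<Sum>i=1..l. d i * max (ln (cmod (w - c0))) ((1 / 2 - \<gamma>) * ln N / d i)) / N)"
  proof eventually_elim
    case (elim w)
    then have "ln (max (cmod (w - c0)) (r i)) = max (ln (cmod (w - c0))) (ln (r i))" for i
      using r[of i] by (auto simp: max_def)
    then show ?case using lnr by (simp add: sum_distrib_left sum_divide_distrib mult_ac)
  qed
  have mm: "(\<lambda>w. \<phi> w * ((\<Sum>i=1..l. d i * max (ln (cmod (w - c0))) ((1 / 2 - \<gamma>) * ln N / d i)) / N)) \<in> borel_measurable lborel"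
    by measurable
  have ms: "(\<lambda>w. \<Sum>i=1..l. d i / N * (\<phi> w * ln (max (cmod (w - c0)) (r i)))) \<in> borel_measurable lborel"
    by measurable
  have i: "integrable lborel (\<lambda>w. \<Sum>i=1..l. d i / N * (\<phi> w * ln (max (cmod (w - c0)) (r i))))"
    by (intro Bochner_Integration.integrable_sum integrable_mult_right circle_potential(1) r)
  show "integrable lborel (\<lambda>w. \<phi> w * ((\<Sum>i=1..l. d i * max (ln (cmod (w - c0))) ((1 / 2 - \<gamma>) * ln N / d i)) / N))"
    using i integrable_cong_AE[OF ms mm ae] by blast
  note im = integral_mixture[of "{1..l}" "\<lambda>i. uniform_circle (c i) (r i)" "\<lambda>i. a i * ln N / N" "log_potential \<phi>",
      OF _ _ w0 uniform_circle_potential(1)[OF r] log_potential_measurable]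
  have "integral\<^sup>L (circle_mixture \<gamma> N l a c) (log_potential \<phi>)
      = (\<Sum>i=1..l. a i * ln N / N * integral\<^sup>L (uniform_circle (c i) (r i)) (log_potential \<phi>))"
    unfolding cm by (rule im) auto
  also have "\<dots> = (\<Sum>i=1..l. d i / N * (\<integral>w. \<phi> w * ln (max (cmod (w - c0)) (r i)) \<partial>lborel))"
    by (intro sum.cong refl) (simp only: w c uniform_circle_potential(2)[OF r])
  also have "\<dots> = (\<integral>w. (\<Sum>i=1..l. d i / N * (\<phi> w * ln (max (cmod (w - c0)) (r i)))) \<partial>lborel)"
    by (subst Bochner_Integration.integral_sum) (intro integrable_mult_right circle_potential(1) r, simp)
  also have "\<dots> = (\<integral>w. \<phi> w * ((\<Sum>i=1..l. d i * max (ln (cmod (w - c0))) ((1 / 2 - \<gamma>) * ln N / d i)) / N) \<partial>lborel)"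
    by (rule integral_cong_AE[OF ms mm ae])
  finally show "integral\<^sup>L (circle_mixture \<gamma> N l a c) (log_potential \<phi>)
      = (\<integral>w. \<phi> w * ((\<Sum>i=1..l. d i * max (ln (cmod (w - c0))) ((1 / 2 - \<gamma>) * ln N / d i)) / N) \<partial>lborel)" .
qed

section \<open>Block coordinates of the perturbed Jordan matrix\<close>

fun block_first :: "nat list \<Rightarrow> nat \<Rightarrow> nat" where
  "block_first [] i = 0"
| "block_first (n # ns) i = (if i < n then 0 else n + block_first ns (i - n))"

fun block_len :: "nat list \<Rightarrow> nat \<Rightarrow> nat" where
  "block_len [] i = 0"
| "block_len (n # ns) i = (if i < n then n else block_len ns (i - n))"

lemma block_partition_list: "block_partition (sum_list ns) (block_first ns) (block_len ns)"
proof (induction ns)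
  case Nil
  show ?case by (rule block_partition.intro) auto
next
  case (Cons n ns)
  interpret block_partition "sum_list ns" "block_first ns" "block_len ns" by (rule Cons.IH)
  show ?case
  proof (rule block_partition.intro)
    fix i assume i: "i < sum_list (n # ns)"
    have i': "i - n < sum_list ns" if "\<not> i < n" using i that by simp
    show "block_first (n # ns) i \<le> i" "i < block_first (n # ns) i + block_len (n # ns) i"
      "block_first (n # ns) i + block_len (n # ns) i \<le> sum_list (n # ns)"
      using first_le[OF i'] less_end[OF i'] end_le[OF i'] by (cases "i < n"; force)+
    fix j assume j: "block_first (n # ns) i \<le> j" "j < block_first (n # ns) i + block_len (n # ns) i"
    have "block_first (n # ns) j = block_first (n # ns) i \<and> block_len (n # ns) j = block_len (n # ns) i"
    proof (cases "i < n")
      case False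
      then have "block_first ns (i - n) \<le> j - n" "j - n < block_first ns (i - n) + block_len ns (i - n)" "\<not> j < n"
        using j by auto
      then show ?thesis using False first_eq[OF i'] len_eq[OF i'] by simp
    qed (use j in simp)
    then show "block_first (n # ns) j = block_first (n # ns) i" "block_len (n # ns) j = block_len (n # ns) i"
      by simp_all
  qed
qed

lemma sum_block_len: "(\<Sum>p<sum_list ns. g (block_len ns p)) = (\<Sum>n\<leftarrow>ns. real n * g n)"
proof (induction ns)
  case (Cons n ns)
  have "(\<Sum>p<n + m. g (block_len (n # ns) p))
      = (\<Sum>p<n. g (block_len (n # ns) p)) + (\<Sum>p<m. g (block_len (n # ns) (n + p)))" for m
    by (induction m) (simp_all add: add.assoc)
  then show ?case using Cons.IH by simp
qed simp

text \<open>Every block is counted as the sum of the reciprocal of its length over its own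
  indices.\<close>

lemma card_block_lasts:
  assumes "\<forall>n\<in>set ns. n > 0"
  shows "card (block_partition.Lasts (sum_list ns) (block_first ns) (block_len ns)) = length ns"
proof -
  interpret block_partition "sum_list ns" "block_first ns" "block_len ns" by (rule block_partition_list)
  have "real (card Lasts) = (\<Sum>p<sum_list ns. 1 / real (block_len ns p))"
    using sum_average[of "\<lambda>_. 1"] by simp
  also have "\<dots> = (\<Sum>n\<leftarrow>ns. real n * (1 / real n))" by (rule sum_block_len)
  also have "\<dots> = (\<Sum>n\<leftarrow>ns. 1)" using assms by (intro arg_cong[where f = sum_list] map_cong) auto
  also have "\<dots> = length ns" by (induction ns) auto
  finally show ?thesis by simp
qed

lemma jordan_matrix_index:
  assumes "i < sum_list ns" "j < sum_list ns"
  shows "jordan_matrix (map (\<lambda>n. (n, c)) ns) $$ (i, j)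
    = (if i = j then c else if j = Suc i \<and> j < block_first ns i + block_len ns i then 1 else (0::complex))"
  using assms
proof (induction ns arbitrary: i j)
  case (Cons n ns)
  have dims: "dim_row (diag_block_mat (map (\<lambda>n. jordan_block n c) ns)) = sum_list ns"
    "dim_col (diag_block_mat (map (\<lambda>n. jordan_block n c) ns)) = sum_list ns"
    using jordan_matrix_dim[of "map (\<lambda>n. (n, c)) ns"] by (simp_all add: jordan_matrix_def comp_def)
  have fl: "k < sum_list ns \<Longrightarrow> k < block_first ns k + block_len ns k" for k
    using block_partition.less_end[OF block_partition_list] .
  have "jordan_matrix (map (\<lambda>n. (n, c)) (n # ns)) $$ (i, j) =
     (if i < n then if j < n then jordan_block n c $$ (i, j) else 0
      else if j < n then 0 else jordan_matrix (map (\<lambda>n. (n, c)) ns) $$ (i - n, j - n))"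
    using Cons.prems dims by (simp add: jordan_matrix_def Let_def comp_def)
  also have "\<dots> = (if i = j then c else if j = Suc i \<and> j < block_first (n # ns) i + block_len (n # ns) i then 1 else 0)"
  proof (cases "i < n")
    case True
    then show ?thesis by (cases "j < n") auto
  next
    case i: False
    show ?thesis
    proof (cases "j < n")
      case True
      then show ?thesis using i by simp
    next
      case False
      have "i = j \<longleftrightarrow> i - n = j - n" "j = Suc i \<longleftrightarrow> j - n = Suc (i - n)"
        "j < n + block_first ns (i - n) + block_len ns (i - n) \<longleftrightarrow> j - n < block_first ns (i - n) + block_len ns (i - n)"
        using i False by linarith+
      moreover have "i - n < sum_list ns" "j - n < sum_list ns" using Cons.prems i False by auto
      ultimately show ?thesis using i False Cons.IH[of "i - n" "j - n"] by simp
    qed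
  qed
  finally show ?case .
qed simp

text \<open>The matrix \<open>A\<close> outside its locale, so that it is available for every
  \<open>v\<close>, including 0 and the unit circle.\<close>

definition shift_mat :: "(nat \<Rightarrow> nat) \<Rightarrow> (nat \<Rightarrow> nat) \<Rightarrow> complex \<Rightarrow> nat \<Rightarrow> nat \<Rightarrow> complex" where
  "shift_mat f len v i j = (if i = j then v else if j = Suc i \<and> j < f i + len i then -1 else 0)"

text \<open>Agrees with \<open>log_potential_gap\<close> for almost every \<open>v\<close>, but is jointly measurable.\<close>

definition potential_gap :: "real \<Rightarrow> nat \<Rightarrow> (nat \<Rightarrow> nat) \<Rightarrow> (nat \<Rightarrow> nat) \<Rightarrow> real \<Rightarrow> complex \<Rightarrow> (nat \<times> nat \<Rightarrow> real) \<Rightarrow> real" where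
  "potential_gap \<gamma> N f len \<delta> v \<omega> =
     \<bar>ln (cmod (noisy_det N {..<N} \<delta> (shift_mat f len v) \<omega>))
       - (\<Sum>p<N. max (ln (cmod v)) ((1 / 2 - \<gamma>) * ln N / len p))\<bar> / N"

lemma potential_gap_eq:
  assumes "block_partition N f len" and v: "v \<noteq> 0" "cmod v \<noteq> 1"
  shows "potential_gap \<gamma> N f len \<delta> v \<omega> = log_potential_gap \<gamma> N f len \<delta> v \<omega>"
proof -
  interpret block_partition N f len by fact
  interpret jordan_split N f len v 1 by standard (use v in auto)
  have "shift_mat f len v = jordan_split.A f len v"
    by (intro ext) (simp add: shift_mat_def A_def)
  then show ?thesis by (simp add: potential_gap_def log_potential_gap_def)
qed

lemma AE_regular: "AE v::complex in lborel. v \<noteq> 0 \<and> cmod v \<noteq> 1"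
proof -
  have "AE v::complex in lborel. v \<notin> {0}"
    by (rule AE_not_in) (rule finite_imp_null_set_lborel, simp)
  moreover have "AE v::complex in lborel. v \<notin> sphere 0 1"
  proof -
    have "sphere (0::complex) 1 \<in> null_sets lebesgue"
      using negligible_sphere[of "0::complex" 1] by (simp add: negligible_iff_null_sets)
    then have "sphere (0::complex) 1 \<in> null_sets lborel"
      by (auto simp: null_sets_def)
    then show ?thesis by (rule AE_not_in)
  qed
  ultimately show ?thesis by eventually_elim simp
qed

lemma borel_measurable_noisy_det_pair:
  "(\<lambda>p. noisy_det N S \<delta> (shift_mat f len (fst p)) (snd p)) \<in> borel_measurable (borel \<Otimes>\<^sub>M gauss_sq N)"
  unfolding noisy_det_def[abs_def] noisy_mat_def
proof (rule borel_measurable_det)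
  fix i j assume "i < N" "j < N"
  then have [measurable]: "(\<lambda>p. snd p (i, j)) \<in> borel_measurable (borel \<Otimes>\<^sub>M gauss_sq N)"
    by (intro measurable_compose[OF measurable_snd measurable_gauss_component]) auto
  have [measurable]: "(\<lambda>p. shift_mat f len (fst p) i j) \<in> borel_measurable (borel \<Otimes>\<^sub>M gauss_sq N)"
    unfolding shift_mat_def by measurable
  show "(\<lambda>p. shift_mat f len (fst p) i j + (if i \<in> S then of_real (\<delta> * snd p (i, j)) else 0)) \<in> borel_measurable (borel \<Otimes>\<^sub>M gauss_sq N)"
    by (cases "i \<in> S") (simp_all, measurable)
qed

lemma borel_measurable_potential_gap:
  "(\<lambda>p. potential_gap \<gamma> N f len \<delta> (fst p) (snd p)) \<in> borel_measurable (borel \<Otimes>\<^sub>M gauss_sq N)"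
proof -
  note [measurable] = borel_measurable_noisy_det_pair
  show ?thesis unfolding potential_gap_def by measurable
qed

lemma borel_measurable_potential_gap_left:
  "(\<lambda>v. potential_gap \<gamma> N f len \<delta> v \<omega>) \<in> borel_measurable borel"
proof -
  have [measurable]: "(\<lambda>v. noisy_det N {..<N} \<delta> (shift_mat f len v) \<omega>) \<in> borel_measurable borel"
    unfolding noisy_det_def[abs_def] noisy_mat_def
    by (rule borel_measurable_det) (unfold shift_mat_def, measurable)
  show ?thesis unfolding potential_gap_def by measurable
qed

lemma integrated_gap_swap:
  shows "(\<lambda>\<omega>. \<integral>\<^sup>+v. indicator (cball 0 R) v * ennreal (potential_gap \<gamma> N f len \<delta> v \<omega>) \<partial>lborel) \<in> borel_measurable (gauss_sq N)"
    and "(\<lambda>v. \<integral>\<^sup>+\<omega>. ennreal (potential_gap \<gamma> N f len \<delta> v \<omega>) \<partial>gauss_sq N) \<in> borel_measurable borel"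
    and "(\<integral>\<^sup>+\<omega>. (\<integral>\<^sup>+v. indicator (cball 0 R) v * ennreal (potential_gap \<gamma> N f len \<delta> v \<omega>) \<partial>lborel) \<partial>gauss_sq N)
      = (\<integral>\<^sup>+v. indicator (cball 0 R) v * (\<integral>\<^sup>+\<omega>. ennreal (potential_gap \<gamma> N f len \<delta> v \<omega>) \<partial>gauss_sq N) \<partial>lborel)"
proof -
  interpret G: prob_space "gauss_sq N" by (rule prob_space_gauss)
  interpret P: pair_sigma_finite "lborel :: complex measure" "gauss_sq N"
    by (intro pair_sigma_finite.intro sigma_finite_lborel G.sigma_finite_measure_axioms)
  have pm: "(\<lambda>p. potential_gap \<gamma> N f len \<delta> (fst p) (snd p)) \<in> borel_measurable (lborel \<Otimes>\<^sub>M gauss_sq N)"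
    using borel_measurable_potential_gap by (simp cong: measurable_cong_sets sets_pair_measure_cong)
  then have m: "(\<lambda>p. ennreal (potential_gap \<gamma> N f len \<delta> (fst p) (snd p))) \<in> borel_measurable (lborel \<Otimes>\<^sub>M gauss_sq N)"
    by measurable
  then have mi: "(\<lambda>(v, \<omega>). indicator (cball 0 R) v * ennreal (potential_gap \<gamma> N f len \<delta> v \<omega>)) \<in> borel_measurable (lborel \<Otimes>\<^sub>M gauss_sq N)"
    unfolding case_prod_beta by (intro borel_measurable_times_ennreal) auto
  show "(\<lambda>\<omega>. \<integral>\<^sup>+v. indicator (cball 0 R) v * ennreal (potential_gap \<gamma> N f len \<delta> v \<omega>) \<partial>lborel) \<in> borel_measurable (gauss_sq N)"
  proof (rule sigma_finite_measure.borel_measurable_nn_integral[OF sigma_finite_lborel])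
    show "(\<lambda>(\<omega>, v). indicator (cball 0 R) v * ennreal (potential_gap \<gamma> N f len \<delta> v \<omega>)) \<in> borel_measurable (gauss_sq N \<Otimes>\<^sub>M lborel)"
      using measurable_pair_swap[OF mi] by simp
  qed
  show "(\<lambda>v. \<integral>\<^sup>+\<omega>. ennreal (potential_gap \<gamma> N f len \<delta> v \<omega>) \<partial>gauss_sq N) \<in> borel_measurable borel"
    using G.borel_measurable_nn_integral_fst[OF m] by simp
  have ms: "(\<lambda>\<omega>. ennreal (potential_gap \<gamma> N f len \<delta> v \<omega>)) \<in> borel_measurable (gauss_sq N)" for v
    using measurable_Pair2[OF m, of v] by simp
  have "(\<integral>\<^sup>+\<omega>. (\<integral>\<^sup>+v. indicator (cball 0 R) v * ennreal (potential_gap \<gamma> N f len \<delta> v \<omega>) \<partial>lborel) \<partial>gauss_sq N)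
      = (\<integral>\<^sup>+v. (\<integral>\<^sup>+\<omega>. indicator (cball 0 R) v * ennreal (potential_gap \<gamma> N f len \<delta> v \<omega>) \<partial>gauss_sq N) \<partial>lborel)"
    using P.Fubini[OF mi] by simp
  also have "\<dots> = (\<integral>\<^sup>+v. indicator (cball 0 R) v * (\<integral>\<^sup>+\<omega>. ennreal (potential_gap \<gamma> N f len \<delta> v \<omega>) \<partial>gauss_sq N) \<partial>lborel)"
    using ms by (intro nn_integral_cong) (rule nn_integral_cmult)
  finally show "(\<integral>\<^sup>+\<omega>. (\<integral>\<^sup>+v. indicator (cball 0 R) v * ennreal (potential_gap \<gamma> N f len \<delta> v \<omega>) \<partial>lborel) \<partial>gauss_sq N)
      = (\<integral>\<^sup>+v. indicator (cball 0 R) v * (\<integral>\<^sup>+\<omega>. ennreal (potential_gap \<gamma> N f len \<delta> v \<omega>) \<partial>gauss_sq N) \<partial>lborel)" .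
qed

text \<open>After the exchange of integrals, dominated convergence in \<open>v\<close> for the inner
  means. Limit and majorant are available off the null set of irregular \<open>v\<close>, and the
  logarithm in the majorant is integrable over the disc.\<close>

lemma integrated_gap_tendsto:
  fixes \<gamma> :: real and \<delta> :: "nat \<Rightarrow> real"
  assumes part: "\<And>N. N \<ge> 2 \<Longrightarrow> block_partition N (f N) (len N)"
    and few: "(\<lambda>N. real (card (block_partition.Lasts N (f N) (len N))) / N) \<longlonglongrightarrow> 0"
    and \<delta>: "\<And>N. N \<ge> 2 \<Longrightarrow> \<bar>\<delta> N\<bar> = N powr - \<gamma>" and \<gamma>: "\<gamma> > 1 / 2"
  shows "(\<lambda>N. \<integral>\<^sup>+\<omega>. (\<integral>\<^sup>+v. indicator (cball 0 R) v * ennreal (potential_gap \<gamma> N (f N) (len N) (\<delta> N) v \<omega>) \<partial>lborel) \<partial>gauss_sq N) \<longlonglongrightarrow> 0"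
proof -
  define \<kappa> where "\<kappa> = (\<lambda>N v. \<integral>\<^sup>+\<omega>. ennreal (potential_gap \<gamma> N (f N) (len N) (\<delta> N) v \<omega>) \<partial>gauss_sq N)"
  define b where "b = (\<lambda>v::complex. indicator (cball 0 R) v * ennreal (19 + (cmod v + 1)\<^sup>2 + 3 * \<bar>ln (cmod v)\<bar>))"
  have [measurable]: "\<kappa> N \<in> borel_measurable borel" for N
    unfolding \<kappa>_def by (rule integrated_gap_swap(2))
  have eq: "\<kappa> N v = (\<integral>\<^sup>+\<omega>. ennreal (log_potential_gap \<gamma> N (f N) (len N) (\<delta> N) v \<omega>) \<partial>gauss_sq N)"
    if "N \<ge> 2" "v \<noteq> 0" "cmod v \<noteq> 1" for N v
    unfolding \<kappa>_def using that part by (simp add: potential_gap_eq)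
  \<comment> \<open>The shift by 2 makes the assumptions, which start at \<open>N = 2\<close>, valid
    for every term of the sequence.\<close>
  have "(\<lambda>n. \<integral>\<^sup>+v. indicator (cball 0 R) v * \<kappa> (n + 2) v \<partial>lborel) \<longlonglongrightarrow> (\<integral>\<^sup>+v. 0 \<partial>(lborel::complex measure))"
  proof (rule nn_integral_dominated_convergence[where w = b])
    show "AE v in lborel. indicator (cball 0 R) v * \<kappa> (n + 2) v \<le> b v" for n
      using AE_regular
    proof eventually_elim
      case (elim v)
      have "\<kappa> N v \<le> ennreal (19 + (cmod v + 1)\<^sup>2 + 3 * \<bar>ln (cmod v)\<bar>)" if N: "N \<ge> 2" for N
      proof -
        have v: "v \<noteq> 0" "cmod v \<noteq> 1" using elim by auto
        show ?thesis unfolding eq[OF N v]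
          by (rule log_potential_gap_bound[OF part[OF N] N \<delta>[OF N] \<gamma> v])
      qed
      then show ?case unfolding b_def by (intro mult_left_mono) (simp_all del: ennreal_plus)
    qed
    have "(\<integral>\<^sup>+v. b v \<partial>lborel) \<le> (\<integral>\<^sup>+v. ennreal (19 + (\<bar>R\<bar> + 1)\<^sup>2) * indicator (cball 0 R) v
        + 3 * (indicator (cball 0 R) v * ennreal \<bar>ln (cmod v)\<bar>) \<partial>lborel)"
    proof (rule nn_integral_mono)
      fix v :: complex
      have "b v \<le> ennreal (19 + (\<bar>R\<bar> + 1)\<^sup>2) + 3 * ennreal \<bar>ln (cmod v)\<bar>" if "cmod v \<le> R"
      proof -
        have "(cmod v + 1)\<^sup>2 \<le> (\<bar>R\<bar> + 1)\<^sup>2" using that by (intro power_mono) auto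
        then have "b v \<le> ennreal ((19 + (\<bar>R\<bar> + 1)\<^sup>2) + 3 * \<bar>ln (cmod v)\<bar>)"
          using that unfolding b_def by (simp add: ennreal_leI)
        then show ?thesis by (simp add: ennreal_plus ennreal_mult)
      qed
      then show "b v \<le> ennreal (19 + (\<bar>R\<bar> + 1)\<^sup>2) * indicator (cball 0 R) v
        + 3 * (indicator (cball 0 R) v * ennreal \<bar>ln (cmod v)\<bar>)"
        by (cases "cmod v \<le> R") (simp_all add: b_def)
    qed
    also have "\<dots> = ennreal (19 + (\<bar>R\<bar> + 1)\<^sup>2) * emeasure lborel (cball (0::complex) R)
        + 3 * (\<integral>\<^sup>+v. indicator (cball 0 R) v * ennreal \<bar>ln (cmod v)\<bar> \<partial>lborel)"
      by (subst nn_integral_add) (simp_all add: nn_integral_cmult nn_integral_cmult_indicator)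
    also have "\<dots> < \<infinity>"
      using nn_integral_ln_ball[of R] emeasure_bounded_finite[OF bounded_cball, of "0::complex" R]
      by (simp add: ennreal_mult_less_top)
    finally show "(\<integral>\<^sup>+v. b v \<partial>lborel) < \<infinity>" .
    show "AE v in lborel. (\<lambda>n. indicator (cball 0 R) v * \<kappa> (n + 2) v) \<longlonglongrightarrow> 0"
      using AE_regular
    proof eventually_elim
      case (elim v)
      have "(\<lambda>N. \<integral>\<^sup>+\<omega>. ennreal (log_potential_gap \<gamma> N (f N) (len N) (\<delta> N) v \<omega>) \<partial>gauss_sq N) \<longlonglongrightarrow> 0"
        using elim by (intro log_potential_gap_tendsto part few \<delta> \<gamma>) auto
      then have "(\<lambda>n. \<kappa> (n + 2) v) \<longlonglongrightarrow> 0"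
        using elim by (simp add: eq) (rule LIMSEQ_ignore_initial_segment[where k = 2, simplified])
      then show ?case by (cases "v \<in> cball 0 R") simp_all
    qed
  qed (unfold b_def, measurable)
  then have "(\<lambda>n. \<integral>\<^sup>+v. indicator (cball 0 R) v * \<kappa> (n + 2) v \<partial>lborel) \<longlonglongrightarrow> 0"
    by simp
  then have "(\<lambda>N. \<integral>\<^sup>+v. indicator (cball 0 R) v * \<kappa> N v \<partial>lborel) \<longlonglongrightarrow> 0"
    by (rule LIMSEQ_offset)
  then show ?thesis unfolding integrated_gap_swap(3) \<kappa>_def .
qed

text \<open>In \<open>w\<close> minus the matrix the noise carries a minus sign; this is why the
  earlier estimates prescribe only \<open>\<bar>\<delta>\<bar>\<close>.\<close>

lemma poly_char_poly_perturbed: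
  assumes g: "g \<in> carrier_mat N N" and N: "(\<Sum>i=1..l. d i) = N"
    and c: "\<And>i. i \<in> {1..l} \<Longrightarrow> c i = c0"
  defines "ns \<equiv> map d [1..<Suc l]"
  shows "perturbed_matrix \<gamma> N l d c g \<in> carrier_mat N N"
    and "poly (char_poly (perturbed_matrix \<gamma> N l d c g)) w
      = noisy_det N {..<N} (- (real N powr - \<gamma>)) (shift_mat (block_first ns) (block_len ns) (w - c0)) (\<lambda>p. g $$ p)"
proof -
  have ns: "sum_list ns = N"
    unfolding ns_def N[symmetric] by (simp add: interv_sum_list_conv_sum_set_nat atLeastLessThanSuc_atLeastAtMost del: upt_Suc)
  have jm: "map (\<lambda>i. (d i, c i)) [1..<Suc l] = map (\<lambda>n. (n, c0)) ns"
    unfolding ns_def using c by (simp del: upt_Suc)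
  have J: "jordan_matrix (map (\<lambda>n. (n, c0)) ns) \<in> carrier_mat N N"
    using jordan_matrix_carrier[of "map (\<lambda>n. (n, c0)) ns"] by (simp add: comp_def ns)
  show X: "perturbed_matrix \<gamma> N l d c g \<in> carrier_mat N N"
    unfolding perturbed_matrix_def jm using g J by simp
  have "- char_matrix (perturbed_matrix \<gamma> N l d c g) w
      = noisy_mat N {..<N} (- (real N powr - \<gamma>)) (shift_mat (block_first ns) (block_len ns) (w - c0)) (\<lambda>p. g $$ p)"
  proof (rule eq_matI)
    fix i j
    assume "i < dim_row (noisy_mat N {..<N} (- (real N powr - \<gamma>)) (shift_mat (block_first ns) (block_len ns) (w - c0)) (\<lambda>p. g $$ p))"
      "j < dim_col (noisy_mat N {..<N} (- (real N powr - \<gamma>)) (shift_mat (block_first ns) (block_len ns) (w - c0)) (\<lambda>p. g $$ p))"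
    then have ij: "i < N" "j < N" by (simp_all add: noisy_mat_def)
    have Xij: "perturbed_matrix \<gamma> N l d c g $$ (i, j)
       = (if i = j then c0 else if j = Suc i \<and> j < block_first ns i + block_len ns i then 1 else 0) + of_real (N powr - \<gamma> * g $$ (i, j))"
      unfolding perturbed_matrix_def jm using ij g J jordan_matrix_index[of i ns j c0] by (simp add: ns)
    have "(- char_matrix (perturbed_matrix \<gamma> N l d c g) w) $$ (i, j) = (if i = j then w else 0) - perturbed_matrix \<gamma> N l d c g $$ (i, j)"
      using ij X by (simp add: char_matrix_def)
    then show "(- char_matrix (perturbed_matrix \<gamma> N l d c g) w) $$ (i, j)
      = noisy_mat N {..<N} (- (real N powr - \<gamma>)) (shift_mat (block_first ns) (block_len ns) (w - c0)) (\<lambda>p. g $$ p) $$ (i, j)"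
      unfolding Xij using ij by (simp add: shift_mat_def)
  qed (use X in \<open>auto simp: char_matrix_def noisy_mat_def\<close>)
  then show "poly (char_poly (perturbed_matrix \<gamma> N l d c g)) w
      = noisy_det N {..<N} (- (real N powr - \<gamma>)) (shift_mat (block_first ns) (block_len ns) (w - c0)) (\<lambda>p. g $$ p)"
    using char_poly_matrix[OF X] by (simp add: noisy_det_def)
qed

lemma ennreal_scaled_indicator:
  "b \<ge> 0 \<Longrightarrow> ennreal b * (indicator S x * ennreal y) = ennreal (b * (indicator S x * y))"
  by (simp add: indicator_def ennreal_mult')

text \<open>Both integrals are integrals of \<open>\<phi>\<close> against a potential, so their
  difference is at most \<open>B\<close> times the integrated gap. The substitution
  \<open>v = w - c0\<close> centres the gap at the common eigenvalue, and \<open>C\<close> makes the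
  disc independent of the position of \<open>c0\<close>.\<close>

lemma (in bounded_support) potential_difference:
  fixes \<gamma> :: real
  assumes g: "g \<in> carrier_mat N N" and N: "N \<ge> 2" "(\<Sum>i=1..l. d i) = N"
    and d: "\<And>i. i \<in> {1..l} \<Longrightarrow> a i > 0 \<and> d i > 0 \<and> real (d i) = a i * ln (real N)"
    and c: "\<And>i. i \<in> {1..l} \<Longrightarrow> c i = c0" and c0: "cmod c0 \<le> C"
  defines "ns \<equiv> map d [1..<Suc l]"
  shows "ennreal \<bar>integral\<^sup>L (empirical_spectral_measure (perturbed_matrix \<gamma> N l d c g)) (log_potential \<phi>)
      - integral\<^sup>L (circle_mixture \<gamma> N l a c) (log_potential \<phi>)\<bar>
    \<le> ennreal B * (\<integral>\<^sup>+v. indicator (cball 0 (\<rho> + C)) v *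
        ennreal (potential_gap \<gamma> N (block_first ns) (block_len ns) (- (real N powr - \<gamma>)) v (\<lambda>p. g $$ p)) \<partial>lborel)"
proof -
  define X where "X = perturbed_matrix \<gamma> N l d c g"
  define S where "S = (\<lambda>w. \<Sum>i=1..l. d i * max (ln (cmod (w - c0))) ((1 / 2 - \<gamma>) * ln N / d i))"
  define G where "G = (\<lambda>v. potential_gap \<gamma> N (block_first ns) (block_len ns) (- (real N powr - \<gamma>)) v (\<lambda>p. g $$ p))"
  have X: "X \<in> carrier_mat N N" unfolding X_def by (rule poly_char_poly_perturbed(1)[OF g N(2) c])
  have sl: "sum_list ns = N"
    unfolding ns_def N(2)[symmetric] by (simp add: interv_sum_list_conv_sum_set_nat atLeastLessThanSuc_atLeastAtMost del: upt_Suc)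
  have S: "S w = (\<Sum>p<N. max (ln (cmod (w - c0))) ((1 / 2 - \<gamma>) * ln N / block_len ns p))" for w
  proof -
    have "(\<Sum>p<N. max (ln (cmod (w - c0))) ((1 / 2 - \<gamma>) * ln N / block_len ns p))
        = (\<Sum>n\<leftarrow>ns. n * max (ln (cmod (w - c0))) ((1 / 2 - \<gamma>) * ln N / n))"
      using sum_block_len[of "\<lambda>n. max (ln (cmod (w - c0))) ((1 / 2 - \<gamma>) * ln N / n)" ns] unfolding sl .
    then show ?thesis
      by (simp add: S_def ns_def comp_def interv_sum_list_conv_sum_set_nat atLeastLessThanSuc_atLeastAtMost del: upt_Suc)
  qed
  have poly: "poly (char_poly X) w
      = noisy_det N {..<N} (- (real N powr - \<gamma>)) (shift_mat (block_first ns) (block_len ns) (w - c0)) (\<lambda>p. g $$ p)" for w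
    unfolding X_def ns_def by (rule poly_char_poly_perturbed(2)[OF g N(2) c])
  have G: "\<bar>ln (cmod (poly (char_poly X) w)) / N - S w / N\<bar> = G (w - c0)" for w
    unfolding G_def S potential_gap_def poly
    using N(1) by (simp add: diff_divide_distrib[symmetric])
  have [measurable]: "G \<in> borel_measurable borel"
    unfolding G_def by (rule borel_measurable_potential_gap_left)
  have N1: "N \<ge> 1" using N(1) by simp
  note e1 = integral_log_potential_empirical[OF X N1]
  have e2: "integrable lborel (\<lambda>w. \<phi> w * (S w / N))"
    "integral\<^sup>L (circle_mixture \<gamma> N l a c) (log_potential \<phi>) = (\<integral>w. \<phi> w * (S w / N) \<partial>lborel)"
    unfolding S_def by (rule circle_mixture_potential[where d = d and a = a and c = c]; use d c N in force)+
  have "ennreal \<bar>integral\<^sup>L (empirical_spectral_measure X) (log_potential \<phi>) - integral\<^sup>L (circle_mixture \<gamma> N l a c) (log_potential \<phi>)\<bar>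
    = ennreal (norm (\<integral>w. \<phi> w * (ln (cmod (poly (char_poly X) w)) / N) - \<phi> w * (S w / N) \<partial>lborel))"
    unfolding e1(2) e2(2) by (subst Bochner_Integration.integral_diff[OF e1(1) e2(1)]) simp
  also have "\<dots> \<le> (\<integral>\<^sup>+w. ennreal (norm (\<phi> w * (ln (cmod (poly (char_poly X) w)) / N) - \<phi> w * (S w / N))) \<partial>lborel)"
    by (intro integral_norm_bound_ennreal Bochner_Integration.integrable_diff e1(1) e2(1))
  also have "\<dots> \<le> (\<integral>\<^sup>+w. ennreal B * (indicator (cball 0 (\<rho> + C)) (- c0 + w) * ennreal (G (- c0 + w))) \<partial>lborel)"
  proof (rule nn_integral_mono)
    fix w
    have "norm (\<phi> w * (ln (cmod (poly (char_poly X) w)) / N) - \<phi> w * (S w / N)) = \<bar>\<phi> w\<bar> * G (w - c0)"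
      unfolding G[symmetric] by (simp only: right_diff_distrib[symmetric] real_norm_def abs_mult)
    also have "\<dots> \<le> B * (indicator (cball 0 (\<rho> + C)) (- c0 + w) * G (- c0 + w))"
    proof (cases "cmod w \<le> \<rho>")
      case True
      then have "cmod (- c0 + w) \<le> \<rho> + C" using norm_triangle_ineq4[of w c0] c0 by simp
      moreover have "G (w - c0) \<ge> 0" using G[of w] by (metis abs_ge_zero)
      ultimately show ?thesis using bound[of w] by (simp add: mult_right_mono)
    next
      case False
      moreover have "G (- c0 + w) \<ge> 0" using G[of w] by (metis abs_ge_zero add.commute uminus_add_conv_diff)
      ultimately show ?thesis using supp[of w] B_nonneg by (simp add: indicator_def)
    qed
    finally show "ennreal (norm (\<phi> w * (ln (cmod (poly (char_poly X) w)) / N) - \<phi> w * (S w / N)))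
        \<le> ennreal B * (indicator (cball 0 (\<rho> + C)) (- c0 + w) * ennreal (G (- c0 + w)))"
      by (simp only: ennreal_scaled_indicator[OF B_nonneg] ennreal_leI)
  qed
  also have "\<dots> = (\<integral>\<^sup>+v. ennreal B * (indicator (cball 0 (\<rho> + C)) v * ennreal (G v)) \<partial>lborel)"
    by (rule nn_integral_lborel_shift) measurable
  also have "\<dots> = ennreal B * (\<integral>\<^sup>+v. indicator (cball 0 (\<rho> + C)) v * ennreal (G v) \<partial>lborel)"
    by (rule nn_integral_cmult) measurable
  finally show ?thesis unfolding X_def G_def .
qed

subsection \<open>Convergence in probability\<close>

text \<open>Transfers the estimates from the product space to the given random matrix. The
  restriction to the index square appears because points of a product space are extensional
  functions.\<close>

lemma distr_gaussian_matrix: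
  assumes G: "std_gaussian_matrix P N G" and N: "N \<ge> 1"
  shows "(\<lambda>\<omega>. \<lambda>p\<in>{..<N} \<times> {..<N}. G \<omega> $$ p) \<in> measurable P (gauss_sq N)"
    and "distr P (gauss_sq N) (\<lambda>\<omega>. \<lambda>p\<in>{..<N} \<times> {..<N}. G \<omega> $$ p) = gauss_sq N"
proof -
  define I where "I = {..<N} \<times> {..<N}"
  interpret prob_space P using G by (simp add: std_gaussian_matrix_def)
  have D: "distributed P lborel (\<lambda>\<omega>. G \<omega> $$ p) (\<lambda>x. ennreal (std_normal_density x))" if "p \<in> I" for p
    using G that by (auto simp: std_gaussian_matrix_def I_def)
  have rv: "(\<lambda>\<omega>. G \<omega> $$ p) \<in> borel_measurable P" if "p \<in> I" for p
    using distributed_measurable[OF D[OF that]] by simp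
  have "(\<lambda>\<omega>. \<lambda>p\<in>I. G \<omega> $$ p) \<in> measurable P (PiM I (\<lambda>_. borel))"
    by (rule measurable_restrict) (rule rv)
  then show m: "(\<lambda>\<omega>. \<lambda>p\<in>{..<N} \<times> {..<N}. G \<omega> $$ p) \<in> measurable P (gauss_sq N)"
    unfolding I_def by (simp add: measurable_cong_sets[OF refl sets_gauss])
  have "(0, 0) \<in> I" using N by (auto simp: I_def)
  then have ne: "I \<noteq> {}" by blast
  have iv: "indep_vars (\<lambda>_. borel) (\<lambda>p \<omega>. G \<omega> $$ p) I" using G by (simp add: std_gaussian_matrix_def I_def)
  have sd: "distr P borel (\<lambda>\<omega>. G \<omega> $$ p) = stdn" if "p \<in> I" for p
  proof -
    have "distr P borel (\<lambda>\<omega>. G \<omega> $$ p) = distr P lborel (\<lambda>\<omega>. G \<omega> $$ p)" by (rule distr_cong) auto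
    then show ?thesis using distributed_distr_eq_density[OF D[OF that]] by (simp add: stdn_def)
  qed
  have "distr P (gauss_sq N) (\<lambda>\<omega>. \<lambda>p\<in>I. G \<omega> $$ p) = distr P (PiM I (\<lambda>_. borel)) (\<lambda>\<omega>. \<lambda>p\<in>I. G \<omega> $$ p)"
    by (rule distr_cong) (simp_all add: sets_gauss I_def)
  also have "\<dots> = PiM I (\<lambda>p. distr P borel (\<lambda>\<omega>. G \<omega> $$ p))"
    using iv indep_vars_iff_distr_eq_PiM'[OF ne, where M' = "\<lambda>_. borel" and X = "\<lambda>p \<omega>. G \<omega> $$ p"] rv by simp
  also have "\<dots> = gauss_sq N"
    unfolding gauss_def I_def[symmetric] by (rule PiM_cong) (simp_all add: sd)
  finally show "distr P (gauss_sq N) (\<lambda>\<omega>. \<lambda>p\<in>{..<N} \<times> {..<N}. G \<omega> $$ p) = gauss_sq N" unfolding I_def .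
qed

text \<open>The entry function of a matrix is not extensional. A functional that reads only entries
  of the index square does not notice the difference.\<close>

lemma nn_integral_gaussian_matrix:
  assumes G: "std_gaussian_matrix P N G" and N: "N \<ge> 1" and H: "H \<in> borel_measurable (gauss_sq N)"
    and restr: "\<And>\<omega>. H (restrict \<omega> ({..<N} \<times> {..<N})) = H \<omega>"
  shows "(\<lambda>\<omega>. H (\<lambda>p. G \<omega> $$ p)) \<in> borel_measurable P"
    and "(\<integral>\<^sup>+\<omega>. H (\<lambda>p. G \<omega> $$ p) \<partial>P) = (\<integral>\<^sup>+\<omega>. H \<omega> \<partial>gauss_sq N)"
proof -
  note m = distr_gaussian_matrix(1)[OF G N]
  have eq: "H (\<lambda>p. G \<omega> $$ p) = H (\<lambda>p\<in>{..<N} \<times> {..<N}. G \<omega> $$ p)" for \<omega>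
    by (rule restr[symmetric])
  show "(\<lambda>\<omega>. H (\<lambda>p. G \<omega> $$ p)) \<in> borel_measurable P"
    unfolding eq by (rule measurable_compose[OF m H])
  show "(\<integral>\<^sup>+\<omega>. H (\<lambda>p. G \<omega> $$ p) \<partial>P) = (\<integral>\<^sup>+\<omega>. H \<omega> \<partial>gauss_sq N)"
    unfolding eq using nn_integral_distr[OF m, of H] H distr_gaussian_matrix(2)[OF G N] by simp
qed

lemma potential_gap_restrict:
  "potential_gap \<gamma> N f len \<delta> v (restrict \<omega> ({..<N} \<times> {..<N})) = potential_gap \<gamma> N f len \<delta> v \<omega>"
proof -
  have "noisy_det N {..<N} \<delta> (shift_mat f len v) (restrict \<omega> ({..<N} \<times> {..<N}))
      = noisy_det N {..<N} \<delta> (shift_mat f len v) \<omega>"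
    by (rule noisy_det_cong) auto
  then show ?thesis by (simp add: potential_gap_def)
qed

lemma prob_space_mixture:
  assumes I: "finite I" and M: "\<And>i. i \<in> I \<Longrightarrow> sets (M i) = sets borel" "\<And>i. i \<in> I \<Longrightarrow> prob_space (M i)"
    and w: "\<And>i. i \<in> I \<Longrightarrow> w i \<ge> 0" "(\<Sum>i\<in>I. w i) = 1"
  shows "prob_space (mixture I w M)"
proof
  have "emeasure (M i) UNIV = 1" if "i \<in> I" for i
    using prob_space.emeasure_space_1[OF M(2)[OF that]] sets_eq_imp_space_eq[OF M(1)[OF that]] by simp
  then have "emeasure (mixture I w M) UNIV = (\<Sum>i\<in>I. ennreal (w i))"
    by (subst emeasure_mixture[OF M(1)]) auto
  also have "\<dots> = ennreal (\<Sum>i\<in>I. w i)" by (rule sum_ennreal) (rule w)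
  finally show "emeasure (mixture I w M) (space (mixture I w M)) = 1" using w(2) by simp
qed

lemma prob_space_empirical:
  assumes X: "X \<in> carrier_mat N N" and N: "N \<ge> 1"
  shows "prob_space (empirical_spectral_measure X)"
  unfolding empirical_spectral_measure_def
proof (rule prob_space_mixture[OF finite_eigenvalues[OF X N]])
  have "(\<Sum>z | poly (char_poly X) z = 0. real (Polynomial.order z (char_poly X))) = N"
    using sum_order[OF X N] by (metis of_nat_sum)
  then show "(\<Sum>z | eigenvalue X z. real (Polynomial.order z (char_poly X)) / real (dim_row X)) = 1"
    unfolding eigenvalues_roots[OF X N] using X N by (simp add: sum_divide_distrib[symmetric])
qed (auto intro: prob_space_return)

lemma prob_space_circle_mixture:
  assumes "\<And>i. i \<in> {1..l} \<Longrightarrow> a i > 0" "(\<Sum>i=1..l. a i * ln (real N)) = real N" "N \<ge> 2"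
  shows "prob_space (circle_mixture \<gamma> N l a c)"
  unfolding circle_mixture_def
  by (rule prob_space_mixture)
     (use assms in \<open>auto simp: prob_space_uniform_circle sum_divide_distrib[symmetric] less_imp_le\<close>)

lemma sets_circle_mixture [simp, measurable_cong]: "sets (circle_mixture \<gamma> N l a c) = sets borel"
  by (simp add: circle_mixture_def)

lemma sets_empirical [simp, measurable_cong]: "sets (empirical_spectral_measure X) = sets borel"
  by (simp add: empirical_spectral_measure_def)

text \<open>The first circle has positive weight in the mixture and therefore meets
  \<open>K\<close>. Its radius is at most 1 because \<open>\<gamma> > 1 / 2\<close>.\<close>

lemma cmod_centre_le:
  assumes K: "K \<subseteq> cball 0 R" "closed K" and l: "l \<ge> 1" and a: "\<And>i. i \<in> {1..l} \<Longrightarrow> a i > 0"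
    and N: "N \<ge> 2" and \<gamma>: "\<gamma> > 1 / 2" and null: "emeasure (circle_mixture \<gamma> N l a c) (- K) = 0"
  shows "cmod (c 1) \<le> R + 1"
proof -
  define r where "r = exp ((- \<gamma> + 1 / 2) / a 1)"
  have a1: "a 1 > 0" using a l by simp
  have r: "0 < r" "r \<le> 1" using a1 \<gamma> by (simp_all add: r_def divide_le_0_iff)
  have Kb: "- K \<in> sets borel" using K(2) by (intro borel_open) auto
  have "ennreal (a 1 * ln N / N) * emeasure (uniform_circle (c 1) r) (- K) \<le>
      (\<Sum>i\<in>{1..l}. ennreal (a i * ln N / N) * emeasure (uniform_circle (c i) (exp ((- \<gamma> + 1 / 2) / a i))) (- K))"
    unfolding r_def using l by (intro member_le_sum) auto
  also have "\<dots> = 0"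
    using null unfolding circle_mixture_def by (subst (asm) emeasure_mixture) (use Kb in auto)
  finally have "emeasure (uniform_circle (c 1) r) (- K) = 0"
    using a1 N by (auto simp: ennreal_eq_0_iff mult_le_0_iff divide_le_0_iff)
  moreover have "emeasure (uniform_circle (c 1) r) (- K) = emeasure angle ((\<lambda>t. c 1 + of_real r * cis t) -` (- K))"
    unfolding uniform_circle_angle using Kb by (subst emeasure_distr) auto
  ultimately have "(\<lambda>t. c 1 + of_real r * cis t) -` (- K) \<noteq> UNIV"
    using angle.emeasure_space_1 by auto
  then obtain t where "c 1 + of_real r * cis t \<in> K" by auto
  then have "cmod (c 1 + of_real r * cis t) \<le> R" using K(1) by auto
  moreover have "cmod (c 1) \<le> cmod (c 1 + of_real r * cis t) + cmod (of_real r * cis t)"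
    using norm_triangle_ineq4[of "c 1 + of_real r * cis t" "of_real r * cis t"] by simp
  ultimately show ?thesis using r by (simp add: norm_mult)
qed

text \<open>Measurability of the events is not needed: they are covered by measurable ones.\<close>

definition vanishing :: "(nat \<Rightarrow> 'w measure) \<Rightarrow> (nat \<Rightarrow> 'w set) \<Rightarrow> bool" where
  "vanishing P S \<longleftrightarrow> (\<exists>E. (\<forall>N\<ge>2. E N \<in> sets (P N) \<and> S N \<inter> space (P N) \<subseteq> E N) \<and> (\<lambda>N. measure (P N) (E N)) \<longlonglongrightarrow> 0)"

lemma vanishing_union:
  assumes "vanishing P S" "vanishing P T" and P: "\<And>N. N \<ge> 2 \<Longrightarrow> prob_space (P N)"
    and sub: "\<forall>\<^sub>F N in sequentially. U N \<inter> space (P N) \<subseteq> S N \<union> T N"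
  shows "(\<lambda>N. measure (P N) (U N \<inter> space (P N))) \<longlonglongrightarrow> 0"
proof -
  obtain E where E: "\<And>N. N \<ge> 2 \<Longrightarrow> E N \<in> sets (P N) \<and> S N \<inter> space (P N) \<subseteq> E N" "(\<lambda>N. measure (P N) (E N)) \<longlonglongrightarrow> 0"
    using assms(1) unfolding vanishing_def by blast
  obtain F where F: "\<And>N. N \<ge> 2 \<Longrightarrow> F N \<in> sets (P N) \<and> T N \<inter> space (P N) \<subseteq> F N" "(\<lambda>N. measure (P N) (F N)) \<longlonglongrightarrow> 0"
    using assms(2) unfolding vanishing_def by blast
  have "(\<lambda>N. measure (P N) (E N) + measure (P N) (F N)) \<longlonglongrightarrow> 0"
    using tendsto_add[OF E(2) F(2)] by simp
  then show ?thesis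
  proof (rule tendsto_sandwich[OF _ _ tendsto_const, rotated 2])
    show "\<forall>\<^sub>F N in sequentially. 0 \<le> measure (P N) (U N \<inter> space (P N))" by simp
    show "\<forall>\<^sub>F N in sequentially. measure (P N) (U N \<inter> space (P N)) \<le> measure (P N) (E N) + measure (P N) (F N)"
      using sub eventually_ge_at_top[of 2]
    proof eventually_elim
      case (elim N)
      interpret prob_space "P N" by (rule P) fact
      have "measure (P N) (U N \<inter> space (P N)) \<le> measure (P N) (E N \<union> F N)"
        using elim E(1) F(1) by (intro finite_measure_mono) blast+
      also have "\<dots> \<le> measure (P N) (E N) + measure (P N) (F N)"
        using elim E(1) F(1) by (intro measure_Un_le) auto
      finally show ?case .
    qed
  qed
qed

lemma vanishing_markov:
  assumes P: "\<And>N. N \<ge> 2 \<Longrightarrow> prob_space (P N)"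
    and H: "\<And>N. N \<ge> 2 \<Longrightarrow> H N \<in> borel_measurable (P N)" and lim: "(\<lambda>N. \<integral>\<^sup>+\<omega>. H N \<omega> \<partial>P N) \<longlonglongrightarrow> 0" and \<epsilon>: "\<epsilon> > 0"
    and sub: "\<And>N \<omega>. N \<ge> 2 \<Longrightarrow> \<omega> \<in> S N \<Longrightarrow> \<omega> \<in> space (P N) \<Longrightarrow> ennreal \<epsilon> \<le> H N \<omega>"
  shows "vanishing P S"
  unfolding vanishing_def
proof (intro exI conjI allI impI)
  let ?E = "\<lambda>N. {\<omega> \<in> space (P N). 1 \<le> ennreal (1 / \<epsilon>) * H N \<omega>}"
  show "?E N \<in> sets (P N)" if "N \<ge> 2" for N
    using H[OF that] by measurable
  show "S N \<inter> space (P N) \<subseteq> ?E N" if "N \<ge> 2" for N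
  proof safe
    fix \<omega> assume "\<omega> \<in> S N" "\<omega> \<in> space (P N)"
    then have "ennreal (1 / \<epsilon>) * ennreal \<epsilon> \<le> ennreal (1 / \<epsilon>) * H N \<omega>"
      using sub[OF that] by (intro mult_left_mono) auto
    then show "1 \<le> ennreal (1 / \<epsilon>) * H N \<omega>" using \<epsilon> by (simp add: ennreal_mult[symmetric])
  qed
  have "(\<lambda>N. ennreal (1 / \<epsilon>) * (\<integral>\<^sup>+\<omega>. H N \<omega> \<partial>P N)) \<longlonglongrightarrow> ennreal (1 / \<epsilon>) * 0"
    by (rule ennreal_tendsto_cmult[OF _ lim]) simp
  then have l: "(\<lambda>N. ennreal (1 / \<epsilon>) * (\<integral>\<^sup>+\<omega>. H N \<omega> \<partial>P N)) \<longlonglongrightarrow> 0" by simp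
  have "(\<lambda>N. ennreal (measure (P N) (?E N))) \<longlonglongrightarrow> ennreal 0"
    unfolding ennreal_0
  proof (rule tendsto_sandwich[OF _ _ tendsto_const l])
    show "\<forall>\<^sub>F N in sequentially. 0 \<le> ennreal (measure (P N) (?E N))" by simp
    show "\<forall>\<^sub>F N in sequentially. ennreal (measure (P N) (?E N)) \<le> ennreal (1 / \<epsilon>) * (\<integral>\<^sup>+\<omega>. H N \<omega> \<partial>P N)"
      using eventually_ge_at_top[of 2]
    proof eventually_elim
      case (elim N)
      interpret prob_space "P N" by (rule P) fact
      show ?case
        using nn_integral_Markov_inequality[of "H N" "space (P N)" "P N" "ennreal (1 / \<epsilon>)"] H[OF elim]
        by (simp add: emeasure_eq_measure)
    qed
  qed
  then show "(\<lambda>N. measure (P N) (?E N)) \<longlonglongrightarrow> 0"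
    by (rule tendsto_ennrealD) simp_all
qed

theorem corollary1p5:
  fixes \<gamma> :: real
    and l :: "nat \<Rightarrow> nat"
    and a :: "nat \<Rightarrow> nat \<Rightarrow> real"
    and d :: "nat \<Rightarrow> nat \<Rightarrow> nat"
    and c :: "nat \<Rightarrow> nat \<Rightarrow> complex"
    and P :: "nat \<Rightarrow> 'w measure"
    and G :: "nat \<Rightarrow> 'w \<Rightarrow> real mat"
    and K :: "complex set"
    and \<mu> :: "complex measure"
  assumes a_pos: "\<And>N i. N \<ge> 2 \<Longrightarrow> i \<in> {1..l N} \<Longrightarrow> a N i > 0"
    and block_dim: "\<And>N i. N \<ge> 2 \<Longrightarrow> i \<in> {1..l N} \<Longrightarrow>
          d N i > 0 \<and> real (d N i) = a N i * ln (real N)"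
    and total_dim: "\<And>N. N \<ge> 2 \<Longrightarrow> (\<Sum>i=1..l N. a N i * ln (real N)) = real N"
    and gaussian: "\<And>N. N \<ge> 2 \<Longrightarrow> std_gaussian_matrix (P N) N (G N)"
    and gamma: "\<gamma> > 1 / 2"
    and few_blocks: "(\<lambda>N. real (l N)) \<in> o(\<lambda>N. real N)"
    and same_eigenvalue: "\<And>N i. N \<ge> 2 \<Longrightarrow> i \<in> {2..l N} \<Longrightarrow> c N i = c N 1"
    and compact_K: "compact K"
    and supported: "\<And>N. N \<ge> 2 \<Longrightarrow>
          emeasure (circle_mixture \<gamma> N (l N) (a N) (c N)) (- K) = 0"
    and prob_mu: "prob_space \<mu>" "sets \<mu> = sets borel"
    and weak_limit: "weakly_converges (\<lambda>N. circle_mixture \<gamma> N (l N) (a N) (c N)) \<mu>"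
  shows "weakly_converges_in_probability P
     (\<lambda>N \<omega>. empirical_spectral_measure (perturbed_matrix \<gamma> N (l N) (d N) (c N) (G N \<omega>))) \<mu>"
proof -
  define \<mu>s where "\<mu>s = (\<lambda>N. circle_mixture \<gamma> N (l N) (a N) (c N))"
  define X where "X = (\<lambda>N \<omega>. perturbed_matrix \<gamma> N (l N) (d N) (c N) (G N \<omega>))"
  define L where "L = (\<lambda>N \<omega>. empirical_spectral_measure (X N \<omega>))"
  define ns where "ns = (\<lambda>N. map (d N) [1..<Suc (l N)])"
  obtain R where "\<forall>x\<in>K. norm x \<le> R"
    using compact_imp_bounded[OF compact_K] unfolding bounded_iff by blast
  then have R: "K \<subseteq> cball 0 R" by auto
  have sumd: "(\<Sum>i=1..l N. d N i) = N" if "N \<ge> 2" for N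
  proof -
    have "real (\<Sum>i=1..l N. d N i) = (\<Sum>i=1..l N. a N i * ln (real N))"
      unfolding of_nat_sum using block_dim[OF that] by (intro sum.cong) auto
    then show ?thesis using total_dim[OF that] by (simp only: of_nat_eq_iff)
  qed
  have l1: "l N \<ge> 1" if "N \<ge> 2" for N using sumd[OF that] that by (cases "l N") auto
  have dd: "a N i > 0 \<and> d N i > 0 \<and> real (d N i) = a N i * ln (real N)" if "N \<ge> 2" "i \<in> {1..l N}" for N i
    using a_pos[OF that] block_dim[OF that] by blast
  have cc: "c N i = c N 1" if "N \<ge> 2" "i \<in> {1..l N}" for N i
    using same_eigenvalue[OF that(1), of i] that(2) by (cases "i = 1") auto
  \<comment> \<open>A common bound for the centres keeps the disc of integration fixed while
    \<open>N\<close> grows.\<close>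
  have C: "cmod (c N 1) \<le> R + 1" if "N \<ge> 2" for N
    by (rule cmod_centre_le[OF R compact_imp_closed[OF compact_K] l1[OF that] a_pos[OF that] that gamma supported[OF that]])
  have Xc: "X N \<omega> \<in> carrier_mat N N" if "N \<ge> 2" "\<omega> \<in> space (P N)" for N \<omega>
    unfolding X_def
    by (rule poly_char_poly_perturbed(1)[OF _ sumd[OF that(1)] cc[OF that(1)]])
       (use gaussian[OF that(1)] that(2) in \<open>auto simp: std_gaussian_matrix_def\<close>)
  have PP: "prob_space (P N)" if "N \<ge> 2" for N using gaussian[OF that] by (simp add: std_gaussian_matrix_def)
  have PL: "prob_space (L N \<omega>)" if "N \<ge> 2" "\<omega> \<in> space (P N)" for N \<omega>
    unfolding L_def by (rule prob_space_empirical[OF Xc[OF that]]) (use that in simp)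
  have P\<mu>: "prob_space (\<mu>s N)" if "N \<ge> 2" for N
    unfolding \<mu>s_def by (rule prob_space_circle_mixture[OF a_pos[OF that] total_dim[OF that] that])
  have sets [measurable_cong]: "sets (L N \<omega>) = sets borel" "sets (\<mu>s N) = sets borel" for N \<omega>
    by (simp_all add: L_def \<mu>s_def)
  have "sum_list (ns N) = (\<Sum>i=1..l N. d N i)" for N
    unfolding ns_def by (simp add: interv_sum_list_conv_sum_set_nat atLeastLessThanSuc_atLeastAtMost del: upt_Suc)
  then have sl: "sum_list (ns N) = N" if "N \<ge> 2" for N
    using sumd[OF that] by metis
  define H where "H = (\<lambda>\<rho> N \<omega>. \<integral>\<^sup>+v. indicator (cball 0 \<rho>) v *
        ennreal (potential_gap \<gamma> N (block_first (ns N)) (block_len (ns N)) (- (real N powr - \<gamma>)) v \<omega>) \<partial>lborel)"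
  have part: "block_partition N (block_first (ns N)) (block_len (ns N))" if "N \<ge> 2" for N
    using block_partition_list[of "ns N"] unfolding sl[OF that] .
  have card: "card (block_partition.Lasts N (block_first (ns N)) (block_len (ns N))) = l N" if N: "N \<ge> 2" for N
  proof -
    have "\<forall>n\<in>set (ns N). n > 0" using block_dim[OF N] by (auto simp: ns_def)
    from card_block_lasts[OF this] show ?thesis unfolding sl[OF N] by (simp add: ns_def del: upt_Suc)
  qed
  have few: "(\<lambda>N. real (card (block_partition.Lasts N (block_first (ns N)) (block_len (ns N)))) / N) \<longlonglongrightarrow> 0"
  proof (rule Lim_transform_eventually)
    show "(\<lambda>N. real (l N) / N) \<longlonglongrightarrow> 0" using smalloD_tendsto[OF few_blocks] .
    show "\<forall>\<^sub>F N in sequentially. real (l N) / N = real (card (block_partition.Lasts N (block_first (ns N)) (block_len (ns N)))) / N"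
      using eventually_ge_at_top[of 2] by eventually_elim (simp add: card)
  qed
  have H_lim: "(\<lambda>N. \<integral>\<^sup>+\<omega>. H \<rho> N \<omega> \<partial>gauss_sq N) \<longlonglongrightarrow> 0" for \<rho>
    unfolding H_def by (rule integrated_gap_tendsto[OF part few _ gamma]) simp_all
  have H_meas: "H \<rho> N \<in> borel_measurable (gauss_sq N)" for \<rho> N
    unfolding H_def by (rule integrated_gap_swap(1))
  have H_restrict: "H \<rho> N (restrict \<omega> ({..<N} \<times> {..<N})) = H \<rho> N \<omega>" for \<rho> N \<omega>
    unfolding H_def potential_gap_restrict ..
  have bint: "integrable M \<phi>" if "prob_space M" "sets M = sets borel" "\<And>w. \<bar>\<phi> w\<bar> \<le> B" "\<phi> \<in> borel_measurable borel"
    for M :: "complex measure" and \<phi> :: "complex \<Rightarrow> real" and B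
  proof -
    interpret prob_space M by fact
    have "\<phi> \<in> borel_measurable M" using that by (simp cong: measurable_cong_sets)
    then show ?thesis using that(3) by (intro integrable_const_bound[where B = B]) auto
  qed
  \<comment> \<open>For test functions of bounded support: replacing them by a logarithmic potential
    costs \<open>\<epsilon> / 4\<close> for each of the two measures, which leaves
    \<open>\<epsilon> / 2\<close> for the difference of the potentials, controlled by Markov's
    inequality.\<close>
  have core: "vanishing P (\<lambda>N. {\<omega>. \<bar>(\<integral>z. \<phi> z \<partial>L N \<omega>) - (\<integral>z. \<phi> z \<partial>\<mu>s N)\<bar> > \<epsilon>})"
    if cont: "continuous_on UNIV \<phi>" and supp: "\<And>w. cmod w > \<rho> \<Longrightarrow> \<phi> w = 0"
      and b: "\<And>w. \<bar>\<phi> w\<bar> \<le> b" and \<epsilon>: "\<epsilon> > 0" for \<phi> :: "complex \<Rightarrow> real" and \<rho> b \<epsilon>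
  proof -
    have [measurable]: "\<phi> \<in> borel_measurable borel" using cont by (rule borel_measurable_continuous_onI)
    obtain \<Phi> B' \<rho>' where \<Phi>: "bounded_support \<Phi> B' \<rho>'" "\<And>v. \<bar>log_potential \<Phi> v - \<phi> v\<bar> \<le> \<epsilon> / 4"
      using log_potential_approximation[where \<eta> = "\<epsilon> / 4", OF cont supp] \<epsilon>
      by (metis divide_pos_pos zero_less_numeral)
    interpret \<Phi>: bounded_support \<Phi> B' \<rho>' by fact
    have close: "\<bar>(\<integral>z. log_potential \<Phi> z \<partial>M) - (\<integral>z. \<phi> z \<partial>M)\<bar> \<le> \<epsilon> / 4" if M: "prob_space M" "sets M = sets borel" for M
    proof -
      interpret prob_space M by fact
      have "\<bar>log_potential \<Phi> v\<bar> \<le> b + \<epsilon> / 4" for v using \<Phi>(2)[of v] b[of v] by linarith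
      then have i: "integrable M (log_potential \<Phi>)" by (rule bint[OF M]) measurable
      have j: "integrable M \<phi>" by (rule bint[OF M b]) measurable
      have "\<bar>(\<integral>z. log_potential \<Phi> z \<partial>M) - (\<integral>z. \<phi> z \<partial>M)\<bar> = \<bar>\<integral>z. log_potential \<Phi> z - \<phi> z \<partial>M\<bar>"
        using i j by simp
      also have "\<dots> \<le> (\<integral>z. \<bar>log_potential \<Phi> z - \<phi> z\<bar> \<partial>M)" by (rule integral_abs_bound)
      also have "\<dots> \<le> (\<integral>z. \<epsilon> / 4 \<partial>M)" using i j \<Phi>(2) by (intro integral_mono) auto
      finally show ?thesis using prob_space by simp
    qed
    show ?thesis
    proof (rule vanishing_markov[where H = "\<lambda>N \<omega>. ennreal B' * H (\<rho>' + (R + 1)) N (\<lambda>p. G N \<omega> $$ p)" and \<epsilon> = "\<epsilon> / 2", OF PP])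
      show "(\<lambda>\<omega>. ennreal B' * H (\<rho>' + (R + 1)) N (\<lambda>p. G N \<omega> $$ p)) \<in> borel_measurable (P N)" if "N \<ge> 2" for N
        using nn_integral_gaussian_matrix(1)[OF gaussian[OF that] _ H_meas H_restrict] that by simp
      have "(\<lambda>N. ennreal B' * (\<integral>\<^sup>+\<omega>. H (\<rho>' + (R + 1)) N \<omega> \<partial>gauss_sq N)) \<longlonglongrightarrow> ennreal B' * 0"
        by (rule ennreal_tendsto_cmult[OF _ H_lim]) simp
      then have "(\<lambda>N. ennreal B' * (\<integral>\<^sup>+\<omega>. H (\<rho>' + (R + 1)) N \<omega> \<partial>gauss_sq N)) \<longlonglongrightarrow> 0" by simp
      then show "(\<lambda>N. \<integral>\<^sup>+\<omega>. ennreal B' * H (\<rho>' + (R + 1)) N (\<lambda>p. G N \<omega> $$ p) \<partial>P N) \<longlonglongrightarrow> 0"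
      proof (rule Lim_transform_eventually)
        show "\<forall>\<^sub>F N in sequentially. ennreal B' * (\<integral>\<^sup>+\<omega>. H (\<rho>' + (R + 1)) N \<omega> \<partial>gauss_sq N)
            = (\<integral>\<^sup>+\<omega>. ennreal B' * H (\<rho>' + (R + 1)) N (\<lambda>p. G N \<omega> $$ p) \<partial>P N)"
          using eventually_ge_at_top[of 2]
        proof eventually_elim
          case (elim N)
          then have N1: "N \<ge> 1" by simp
          note g = nn_integral_gaussian_matrix[OF gaussian[OF elim] N1 H_meas H_restrict]
          show ?case unfolding nn_integral_cmult[OF g(1)] g(2) ..
        qed
      qed
      show "\<epsilon> / 2 > 0" using \<epsilon> by simp
      fix N \<omega>
      assume N: "N \<ge> 2" and ev: "\<omega> \<in> {\<omega>. \<bar>(\<integral>z. \<phi> z \<partial>L N \<omega>) - (\<integral>z. \<phi> z \<partial>\<mu>s N)\<bar> > \<epsilon>}" and \<omega>: "\<omega> \<in> space (P N)"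
      have g: "G N \<omega> \<in> carrier_mat N N" using gaussian[OF N] \<omega> by (auto simp: std_gaussian_matrix_def)
      have "\<epsilon> / 2 \<le> \<bar>(\<integral>z. log_potential \<Phi> z \<partial>L N \<omega>) - (\<integral>z. log_potential \<Phi> z \<partial>\<mu>s N)\<bar>"
      proof -
        have "\<epsilon> / 2 \<le> \<bar>p - q\<bar>" if "\<bar>p - x\<bar> \<le> \<epsilon> / 4" "\<bar>q - y\<bar> \<le> \<epsilon> / 4" "\<bar>x - y\<bar> > \<epsilon>" for p q x y :: real
          using that by (simp add: abs_le_iff abs_if split: if_splits)
        then show ?thesis
          using close[OF PL[OF N \<omega>] sets(1)] close[OF P\<mu>[OF N] sets(2)] ev by blast
      qed
      then have "ennreal (\<epsilon> / 2) \<le> ennreal \<bar>(\<integral>z. log_potential \<Phi> z \<partial>L N \<omega>) - (\<integral>z. log_potential \<Phi> z \<partial>\<mu>s N)\<bar>"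
        by (rule ennreal_leI)
      also have "\<dots> \<le> ennreal B' * H (\<rho>' + (R + 1)) N (\<lambda>p. G N \<omega> $$ p)"
        unfolding H_def L_def X_def \<mu>s_def ns_def
        by (rule \<Phi>.potential_difference[OF g N sumd[OF N] dd[OF N] cc[OF N] C[OF N]])
      finally show "ennreal (\<epsilon> / 2) \<le> ennreal B' * H (\<rho>' + (R + 1)) N (\<lambda>p. G N \<omega> $$ p)" .
    qed
  qed
  \<comment> \<open>The empirical measures need not live in a fixed disc. Testing them with
    \<open>cut\<close>, which is 1 on \<open>K\<close>, shows that in probability almost no mass
    escapes, and this reduces bounded test functions to those of bounded support.\<close>
  define cut where "cut = (\<lambda>w::complex. max 0 (min 1 (R + 1 - cmod w)))"
  have cut: "continuous_on UNIV cut" "\<And>w. 0 \<le> cut w" "\<And>w. cut w \<le> 1" "\<And>w. cmod w > R + 1 \<Longrightarrow> cut w = 0" "\<And>w. cmod w \<le> R \<Longrightarrow> cut w = 1"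
    by (auto simp: cut_def intro!: continuous_intros)
  have cutb: "\<bar>cut w\<bar> \<le> 1" for w using cut(2,3)[of w] by simp
  have [measurable]: "cut \<in> borel_measurable borel" using cut(1) by (rule borel_measurable_continuous_onI)
  show ?thesis
    unfolding weakly_converges_in_probability_def
  proof (intro allI impI)
    fix \<phi> :: "complex \<Rightarrow> real" and \<epsilon> :: real
    assume \<phi>: "continuous_on UNIV \<phi> \<and> bounded (range \<phi>)" and \<epsilon>: "\<epsilon> > 0"
    have [measurable]: "\<phi> \<in> borel_measurable borel" using \<phi> by (auto intro: borel_measurable_continuous_onI)
    obtain B where B: "B > 0" "\<And>w. \<bar>\<phi> w\<bar> \<le> B" using \<phi> by (auto simp: bounded_pos)
    have phicutb: "\<bar>\<phi> w * cut w\<bar> \<le> B" for w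
      using mult_mono[OF B(2)[of w] cutb[of w]] B(1) by (simp add: abs_mult)
    \<comment> \<open>The budget is \<open>\<epsilon> / 2\<close> for the weak limit of the
      mixtures, \<open>\<epsilon> / 4\<close> for the truncated test function, and
      \<open>\<epsilon> / 4\<close> for the mass missed by \<open>cut\<close>, on which the test
      function is at most \<open>B\<close>.\<close>
    define S where "S = (\<lambda>N. {\<omega>. \<bar>(\<integral>z. \<phi> z * cut z \<partial>L N \<omega>) - (\<integral>z. \<phi> z * cut z \<partial>\<mu>s N)\<bar> > \<epsilon> / 4})"
    define T where "T = (\<lambda>N. {\<omega>. \<bar>(\<integral>z. cut z \<partial>L N \<omega>) - (\<integral>z. cut z \<partial>\<mu>s N)\<bar> > \<epsilon> / (4 * B)})"
    have "vanishing P S" unfolding S_def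
      by (rule core[of _ "R + 1" B]) (use \<phi> cut \<epsilon> phicutb in \<open>auto intro!: continuous_intros\<close>)
    moreover have "vanishing P T" unfolding T_def
      by (rule core[of _ "R + 1" 1]) (use cut \<epsilon> B(1) cutb in auto)
    moreover have "\<forall>\<^sub>F N in sequentially. {\<omega>. \<bar>(\<integral>z. \<phi> z \<partial>L N \<omega>) - (\<integral>z. \<phi> z \<partial>\<mu>)\<bar> > \<epsilon>} \<inter> space (P N) \<subseteq> S N \<union> T N"
    proof -
      have "(\<lambda>N. \<integral>z. \<phi> z \<partial>\<mu>s N) \<longlonglongrightarrow> (\<integral>z. \<phi> z \<partial>\<mu>)"
        using weak_limit \<phi> unfolding weakly_converges_def \<mu>s_def by blast
      then have "\<forall>\<^sub>F N in sequentially. dist (\<integral>z. \<phi> z \<partial>\<mu>s N) (\<integral>z. \<phi> z \<partial>\<mu>) < \<epsilon> / 2"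
        using \<epsilon> by (intro tendstoD) auto
      then show ?thesis using eventually_ge_at_top[of 2]
      proof eventually_elim
        case (elim N)
        then have N: "N \<ge> 2" and near: "\<bar>(\<integral>z. \<phi> z \<partial>\<mu>s N) - (\<integral>z. \<phi> z \<partial>\<mu>)\<bar> < \<epsilon> / 2" by (simp_all add: dist_real_def)
        interpret M: prob_space "\<mu>s N" by (rule P\<mu>[OF N])
        have "AE z in \<mu>s N. z \<notin> - K"
          using supported[OF N] compact_imp_closed[OF compact_K]
          by (intro AE_not_in null_setsI) (auto simp: \<mu>s_def intro: borel_open)
        then have ae: "AE z in \<mu>s N. cut z = 1" by eventually_elim (use R cut(5) in auto)
        have mcut: "(\<integral>z. cut z \<partial>\<mu>s N) = 1"
        proof -
          have "(\<integral>z. cut z \<partial>\<mu>s N) = (\<integral>z. 1 \<partial>\<mu>s N)" by (rule integral_cong_AE) (use ae in auto)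
          then show ?thesis using M.prob_space by simp
        qed
        have mphi: "(\<integral>z. \<phi> z * cut z \<partial>\<mu>s N) = (\<integral>z. \<phi> z \<partial>\<mu>s N)"
          by (rule integral_cong_AE) (measurable, use ae in eventually_elim, simp)
        show ?case
        proof (rule subsetI, rule ccontr)
          fix \<omega>
          assume "\<omega> \<in> {\<omega>. \<bar>(\<integral>z. \<phi> z \<partial>L N \<omega>) - (\<integral>z. \<phi> z \<partial>\<mu>)\<bar> > \<epsilon>} \<inter> space (P N)" and nST: "\<omega> \<notin> S N \<union> T N"
          then have \<omega>: "\<omega> \<in> space (P N)" and far: "\<bar>(\<integral>z. \<phi> z \<partial>L N \<omega>) - (\<integral>z. \<phi> z \<partial>\<mu>)\<bar> > \<epsilon>" by auto
          interpret L: prob_space "L N \<omega>" by (rule PL[OF N \<omega>])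
          have i: "integrable (L N \<omega>) \<phi>" "integrable (L N \<omega>) cut" "integrable (L N \<omega>) (\<lambda>z. \<phi> z * cut z)"
            by (rule bint[OF PL[OF N \<omega>] sets(1) B(2)], measurable)
               (rule bint[OF PL[OF N \<omega>] sets(1) cutb], measurable, rule bint[OF PL[OF N \<omega>] sets(1) phicutb], measurable)
          have s: "\<bar>(\<integral>z. \<phi> z * cut z \<partial>L N \<omega>) - (\<integral>z. \<phi> z \<partial>\<mu>s N)\<bar> \<le> \<epsilon> / 4"
            and t: "\<bar>(\<integral>z. cut z \<partial>L N \<omega>) - 1\<bar> \<le> \<epsilon> / (4 * B)"
            using nST mcut mphi by (auto simp: S_def T_def)
          have "\<bar>(\<integral>z. \<phi> z \<partial>L N \<omega>) - (\<integral>z. \<phi> z * cut z \<partial>L N \<omega>)\<bar> = \<bar>\<integral>z. \<phi> z - \<phi> z * cut z \<partial>L N \<omega>\<bar>"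
            using i by simp
          also have "\<dots> \<le> (\<integral>z. \<bar>\<phi> z - \<phi> z * cut z\<bar> \<partial>L N \<omega>)" by (rule integral_abs_bound)
          also have "\<dots> \<le> (\<integral>z. B * (1 - cut z) \<partial>L N \<omega>)"
          proof (rule integral_mono)
            fix z
            have "\<phi> z - \<phi> z * cut z = \<phi> z * (1 - cut z)" by (simp add: right_diff_distrib)
            then have "\<bar>\<phi> z - \<phi> z * cut z\<bar> = \<bar>\<phi> z\<bar> * (1 - cut z)"
              using cut(3)[of z] by (simp add: abs_mult)
            then show "\<bar>\<phi> z - \<phi> z * cut z\<bar> \<le> B * (1 - cut z)"
              using B(2)[of z] cut(3)[of z] by (simp add: mult_right_mono)
          qed (use i in auto)
          also have "\<dots> = B * (1 - (\<integral>z. cut z \<partial>L N \<omega>))" using i L.prob_space by simp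
          also have "\<dots> \<le> B * (\<epsilon> / (4 * B))" using t B(1) by (intro mult_left_mono) auto
          also have "\<dots> = \<epsilon> / 4" using B(1) by simp
          finally show False using s near far by linarith
        qed
      qed
    qed
    ultimately have "(\<lambda>N. measure (P N) ({\<omega>. \<bar>(\<integral>z. \<phi> z \<partial>L N \<omega>) - (\<integral>z. \<phi> z \<partial>\<mu>)\<bar> > \<epsilon>} \<inter> space (P N))) \<longlonglongrightarrow> 0"
      by (intro vanishing_union[of P S T]) (use PP in auto)
    moreover have "{\<omega>. \<bar>(\<integral>z. \<phi> z \<partial>L N \<omega>) - (\<integral>z. \<phi> z \<partial>\<mu>)\<bar> > \<epsilon>} \<inter> space (P N)
        = {\<omega> \<in> space (P N). \<bar>(\<integral>z. \<phi> z \<partial>L N \<omega>) - (\<integral>z. \<phi> z \<partial>\<mu>)\<bar> > \<epsilon>}" for N by auto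
    ultimately show "(\<lambda>N. measure (P N) {\<omega> \<in> space (P N).
        \<bar>(\<integral>z. \<phi> z \<partial>empirical_spectral_measure (perturbed_matrix \<gamma> N (l N) (d N) (c N) (G N \<omega>))) - (\<integral>z. \<phi> z \<partial>\<mu>)\<bar> > \<epsilon>}) \<longlonglongrightarrow> 0"
      by (simp add: L_def X_def)
  qed
qed

end
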